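(* Let $2\le k\le n-2$, and let $\widetilde w\in\mathrm{SL}_n(\mathbb C)$ represent $w\in\mathfrak S_n$ in the normalizer of the diagonal torus. Then $\widetilde w$ permutes the specialized canonical basis of the $\mathfrak{sl}_n$-representation $V^{2\omega_k}$ up to nonzero scalar multiples if and only if $w$ belongs to the dihedral group generated by $c_0:=(1\,2\,\cdots\,n)$ and $w_0:i\mapsto n+1-i$. The same criterion holds for the dual canonical basis of $(V^{2\omega_k})^*$. In particular, the only Coxeter elements with this property are $c_0$ and $c_0^{-1}$.
   Context: $V^{2\omega_k}$ is the irreducible representation of $\mathrm{SL}_n(\mathbb C)$ with highest weight $2\omega_k$, where $\omega_k$ is the $k$th fundamental weight. The specialized canonical basis is Lusztig's canonical basis (Kashiwara's lower global basis) of the irreducible module of highest weight $2\omega_k$ over the quantized enveloping algebra of $\mathfrak{sl}_n$, specialized at $q=1$, with respect to the standard matrix Chevalley generators; the dual canonical basis of $(V^{2\omega_k})^*$ is the dual basis. The Weyl group is identified with $\mathfrak S_n$ acting on the coordinates; a Coxeter element is a product of all the adjacent transpositions $s_1,\dots,s_{n-1}$, each once, in some order. An operator permutes a basis up to nonzero scalar multiples if it sends each basis vector to a nonzero scalar multiple of some basis vector. *)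

theory Defs
  imports
    Complex_Main
    "HOL-Computational_Algebra.Polynomial"
    "HOL-Computational_Algebra.Fraction_Field"
    "HOL-Combinatorics.Cycles"
    "HOL-Algebra.Group_Action"
    "HOL-Algebra.Generated_Groups"
    "HOL-Algebra.Sym_Groups"
    "Jordan_Normal_Form.Matrix"
    "Jordan_Normal_Form.Determinant"
begin

section \<open>The root datum of type A\<close>

text \<open>
  The vertices of the Dynkin diagram of \<open>sl\<^sub>n\<close> are \<open>1, \<dots>, n - 1\<close>.  An integral weight is given by
  its values on the simple coroots.
\<close>

definition cartan :: "nat \<Rightarrow> nat \<Rightarrow> int" where
  "cartan i j = (if i = j then 2 else if j = Suc i \<or> i = Suc j then -1 else 0)"

definition fundamental_weight :: "nat \<Rightarrow> nat \<Rightarrow> nat" where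
  "fundamental_weight k i = (if i = k then 1 else 0)"


section \<open>Modules over the quantized enveloping algebra of \<open>sl\<^sub>n\<close>\<close>

type_synonym Qq = "rat poly fract"

definition qv :: Qq where
  "qv = Fract [:0, 1:] 1"

definition qint :: "nat \<Rightarrow> Qq" where
  "qint m = (qv ^ m - inverse qv ^ m) / (qv - inverse qv)"

definition qfact :: "nat \<Rightarrow> Qq" where
  "qfact m = (\<Prod>j = 1..m. qint j)"

record 'v Uq_structure =
  qscale :: "Qq \<Rightarrow> 'v \<Rightarrow> 'v"
  Eop :: "nat \<Rightarrow> 'v \<Rightarrow> 'v"
  Fop :: "nat \<Rightarrow> 'v \<Rightarrow> 'v"
  Kop :: "nat \<Rightarrow> 'v \<Rightarrow> 'v"
  Kinv :: "nat \<Rightarrow> 'v \<Rightarrow> 'v"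

definition quantum_serre :: "nat \<Rightarrow> (Qq \<Rightarrow> 'v::ab_group_add \<Rightarrow> 'v) \<Rightarrow> (nat \<Rightarrow> 'v \<Rightarrow> 'v) \<Rightarrow> bool" where
  "quantum_serre n s X \<longleftrightarrow>
     (\<forall>i\<in>{1..<n}. \<forall>j\<in>{1..<n}. \<forall>x.
        (cartan i j = 0 \<longrightarrow> X i (X j x) = X j (X i x)) \<and>
        (cartan i j = -1 \<longrightarrow>
           X i (X i (X j x)) - s (qv + inverse qv) (X i (X j (X i x))) + X j (X i (X i x)) = 0))"

text \<open>A module over the algebra is a vector space over \<open>\<rat>(q)\<close> with operators satisfying the
  Drinfeld--Jimbo relations.\<close>

definition Uq_module :: "nat \<Rightarrow> 'v::ab_group_add Uq_structure \<Rightarrow> bool" where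
  "Uq_module n M \<longleftrightarrow>
     vector_space (qscale M) \<and>
     (\<forall>i\<in>{1..<n}.
        Vector_Spaces.linear (qscale M) (qscale M) (Eop M i) \<and>
        Vector_Spaces.linear (qscale M) (qscale M) (Fop M i) \<and>
        Vector_Spaces.linear (qscale M) (qscale M) (Kop M i) \<and>
        Vector_Spaces.linear (qscale M) (qscale M) (Kinv M i) \<and>
        (\<forall>x. Kop M i (Kinv M i x) = x \<and> Kinv M i (Kop M i x) = x)) \<and>
     (\<forall>i\<in>{1..<n}. \<forall>j\<in>{1..<n}. \<forall>x.
        Kop M i (Kop M j x) = Kop M j (Kop M i x) \<and>
        Kop M i (Eop M j x) = qscale M (qv powi cartan i j) (Eop M j (Kop M i x)) \<and>
        Kop M i (Fop M j x) = qscale M (qv powi (- cartan i j)) (Fop M j (Kop M i x)) \<and>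
        Eop M i (Fop M j x) - Fop M j (Eop M i x) =
          (if i = j then qscale M (inverse (qv - inverse qv)) (Kop M i x - Kinv M i x) else 0)) \<and>
     quantum_serre n (qscale M) (Eop M) \<and>
     quantum_serre n (qscale M) (Fop M)"

definition Uq_submodule :: "nat \<Rightarrow> 'v::ab_group_add Uq_structure \<Rightarrow> 'v set \<Rightarrow> bool" where
  "Uq_submodule n M S \<longleftrightarrow>
     module.subspace (qscale M) S \<and>
     (\<forall>i\<in>{1..<n}. \<forall>x\<in>S. Eop M i x \<in> S \<and> Fop M i x \<in> S \<and> Kop M i x \<in> S \<and> Kinv M i x \<in> S)"

definition Uq_irreducible_hw ::
    "nat \<Rightarrow> (nat \<Rightarrow> nat) \<Rightarrow> 'v::ab_group_add Uq_structure \<Rightarrow> 'v \<Rightarrow> bool" where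
  "Uq_irreducible_hw n \<Lambda> M u \<longleftrightarrow>
     Uq_module n M \<and>
     (\<forall>S. Uq_submodule n M S \<longrightarrow> S = {0} \<or> S = UNIV) \<and>
     u \<noteq> 0 \<and>
     (\<forall>i\<in>{1..<n}. Eop M i u = 0 \<and> Kop M i u = qscale M (qv ^ \<Lambda> i) u)"


section \<open>Lower global basis\<close>

text \<open>
  Throughout, \<open>u\<close> is the highest weight vector of an irreducible highest weight module \<open>M\<close>.  The
  conventions are those of Kashiwara, with crystal lattices at \<open>q = 0\<close>; Lusztig's \<open>v\<close> is \<open>q\<^sup>-\<^sup>1\<close>.
\<close>

definition Fdiv :: "'v::ab_group_add Uq_structure \<Rightarrow> nat \<Rightarrow> nat \<Rightarrow> 'v \<Rightarrow> 'v" where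
  "Fdiv M i m x = qscale M (inverse (qfact m)) ((Fop M i ^^ m) x)"

definition laurent_polys :: "Qq set" where
  "laurent_polys = {Fract p 1 / qv ^ m | p m. True}"

definition regular_at_0 :: "Qq set" where
  "regular_at_0 = {Fract a b | a b. poly b 0 \<noteq> 0}"

text \<open>The integral form \<open>U\<^sup>-\<^sub>\<rat> u\<close> over \<open>\<rat>[q, q\<^sup>-\<^sup>1]\<close>, generated by the divided powers.\<close>

inductive_set integral_form :: "nat \<Rightarrow> 'v::ab_group_add Uq_structure \<Rightarrow> 'v \<Rightarrow> 'v set"
  for n M u where
  hw: "u \<in> integral_form n M u"
| add: "x \<in> integral_form n M u \<Longrightarrow> y \<in> integral_form n M u \<Longrightarrow> x + y \<in> integral_form n M u"
| scale: "c \<in> laurent_polys \<Longrightarrow> x \<in> integral_form n M u \<Longrightarrow> qscale M c x \<in> integral_form n M u"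
| div_power: "i \<in> {1..<n} \<Longrightarrow> x \<in> integral_form n M u \<Longrightarrow> Fdiv M i m x \<in> integral_form n M u"

text \<open>
  The operator \<open>f\<^sub>i\<close> with a tilde: if \<open>x = \<Sum>\<^sub>m f\<^sub>i\<^sup>(\<^sup>m\<^sup>) c\<^sub>m\<close> with \<open>e\<^sub>i c\<^sub>m = 0\<close>, then \<open>x\<close> is
  sent to \<open>\<Sum>\<^sub>m f\<^sub>i\<^sup>(\<^sup>m\<^sup>+\<^sup>1\<^sup>) c\<^sub>m\<close>.  On an integrable module the summands \<open>f\<^sub>i\<^sup>(\<^sup>m\<^sup>) c\<^sub>m\<close>
  are determined by \<open>x\<close>, hence so is the image.
\<close>

definition kashiwara_f :: "'v::ab_group_add Uq_structure \<Rightarrow> nat \<Rightarrow> 'v \<Rightarrow> 'v" where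
  "kashiwara_f M i x =
     (THE y. \<exists>c N. (\<forall>m. Eop M i (c m) = 0) \<and>
        x = (\<Sum>m\<le>N. Fdiv M i m (c m)) \<and> y = (\<Sum>m\<le>N. Fdiv M i (Suc m) (c m)))"

inductive_set crystal_vectors :: "nat \<Rightarrow> 'v::ab_group_add Uq_structure \<Rightarrow> 'v \<Rightarrow> 'v set"
  for n M u where
  hw: "u \<in> crystal_vectors n M u"
| step: "i \<in> {1..<n} \<Longrightarrow> x \<in> crystal_vectors n M u \<Longrightarrow> kashiwara_f M i x \<in> crystal_vectors n M u"

inductive_set crystal_lattice :: "nat \<Rightarrow> 'v::ab_group_add Uq_structure \<Rightarrow> 'v \<Rightarrow> 'v set"
  for n M u where
  gen: "x \<in> crystal_vectors n M u \<Longrightarrow> x \<in> crystal_lattice n M u"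
| add: "x \<in> crystal_lattice n M u \<Longrightarrow> y \<in> crystal_lattice n M u \<Longrightarrow> x + y \<in> crystal_lattice n M u"
| scale: "c \<in> regular_at_0 \<Longrightarrow> x \<in> crystal_lattice n M u \<Longrightarrow> qscale M c x \<in> crystal_lattice n M u"

definition q_crystal_lattice :: "nat \<Rightarrow> 'v::ab_group_add Uq_structure \<Rightarrow> 'v \<Rightarrow> 'v set" where
  "q_crystal_lattice n M u = qscale M qv ` crystal_lattice n M u"

text \<open>
  The bar involution \<open>P u \<mapsto> P\<^sup>- u\<close>.  An additive map is \<open>\<rat>\<close>-linear, so the first two
  conditions amount to semilinearity with respect to \<open>q \<mapsto> q\<^sup>-\<^sup>1\<close> on all of \<open>\<rat>(q)\<close>.
\<close>

definition bar_involution :: "nat \<Rightarrow> 'v::ab_group_add Uq_structure \<Rightarrow> 'v \<Rightarrow> 'v \<Rightarrow> 'v" where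
  "bar_involution n M u =
     (THE \<beta>. (\<forall>x y. \<beta> (x + y) = \<beta> x + \<beta> y) \<and>
        (\<forall>x. \<beta> (qscale M qv x) = qscale M (inverse qv) (\<beta> x)) \<and>
        \<beta> u = u \<and>
        (\<forall>i\<in>{1..<n}. \<forall>x. \<beta> (Fop M i x) = Fop M i (\<beta> x)))"

text \<open>
  With \<open>L\<close> the crystal lattice, \<open>L\<^sup>-\<close> its image under the bar involution and \<open>B\<close> the set of
  nonzero residues modulo \<open>q L\<close> of crystal vectors, the global basis is the preimage of \<open>B\<close> under
  Kashiwara's isomorphism from the intersection of \<open>L\<close>, \<open>L\<^sup>-\<close> and the integral form onto
  \<open>L / q L\<close>.
\<close>

definition global_basis :: "nat \<Rightarrow> 'v::ab_group_add Uq_structure \<Rightarrow> 'v \<Rightarrow> 'v set" where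
  "global_basis n M u =
     {x \<in> integral_form n M u \<inter> crystal_lattice n M u
            \<inter> bar_involution n M u ` crystal_lattice n M u.
        \<exists>b\<in>crystal_vectors n M u.
          b \<notin> q_crystal_lattice n M u \<and> x - b \<in> q_crystal_lattice n M u}"


section \<open>The group \<open>SL\<^sub>n(\<complex>)\<close> and its representations\<close>

definition SL :: "nat \<Rightarrow> complex mat monoid" where
  "SL n = \<lparr>carrier = {A \<in> carrier_mat n n. det A = 1}, monoid.mult = (*), one = 1\<^sub>m n\<rparr>"

text \<open>Matrix entries are indexed from \<open>0\<close>; coordinates and permutations from \<open>1\<close>.\<close>

definition diag_elt :: "nat \<Rightarrow> (nat \<Rightarrow> complex) \<Rightarrow> complex mat" where
  "diag_elt n t = mat_diag n (\<lambda>a. t (Suc a))"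

definition torus :: "nat \<Rightarrow> complex mat set" where
  "torus n = {diag_elt n t | t. (\<Prod>i = 1..n. t i) = 1}"

definition represents :: "nat \<Rightarrow> complex mat \<Rightarrow> (nat \<Rightarrow> nat) \<Rightarrow> bool" where
  "represents n W w \<longleftrightarrow>
     W \<in> normalizer (SL n) (torus n) \<and> w permutes {1..n} \<and>
     (\<forall>t. (\<Prod>i = 1..n. t i) = 1 \<longrightarrow>
        W \<otimes>\<^bsub>SL n\<^esub> diag_elt n t \<otimes>\<^bsub>SL n\<^esub> inv\<^bsub>SL n\<^esub> W = diag_elt n (t \<circ> inv' w))"

inductive_set matrix_polynomials :: "nat \<Rightarrow> (complex mat \<Rightarrow> complex) set" for n where
  const: "(\<lambda>A. c) \<in> matrix_polynomials n"
| entry: "i < n \<Longrightarrow> j < n \<Longrightarrow> (\<lambda>A. A $$ (i, j)) \<in> matrix_polynomials n"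
| add: "f \<in> matrix_polynomials n \<Longrightarrow> g \<in> matrix_polynomials n \<Longrightarrow> (\<lambda>A. f A + g A) \<in> matrix_polynomials n"
| mult: "f \<in> matrix_polynomials n \<Longrightarrow> g \<in> matrix_polynomials n \<Longrightarrow> (\<lambda>A. f A * g A) \<in> matrix_polynomials n"

abbreviation functional :: "(complex \<Rightarrow> 'w::ab_group_add \<Rightarrow> 'w) \<Rightarrow> ('w \<Rightarrow> complex) \<Rightarrow> bool" where
  "functional s \<phi> \<equiv> Vector_Spaces.linear s (*) \<phi>"

text \<open>Finite-dimensional algebraic representations.\<close>

definition SL_rep ::
    "nat \<Rightarrow> (complex \<Rightarrow> 'w::ab_group_add \<Rightarrow> 'w) \<Rightarrow> (complex mat \<Rightarrow> 'w \<Rightarrow> 'w) \<Rightarrow> bool" where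
  "SL_rep n s \<rho> \<longleftrightarrow>
     vector_space s \<and>
     (\<exists>X. finite X \<and> module.span s X = UNIV) \<and>
     (\<forall>A\<in>carrier (SL n). Vector_Spaces.linear s s (\<rho> A)) \<and>
     \<rho> \<one>\<^bsub>SL n\<^esub> = id \<and>
     (\<forall>A\<in>carrier (SL n). \<forall>B\<in>carrier (SL n). \<rho> (A \<otimes>\<^bsub>SL n\<^esub> B) = \<rho> A \<circ> \<rho> B) \<and>
     (\<forall>x \<phi>. functional s \<phi> \<longrightarrow>
        (\<exists>f\<in>matrix_polynomials n. \<forall>A\<in>carrier (SL n). \<phi> (\<rho> A x) = f A))"

definition torus_character :: "nat \<Rightarrow> (nat \<Rightarrow> nat) \<Rightarrow> (nat \<Rightarrow> complex) \<Rightarrow> complex" where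
  "torus_character n \<Lambda> t = (\<Prod>j = 1..<n. (\<Prod>i = 1..j. t i) ^ \<Lambda> j)"

definition SL_irreducible_hw ::
    "nat \<Rightarrow> (nat \<Rightarrow> nat) \<Rightarrow> (complex \<Rightarrow> 'w::ab_group_add \<Rightarrow> 'w) \<Rightarrow> (complex mat \<Rightarrow> 'w \<Rightarrow> 'w) \<Rightarrow> bool" where
  "SL_irreducible_hw n \<Lambda> s \<rho> \<longleftrightarrow>
     SL_rep n s \<rho> \<and>
     (\<forall>S. module.subspace s S \<and> (\<forall>A\<in>carrier (SL n). \<forall>x\<in>S. \<rho> A x \<in> S) \<longrightarrow> S = {0} \<or> S = UNIV) \<and>
     (\<exists>v. v \<noteq> 0 \<and>
        (\<forall>A\<in>carrier (SL n). upper_triangular A \<and> (\<forall>i<n. A $$ (i, i) = 1) \<longrightarrow> \<rho> A v = v) \<and>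
        (\<forall>t. (\<Prod>i = 1..n. t i) = 1 \<longrightarrow> \<rho> (diag_elt n t) v = s (torus_character n \<Lambda> t) v))"

text \<open>
  The action of the matrix unit \<open>E\<^sub>a\<^sub>b\<close> (\<open>a \<noteq> b\<close>, indices from \<open>1\<close>) in the differential of \<open>\<rho>\<close>,
  obtained by differentiating the one-parameter subgroup \<open>t \<mapsto> exp (t E\<^sub>a\<^sub>b) = 1 + t E\<^sub>a\<^sub>b\<close>.
\<close>

definition root_subgroup :: "nat \<Rightarrow> nat \<Rightarrow> nat \<Rightarrow> complex \<Rightarrow> complex mat" where
  "root_subgroup n a b t =
     mat n n (\<lambda>(i, j). if i = j then 1 else if Suc i = a \<and> Suc j = b then t else 0)"

definition matrix_unit_action ::
    "nat \<Rightarrow> (complex \<Rightarrow> 'w::ab_group_add \<Rightarrow> 'w) \<Rightarrow> (complex mat \<Rightarrow> 'w \<Rightarrow> 'w) \<Rightarrow> nat \<Rightarrow> nat \<Rightarrow> 'w \<Rightarrow> 'w" where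
  "matrix_unit_action n s \<rho> a b x =
     (THE y. \<forall>\<phi>. functional s \<phi> \<longrightarrow>
        ((\<lambda>t. \<phi> (\<rho> (root_subgroup n a b t) x)) has_field_derivative \<phi> y) (at 0))"


section \<open>Specialization at \<open>q = 1\<close>\<close>

text \<open>
  \<open>\<sigma>\<close> identifies \<open>V\<^sub>\<rat> / (q - 1) V\<^sub>\<rat>\<close> (\<open>V\<^sub>\<rat>\<close> the integral form) with a rational form of the
  representation \<open>\<rho>\<close>, the generators \<open>E\<^sub>i\<close>, \<open>F\<^sub>i\<close> acting as the matrix units \<open>E\<^sub>i\<^sub>,\<^sub>i\<^sub>+\<^sub>1\<close>,
  \<open>E\<^sub>i\<^sub>+\<^sub>1\<^sub>,\<^sub>i\<close>.  For irreducible modules such a \<open>\<sigma>\<close> is unique up to a nonzero scalar.  Its values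
  outside \<open>V\<^sub>\<rat>\<close> are irrelevant.
\<close>

definition specialization_at_1 ::
    "nat \<Rightarrow> 'v::ab_group_add Uq_structure \<Rightarrow> 'v \<Rightarrow> (complex \<Rightarrow> 'w::ab_group_add \<Rightarrow> 'w) \<Rightarrow>
     (complex mat \<Rightarrow> 'w \<Rightarrow> 'w) \<Rightarrow> ('v \<Rightarrow> 'w) \<Rightarrow> bool" where
  "specialization_at_1 n M u s \<rho> \<sigma> \<longleftrightarrow>
     (\<forall>x\<in>integral_form n M u. \<forall>y\<in>integral_form n M u. \<sigma> (x + y) = \<sigma> x + \<sigma> y) \<and>
     (\<forall>p m. \<forall>x\<in>integral_form n M u.
        \<sigma> (qscale M (Fract p 1 / qv ^ m) x) = s (of_rat (poly p 1)) (\<sigma> x)) \<and>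
     (\<forall>i\<in>{1..<n}. \<forall>x\<in>integral_form n M u.
        \<sigma> (Eop M i x) = matrix_unit_action n s \<rho> i (Suc i) (\<sigma> x) \<and>
        \<sigma> (Fop M i x) = matrix_unit_action n s \<rho> (Suc i) i (\<sigma> x)) \<and>
     (\<forall>x\<in>integral_form n M u. \<sigma> x = 0 \<longleftrightarrow> x \<in> qscale M (qv - 1) ` integral_form n M u) \<and>
     module.span s (\<sigma> ` integral_form n M u) = UNIV"

definition specialized_canonical_basis ::
    "nat \<Rightarrow> 'v::ab_group_add Uq_structure \<Rightarrow> 'v \<Rightarrow> ('v \<Rightarrow> 'w) \<Rightarrow> 'w set" where
  "specialized_canonical_basis n M u \<sigma> = \<sigma> ` global_basis n M u"


section \<open>The dual representation and the dual basis\<close>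

definition dual_scale :: "complex \<Rightarrow> ('w \<Rightarrow> complex) \<Rightarrow> 'w \<Rightarrow> complex" where
  "dual_scale c \<phi> = (\<lambda>x. c * \<phi> x)"

definition dual_action ::
    "nat \<Rightarrow> (complex mat \<Rightarrow> 'w \<Rightarrow> 'w) \<Rightarrow> complex mat \<Rightarrow> ('w \<Rightarrow> complex) \<Rightarrow> 'w \<Rightarrow> complex" where
  "dual_action n \<rho> A \<phi> = (\<lambda>x. \<phi> (\<rho> (inv\<^bsub>SL n\<^esub> A) x))"

definition dual_basis :: "(complex \<Rightarrow> 'w::ab_group_add \<Rightarrow> 'w) \<Rightarrow> 'w set \<Rightarrow> ('w \<Rightarrow> complex) set" where
  "dual_basis s B =
     {\<phi>. functional s \<phi> \<and> (\<exists>b\<in>B. \<phi> b = 1 \<and> (\<forall>b'\<in>B - {b}. \<phi> b' = 0))}"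

definition permutes_up_to_scalars :: "(complex \<Rightarrow> 'x \<Rightarrow> 'x) \<Rightarrow> ('x \<Rightarrow> 'x) \<Rightarrow> 'x set \<Rightarrow> bool" where
  "permutes_up_to_scalars s f B \<longleftrightarrow> (\<forall>b\<in>B. \<exists>b'\<in>B. \<exists>c. c \<noteq> 0 \<and> f b = s c b')"


section \<open>Permutations\<close>

definition long_cycle :: "nat \<Rightarrow> nat \<Rightarrow> nat" where
  "long_cycle n = cycle_of_list [1..<Suc n]"

definition longest_perm :: "nat \<Rightarrow> nat \<Rightarrow> nat" where
  "longest_perm n i = (if i \<in> {1..n} then n + 1 - i else i)"

definition dihedral :: "nat \<Rightarrow> (nat \<Rightarrow> nat) set" where
  "dihedral n = generate (sym_group n) {long_cycle n, longest_perm n}"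

definition coxeter_element :: "nat \<Rightarrow> (nat \<Rightarrow> nat) \<Rightarrow> bool" where
  "coxeter_element n w \<longleftrightarrow>
     (\<exists>is. distinct is \<and> set is = {1..<n} \<and>
        w = foldr (\<circ>) (map (\<lambda>i. Transposition.transpose i (Suc i)) is) id)"

end

theory Submission
  imports Defs
begin

text \<open>
  The global basis of the module of highest weight \<open>2\<omega>\<^sub>k\<close> is indexed by webs \<open>(D, p)\<close>: \<open>D\<close> is a
  set of doubled sites of \<open>{1..n}\<close> and \<open>p\<close> a noncrossing involution whose arcs join the singly occupied
  sites; \<open>E\<^sub>i\<close> and \<open>F\<^sub>i\<close> send a web to \<open>0\<close>, \<open>1\<close> or \<open>q + q\<^sup>-\<^sup>1\<close> times a web.  At \<open>q = 1\<close> a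
  representative of \<open>w\<close> conjugates the matrix unit \<open>E\<^sub>a\<^sub>b\<close> into a multiple of \<open>E\<^sub>w\<^sub>(\<^sub>a\<^sub>)\<^sub>w\<^sub>(\<^sub>b\<^sub>)\<close>.

  If \<open>w(i)\<close> and \<open>w(i+1)\<close> are neighbours for all \<open>i \<le> n - 2\<close>, as for \<open>c\<^sub>0\<close> and \<open>w\<^sub>0\<close>, then all basis
  vectors go to multiples of basis vectors: those of webs with at most one arc span their weight spaces,
  and \<open>F\<^sub>1, \<dots>, F\<^sub>n\<^sub>-\<^sub>2\<close> generate the other webs from them.

  Conversely, let \<open>w(i) = a\<close> and \<open>w(i+1) = b\<close> not be cyclically adjacent, and choose sites \<open>r\<close>, \<open>t\<close>
  separating \<open>a\<close> from \<open>b\<close>.  A web with the arc \<open>{i, i+1}\<close> arises by \<open>F\<^sub>i\<close> from a web with one arc, so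
  its image is a multiple of \<open>E\<^sub>b\<^sub>a\<close> applied to a web with the single arc \<open>{r, t}\<close>.  Were it a multiple of a
  web, that web would have the arcs \<open>{a, y}\<close> and \<open>{b, z}\<close> with \<open>{y, z} = {r, t}\<close>, and would also arise
  by creating one of these arcs.  Moving the four sites to \<open>1, 2, 3, 4\<close> turns the two descriptions into
  multiples of distinct webs, with arcs \<open>{1, 2}, {3, 4}\<close> and \<open>{2, 3}, {1, 4}\<close>, a contradiction.
\<close>

section \<open>Noncrossing webs\<close>

text \<open>A weight with 2m sites of value 1 has as many webs as there are noncrossing matchings of
  2m points: one for m \<le> 1, two for m = 2, and every obstruction is already found for m = 2.
  Four sites of value 1 beside k - 2 doubled ones fit exactly when 2 \<le> k \<le> n - 2.
  Noncrossing is a cyclic condition on the sites; hence the dihedral group.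

  The module \<open>M\<close> is known only by its relations and its irreducibility. Webs are
  therefore computed with as explicit functions in the tensor square of an exterior power and
  carried to \<open>M\<close> along the graph of a homomorphism; what needs work is that the highest
  weight vector is not a combination of vectors of lower weight. As no site has weight above 2,
  \<open>F\<^sub>i\<close> has cube 0. So only \<open>F\<^sub>i\<close> and its second divided power
  occur, the Kashiwara operator has a closed formula in them and \<open>E\<^sub>i\<close>, and
  global basis elements are recognised coordinate by coordinate: a Laurent polynomial without poles
  at 0 and at infinity is constant.\<close>

type_synonym web = "nat set \<times> (nat \<Rightarrow> nat)"

text \<open>Only left ends, that is \<open>i < p i\<close>, are tested, and a fixed point
  \<open>j\<close> under an arc meets the condition trivially.\<close>

definition noncrossing :: "(nat \<Rightarrow> nat) \<Rightarrow> bool" where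
  "noncrossing p \<longleftrightarrow> (\<forall>i j. i < j \<longrightarrow> j < p i \<longrightarrow> i < p j \<and> p j < p i)"

definition moved :: "(nat \<Rightarrow> nat) \<Rightarrow> nat set" where
  "moved p = {i. p i \<noteq> i}"

definition is_web :: "nat \<Rightarrow> nat \<Rightarrow> web \<Rightarrow> bool" where
  "is_web n k = (\<lambda>(D, p). D \<subseteq> {1..n} \<and> p permutes {1..n} \<and> (\<forall>i. p (p i) = i) \<and>
     (\<forall>i\<in>D. p i = i) \<and> 2 * card D + card (moved p) = 2 * k \<and> noncrossing p)"

definition weight :: "web \<Rightarrow> nat \<Rightarrow> nat" where
  "weight = (\<lambda>(D, p) i. if i \<in> D then 2 else if p i \<noteq> i then 1 else 0)"

definition top_web :: "nat \<Rightarrow> web" where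
  "top_web k = ({1..k}, id)"

text \<open>One unit of weight moves from \<open>a\<close> to \<open>b\<close>. A doubled and an
  empty site open an arc; two arc ends merge into a doubled site and their partners are joined,
  where the last two updates take care of the case \<open>p a = b\<close>; otherwise an arc end
  trades places with a doubled or an empty site. The value has a meaning only if
  \<open>kind a b\<close> is nonzero.\<close>

definition step :: "nat \<Rightarrow> nat \<Rightarrow> web \<Rightarrow> web" where
  "step a b = (\<lambda>(D, p).
     if a \<in> D \<and> b \<notin> D \<and> p b = b then (D - {a}, p(a := b, b := a))
     else if p a \<noteq> a \<and> p b \<noteq> b then (insert b D, p(p a := p b, p b := p a, a := a, b := b))
     else (Transposition.transpose a b ` D, Transposition.transpose a b \<circ> p \<circ> Transposition.transpose a b))"

text \<open>\<open>0\<close>, \<open>1\<close>, \<open>2\<close> encode the structure constants \<open>0\<close>, \<open>1\<close>, \<open>q + q\<^sup>-\<^sup>1\<close>.\<close>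

definition kind :: "nat \<Rightarrow> nat \<Rightarrow> web \<Rightarrow> nat" where
  "kind a b = (\<lambda>(D, p).
     if (a \<notin> D \<and> p a = a) \<or> b \<in> D then 0
     else if p a = b then 2 else 1)"

text \<open>This is the sum of \<open>i * weight \<omega> i\<close>, so a step from \<open>a\<close>
  to \<open>b\<close> changes it by \<open>b - a\<close>: \<open>F\<^sub>i\<close> raises it and
  \<open>E\<^sub>i\<close> lowers it by one.\<close>

definition height :: "web \<Rightarrow> nat" where
  "height = (\<lambda>(D, p). 2 * \<Sum>D + \<Sum>(moved p))"

definition adjacent :: "nat \<Rightarrow> nat \<Rightarrow> bool" where
  "adjacent a b \<longleftrightarrow> b = Suc a \<or> a = Suc b"

section \<open>The moves preserve webs\<close>

lemma moved_subset: "p permutes A \<Longrightarrow> moved p \<subseteq> A"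
  unfolding moved_def permutes_def by auto

lemma involution_permutes:
  assumes "\<forall>i. p (p i) = i" "\<And>x. x \<notin> A \<Longrightarrow> p x = x"
  shows "p permutes A"
  unfolding permutes_def using assms by metis

lemma finite_webs: "finite {\<omega>. is_web n k \<omega>}"
proof (rule finite_subset)
  show "{\<omega>. is_web n k \<omega>} \<subseteq> Pow {1..n} \<times> {p. p permutes {1..n}}"
    by (auto simp: is_web_def)
  show "finite (Pow {1..n} \<times> {p. p permutes {1..n}})"
    by (simp add: finite_permutations)
qed

lemma step_conj:
  fixes p :: "nat \<Rightarrow> nat"
  assumes "\<forall>i. p (p i) = i"
  shows "moved (Transposition.transpose a b \<circ> p \<circ> Transposition.transpose a b) = Transposition.transpose a b ` moved p"
proof -
  let ?t = "Transposition.transpose a b"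
  have "i \<in> moved (?t \<circ> p \<circ> ?t) \<longleftrightarrow> i \<in> ?t ` moved p" for i
  proof -
    have "i \<in> moved (?t \<circ> p \<circ> ?t) \<longleftrightarrow> ?t i \<in> moved p"
      by (simp add: moved_def) (metis transpose_involutory)
    also have "\<dots> \<longleftrightarrow> i \<in> ?t ` moved p"
      by (metis image_iff transpose_involutory)
    finally show ?thesis .
  qed
  then show ?thesis by blast
qed

lemma transpose_less:
  assumes "adjacent a b" "u < v" "\<not> (u \<in> {a, b} \<and> v \<in> {a, b})"
  shows "Transposition.transpose a b u < Transposition.transpose a b v"
  using assms by (auto simp: adjacent_def Transposition.transpose_def)

text \<open>A transposition of neighbours reverses the order of no pair except \<open>a\<close>,
  \<open>b\<close>, and these are not both arc ends.\<close>

lemma noncrossing_conj: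
  fixes p :: "nat \<Rightarrow> nat"
  assumes p: "\<forall>i. p (p i) = i" "noncrossing p" and ab: "adjacent a b" "p a = a \<or> p b = b"
  shows "noncrossing (Transposition.transpose a b \<circ> p \<circ> Transposition.transpose a b)"
  unfolding noncrossing_def
proof (intro allI impI)
  let ?t = "Transposition.transpose a b"
  let ?p = "?t \<circ> p \<circ> ?t"
  fix i j assume ij: "i < j" "j < ?p i"
  let ?i = "?t i" and ?j = "?t j"
  have mi: "p ?i \<noteq> ?i" using ij by auto
  have *: "\<not> (u \<in> {a, b} \<and> v \<in> {a, b})" if "u < v" "p u \<noteq> u" "p v \<noteq> v" for u v
    using that ab(2) by auto
  have **: "\<not> (u \<in> {a, b} \<and> v \<in> {a, b})" if "u < v" "p (?t u) \<noteq> ?t u" "p (?t v) \<noteq> ?t v" for u v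
    using that ab(2) by auto
  show "i < ?p j \<and> ?p j < ?p i"
  proof (cases "p ?j = ?j")
    case True
    then show ?thesis using ij by simp
  next
    case mj: False
    have mpp: "p (p ?i) \<noteq> p ?i" "p (p ?j) \<noteq> p ?j" using mi mj p(1) by auto
    have 1: "?i < ?j" using transpose_less[OF ab(1) ij(1) **] ij mi mj by auto
    have 2: "?j < p ?i" using transpose_less[OF ab(1) ij(2)[unfolded o_apply] **] ij(2) mi mj mpp by auto
    have 3: "?i < p ?j" "p ?j < p ?i" using p(2) 1 2 unfolding noncrossing_def by blast+
    have "?t ?i < ?t (p ?j)" using transpose_less[OF ab(1) 3(1) *] 3 mi mpp by auto
    moreover have "?t (p ?j) < ?t (p ?i)" using transpose_less[OF ab(1) 3(2) *] 3 mpp by auto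
    ultimately show ?thesis by simp
  qed
qed

lemma web_relabel:
  assumes w: "is_web n k (D, p)" and ab: "a \<in> {1..n}" "b \<in> {1..n}" "adjacent a b" "p a = a \<or> p b = b"
  shows "is_web n k (Transposition.transpose a b ` D, Transposition.transpose a b \<circ> p \<circ> Transposition.transpose a b)"
proof -
  let ?t = "Transposition.transpose a b"
  have p: "p permutes {1..n}" "\<forall>i. p (p i) = i" "noncrossing p" "D \<subseteq> {1..n}" "\<forall>i\<in>D. p i = i"
    "2 * card D + card (moved p) = 2 * k"
    using w by (auto simp: is_web_def)
  have t: "?t permutes {1..n}" using ab by (simp add: permutes_swap_id)
  have "card (?t ` moved p) = card (moved p)" "card (?t ` D) = card D"
    by (simp_all add: card_image)
  moreover have "?t ` D \<subseteq> {1..n}" using p(4) t by (metis image_mono permutes_image)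
  moreover have "?t \<circ> p \<circ> ?t permutes {1..n}" using t p(1) by (metis permutes_compose)
  ultimately show ?thesis
    unfolding is_web_def using p step_conj[OF p(2), of a b] noncrossing_conj[OF p(2,3) ab(3,4)]
    by auto
qed

lemma web_cup:
  assumes w: "is_web n k (D, p)" and ab: "a \<in> {1..n}" "b \<in> {1..n}" "adjacent a b"
    "a \<in> D" "b \<notin> D" "p b = b"
  shows "is_web n k (D - {a}, p(a := b, b := a))"
proof -
  let ?p = "p(a := b, b := a)"
  have p: "p permutes {1..n}" "\<forall>i. p (p i) = i" "noncrossing p" "D \<subseteq> {1..n}" "\<forall>i\<in>D. p i = i"
    "2 * card D + card (moved p) = 2 * k"
    using w by (auto simp: is_web_def)
  have pa: "p a = a" and ne: "a \<noteq> b" using p ab by auto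
  have inv: "\<forall>i. ?p (?p i) = i" using p(2) pa ab(6) ne by auto
  have perm: "?p permutes {1..n}"
    by (rule involution_permutes[OF inv]) (use p(1) ab(1,2) in \<open>auto simp: permutes_def\<close>)
  have mv: "moved ?p = insert a (insert b (moved p))"
    using pa ab(6) ne by (auto simp: moved_def)
  have fin: "finite (moved p)" "finite D" using p(1,4) by (auto intro: finite_subset dest: moved_subset)
  have "card (moved ?p) = card (moved p) + 2"
    unfolding mv using fin pa ab(6) ne by (simp add: moved_def)
  moreover have "card D = Suc (card (D - {a}))" using card.remove[OF fin(2) ab(4)] by simp
  ultimately have card: "2 * card (D - {a}) + card (moved ?p) = 2 * k" using p(6) by simp
  have "noncrossing ?p"
    unfolding noncrossing_def
  proof (intro allI impI)
    fix i j assume ij: "i < j" "j < ?p i"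
    have i: "i \<noteq> a" "i \<noteq> b" using ij ab(3) ne by (auto simp: adjacent_def)
    have ip: "p i \<noteq> a" "p i \<noteq> b" using p(2) pa ab(6) i by metis+
    have pij: "?p i = p i" using i by simp
    show "i < ?p j \<and> ?p j < ?p i"
    proof (cases "j = a \<or> j = b")
      case True
      then show ?thesis using ij i ip ab(3) ne unfolding pij by (auto simp: adjacent_def)
    next
      case False
      then show ?thesis using ij p(3) unfolding pij noncrossing_def by simp
    qed
  qed
  then show ?thesis unfolding is_web_def using inv perm card p(4,5) ne ab by auto
qed

lemma join_involution:
  fixes p :: "nat \<Rightarrow> nat"
  assumes inv: "\<forall>i. p (p i) = i" and ne: "a \<noteq> b" "p a \<noteq> a" "p b \<noteq> b"
  defines "r \<equiv> p(p a := p b, p b := p a, a := a, b := b)"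
  shows "r (r i) = i" and "i \<in> moved r \<longleftrightarrow> i \<in> moved p - {a, b}"
proof -
  have pin: "p i = p j \<longleftrightarrow> i = j" for i j using inv by metis
  consider (1) "i = a \<or> i = b" | (2) "i \<noteq> a" "i \<noteq> b" "i = p a" | (3) "i \<noteq> a" "i \<noteq> b" "i = p b" | (4) "i \<noteq> a" "i \<noteq> b" "i \<noteq> p a" "i \<noteq> p b"
    by blast
  then have "r (r i) = i \<and> (i \<in> moved r \<longleftrightarrow> i \<in> moved p - {a, b})"
  proof cases
    case 1 then show ?thesis by (auto simp: r_def moved_def)
  next
    case 2
    have "p b \<noteq> a" using 2 inv by metis
    then have "r i = p b" "r (p b) = i" using 2 ne pin[of a b] by (simp_all add: r_def)
    moreover have "p i = a" using 2 inv by simp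
    moreover have "p b \<noteq> i" using 2 pin[of a b] ne by metis
    ultimately show ?thesis using 2 by (simp add: moved_def)
  next
    case 3
    have "p a \<noteq> b" using 3 inv by metis
    then have "r i = p a" "r (p a) = i" using 3 ne pin[of a b] by (simp_all add: r_def)
    moreover have "p i = b" using 3 inv by simp
    moreover have "p a \<noteq> i" using 3 pin[of a b] ne by metis
    ultimately show ?thesis using 3 by (simp add: moved_def)
  next
    case 4
    have "p i \<noteq> a" "p i \<noteq> b" using 4 inv by metis+
    moreover have "p i \<noteq> p a" "p i \<noteq> p b" using 4 pin by auto
    moreover have "r i = p i" using 4 by (simp add: r_def)
    ultimately show ?thesis using 4 inv by (simp add: r_def moved_def)
  qed
  then show "r (r i) = i" "i \<in> moved r \<longleftrightarrow> i \<in> moved p - {a, b}" by auto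
qed

lemma web_cap:
  assumes w: "is_web n k (D, p)" and ab: "a \<in> {1..n}" "b \<in> {1..n}" "adjacent a b"
    "p a \<noteq> a" "p b \<noteq> b"
  shows "is_web n k (insert b D, p(p a := p b, p b := p a, a := a, b := b))"
proof -
  let ?p = "p(p a := p b, p b := p a, a := a, b := b)"
  have p: "p permutes {1..n}" "\<forall>i. p (p i) = i" "noncrossing p" "D \<subseteq> {1..n}" "\<forall>i\<in>D. p i = i"
    "2 * card D + card (moved p) = 2 * k"
    using w by (auto simp: is_web_def)
  have ne: "a \<noteq> b" using ab by (auto simp: adjacent_def)
  have pin: "p i = p j \<longleftrightarrow> i = j" for i j using p(2) by metis
  have inv: "\<forall>i. ?p (?p i) = i"
    using join_involution[OF p(2) ne ab(4,5)] by blast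
  have in_n: "p a \<in> {1..n}" "p b \<in> {1..n}" using p(1) ab by (metis permutes_in_image)+
  have perm: "?p permutes {1..n}"
    by (rule involution_permutes[OF inv]) (use p(1) ab(1,2) in_n in \<open>auto simp: permutes_def\<close>)
  have mv: "moved ?p = moved p - {a, b}"
    using join_involution(2)[OF p(2) ne ab(4,5)] by blast
  have fin: "finite (moved p)" "finite D" using p(1,4) by (auto intro: finite_subset dest: moved_subset)
  have "card (moved p - {a, b}) = card (moved p) - 2"
    using ab ne fin by (subst card_Diff_subset) (auto simp: moved_def)
  moreover have "card (moved p) \<ge> 2"
    using card_mono[OF fin(1), of "{a, b}"] ab ne by (auto simp: moved_def)
  moreover have "b \<notin> D" using ab p by auto
  ultimately have card: "2 * card (insert b D) + card (moved ?p) = 2 * k"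
    unfolding mv using p(6) fin by simp
  have "noncrossing ?p"
    unfolding noncrossing_def
  proof (intro allI impI)
    fix i j assume ij: "i < j" "j < ?p i"
    have nc: "u < p v \<and> p v < p u" if "u < v" "v < p u" for u v
      using p(3) that unfolding noncrossing_def by blast
    have iab: "i \<noteq> a" "i \<noteq> b" using ij ne by (auto split: if_splits)
    have pp: "p (p i) = i" "p (p j) = j" "p (p a) = a" "p (p b) = b" using p(2) by auto
    have pab: "p a \<noteq> p b" using pin ne by auto
    have c4: "i = p a \<Longrightarrow> ?p i = p b" and c5: "i = p b \<Longrightarrow> ?p i = p a" using iab pab by simp_all
    have gap: "(x < a \<longleftrightarrow> x < b) \<and> (a < x \<longleftrightarrow> b < x)" if "x \<noteq> a" "x \<noteq> b" for x
      using that ab(3) by (auto simp: adjacent_def)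
    \<comment> \<open>An arc over \<open>p a\<close> is over \<open>a\<close> by noncrossing, hence
      over the neighbour \<open>b\<close>, hence over \<open>p b\<close>.\<close>
    have enclose: "u < p b \<and> p b < p u" if "u < p a" "p a < p u" "u \<notin> {a, b}" "p u \<notin> {a, b}" for u
      using nc[of u "p a"] nc[of u b] that gap[of u] gap[of "p u"] pp by auto
    have enclose': "u < p a \<and> p a < p u" if "u < p b" "p b < p u" "u \<notin> {a, b}" "p u \<notin> {a, b}" for u
      using nc[of u "p b"] nc[of u a] that gap[of u] gap[of "p u"] pp by auto
    show "i < ?p j \<and> ?p j < ?p i"
    proof (cases "j = a \<or> j = b")
      case True
      then have "?p j = j" by (elim disjE) simp_all
      then show ?thesis using ij by (simp only:)
    next
      case jab: False
      have c1: "j = p a \<Longrightarrow> ?p j = p b" and c2: "j = p b \<Longrightarrow> ?p j = p a" and c3: "j \<noteq> p a \<Longrightarrow> j \<noteq> p b \<Longrightarrow> ?p j = p j"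
        using jab pab by simp_all
      show ?thesis
      proof (cases "i = p a \<or> i = p b")
        case False
        then have i': "?p i = p i" using iab by simp
        have pia: "p i \<noteq> a" "p i \<noteq> b" using False pp by auto
        consider "j = p a" "?p j = p b" | "j = p b" "?p j = p a" | "?p j = p j"
          using c1 c2 c3 by blast
        then show ?thesis
        proof cases
          case 1
          have "i < p a" "p a < p i" using ij unfolding 1(1) i' by blast+
          then show ?thesis unfolding 1(2) i' using enclose iab pia by blast
        next
          case 2
          have "i < p b" "p b < p i" using ij unfolding 2(1) i' by blast+
          then show ?thesis unfolding 2(2) i' using enclose' iab pia by blast
        next
          case 3
          then show ?thesis using nc[of i j] ij unfolding i' 3 by blast
        qed
      next
        case True
        then consider "i = p a" "?p i = p b" | "i = p b" "?p i = p a" using c4 c5 by blast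
        note ci = this
        have jj: "j \<notin> {p a, p b}" using ci ij by cases auto
        then have j': "?p j = p j" using jab by simp
        have pja: "p j \<noteq> a" "p j \<noteq> b" using jj pp by auto
        have pjx: "p j \<noteq> p a" "p j \<noteq> p b" using jab pin by auto
        have enc: "p j < p a \<Longrightarrow> p a < j \<Longrightarrow> p b < j" "j < p b \<Longrightarrow> p b < p j \<Longrightarrow> j < p a"
          "p j < p b \<Longrightarrow> p b < j \<Longrightarrow> p a < j" "j < p a \<Longrightarrow> p a < p j \<Longrightarrow> j < p b"
          using enclose[of "p j"] enclose'[of "p j"] enclose[of j] enclose'[of j] pp(2) jab pja by (metis insert_iff singletonD)+
        from ci show ?thesis
        proof cases
          case 1
          have l: "p a < j" "j < p b" using ij unfolding 1(2) unfolding 1(1) by blast+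
          then have "\<not> p j < p a" "\<not> p b < p j" using enc(1,2) by linarith+
          then show ?thesis unfolding j' 1(2) unfolding 1(1) using pjx by linarith
        next
          case 2
          have l: "p b < j" "j < p a" using ij unfolding 2(2) unfolding 2(1) by blast+
          then have "\<not> p j < p b" "\<not> p a < p j" using enc(3,4) by linarith+
          then show ?thesis unfolding j' 2(2) unfolding 2(1) using pjx by linarith
        qed
      qed
    qed
  qed
  moreover have "?p i = i" if "i \<in> insert b D" for i
  proof (cases "i = b")
    case False
    then have "p i = i" using that p(5) by auto
    then have "i \<noteq> a" "i \<noteq> p a" "i \<noteq> p b" using ab(4,5) p(2) by metis+
    then show ?thesis using False \<open>p i = i\<close> by simp
  qed simp
  moreover have "insert b D \<subseteq> {1..n}" using p(4) ab by simp
  ultimately show ?thesis unfolding is_web_def using inv perm card by blast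
qed

text \<open>The cases are sorted by the number of arc ends among \<open>a\<close> and
  \<open>b\<close>: one, none, two.\<close>

lemma step_cases [consumes 4, case_names relabel cup cap]:
  assumes "kind a b (D, p) \<noteq> 0" "a \<noteq> b"
    and "\<forall>i\<in>D. p i = i" and inv: "\<forall>i. p (p i) = i"
  obtains "p a = a \<or> p b = b" "p a \<noteq> a \<or> p b \<noteq> b" "a \<in> D \<longleftrightarrow> p a = a" "b \<notin> D" "kind a b (D, p) = 1"
      "step a b (D, p) = (Transposition.transpose a b ` D, Transposition.transpose a b \<circ> p \<circ> Transposition.transpose a b)"
  | "a \<in> D" "b \<notin> D" "p b = b" "p a = a" "kind a b (D, p) = 1" "step a b (D, p) = (D - {a}, p(a := b, b := a))"
  | "p a \<noteq> a" "p b \<noteq> b" "a \<notin> D" "b \<notin> D" "kind a b (D, p) = (if p a = b then 2 else 1)"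
      "step a b (D, p) = (insert b D, p(p a := p b, p b := p a, a := a, b := b))"
proof -
  have b: "b \<notin> D" and a: "a \<in> D \<or> p a \<noteq> a" using assms(1) by (auto simp: kind_def split: if_splits)
  have aD: "a \<in> D \<Longrightarrow> p a = a" using assms(3) by auto
  show thesis
  proof (cases "p b = b")
    case True
    then have pab: "p a \<noteq> b" using inv assms(2) by metis
    show thesis
    proof (cases "a \<in> D")
      case A: True
      show thesis by (rule that(2)) (use True A aD b assms(2) in \<open>auto simp: kind_def step_def\<close>)
    next
      case A: False
      show thesis by (rule that(1)) (use True A a b assms(2) pab in \<open>auto simp: kind_def step_def\<close>)
    qed
  next
    case False
    show thesis
    proof (cases "a \<in> D")
      case A: True
      show thesis by (rule that(1)) (use False A aD b assms(2) in \<open>auto simp: kind_def step_def\<close>)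
    next
      case A: False
      show thesis by (rule that(3)) (use False A a b assms(2) in \<open>auto simp: kind_def step_def\<close>)
    qed
  qed
qed

lemma is_webD:
  assumes "is_web n k (D, p)"
  shows "D \<subseteq> {1..n}" "p permutes {1..n}" "\<forall>i. p (p i) = i" "\<forall>i\<in>D. p i = i"
     "2 * card D + card (moved p) = 2 * k" "noncrossing p" "finite D" "finite (moved p)" "moved p \<subseteq> {1..n}"
  using assms by (auto simp: is_web_def intro: finite_subset dest: moved_subset)

lemma web_step:
  assumes w: "is_web n k \<omega>" and ab: "a \<in> {1..n}" "b \<in> {1..n}" "adjacent a b" and k: "kind a b \<omega> \<noteq> 0"
  shows "is_web n k (step a b \<omega>)"
proof -
  obtain D p where [simp]: "\<omega> = (D, p)" by fastforce
  have ne: "a \<noteq> b" using ab by (auto simp: adjacent_def)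
  have p: "\<forall>i\<in>D. p i = i" "\<forall>i. p (p i) = i" using w by (auto simp: is_web_def)
  have k': "kind a b (D, p) \<noteq> 0" using k by simp
  show ?thesis
    using k' ne p
  proof (cases rule: step_cases)
    case relabel show ?thesis unfolding relabel(6) \<open>\<omega> = (D, p)\<close> by (rule web_relabel[of n k D p a b, OF _ ab relabel(1)]) (use w in simp)
  next
    case cup show ?thesis unfolding cup(6) \<open>\<omega> = (D, p)\<close> by (rule web_cup[of n k D p a b, OF _ ab cup(1,2,3)]) (use w in simp)
  next
    case cap show ?thesis unfolding cap(6) \<open>\<omega> = (D, p)\<close> by (rule web_cap[of n k D p a b, OF _ ab cap(1,2)]) (use w in simp)
  qed
qed

section \<open>Undoing a move\<close>

lemma step_step_relabel:
  assumes "p a = a \<or> p b = b" "p a \<noteq> a \<or> p b \<noteq> b" "a \<in> D \<longleftrightarrow> p a = a" "b \<notin> D" "\<forall>i. p (p i) = i" "\<forall>i\<in>D. p i = i" "a \<noteq> b"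
  shows "kind b a (step a b (D, p)) = 1" "step b a (step a b (D, p)) = (D, p)"
proof -
  let ?t = "Transposition.transpose a b"
  have pne: "p a \<noteq> b" "p b \<noteq> a" using assms(1,5,7) by metis+
  have st: "step a b (D, p) = (?t ` D, ?t \<circ> p \<circ> ?t)"
    using assms by (auto simp: step_def)
  have Da: "a \<in> ?t ` D \<longleftrightarrow> b \<in> D" "b \<in> ?t ` D \<longleftrightarrow> a \<in> D"
    by (metis image_iff transpose_apply_first transpose_apply_second transpose_involutory)+
  have pa: "(?t \<circ> p \<circ> ?t) a = ?t (p b)" "(?t \<circ> p \<circ> ?t) b = ?t (p a)" by simp_all
  have ta: "?t (p b) = a \<longleftrightarrow> p b = b" "?t (p a) = b \<longleftrightarrow> p a = a" "?t (p a) = a \<longleftrightarrow> p a = b"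
    by (metis transpose_apply_first transpose_apply_second transpose_involutory)+
  show "kind b a (step a b (D, p)) = 1"
    unfolding st kind_def using Da pa ta assms pne by auto
  have "step b a (?t ` D, ?t \<circ> p \<circ> ?t) = (?t ` ?t ` D, ?t \<circ> (?t \<circ> p \<circ> ?t) \<circ> ?t)"
    unfolding step_def using Da pa ta assms pne by (auto simp: transpose_commute[of b a])
  also have "?t ` ?t ` D = D" by (simp add: image_comp)
  also have "?t \<circ> (?t \<circ> p \<circ> ?t) \<circ> ?t = p" by (auto simp: fun_eq_iff)
  finally show "step b a (step a b (D, p)) = (D, p)" unfolding st .
qed

text \<open>The string of length three for the \<open>sl\<^sub>2\<close> of \<open>a\<close> and
  \<open>b\<close>: doubled \<open>a\<close>, an arc between them, doubled \<open>b\<close>. The arc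
  is left in both directions with kind 2.\<close>

lemma step_step_cup:
  assumes "a \<in> D" "b \<notin> D" "p a = a" "p b = b" "\<forall>i. p (p i) = i" "a \<noteq> b"
  shows "kind b a (step a b (D, p)) = 2" "step b a (step a b (D, p)) = (D, p)"
    "kind a b (step a b (D, p)) = 2"
    "step a b (step a b (D, p)) = (insert b (D - {a}), p)"
proof -
  have st: "step a b (D, p) = (D - {a}, p(a := b, b := a))"
    using assms by (auto simp: step_def)
  show "kind b a (step a b (D, p)) = 2" "kind a b (step a b (D, p)) = 2"
    unfolding st kind_def using assms by auto
  have p: "p(a := b, b := a, a := a, b := b) = p" "p(b := a, a := b, a := a, b := b) = p"
      "p(a := b, b := a, b := b, a := a) = p" "p(b := a, a := b, b := b, a := a) = p" using assms(3,4) by auto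
  show "step b a (step a b (D, p)) = (D, p)"
    unfolding st step_def using assms p by auto
  show "step a b (step a b (D, p)) = (insert b (D - {a}), p)"
    unfolding st step_def using assms p by auto
qed

lemma step_step_matched:
  assumes "p a = b" "p b = a" "a \<notin> D" "b \<notin> D" "a \<noteq> b"
  shows "kind b a (step a b (D, p)) = 1" "step b a (step a b (D, p)) = (D, p)"
proof -
  have st: "step a b (D, p) = (insert b D, p(a := a, b := b))"
    using assms by (auto simp: step_def fun_upd_twist)
  show "kind b a (step a b (D, p)) = 1" unfolding st kind_def using assms by auto
  show "step b a (step a b (D, p)) = (D, p)" unfolding st step_def using assms by (auto)
qed

section \<open>Height and descent to the highest weight\<close>

lemma sum_insert_minus:
  fixes D :: "nat set"
  assumes "finite D" "a \<in> D" "b \<notin> D"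
  shows "\<Sum>(insert b (D - {a})) + a = \<Sum>D + b"
  using assms by (simp add: sum.remove[of D a] add.commute)

lemma transpose_image_insert:
  assumes "a \<in> D" "b \<notin> D"
  shows "Transposition.transpose a b ` D = insert b (D - {a})"
  using assms by (auto simp: Transposition.transpose_def image_iff split: if_splits)

lemma transpose_image_id:
  assumes "a \<in> D \<longleftrightarrow> b \<in> D"
  shows "Transposition.transpose a b ` D = D"
  using assms by (auto simp: Transposition.transpose_def image_iff split: if_splits)

lemma height_step:
  assumes w: "is_web n k \<omega>" and ne: "a \<noteq> b" and k: "kind a b \<omega> \<noteq> 0"
  shows "height (step a b \<omega>) + a = height \<omega> + b"
proof -
  obtain D p where \<omega>: "\<omega> = (D, p)" by fastforce
  note W = is_webD[OF w[unfolded \<omega>]]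
  let ?t = "Transposition.transpose a b"
  show ?thesis using k[unfolded \<omega>] ne W(4,3)
  proof (cases rule: step_cases)
    case relabel
    show ?thesis
    proof (cases "a \<in> D")
      case True
      then have mv: "b \<in> moved p" "a \<notin> moved p" using relabel W by (auto simp: moved_def)
      have "?t ` moved p = insert a (moved p - {b})"
        using transpose_image_insert[OF mv] by (simp add: transpose_commute)
      then show ?thesis
        unfolding \<omega> relabel(6) height_def using W(3,7,8) mv True relabel(4)
        using sum_insert_minus[of D a b] sum_insert_minus[of "moved p" b a]
        by (simp add: step_conj transpose_image_insert)
    next
      case False
      then have mv: "a \<in> moved p" "b \<notin> moved p" using relabel W by (auto simp: moved_def)
      then show ?thesis
        unfolding \<omega> relabel(6) height_def using W(3,7,8) False relabel(4)
        using sum_insert_minus[of "moved p" a b]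
        by (simp add: step_conj transpose_image_insert transpose_image_id)
    qed
  next
    case cup
    have "moved (p(a := b, b := a)) = insert a (insert b (moved p))" "a \<notin> moved p" "b \<notin> moved p"
      using cup ne by (auto simp: moved_def)
    then show ?thesis unfolding \<omega> cup(6) height_def using W(7,8) cup ne
      by (simp add: sum.remove[of D a])
  next
    case cap
    have mv': "moved (p(p a := p b, p b := p a, a := a, b := b)) = moved p - {a, b}"
      using join_involution(2)[OF W(3) ne cap(1,2)] by blast
    have mem: "a \<in> moved p" "b \<in> moved p - {a}" using cap ne by (auto simp: moved_def)
    have "\<Sum>(moved p) = a + (b + \<Sum>(moved p - {a} - {b}))"
      using W(8) mem by (metis finite_Diff sum.remove)
    moreover have "moved p - {a} - {b} = moved p - {a, b}" by auto
    ultimately show ?thesis unfolding \<omega> cap(6) height_def using W(7) cap mv' by simp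
  qed
qed

text \<open>A web that fails this has a predecessor under some \<open>F\<^sub>i\<close> with
  \<open>i < m\<close>, see \<open>web_reach\<close>. The bound is \<open>n\<close> for the full
  descent and \<open>n - 1\<close> if \<open>F\<^sub>n\<^sub>-\<^sub>1\<close> has to be
  avoided.\<close>

definition reduced :: "nat \<Rightarrow> web \<Rightarrow> bool" where
  "reduced m \<omega> \<longleftrightarrow> (\<forall>i\<in>{1..<m}. weight \<omega> (Suc i) \<le> weight \<omega> i \<and> snd \<omega> i \<noteq> Suc i)"

text \<open>Apply \<open>E\<^sub>i\<close> at a place where reducedness fails. If \<open>i\<close>
  is empty and \<open>Suc i\<close> doubled, the web ends a string of length three and its last
  arrow has the factor \<open>q + q\<^sup>-\<^sup>1\<close>, so both predecessors are returned. That
  \<open>i\<close> and \<open>Suc i\<close> are not both arc ends of the first web is recorded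
  because there the Kashiwara operator equals \<open>F\<^sub>i\<close>.\<close>

lemma web_reach:
  assumes w: "is_web n k \<omega>" and "m \<le> n" and nr: "\<not> reduced m \<omega>"
  obtains i \<omega>' where "i \<in> {1..<m}" "is_web n k \<omega>'" "height \<omega>' < height \<omega>" "kind i (Suc i) \<omega>' = 1" "snd \<omega>' i = i \<or> snd \<omega>' (Suc i) = Suc i" "step i (Suc i) \<omega>' = \<omega>"
  | i \<omega>1 \<omega>2 where "i \<in> {1..<m}" "is_web n k \<omega>1" "is_web n k \<omega>2" "height \<omega>1 < height \<omega>" "height \<omega>2 < height \<omega>"
     "kind i (Suc i) \<omega>2 = 1" "snd \<omega>2 i = i \<or> snd \<omega>2 (Suc i) = Suc i" "step i (Suc i) \<omega>2 = \<omega>1" "kind i (Suc i) \<omega>1 = 2" "step i (Suc i) \<omega>1 = \<omega>"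
proof -
  obtain D p where \<omega>: "\<omega> = (D, p)" by fastforce
  note W = is_webD[OF w[unfolded \<omega>]]
  obtain i where i: "i \<in> {1..<m}" and "weight \<omega> (Suc i) > weight \<omega> i \<or> p i = Suc i"
    using nr unfolding reduced_def \<omega> by auto
  then consider (cup) "Suc i \<in> D" "i \<notin> D" "p i = i" "p (Suc i) = Suc i" | (matched) "p i = Suc i"
    | (relabel) "p (Suc i) = Suc i \<or> p i = i" "p (Suc i) \<noteq> Suc i \<or> p i \<noteq> i" "Suc i \<in> D \<longleftrightarrow> p (Suc i) = Suc i" "i \<notin> D"
    unfolding \<omega> weight_def using W(4) by (auto split: if_splits)
  then show thesis
  proof cases
    case relabel
    have k: "kind (Suc i) i \<omega> \<noteq> 0" unfolding \<omega> kind_def using relabel by auto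
    note s = step_step_relabel[OF relabel W(3,4), simplified]
    have f: "snd (step (Suc i) i \<omega>) i = i \<or> snd (step (Suc i) i \<omega>) (Suc i) = Suc i"
      using relabel by (auto simp: \<omega> step_def)
    show thesis
      by (rule that(1)[OF i, of "step (Suc i) i \<omega>"])
        (use s f web_step[OF w, of "Suc i" i] height_step[OF w, of "Suc i" i] k i \<open>m \<le> n\<close> in \<open>auto simp: \<omega> adjacent_def\<close>)
  next
    case matched
    then have pSi: "p (Suc i) = i" using W(3) by metis
    have nD: "i \<notin> D" "Suc i \<notin> D" using W(4) matched pSi by auto
    have k: "kind (Suc i) i \<omega> \<noteq> 0" unfolding \<omega> kind_def using matched pSi nD by auto
    note s = step_step_matched[OF pSi matched nD(2,1), simplified]
    have f: "snd (step (Suc i) i \<omega>) i = i \<or> snd (step (Suc i) i \<omega>) (Suc i) = Suc i"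
      using matched pSi by (auto simp: \<omega> step_def)
    show thesis
      by (rule that(1)[OF i, of "step (Suc i) i \<omega>"])
        (use s f web_step[OF w, of "Suc i" i] height_step[OF w, of "Suc i" i] k i \<open>m \<le> n\<close> in \<open>auto simp: \<omega> adjacent_def\<close>)
  next
    case cup
    have k: "kind (Suc i) i \<omega> \<noteq> 0" unfolding \<omega> kind_def using cup by auto
    note s = step_step_cup[OF cup(1,2,4,3) W(3), simplified]
    let ?w1 = "step (Suc i) i \<omega>"
    have w1: "is_web n k ?w1" "height ?w1 < height \<omega>"
      using web_step[OF w, of "Suc i" i] height_step[OF w, of "Suc i" i] k i \<open>m \<le> n\<close> by (auto simp: adjacent_def)
    have k1: "kind (Suc i) i ?w1 \<noteq> 0" using s by (simp add: \<omega>)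
    let ?w2 = "step (Suc i) i ?w1"
    have w2: "is_web n k ?w2" "height ?w2 < height ?w1"
      using web_step[OF w1(1), of "Suc i" i] height_step[OF w1(1), of "Suc i" i] k1 i \<open>m \<le> n\<close> by (auto simp: adjacent_def)
    have st: "?w1 = (D - {Suc i}, p(Suc i := i, i := Suc i))" using cup by (auto simp: \<omega> step_def)
    have s2: "kind i (Suc i) ?w2 = 1" "step i (Suc i) ?w2 = ?w1"
      using step_step_matched[of "p(Suc i := i, i := Suc i)" "Suc i" i "D - {Suc i}"] cup unfolding st by auto
    have f: "snd ?w2 i = i \<or> snd ?w2 (Suc i) = Suc i"
      unfolding st by (auto simp: step_def)
    show thesis
      by (rule that(2)[OF i w1(1) w2(1) w1(2)]) (use w1 w2 s s2 f in \<open>auto simp: \<omega>\<close>)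
  qed
qed

text \<open>Under an arc from \<open>i\<close> to \<open>j\<close> the nonincreasing weights are
  squeezed to 1, so \<open>Suc i\<close> carries an arc nested inside, which is shorter.\<close>

lemma reduced_no_arc:
  assumes w: "is_web n k (D, p)" and r: "reduced m (D, p)"
  shows "1 \<le> i \<Longrightarrow> i < j \<Longrightarrow> j \<le> m \<Longrightarrow> p i \<noteq> j"
proof (induction "j - i" arbitrary: i j rule: less_induct)
  case less
  note W = is_webD[OF w]
  show ?case
  proof
    assume pij: "p i = j"
    then have pji: "p j = i" using W(3) by metis
    have decr: "weight (D, p) (i + d) \<le> weight (D, p) i" if "i + d \<le> m" for d
      using that
    proof (induction d)
      case (Suc d)
      have "weight (D, p) (Suc (i + d)) \<le> weight (D, p) (i + d)"
        using r Suc.prems less.prems unfolding reduced_def by auto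
      then show ?case using Suc by auto
    qed simp
    have mono2: "weight (D, p) j \<le> weight (D, p) (j - d)" if "i + d \<le> j" for d
      using that
    proof (induction d)
      case (Suc d)
      have "j - Suc d \<in> {1..<m}" using Suc.prems less.prems by auto
      then have "weight (D, p) (Suc (j - Suc d)) \<le> weight (D, p) (j - Suc d)"
        using r unfolding reduced_def by blast
      moreover have "Suc (j - Suc d) = j - d" using Suc.prems by auto
      ultimately show ?case using Suc by auto
    qed simp
    have w1: "weight (D, p) i = 1" "weight (D, p) j = 1" using pij pji less.prems W(4) by (auto simp: weight_def)
    have nsi: "p i \<noteq> Suc i" using r less.prems by (auto simp: reduced_def)
    have "weight (D, p) (Suc i) = 1"
      using decr[of 1] mono2[of "j - Suc i"] w1 less.prems by auto
    then have "p (Suc i) \<noteq> Suc i" by (auto simp: weight_def split: if_splits)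
    moreover have "i < p (Suc i)" "p (Suc i) < j"
      using W(6) nsi pij less.prems unfolding noncrossing_def by (metis Suc_lessI lessI)+
    ultimately have "Suc i < p (Suc i)" by linarith
    then have "p (Suc i) - Suc i < j - i" using \<open>p (Suc i) < j\<close> by linarith
    then show False using \<open>Suc i < p (Suc i)\<close> less.hyps[of "p (Suc i)" "Suc i"] less.prems \<open>p (Suc i) < j\<close> by auto
  qed
qed

text \<open>Without arcs a nonincreasing weight consists of values 2 followed by values 0, and the
  degree tells how many.\<close>

lemma reduced_all:
  assumes w: "is_web n k \<omega>" and r: "reduced n \<omega>"
  shows "\<omega> = top_web k"
proof -
  obtain D p where \<omega>: "\<omega> = (D, p)" by fastforce
  note W = is_webD[OF w[unfolded \<omega>]]
  have "p i = i" for i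
  proof (rule ccontr)
    assume "p i \<noteq> i"
    then have "i \<in> {1..n}" using W(2) by (auto simp: permutes_def)
    then have "p i \<in> {1..n}" "i \<in> {1..n}" using W(2) by (simp_all only: permutes_in_image)
    then show False using reduced_no_arc[OF w[unfolded \<omega>] r[unfolded \<omega>], of i "p i"]
      reduced_no_arc[OF w[unfolded \<omega>] r[unfolded \<omega>], of "p i" i] W(3) \<open>p i \<noteq> i\<close> by (metis atLeastAtMost_iff nat_neq_iff)
  qed
  then have p: "p = id" by auto
  then have "card D = k" using W(5) by (simp add: moved_def)
  have down: "i \<in> D" if "Suc i \<in> D" "1 \<le> i" for i
  proof -
    have "i \<in> {1..<n}" using that W(1) by auto
    then show ?thesis using r that unfolding reduced_def \<omega> p by (auto simp: weight_def split: if_splits)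
  qed
  have all: "j \<in> D \<Longrightarrow> i \<in> {1..j} \<Longrightarrow> i \<in> D" for i j
  proof (induction j)
    case (Suc j)
    then show ?case using down[of j] by (cases "i = Suc j") auto
  qed simp
  have "D = {1..k}"
  proof (cases "D = {}")
    case True then show ?thesis using \<open>card D = k\<close> by simp
  next
    case False
    then have "Max D \<in> D" using W(7) by (simp add: Max_in)
    then have "{1..Max D} \<subseteq> D" using all by blast
    moreover have "D \<subseteq> {1..Max D}" using W(1,7) by (auto intro: Max_ge)
    ultimately obtain m where m: "D = {1..m}" by blast
    then have "m = k" using \<open>card D = k\<close> by simp
    then show ?thesis using m by simp
  qed
  then show ?thesis by (simp add: \<omega> p top_web_def)
qed

text \<open>An arc avoiding \<open>n\<close> would lie within the first \<open>n - 1\<close> sites,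
  where \<open>reduced_no_arc\<close> excludes it.\<close>

lemma reduced_butlast:
  assumes w: "is_web n k (D, p)" and r: "reduced (n - 1) (D, p)"
  shows "moved p \<subseteq> {p n, n}"
proof
  note W = is_webD[OF w]
  fix i assume i: "i \<in> moved p"
  then have pi: "p i \<noteq> i" "i \<in> {1..n}" using W(9) by (auto simp: moved_def)
  then have pi': "p i \<in> {1..n}" using W(2) by (simp only: permutes_in_image)
  show "i \<in> {p n, n}"
  proof (rule ccontr)
    assume "i \<notin> {p n, n}"
    then have "i \<noteq> n" "p i \<noteq> n" using W(3) by auto
    then have "i \<le> n - 1" "p i \<le> n - 1" using pi pi' by auto
    then show False using reduced_no_arc[OF w r, of i "p i"]
      reduced_no_arc[OF w r, of "p i" i] W(3) pi pi' by (cases "i < p i") auto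
  qed
qed

text \<open>In the case \<open>double\<close> the new web is the second divided power of
  \<open>F\<^sub>i\<close> applied to \<open>\<omega>\<close>, while \<open>F\<^sub>i\<close>
  applied to the middle web \<open>\<omega>1\<close> gives \<open>q + q\<^sup>-\<^sup>1\<close>
  times it. Both hypotheses are offered, so that one may use the divided power or cancel the
  factor.\<close>

lemma web_induct [consumes 1, case_names top step double]:
  assumes w: "is_web n k \<omega>"
    and top: "P (top_web k)"
    and s: "\<And>i \<omega>. i \<in> {1..<n} \<Longrightarrow> is_web n k \<omega> \<Longrightarrow> kind i (Suc i) \<omega> = 1 \<Longrightarrow> snd \<omega> i = i \<or> snd \<omega> (Suc i) = Suc i \<Longrightarrow> is_web n k (step i (Suc i) \<omega>) \<Longrightarrow> P \<omega> \<Longrightarrow> P (step i (Suc i) \<omega>)"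
    and d: "\<And>i \<omega> \<omega>1. i \<in> {1..<n} \<Longrightarrow> is_web n k \<omega> \<Longrightarrow> kind i (Suc i) \<omega> = 1 \<Longrightarrow> snd \<omega> i = i \<or> snd \<omega> (Suc i) = Suc i \<Longrightarrow> \<omega>1 = step i (Suc i) \<omega> \<Longrightarrow> is_web n k \<omega>1 \<Longrightarrow>
         kind i (Suc i) \<omega>1 = 2 \<Longrightarrow> is_web n k (step i (Suc i) \<omega>1) \<Longrightarrow> P \<omega> \<Longrightarrow> P \<omega>1 \<Longrightarrow> P (step i (Suc i) \<omega>1)"
  shows "P \<omega>"
  using w
proof (induction "height \<omega>" arbitrary: \<omega> rule: less_induct)
  case less
  show ?case
  proof (cases "reduced n \<omega>")
    case True then show ?thesis using reduced_all[OF less.prems] top by simp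
  next
    case False
    show ?thesis
      by (rule web_reach[OF less.prems order_refl False]) (use less s d in blast)+
  qed
qed

text \<open>\<open>F\<^sub>n\<^sub>-\<^sub>1\<close> is left out because \<open>c\<^sub>0\<close>
  sends \<open>n - 1\<close>, \<open>n\<close> to \<open>n\<close>, 1, which are not neighbours. The
  price is a larger base: the webs whose only possible arc ends at \<open>n\<close>.\<close>

lemma web_induct_butlast [consumes 1, case_names base step double]:
  assumes w: "is_web n k \<omega>"
    and base: "\<And>D p. is_web n k (D, p) \<Longrightarrow> moved p \<subseteq> {p n, n} \<Longrightarrow> P (D, p)"
    and s: "\<And>i \<omega>. i \<in> {1..<n-1} \<Longrightarrow> is_web n k \<omega> \<Longrightarrow> kind i (Suc i) \<omega> = 1 \<Longrightarrow> snd \<omega> i = i \<or> snd \<omega> (Suc i) = Suc i \<Longrightarrow> is_web n k (step i (Suc i) \<omega>) \<Longrightarrow> P \<omega> \<Longrightarrow> P (step i (Suc i) \<omega>)"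
    and d: "\<And>i \<omega> \<omega>1. i \<in> {1..<n-1} \<Longrightarrow> is_web n k \<omega> \<Longrightarrow> kind i (Suc i) \<omega> = 1 \<Longrightarrow> snd \<omega> i = i \<or> snd \<omega> (Suc i) = Suc i \<Longrightarrow> \<omega>1 = step i (Suc i) \<omega> \<Longrightarrow> is_web n k \<omega>1 \<Longrightarrow>
         kind i (Suc i) \<omega>1 = 2 \<Longrightarrow> is_web n k (step i (Suc i) \<omega>1) \<Longrightarrow> P \<omega> \<Longrightarrow> P \<omega>1 \<Longrightarrow> P (step i (Suc i) \<omega>1)"
  shows "P \<omega>"
  using w
proof (induction "height \<omega>" arbitrary: \<omega> rule: less_induct)
  case less
  show ?case
  proof (cases "reduced (n - 1) \<omega>")
    case True then show ?thesis using reduced_butlast less.prems base by (cases \<omega>) auto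
  next
    case False
    show ?thesis
      by (rule web_reach[OF less.prems diff_le_self False]) (use less s d in blast)+
  qed
qed

lemma web_top: "k \<le> n \<Longrightarrow> is_web n k (top_web k)"
  by (auto simp: is_web_def top_web_def permutes_id moved_def noncrossing_def)

section \<open>The tensor square of an exterior power\<close>

text \<open>The preimage of a configuration with \<open>b\<close> and without \<open>a\<close> under
  moving an element from \<open>a\<close> to \<open>b\<close>; operators on functions are evaluated
  at such preimages.\<close>

definition mv :: "nat \<Rightarrow> nat \<Rightarrow> nat set \<Rightarrow> nat set" where
  "mv a b I = insert a (I - {b})"

lemma mem_mv [simp]: "x \<in> mv a b I \<longleftrightarrow> x = a \<or> (x \<in> I \<and> x \<noteq> b)"
  by (auto simp: mv_def)

lemma mv_mv [simp]: "a \<notin> I \<Longrightarrow> b \<in> I \<Longrightarrow> mv b a (mv a b I) = I"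
  by (auto simp: mv_def)

lemma mv_commute: "a \<noteq> d \<Longrightarrow> b \<noteq> c \<Longrightarrow> mv a b (mv c d I) = mv c d (mv a b I)"
  by (auto simp: mv_def)

lemma mv_transpose: "a \<notin> I \<Longrightarrow> b \<in> I \<Longrightarrow> mv a b I = Transposition.transpose a b ` I"
  by (subst transpose_commute, subst transpose_image_insert) (auto simp: mv_def)

text \<open>A function of two subsets \<open>I\<close>, \<open>J\<close> of \<open>{1..n}\<close> stands for an element of the tensor square; the
  comultiplication is \<open>F \<otimes> K + 1 \<otimes> F\<close>, \<open>E \<otimes> 1 + K\<^sup>-\<^sup>1 \<otimes> E\<close>, and \<open>mvop q a b\<close> moves an
  element of \<open>I\<close> or \<open>J\<close> from \<open>a\<close> to \<open>b\<close>.\<close>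

definition kap :: "'a::field \<Rightarrow> nat \<Rightarrow> nat set \<Rightarrow> 'a" where
  "kap q i I = (if i \<in> I \<and> Suc i \<notin> I then q else if i \<notin> I \<and> Suc i \<in> I then inverse q else 1)"

text \<open>\<open>gl\<close> and \<open>gr\<close> are the values of the Cartan factors of the
  comultiplication on the set that is left unchanged: for \<open>a < b\<close> the lowering operator
  puts the factor on \<open>J\<close>, for \<open>a > b\<close> the raising operator puts its
  inverse on \<open>I\<close>. They are written for all \<open>a\<close>, \<open>b\<close> so that
  one computation serves both directions.\<close>

definition gl :: "'a::field \<Rightarrow> nat \<Rightarrow> nat \<Rightarrow> nat set \<Rightarrow> 'a" where
  "gl q a b J = (if a \<in> J \<and> b \<notin> J then (if a < b then q else 1)
     else if a \<notin> J \<and> b \<in> J then (if a < b then inverse q else 1) else 1)"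

definition gr :: "'a::field \<Rightarrow> nat \<Rightarrow> nat \<Rightarrow> nat set \<Rightarrow> 'a" where
  "gr q a b I = (if a \<in> I \<and> b \<notin> I then (if a < b then 1 else q)
     else if a \<notin> I \<and> b \<in> I then (if a < b then 1 else inverse q) else 1)"

definition mvop :: "'a::field \<Rightarrow> nat \<Rightarrow> nat \<Rightarrow> (nat set \<Rightarrow> nat set \<Rightarrow> 'a) \<Rightarrow> nat set \<Rightarrow> nat set \<Rightarrow> 'a" where
  "mvop q a b f I J = (if a \<notin> I \<and> b \<in> I then gl q a b J * f (mv a b I) J else 0) +
     (if a \<notin> J \<and> b \<in> J then gr q a b I * f I (mv a b J) else 0)"

abbreviation "TF q i \<equiv> mvop q i (Suc i)"
abbreviation "TE q i \<equiv> mvop q (Suc i) i"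

definition TK :: "'a::field \<Rightarrow> nat \<Rightarrow> (nat set \<Rightarrow> nat set \<Rightarrow> 'a) \<Rightarrow> nat set \<Rightarrow> nat set \<Rightarrow> 'a" where
  "TK q i f I J = kap q i I * kap q i J * f I J"

definition TKi :: "'a::field \<Rightarrow> nat \<Rightarrow> (nat set \<Rightarrow> nat set \<Rightarrow> 'a) \<Rightarrow> nat set \<Rightarrow> nat set \<Rightarrow> 'a" where
  "TKi q i f I J = inverse (kap q i I * kap q i J) * f I J"

lemma gl_F: "gl q i (Suc i) J = kap q i J" and gr_F: "gr q i (Suc i) J = 1"
  and gl_E: "gl q (Suc i) i J = 1" and gr_E: "gr q (Suc i) i J = inverse (kap q i J)"
  by (auto simp: gl_def gr_def kap_def)

lemma kap_nz: "q \<noteq> 0 \<Longrightarrow> kap q i I \<noteq> 0"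
  by (auto simp: kap_def)

section \<open>Relations of the quantum group on the tensor square\<close>

lemma kap_mv:
  assumes "q \<noteq> 0" "j \<notin> I" "Suc j \<in> I"
  shows "kap q i (mv j (Suc j) I) = q powi (cartan i j) * kap q i I"
proof -
  have p: "q powi 2 = q * q" "q powi - 1 = inverse q"
    by (simp_all add: power_int_def power2_eq_square)
  have q2: "q\<^sup>2 * inverse q = q" using assms by (simp add: power2_eq_square)
  consider "i = j" | "i = Suc j" | "j = Suc i" | "i \<noteq> j" "i \<noteq> Suc j" "j \<noteq> Suc i" by blast
  then show ?thesis
    by cases (use assms in \<open>simp_all add: kap_def cartan_def p q2\<close>)
qed

text \<open>A check of the sixteen memberships of \<open>i\<close>, \<open>Suc i\<close> in
  \<open>I\<close>, \<open>J\<close>. The four auxiliary facts evaluate the quantum integers of 1,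
  2, -1 and -2 that come from the Cartan side.\<close>

lemma TE_TF_same:
  fixes q :: "'a::field"
  assumes q: "q \<noteq> 0" "q - inverse q \<noteq> 0"
  shows "TE q i (TF q i f) I J - TF q i (TE q i f) I J = inverse (q - inverse q) * (TK q i f I J - TKi q i f I J)"
proof -
  define s where "s = inverse (q - inverse q)"
  have s: "s * (q - inverse q) = 1" using q by (simp add: s_def)
  have 1: "s * (q * x - inverse q * x) = x" for x
    using s by (metis left_diff_distrib mult.assoc mult_1)
  have 2: "s * (q * (q * x) - inverse q * (inverse q * x)) = q * x + inverse q * x" for x
  proof -
    have "q * (q * x) - inverse q * (inverse q * x) = q * (q * x + inverse q * x) - inverse q * (q * x + inverse q * x)"
      using q by (simp add: distrib_left)
    then show ?thesis using 1 by simp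
  qed
  have 3: "s * (inverse q * x - q * x) = - x" for x using 1[of x] by (metis minus_diff_eq mult_minus_right)
  have 4: "s * (inverse q * (inverse q * x) - q * (q * x)) = - (q * x + inverse q * x)" for x
    using 2[of x] by (metis minus_diff_eq mult_minus_right)
  show ?thesis
    unfolding mvop_def gl_F gr_F gl_E gr_E TK_def TKi_def s_def[symmetric]
    using q(1)
    by (cases "i \<in> I"; cases "Suc i \<in> I"; cases "i \<in> J"; cases "Suc i \<in> J")
       (simp_all add: kap_def mult.assoc 1 2 3 4)
qed

text \<open>Expands two composites into four terms each, sorted by the tensor factors on which the
  two operators act. Only one mixed pair carries different scalars on the two sides.\<close>

lemma swap_ifs:
  fixes x1 :: "'a::comm_ring_1"
  assumes "c1 \<and> p \<longleftrightarrow> c3 \<and> p'" "c2 \<and> r \<longleftrightarrow> c4 \<and> r'"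
    and "c1 \<and> p \<Longrightarrow> x1 = y1" "c2 \<and> c3 \<Longrightarrow> ki * x3 = kj * y3" "c2 \<and> r \<Longrightarrow> x4 = y4" "c1 \<and> c4 \<Longrightarrow> x2 = y2"
  shows "(if c1 then (if p then kj * x1 else 0) + (if c4 then x2 else 0) else 0) +
      (if c2 then ki * ((if c3 then x3 else 0) + (if r then x4 else 0)) else 0) =
    (if c3 then kj * ((if p' then y1 else 0) + (if c2 then y3 else 0)) else 0) +
      (if c4 then (if c1 then y2 else 0) + (if r' then ki * y4 else 0) else 0)"
proof -
  have "(if c1 then (if p then kj * x1 else 0) + (if c4 then x2 else 0) else 0) =
      (if c1 \<and> p then kj * x1 else 0) + (if c1 \<and> c4 then x2 else 0)"
    "(if c2 then ki * ((if c3 then x3 else 0) + (if r then x4 else 0)) else 0) =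
      (if c2 \<and> c3 then ki * x3 else 0) + (if c2 \<and> r then ki * x4 else 0)"
    "(if c3 then kj * ((if p' then y1 else 0) + (if c2 then y3 else 0)) else 0) =
      (if c3 \<and> p' then kj * y1 else 0) + (if c2 \<and> c3 then kj * y3 else 0)"
    "(if c4 then (if c1 then y2 else 0) + (if r' then ki * y4 else 0) else 0) =
      (if c1 \<and> c4 then y2 else 0) + (if c4 \<and> r' then ki * y4 else 0)"
    by (auto simp: distrib_left)
  moreover have "(if c1 \<and> p then kj * x1 else 0) = (if c3 \<and> p' then kj * y1 else 0)"
    "(if c2 \<and> r then ki * x4 else 0) = (if c4 \<and> r' then ki * y4 else 0)"
    "(if c2 \<and> c3 then ki * x3 else 0) = (if c2 \<and> c3 then kj * y3 else 0)"
    "(if c1 \<and> c4 then x2 else 0) = (if c1 \<and> c4 then y2 else 0)"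
    using assms by auto
  ultimately show ?thesis by (simp only: add.assoc add.commute add.left_commute)
qed

lemma TE_TF_diff:
  fixes q :: "'a::field"
  assumes q: "q \<noteq> 0" and ij: "i \<noteq> j"
  shows "TE q i (TF q j f) I J = TF q j (TE q i f) I J"
proof -
  have k1: "kap q i (mv j (Suc j) I) = q powi (cartan i j) * kap q i I" if "j \<notin> I" "Suc j \<in> I" for I
    using kap_mv[OF q that] .
  have k2: "kap q j J = q powi (cartan i j) * kap q j (mv (Suc i) i J)" if "i \<in> J" "Suc i \<notin> J" for J
  proof -
    have "mv i (Suc i) (mv (Suc i) i J) = J" using that by simp
    then have "kap q j J = q powi (cartan j i) * kap q j (mv (Suc i) i J)"
      using kap_mv[OF q, of i "mv (Suc i) i J" j] that by simp
    moreover have "cartan j i = cartan i j" by (auto simp: cartan_def)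
    ultimately show ?thesis by simp
  qed
  have mm: "mv j (Suc j) (mv (Suc i) i I) = mv (Suc i) i (mv j (Suc j) I)" for I
    by (rule mv_commute) (use ij in auto)
  have qq: "q powi (cartan i j) \<noteq> 0" using q by simp
  \<comment> \<open>The mixed term: \<open>F\<^sub>j\<close> moves \<open>I\<close> and
    \<open>E\<^sub>i\<close> moves \<open>J\<close>, and the powers of \<open>q\<close> picked up by
    the two Cartan factors cancel.\<close>
  have B: "inverse (kap q i I) * (kap q j (mv (Suc i) i J) * x) = kap q j J * (inverse (kap q i (mv j (Suc j) I)) * x)"
    if "i \<in> J" "Suc i \<notin> J" "j \<notin> I" "Suc j \<in> I" for x
    unfolding k1[OF that(3,4)] k2[OF that(1,2)] inverse_mult_distrib using qq by simp
  show ?thesis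
    unfolding mvop_def gl_F gr_F gl_E gr_E mult_1_left
    by (rule swap_ifs) (use ij B in \<open>auto simp: mm\<close>)
qed

lemma TK_TF:
  fixes q :: "'a::field"
  assumes q: "q \<noteq> 0"
  shows "TK q i (TF q j f) I J = q powi (- cartan i j) * TF q j (TK q i f) I J"
    and "TKi q i (TF q j f) I J = q powi (cartan i j) * TF q j (TKi q i f) I J"
proof -
  have qq: "q powi (cartan i j) \<noteq> 0" "kap q i I \<noteq> 0" "kap q i J \<noteq> 0" using q kap_nz by auto
  show "TK q i (TF q j f) I J = q powi (- cartan i j) * TF q j (TK q i f) I J"
    unfolding mvop_def gl_F gr_F TK_def using q qq by (auto simp: kap_mv power_int_minus field_simps)
  show "TKi q i (TF q j f) I J = q powi (cartan i j) * TF q j (TKi q i f) I J"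
    unfolding mvop_def gl_F gr_F TKi_def using q qq by (auto simp: kap_mv power_int_minus field_simps)
qed

lemma TE_TK:
  fixes q :: "'a::field"
  assumes q: "q \<noteq> 0"
  shows "TE q i (TK q i f) I J = inverse (q * q) * TK q i (TE q i f) I J"
  unfolding mvop_def gl_E gr_E TK_def using q
  by (cases "i \<in> I"; cases "Suc i \<in> I"; cases "i \<in> J"; cases "Suc i \<in> J") (simp_all add: kap_def field_simps)

section \<open>The bilinear form\<close>

definition ip :: "nat \<Rightarrow> (nat set \<Rightarrow> nat set \<Rightarrow> 'a::comm_ring_1) \<Rightarrow> (nat set \<Rightarrow> nat set \<Rightarrow> 'a) \<Rightarrow> 'a" where
  "ip n f g = (\<Sum>I\<in>Pow {1..n}. \<Sum>J\<in>Pow {1..n}. f I J * g I J)"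

lemma sum_mv:
  assumes "a \<in> N" "b \<in> N" "a \<noteq> b" "finite N"
  shows "(\<Sum>I\<in>Pow N. if a \<notin> I \<and> b \<in> I then h (mv a b I) I else (0::'a::comm_monoid_add))
       = (\<Sum>I\<in>Pow N. if b \<notin> I \<and> a \<in> I then h I (mv b a I) else 0)"
proof -
  have "(\<Sum>I\<in>Pow N. if a \<notin> I \<and> b \<in> I then h (mv a b I) I else 0) = (\<Sum>I\<in>{I \<in> Pow N. a \<notin> I \<and> b \<in> I}. h (mv a b I) I)"
    by (rule sum.inter_filter[symmetric]) (use assms in simp)
  also have "\<dots> = (\<Sum>I\<in>{I \<in> Pow N. b \<notin> I \<and> a \<in> I}. h I (mv b a I))"
    by (rule sum.reindex_bij_witness[where i = "mv b a" and j = "mv a b"]) (use assms in \<open>auto simp: mv_def insert_absorb\<close>)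
  also have "\<dots> = (\<Sum>I\<in>Pow N. if b \<notin> I \<and> a \<in> I then h I (mv b a I) else 0)"
    by (rule sum.inter_filter) (use assms in simp)
  finally show ?thesis .
qed

lemma ip_TF:
  fixes q :: "'a::field"
  assumes q: "q \<noteq> 0" and i: "i \<in> {1..<n}"
  shows "ip n (TF q i f) g = q * ip n f (TE q i (TK q i g))"
proof -
  let ?N = "{1..n}"
  have N: "i \<in> ?N" "Suc i \<in> ?N" "i \<noteq> Suc i" using i by auto
  have "ip n (TF q i f) g = (\<Sum>J\<in>Pow ?N. \<Sum>I\<in>Pow ?N. if i \<notin> I \<and> Suc i \<in> I then kap q i J * f (mv i (Suc i) I) J * g I J else 0)
     + (\<Sum>I\<in>Pow ?N. \<Sum>J\<in>Pow ?N. if i \<notin> J \<and> Suc i \<in> J then f I (mv i (Suc i) J) * g I J else 0)"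
    unfolding ip_def mvop_def gl_F gr_F
    by (subst (2) sum.swap) (simp add: sum.distrib[symmetric] distrib_right if_distrib[of "\<lambda>x. x * _"] cong: if_cong)
  also have "\<dots> = (\<Sum>J\<in>Pow ?N. \<Sum>I\<in>Pow ?N. if Suc i \<notin> I \<and> i \<in> I then kap q i J * f I J * g (mv (Suc i) i I) J else 0)
     + (\<Sum>I\<in>Pow ?N. \<Sum>J\<in>Pow ?N. if Suc i \<notin> J \<and> i \<in> J then f I J * g I (mv (Suc i) i J) else 0)"
    using sum_mv[OF N finite_atLeastAtMost, of "\<lambda>I I'. kap q i J * f I J * g I' J" for J]
      sum_mv[OF N finite_atLeastAtMost, of "\<lambda>J J'. f I J * g I J'" for I] by simp
  also have "\<dots> = q * ip n f (TE q i (TK q i g))"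
  proof -
    have *: "q * (f I J * TE q i (TK q i g) I J) = (if Suc i \<notin> I \<and> i \<in> I then kap q i J * f I J * g (mv (Suc i) i I) J else 0)
        + (if Suc i \<notin> J \<and> i \<in> J then f I J * g I (mv (Suc i) i J) else 0)" for I J
      unfolding mvop_def gl_E gr_E TK_def using q kap_nz[OF q, of i I] by (auto simp: kap_def field_simps)
    show ?thesis
      unfolding ip_def sum_distrib_left * by (subst sum.swap) (simp add: sum.distrib)
  qed
  finally show ?thesis .
qed

text \<open>\<open>bvec\<close> is the sum over the orientations of the arcs, one end of an arc in \<open>I\<close> and the other in \<open>J\<close>,
  with a factor \<open>q\<close> for each arc whose left end is in \<open>J\<close>.\<close>

definition compat :: "nat set \<Rightarrow> (nat \<Rightarrow> nat) \<Rightarrow> nat set \<Rightarrow> nat set \<Rightarrow> bool" where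
  "compat D p I J \<longleftrightarrow> (\<forall>i. (i \<in> D \<longrightarrow> i \<in> I \<and> i \<in> J) \<and> (i \<notin> D \<and> p i = i \<longrightarrow> i \<notin> I \<and> i \<notin> J) \<and>
      (p i \<noteq> i \<longrightarrow> (i \<in> I \<longleftrightarrow> i \<notin> J) \<and> (i \<in> I \<longleftrightarrow> p i \<in> J)))"

definition rev_arcs :: "'a::comm_ring_1 \<Rightarrow> nat \<Rightarrow> (nat \<Rightarrow> nat) \<Rightarrow> nat set \<Rightarrow> 'a" where
  "rev_arcs q n p J = (\<Prod>i\<in>{1..n}. if i < p i \<and> i \<in> J then q else 1)"

definition bvec :: "'a::comm_ring_1 \<Rightarrow> nat \<Rightarrow> web \<Rightarrow> nat set \<Rightarrow> nat set \<Rightarrow> 'a" where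
  "bvec q n = (\<lambda>(D, p) I J. if compat D p I J then rev_arcs q n p J else 0)"

section \<open>The operators on web vectors\<close>

definition coef :: "'a::comm_ring_1 \<Rightarrow> nat \<Rightarrow> 'a" where
  "coef d m = (if m = 0 then 0 else if m = 1 then 1 else d)"

text \<open>The left end of every arc stays its left end under the transposition of neighbours, as
  \<open>a\<close> and \<open>b\<close> are not joined; so the power of \<open>q\<close> is
  unchanged.\<close>

lemma bvec_conj:
  fixes p :: "nat \<Rightarrow> nat"
  assumes W: "\<forall>i. p (p i) = i" and ab: "adjacent a b" "p a = a \<or> p b = b" "a \<in> {1..n}" "b \<in> {1..n}"
  defines "t \<equiv> Transposition.transpose a b"
  shows "bvec q n (D, p) (t ` I) (t ` J) = bvec q n (t ` D, t \<circ> p \<circ> t) I J"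
proof -
  have tt: "t (t x) = x" for x by (simp add: t_def)
  have mem: "x \<in> t ` S \<longleftrightarrow> t x \<in> S" for x S by (metis image_iff tt)
  have eqt: "t x = t y \<longleftrightarrow> x = y" for x y by (metis tt)
  have tin: "t x \<in> {a, b} \<longleftrightarrow> x \<in> {a, b}" for x by (auto simp: t_def Transposition.transpose_def)
  have pt: "p (t i) = t i \<longleftrightarrow> t (p (t i)) = i" for i by (metis tt)
  have all: "(\<forall>i. P i) \<longleftrightarrow> (\<forall>i. P (t i))" for P by (metis tt)
  have c: "compat D p (t ` I) (t ` J) \<longleftrightarrow> compat (t ` D) (t \<circ> p \<circ> t) I J"
  proof -
    have "compat D p (t ` I) (t ` J) \<longleftrightarrow> (\<forall>i. (t i \<in> D \<longrightarrow> t i \<in> t ` I \<and> t i \<in> t ` J) \<and> (t i \<notin> D \<and> p (t i) = t i \<longrightarrow> t i \<notin> t ` I \<and> t i \<notin> t ` J) \<and>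
      (p (t i) \<noteq> t i \<longrightarrow> (t i \<in> t ` I \<longleftrightarrow> t i \<notin> t ` J) \<and> (t i \<in> t ` I \<longleftrightarrow> p (t i) \<in> t ` J)))"
      unfolding compat_def by (rule all)
    also have "\<dots> \<longleftrightarrow> compat (t ` D) (t \<circ> p \<circ> t) I J"
      unfolding compat_def mem tt o_apply pt ..
    finally show ?thesis .
  qed
  have less: "t i < p (t i) \<longleftrightarrow> i < (t \<circ> p \<circ> t) i" for i
  proof (cases "p (t i) = t i")
    case True then show ?thesis by (simp add: tt)
  next
    case False
    have n1: "\<not> (t i \<in> {a, b} \<and> p (t i) \<in> {a, b})" using False ab(2) W by auto
    have n2: "\<not> (i \<in> {a, b} \<and> t (p (t i)) \<in> {a, b})"
    proof
      assume "i \<in> {a, b} \<and> t (p (t i)) \<in> {a, b}"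
      then have "t i \<in> {a, b}" "p (t i) \<in> {a, b}" unfolding tin by blast+
      then show False using n1 by blast
    qed
    show ?thesis
      using transpose_less[OF ab(1) _ n1] transpose_less[OF ab(1), of i "t (p (t i))"]
        transpose_less[OF ab(1), of "p (t i)" "t i"] transpose_less[OF ab(1), of "t (p (t i))" i] n1 n2 False
      unfolding t_def[symmetric] tt o_apply by (metis nat_neq_iff tt)
  qed
  have "rev_arcs q n p (t ` J) = rev_arcs q n (t \<circ> p \<circ> t) J"
    unfolding rev_arcs_def
    by (rule prod.reindex_bij_witness[where i = t and j = t])
       (use ab(3,4) in \<open>auto simp: tt mem less[symmetric] simp del: o_apply, auto simp: t_def Transposition.transpose_def\<close>)
  then show ?thesis unfolding bvec_def using c by simp
qed

lemma prod_split4: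
  fixes g :: "nat \<Rightarrow> 'a::comm_ring_1"
  assumes "finite N" "a \<in> N" "b \<in> N" "x \<in> N" "y \<in> N" "distinct [a, b, x, y]"
  shows "prod g N = g a * g b * g x * g y * prod g (N - {a, b, x, y})"
proof -
  have "prod g N = prod g {a, b, x, y} * prod g (N - {a, b, x, y})"
    using assms by (subst prod.subset_diff[of "{a, b, x, y}"]) (auto simp: mult.commute)
  then show ?thesis using assms by (simp add: mult.assoc)
qed

lemma prod_split2:
  fixes g :: "nat \<Rightarrow> 'a::comm_ring_1"
  assumes "finite N" "a \<in> N" "b \<in> N" "a \<noteq> b"
  shows "prod g N = g a * g b * prod g (N - {a, b})"
proof -
  have "prod g N = prod g {a, b} * prod g (N - {a, b})"
    using assms by (subst prod.subset_diff[of "{a, b}"]) (auto simp: mult.commute)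
  then show ?thesis using assms by simp
qed

lemma compatD:
  assumes "compat D p I J"
  shows "i \<in> D \<Longrightarrow> i \<in> I" "i \<in> D \<Longrightarrow> i \<in> J" "i \<notin> D \<Longrightarrow> p i = i \<Longrightarrow> i \<notin> I" "i \<notin> D \<Longrightarrow> p i = i \<Longrightarrow> i \<notin> J"
     "p i \<noteq> i \<Longrightarrow> i \<in> I \<longleftrightarrow> i \<notin> J" "p i \<noteq> i \<Longrightarrow> i \<in> I \<longleftrightarrow> p i \<in> J"
  using assms unfolding compat_def by auto

lemma bvec_0: "\<not> compat D p I J \<Longrightarrow> bvec q n (D, p) I J = 0"
  and bvec_1: "compat D p I J \<Longrightarrow> bvec q n (D, p) I J = rev_arcs q n p J"
  by (auto simp: bvec_def)

lemma mvop_bvec_zero: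
  fixes q :: "'a::field"
  assumes W: "\<forall>i\<in>D. p i = i" and k: "a \<notin> D \<and> p a = a \<or> b \<in> D" and ne: "a \<noteq> b"
  shows "mvop q a b (bvec q n (D, p)) I J = 0"
proof -
  have "\<not> compat D p (mv a b I) J"
    using k compatD(1)[of D p "mv a b I" J b] compatD(3)[of D p "mv a b I" J a] ne by auto
  moreover have "\<not> compat D p I (mv a b J)"
    using k compatD(2)[of D p I "mv a b J" b] compatD(4)[of D p I "mv a b J" a] ne by auto
  ultimately show ?thesis by (simp add: mvop_def bvec_0)
qed

text \<open>In a contributing configuration exactly one of \<open>I\<close>, \<open>J\<close>
  contains just one of \<open>a\<close>, \<open>b\<close>. So the Cartan factor is 1 and the
  operator acts as the transposition.\<close>

lemma mvop_bvec_relabel: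
  fixes q :: "'a::field" and p :: "nat \<Rightarrow> nat"
  assumes W: "\<forall>i\<in>D. p i = i" "\<forall>i. p (p i) = i" and ab: "adjacent a b" "a \<in> {1..n}" "b \<in> {1..n}"
    and k: "p a = a \<or> p b = b" "p a \<noteq> a \<or> p b \<noteq> b" "a \<in> D \<longleftrightarrow> p a = a" "b \<notin> D"
  defines "t \<equiv> Transposition.transpose a b"
  shows "mvop q a b (bvec q n (D, p)) I J = bvec q n (t ` D, t \<circ> p \<circ> t) I J"
proof -
  have ne: "a \<noteq> b" using k by auto
  have tt: "t (t x) = x" for x by (simp add: t_def)
  have mem: "x \<in> t ` S \<longleftrightarrow> t x \<in> S" for x S by (metis image_iff tt)
  have tab: "t a = b" "t b = a" by (simp_all add: t_def)
  have pab: "p a \<noteq> b" "p b \<noteq> a" using k W(2) ne by metis+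
  have bv: "bvec q n (t ` D, t \<circ> p \<circ> t) I J = bvec q n (D, p) (t ` I) (t ` J)"
    unfolding t_def by (rule bvec_conj[symmetric, OF W(2) ab(1) k(1) ab(2,3)])
  have tJ: "t ` S = S" if "a \<in> S \<longleftrightarrow> b \<in> S" for S unfolding t_def by (rule transpose_image_id[OF that])
  have tI: "t ` S = mv a b S" if "a \<notin> S" "b \<in> S" for S unfolding t_def by (rule mv_transpose[OF that, symmetric])
  note c = compatD[of D p "t ` I" "t ` J", unfolded mem]
  show ?thesis
  proof (cases "a \<notin> I \<and> b \<in> I \<and> (a \<in> J \<longleftrightarrow> b \<in> J)")
    case True
    then show ?thesis unfolding bv using tI[of I] tJ[of J] by (simp add: mvop_def gl_def)
  next
    case False
    show ?thesis
    proof (cases "a \<notin> J \<and> b \<in> J \<and> (a \<in> I \<longleftrightarrow> b \<in> I)")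
      case True
      then show ?thesis unfolding bv using tI[of J] tJ[of I] by (auto simp add: mvop_def gr_def)
    next
      case F2: False
      have c1: "\<not> compat D p (mv a b I) J" if "a \<notin> I" "b \<in> I"
        using that False k ne W(1) compatD[of D p "mv a b I" J a] compatD[of D p "mv a b I" J b] by auto
      have c2: "\<not> compat D p I (mv a b J)" if "a \<notin> J" "b \<in> J"
        using that F2 k ne W(1) compatD[of D p I "mv a b J" a] compatD[of D p I "mv a b J" b] by auto
      have c3: "\<not> compat D p (t ` I) (t ` J)"
        using False F2 k ne W(1) c[of a] c[of b] unfolding tab by auto
      show ?thesis unfolding bv mvop_def using c1 c2 c3 by (simp add: bvec_0)
    qed
  qed
qed

text \<open>The two summands of the comultiplication give the two orientations of the new arc, and
  the Cartan factor is \<open>q\<close> precisely when the left end falls into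
  \<open>J\<close>.\<close>

lemma mvop_bvec_cup:
  fixes q :: "'a::field" and p :: "nat \<Rightarrow> nat"
  assumes W: "\<forall>i\<in>D. p i = i" "\<forall>i. p (p i) = i" and ab: "a \<noteq> b" "a \<in> {1..n}" "b \<in> {1..n}"
    and k: "a \<in> D" "b \<notin> D" "p b = b" "p a = a"
  shows "mvop q a b (bvec q n (D, p)) I J = bvec q n (D - {a}, p(a := b, b := a)) I J"
proof -
  let ?p = "p(a := b, b := a)" and ?D = "D - {a}"
  have px: "p x \<noteq> a" "p x \<noteq> b" if "x \<noteq> a" "x \<noteq> b" for x using that W(2) k by metis+
  have rest: "(\<Prod>i\<in>{1..n} - {a, b}. if i < ?p i \<and> i \<in> J then q else 1) = (\<Prod>i\<in>{1..n} - {a, b}. if i < p i \<and> i \<in> J' then q else 1)"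
    if "\<And>i. i \<noteq> a \<Longrightarrow> i \<noteq> b \<Longrightarrow> i \<in> J \<longleftrightarrow> i \<in> J'" for J J'
    by (rule prod.cong) (use that in auto)
  have rp: "rev_arcs q n ?p J = (if a < b \<and> a \<in> J \<or> b < a \<and> b \<in> J then q else 1) * rev_arcs q n p J'"
    if "\<And>i. i \<noteq> a \<Longrightarrow> i \<noteq> b \<Longrightarrow> i \<in> J \<longleftrightarrow> i \<in> J'" for J J'
    unfolding rev_arcs_def using rest[of J J', OF that] ab k
    by (subst (1 2) prod_split2[of _ a b]) auto
  have cx: "(i \<in> D \<longrightarrow> i \<in> I1 \<and> i \<in> J1) \<and> (i \<notin> D \<and> p i = i \<longrightarrow> i \<notin> I1 \<and> i \<notin> J1) \<and>
      (p i \<noteq> i \<longrightarrow> (i \<in> I1 \<longleftrightarrow> i \<notin> J1) \<and> (i \<in> I1 \<longleftrightarrow> p i \<in> J1)) \<longleftrightarrow>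
     (i \<in> ?D \<longrightarrow> i \<in> I \<and> i \<in> J) \<and> (i \<notin> ?D \<and> ?p i = i \<longrightarrow> i \<notin> I \<and> i \<notin> J) \<and>
      (?p i \<noteq> i \<longrightarrow> (i \<in> I \<longleftrightarrow> i \<notin> J) \<and> (i \<in> I \<longleftrightarrow> ?p i \<in> J))"
    if "i \<noteq> a" "i \<noteq> b" "\<And>i. i \<noteq> a \<Longrightarrow> i \<noteq> b \<Longrightarrow> (i \<in> I1 \<longleftrightarrow> i \<in> I) \<and> (i \<in> J1 \<longleftrightarrow> i \<in> J)" for i I1 J1
    using that(3)[of i] that(3)[of "p i"] that(1,2) px[OF that(1,2)] by simp
  have cc: "compat D p I1 J1 \<longleftrightarrow> compat ?D ?p I J"
    if "a \<in> I1" "a \<in> J1" "b \<notin> I1" "b \<notin> J1" "a \<in> I \<longleftrightarrow> a \<notin> J" "b \<in> I \<longleftrightarrow> b \<notin> J" "a \<in> I \<longleftrightarrow> b \<in> J"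
      "\<And>i. i \<noteq> a \<Longrightarrow> i \<noteq> b \<Longrightarrow> (i \<in> I1 \<longleftrightarrow> i \<in> I) \<and> (i \<in> J1 \<longleftrightarrow> i \<in> J)" for I1 J1
  proof
    assume c: "compat D p I1 J1"
    show "compat ?D ?p I J"
      unfolding compat_def
    proof
      fix i show "(i \<in> ?D \<longrightarrow> i \<in> I \<and> i \<in> J) \<and> (i \<notin> ?D \<and> ?p i = i \<longrightarrow> i \<notin> I \<and> i \<notin> J) \<and>
      (?p i \<noteq> i \<longrightarrow> (i \<in> I \<longleftrightarrow> i \<notin> J) \<and> (i \<in> I \<longleftrightarrow> ?p i \<in> J))"
      proof (cases "i = a \<or> i = b")
        case True then show ?thesis using that(1-7) k ab by auto
      next
        case False then show ?thesis using cx[of i, OF _ _ that(8)] c unfolding compat_def by blast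
      qed
    qed
  next
    assume c: "compat ?D ?p I J"
    show "compat D p I1 J1"
      unfolding compat_def
    proof
      fix i show "(i \<in> D \<longrightarrow> i \<in> I1 \<and> i \<in> J1) \<and> (i \<notin> D \<and> p i = i \<longrightarrow> i \<notin> I1 \<and> i \<notin> J1) \<and>
      (p i \<noteq> i \<longrightarrow> (i \<in> I1 \<longleftrightarrow> i \<notin> J1) \<and> (i \<in> I1 \<longleftrightarrow> p i \<in> J1))"
      proof (cases "i = a \<or> i = b")
        case True then show ?thesis using that(1-7) k ab by auto
      next
        case False then show ?thesis using cx[of i, OF _ _ that(8)] c unfolding compat_def by blast
      qed
    qed
  qed
  consider (l) "a \<notin> I" "b \<in> I" "a \<in> J" "b \<notin> J" | (r) "a \<in> I" "b \<notin> I" "a \<notin> J" "b \<in> J"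
    | (no) "\<not> (a \<notin> I \<and> b \<in> I \<and> a \<in> J \<and> b \<notin> J)" "\<not> (a \<in> I \<and> b \<notin> I \<and> a \<notin> J \<and> b \<in> J)" by blast
  then show ?thesis
  proof cases
    case l
    have "compat D p (mv a b I) J \<longleftrightarrow> compat ?D ?p I J" by (rule cc) (use l ab in auto)
    then show ?thesis using l rp[of J J] ab by (auto simp: mvop_def gl_def bvec_def)
  next
    case r
    have "compat D p I (mv a b J) \<longleftrightarrow> compat ?D ?p I J" by (rule cc) (use r ab in auto)
    then show ?thesis using r rp[of J "mv a b J"] ab by (auto simp: mvop_def gr_def bvec_def)
  next
    case no
    have "\<not> compat D p (mv a b I) J" if "a \<notin> I" "b \<in> I"
      using that no k ab compatD[of D p "mv a b I" J a] compatD[of D p "mv a b I" J b] by auto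
    moreover have "\<not> compat D p I (mv a b J)" if "a \<notin> J" "b \<in> J"
      using that no k ab compatD[of D p I "mv a b J" a] compatD[of D p I "mv a b J" b] by auto
    moreover have "\<not> compat ?D ?p I J"
      using no k ab compatD(5,6)[of ?D ?p I J a] compatD(5,6)[of ?D ?p I J b] by auto
    ultimately show ?thesis by (simp add: mvop_def bvec_0)
  qed
qed

lemma rev_arcs_cong:
  assumes "\<And>i. i \<in> {1..n} \<Longrightarrow> i \<notin> X \<Longrightarrow> p i = p' i" "\<And>i. i \<in> {1..n} \<Longrightarrow> i \<notin> X \<Longrightarrow> i \<in> J \<longleftrightarrow> i \<in> J'"
  shows "(\<Prod>i\<in>{1..n} - X. if i < p i \<and> i \<in> J then q else 1) = (\<Prod>i\<in>{1..n} - X. if i < p' i \<and> i \<in> J' then q else (1::'a::comm_ring_1))"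
  by (rule prod.cong) (use assms in auto)

text \<open>Both orientations of the arc are carried to the same configuration; the factor of the
  orientation times the Cartan factor is \<open>q\<close> for one of them and
  \<open>q\<^sup>-\<^sup>1\<close> for the other.\<close>

lemma mvop_bvec_matched:
  fixes q :: "'a::field" and p :: "nat \<Rightarrow> nat"
  assumes q: "q \<noteq> 0" and W: "\<forall>i\<in>D. p i = i" "\<forall>i. p (p i) = i" and ab: "a \<noteq> b" "a \<in> {1..n}" "b \<in> {1..n}"
    and k: "p a = b" "a \<notin> D" "b \<notin> D"
  shows "mvop q a b (bvec q n (D, p)) I J = (q + inverse q) * bvec q n (insert b D, p(a := a, b := b)) I J"
proof -
  let ?p = "p(a := a, b := b)" and ?D = "insert b D"
  have pb: "p b = a" using W k by metis
  have px: "p x \<noteq> a" "p x \<noteq> b" if "x \<noteq> a" "x \<noteq> b" for x using that W(2) k by metis+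
  have rp: "rev_arcs q n p J' = (if a < b \<and> a \<in> J' \<or> b < a \<and> b \<in> J' then q else 1) * rev_arcs q n ?p J"
    if "\<And>i. i \<noteq> a \<Longrightarrow> i \<noteq> b \<Longrightarrow> i \<in> J' \<longleftrightarrow> i \<in> J" for J'
  proof -
    have "rev_arcs q n p J' = (if a < b \<and> a \<in> J' \<or> b < a \<and> b \<in> J' then q else 1) * (\<Prod>i\<in>{1..n} - {a, b}. if i < p i \<and> i \<in> J' then q else 1)"
      unfolding rev_arcs_def by (subst prod_split2[of _ a b]) (use ab k(1) pb in auto)
    also have "(\<Prod>i\<in>{1..n} - {a, b}. if i < p i \<and> i \<in> J' then q else 1) = (\<Prod>i\<in>{1..n} - {a, b}. if i < ?p i \<and> i \<in> J then q else 1)"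
      by (rule rev_arcs_cong) (use that in auto)
    also have "\<dots> = rev_arcs q n ?p J"
      unfolding rev_arcs_def by (subst prod_split2[of _ a b]) (use ab in auto)
    finally show ?thesis .
  qed
  have cc: "compat D p I1 J1 \<longleftrightarrow> compat ?D ?p I J"
    if "a \<in> I1 \<longleftrightarrow> a \<notin> J1" "b \<in> I1 \<longleftrightarrow> b \<notin> J1" "a \<in> I1 \<longleftrightarrow> b \<in> J1" "a \<notin> I" "a \<notin> J" "b \<in> I" "b \<in> J"
      and eq: "\<And>i. i \<noteq> a \<Longrightarrow> i \<noteq> b \<Longrightarrow> (i \<in> I1 \<longleftrightarrow> i \<in> I) \<and> (i \<in> J1 \<longleftrightarrow> i \<in> J)" for I1 J1
  proof -
    have "((i \<in> D \<longrightarrow> i \<in> I1 \<and> i \<in> J1) \<and> (i \<notin> D \<and> p i = i \<longrightarrow> i \<notin> I1 \<and> i \<notin> J1) \<and>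
        (p i \<noteq> i \<longrightarrow> (i \<in> I1 \<longleftrightarrow> i \<notin> J1) \<and> (i \<in> I1 \<longleftrightarrow> p i \<in> J1))) \<longleftrightarrow>
       ((i \<in> ?D \<longrightarrow> i \<in> I \<and> i \<in> J) \<and> (i \<notin> ?D \<and> ?p i = i \<longrightarrow> i \<notin> I \<and> i \<notin> J) \<and>
        (?p i \<noteq> i \<longrightarrow> (i \<in> I \<longleftrightarrow> i \<notin> J) \<and> (i \<in> I \<longleftrightarrow> ?p i \<in> J)))" for i
    proof -
      consider "i = a" | "i = b" | "i \<noteq> a" "i \<noteq> b" by blast
      then show ?thesis
      proof cases
        case 1 show ?thesis unfolding 1 using that(1-7) k ab by simp
      next
        case 2 show ?thesis unfolding 2 using that(1-7) k pb ab by auto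
      next
        case 3 then show ?thesis using eq[of i] eq[of "p i"] px[of i] by simp
      qed
    qed
    then show ?thesis unfolding compat_def by simp
  qed
  have T: "compat D p (mv a b I) J \<Longrightarrow> a \<notin> I \<Longrightarrow> b \<in> I \<Longrightarrow> a \<notin> J \<and> b \<in> J"
    using compatD(5)[of D p "mv a b I" J a] compatD(5)[of D p "mv a b I" J b] k pb ab by auto
  have T': "compat D p I (mv a b J) \<Longrightarrow> a \<notin> J \<Longrightarrow> b \<in> J \<Longrightarrow> a \<notin> I \<and> b \<in> I"
    using compatD(5)[of D p I "mv a b J" a] compatD(5)[of D p I "mv a b J" b] k pb ab by auto
  have T2: "compat ?D ?p I J \<Longrightarrow> a \<notin> I \<and> b \<in> I \<and> a \<notin> J \<and> b \<in> J"
    using compatD(1,2)[of ?D ?p I J b] compatD(3,4)[of ?D ?p I J a] k ab by auto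
  show ?thesis
  proof (cases "a \<notin> I \<and> b \<in> I \<and> a \<notin> J \<and> b \<in> J")
    case True
    have c1: "compat D p (mv a b I) J \<longleftrightarrow> compat ?D ?p I J" by (rule cc) (use True ab in auto)
    have c2: "compat D p I (mv a b J) \<longleftrightarrow> compat ?D ?p I J" by (rule cc) (use True ab in auto)
    have r1: "rev_arcs q n p J = (if b < a then q else 1) * rev_arcs q n ?p J" by (subst rp) (use True in auto)
    have r2: "rev_arcs q n p (mv a b J) = (if a < b then q else 1) * rev_arcs q n ?p J" by (subst rp) (use True ab in auto)
    show ?thesis
    proof (cases "compat ?D ?p I J")
      case c: True
      show ?thesis using True ab q
        by (cases "a < b") (simp_all add: mvop_def gl_def gr_def bvec_1[OF c] bvec_1[OF c1[THEN iffD2, OF c]] bvec_1[OF c2[THEN iffD2, OF c]] r1 r2 algebra_simps)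
    next
      case c: False
      then show ?thesis using c1 c2 by (simp add: mvop_def bvec_0)
    qed
  next
    case False
    then show ?thesis using T T' T2 by (auto simp add: mvop_def bvec_def)
  qed
qed

lemma arc_propositional:
  assumes ra rb "Q \<longleftrightarrow> Q'" "b1 \<longleftrightarrow> \<not> b2" "a1 \<longleftrightarrow> b2"
  shows "((a1 \<longleftrightarrow> xJ) \<and> (b1 \<longleftrightarrow> yJ) \<and> ((xI \<longleftrightarrow> \<not> xJ) \<and> (xI \<longleftrightarrow> \<not> a1)) \<and> ((yI \<longleftrightarrow> \<not> yJ) \<and> (yI \<longleftrightarrow> \<not> b1)) \<and> Q) \<longleftrightarrow>
    (ra \<and> rb \<and> ((xI \<longleftrightarrow> \<not> xJ) \<and> (xI \<longleftrightarrow> yJ)) \<and> ((yI \<longleftrightarrow> \<not> yJ) \<and> (yI \<longleftrightarrow> xJ)) \<and> Q') \<and>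
      (xI \<longleftrightarrow> \<not> xJ) \<and> (yI \<longleftrightarrow> \<not> yJ) \<and> (a1 \<longleftrightarrow> xJ) \<and> (b1 \<longleftrightarrow> yJ)"
  using assms by (cases a1; cases b1) auto

text \<open>A given orientation of the joined arc comes from exactly one orientation of the two old
  arcs (\<open>c1\<close>, \<open>c2\<close>), so one summand survives. The powers of
  \<open>q\<close> agree because noncrossing leaves few positions of \<open>x\<close> and
  \<open>y\<close> relative to \<open>a\<close> and \<open>b\<close>; these are recorded in
  \<open>ord\<close> and \<open>ord2\<close>.\<close>

lemma mvop_bvec_cap:
  fixes q :: "'a::field" and p :: "nat \<Rightarrow> nat"
  assumes q: "q \<noteq> 0" and W: "\<forall>i\<in>D. p i = i" "\<forall>i. p (p i) = i" "noncrossing p" "p permutes {1..n}"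
    and ab: "adjacent a b" "a \<in> {1..n}" "b \<in> {1..n}"
    and k: "p a \<noteq> a" "p b \<noteq> b" "p a \<noteq> b"
  shows "mvop q a b (bvec q n (D, p)) I J = bvec q n (insert b D, p(p a := p b, p b := p a, a := a, b := b)) I J"
proof -
  define x y where "x = p a" and "y = p b"
  let ?p = "p(x := y, y := x, a := a, b := b)" and ?D = "insert b D"
  have ne: "a \<noteq> b" using ab by (auto simp: adjacent_def)
  have pin: "p i = p j \<longleftrightarrow> i = j" for i j using W by metis
  have pxy: "p x = a" "p y = b" using W by (auto simp: x_def y_def)
  have d: "distinct [a, b, x, y]" using k ne pin[of a b] W(2) unfolding x_def y_def by (auto)
  have N: "x \<in> {1..n}" "y \<in> {1..n}" unfolding x_def y_def using W(4) ab(2,3) by (simp_all only: permutes_in_image)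
  have nD: "a \<notin> D" "b \<notin> D" "x \<notin> D" "y \<notin> D" using W(1) k d pxy x_def y_def by auto
  have oth: "p i \<noteq> a" "p i \<noteq> b" "p i \<noteq> x" "p i \<noteq> y" if "i \<notin> {a, b, x, y}" for i
    using that pin[of i x] pin[of i y] pin[of i a] pin[of i b] pxy unfolding x_def[symmetric] y_def[symmetric] by auto
  have nc: "u < p v \<and> p v < p u" if "u < v" "v < p u" for u v
    using W(3) that unfolding noncrossing_def by blast
  have dd: "x \<noteq> a" "x \<noteq> b" "y \<noteq> a" "y \<noteq> b" "x \<noteq> y" using d by auto
  have gap: "z < a \<longleftrightarrow> z < b" "a < z \<longleftrightarrow> b < z" if "z \<noteq> a" "z \<noteq> b" for z
    using that ab(1) by (auto simp: adjacent_def)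
  have ord: "x < y \<longleftrightarrow> (if a < b then x < a \<and> b < y else x < a \<or> b < y)"
  proof (cases "a < b")
    case True
    show ?thesis
    proof (cases "y < a")
      case y: True
      then have "y < x" using nc[of y a] pxy True x_def by auto
      then show ?thesis using y True by simp
    next
      case False
      then have y: "b < y" using dd gap(2)[of y] by linarith
      show ?thesis
      proof (cases "x < a")
        case True then show ?thesis using y \<open>a < b\<close> by simp
      next
        case False
        then have "b < x" using dd gap(2)[of x] by linarith
        then have "y < x" using nc[of a b] True x_def y_def by auto
        then show ?thesis using False True by simp
      qed
    qed
  next
    case False
    then have ba: "b < a" using ne by linarith
    show ?thesis
    proof (cases "x < a")
      case True
      then have "x < b" using dd gap(1)[of x] by linarith
      then have "x < y" using nc[of x b] pxy ba y_def by auto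
      then show ?thesis using True ba by simp
    next
      case False
      show ?thesis
      proof (cases "b < y")
        case True
        then have "a < y" using dd gap(2)[of y] by linarith
        then have "x < y" using nc[of b a] ba x_def y_def by auto
        then show ?thesis using True ba by simp
      next
        case F: False
        then have "y < x" using False ba by linarith
        then show ?thesis using F False ba by simp
      qed
    qed
  qed
  have ord2: "a < b \<Longrightarrow> \<not> (a < x \<and> y < b)" "b < a \<Longrightarrow> \<not> (x < a \<and> b < y)"
  proof -
    assume "a < b" show "\<not> (a < x \<and> y < b)"
    proof
      assume "a < x \<and> y < b"
      then have "y < a" "b < x" using d ab(1) \<open>a < b\<close> by (auto simp: adjacent_def)
      then show False using nc[of y a] pxy x_def \<open>a < b\<close> by auto
    qed
  next
    assume "b < a" show "\<not> (x < a \<and> b < y)"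
    proof
      assume "x < a \<and> b < y"
      then have "x < b" "a < y" using d ab(1) \<open>b < a\<close> by (auto simp: adjacent_def)
      then show False using nc[of x b] pxy y_def \<open>b < a\<close> by auto
    qed
  qed
  define R where "R = (\<Prod>i\<in>{1..n} - {a, b, x, y}. if i < ?p i \<and> i \<in> J then q else 1)"
  have rt: "rev_arcs q n ?p J = (if x < y \<and> x \<in> J then q else 1) * (if y < x \<and> y \<in> J then q else 1) * R"
    unfolding rev_arcs_def R_def
    by (subst prod_split4[of _ a b x y]) (use ab(2,3) N d in \<open>auto\<close>)
  have rp: "rev_arcs q n p J' = (if a < x \<and> a \<in> J' then q else 1) * (if b < y \<and> b \<in> J' then q else 1) *
       (if x < a \<and> x \<in> J' then q else 1) * (if y < b \<and> y \<in> J' then q else 1) * R"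
    if "\<And>i. i \<noteq> a \<Longrightarrow> i \<noteq> b \<Longrightarrow> i \<in> J' \<longleftrightarrow> i \<in> J" for J'
  proof -
    have "R = (\<Prod>i\<in>{1..n} - {a, b, x, y}. if i < p i \<and> i \<in> J' then q else 1)"
      unfolding R_def by (rule rev_arcs_cong) (use that in auto)
    moreover have "rev_arcs q n p J' = (if a < p a \<and> a \<in> J' then q else 1) * (if b < p b \<and> b \<in> J' then q else 1) *
       (if x < p x \<and> x \<in> J' then q else 1) * (if y < p y \<and> y \<in> J' then q else 1) *
       (\<Prod>i\<in>{1..n} - {a, b, x, y}. if i < p i \<and> i \<in> J' then q else 1)"
      unfolding rev_arcs_def by (rule prod_split4) (use ab(2,3) N d in simp_all)
    ultimately show ?thesis by (simp only: pxy x_def[symmetric] y_def[symmetric])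
  qed
  have cc: "compat D p I1 J1 \<longleftrightarrow> compat ?D ?p I J \<and> (x \<in> I \<longleftrightarrow> x \<notin> J) \<and> (y \<in> I \<longleftrightarrow> y \<notin> J) \<and> (a \<in> I1 \<longleftrightarrow> x \<in> J) \<and> (b \<in> I1 \<longleftrightarrow> y \<in> J)"
    if that: "a \<in> I1 \<longleftrightarrow> a \<notin> J1" "b \<in> I1 \<longleftrightarrow> b \<notin> J1" "a \<in> I1 \<longleftrightarrow> b \<in> J1" "a \<notin> I" "a \<notin> J" "b \<in> I" "b \<in> J"
      and eq: "\<And>i. i \<noteq> a \<Longrightarrow> i \<noteq> b \<Longrightarrow> (i \<in> I1 \<longleftrightarrow> i \<in> I) \<and> (i \<in> J1 \<longleftrightarrow> i \<in> J)" for I1 J1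
  proof -
    let ?l = "\<lambda>i. ((i \<in> D \<longrightarrow> i \<in> I1 \<and> i \<in> J1) \<and> (i \<notin> D \<and> p i = i \<longrightarrow> i \<notin> I1 \<and> i \<notin> J1) \<and>
        (p i \<noteq> i \<longrightarrow> (i \<in> I1 \<longleftrightarrow> i \<notin> J1) \<and> (i \<in> I1 \<longleftrightarrow> p i \<in> J1)))"
    let ?r = "\<lambda>i. ((i \<in> ?D \<longrightarrow> i \<in> I \<and> i \<in> J) \<and> (i \<notin> ?D \<and> ?p i = i \<longrightarrow> i \<notin> I \<and> i \<notin> J) \<and>
        (?p i \<noteq> i \<longrightarrow> (i \<in> I \<longleftrightarrow> i \<notin> J) \<and> (i \<in> I \<longleftrightarrow> ?p i \<in> J)))"
    have dd: "x \<noteq> a" "x \<noteq> b" "y \<noteq> a" "y \<noteq> b" "x \<noteq> y" "a \<noteq> x" "b \<noteq> x" "a \<noteq> y" "b \<noteq> y" "y \<noteq> x" "b \<noteq> a" "a \<noteq> b" using d by auto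
    have e: "(x \<in> I1 \<longleftrightarrow> x \<in> I)" "(x \<in> J1 \<longleftrightarrow> x \<in> J)" "(y \<in> I1 \<longleftrightarrow> y \<in> I)" "(y \<in> J1 \<longleftrightarrow> y \<in> J)"
      using eq[of x] eq[of y] dd by auto
    have la: "?l a \<longleftrightarrow> (a \<in> I1 \<longleftrightarrow> x \<in> J)" using that(1) nD k e(2) by (simp add: x_def[symmetric])
    have lb: "?l b \<longleftrightarrow> (b \<in> I1 \<longleftrightarrow> y \<in> J)" using that(2) nD k e(4) by (simp add: y_def[symmetric])
    have lx: "?l x \<longleftrightarrow> (x \<in> I \<longleftrightarrow> x \<notin> J) \<and> (x \<in> I \<longleftrightarrow> a \<notin> I1)" using that(1) nD dd e by (simp add: pxy)
    have ly: "?l y \<longleftrightarrow> (y \<in> I \<longleftrightarrow> y \<notin> J) \<and> (y \<in> I \<longleftrightarrow> b \<notin> I1)" using that(2) nD dd e by (simp add: pxy)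
    have ra: "?r a" using that nD dd by simp
    have rb: "?r b" using that nD dd by simp
    have rx: "?r x \<longleftrightarrow> (x \<in> I \<longleftrightarrow> x \<notin> J) \<and> (x \<in> I \<longleftrightarrow> y \<in> J)" using nD dd by simp
    have ry: "?r y \<longleftrightarrow> (y \<in> I \<longleftrightarrow> y \<notin> J) \<and> (y \<in> I \<longleftrightarrow> x \<in> J)" using nD dd by simp
    have oo: "?l i \<longleftrightarrow> ?r i" if i: "i \<notin> {a, b, x, y}" for i
      using i eq[of i] eq[of "p i"] oth[OF i] by simp
    have all: "(\<forall>i. P i) \<longleftrightarrow> P a \<and> P b \<and> P x \<and> P y \<and> (\<forall>i. i \<notin> {a, b, x, y} \<longrightarrow> P i)" for P :: "nat \<Rightarrow> bool"
    proof
      assume h: "P a \<and> P b \<and> P x \<and> P y \<and> (\<forall>i. i \<notin> {a, b, x, y} \<longrightarrow> P i)"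
      show "\<forall>i. P i"
      proof
        fix i show "P i" using h by (cases "i \<in> {a, b, x, y}") auto
      qed
    qed simp
    have oo': "(\<forall>i. i \<notin> {a, b, x, y} \<longrightarrow> ?l i) \<longleftrightarrow> (\<forall>i. i \<notin> {a, b, x, y} \<longrightarrow> ?r i)" using oo by blast
    have "(\<forall>i. ?l i) \<longleftrightarrow> (\<forall>i. ?r i) \<and> (x \<in> I \<longleftrightarrow> x \<notin> J) \<and> (y \<in> I \<longleftrightarrow> y \<notin> J) \<and> (a \<in> I1 \<longleftrightarrow> x \<in> J) \<and> (b \<in> I1 \<longleftrightarrow> y \<in> J)"
      unfolding all[of ?l] all[of ?r] la lb lx ly rx ry by (rule arc_propositional[OF ra rb oo' that(2,3)])
    then show ?thesis unfolding compat_def .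
  qed
  have T: "compat D p (mv a b I) J \<Longrightarrow> a \<notin> I \<Longrightarrow> b \<in> I \<Longrightarrow> a \<notin> J \<and> b \<in> J"
    using compatD(5)[of D p "mv a b I" J a] compatD(5)[of D p "mv a b I" J b] k ne by auto
  have T': "compat D p I (mv a b J) \<Longrightarrow> a \<notin> J \<Longrightarrow> b \<in> J \<Longrightarrow> a \<notin> I \<and> b \<in> I"
    using compatD(5)[of D p I "mv a b J" a] compatD(5)[of D p I "mv a b J" b] k ne by auto
  have T2: "a \<notin> I \<and> b \<in> I \<and> a \<notin> J \<and> b \<in> J" if c: "compat ?D ?p I J"
    using compatD(1,2)[OF c, of b] compatD(3,4)[OF c, of a] nD ne by auto
  have main: "mvop q a b (bvec q n (D, p)) I J = bvec q n (?D, ?p) I J"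
  proof (cases "compat ?D ?p I J")
    case c: True
    note T2 = T2[OF c]
    have xy: "(x \<in> I \<longleftrightarrow> x \<notin> J)" "(y \<in> I \<longleftrightarrow> y \<notin> J)" "x \<in> I \<longleftrightarrow> y \<in> J"
      using compatD(5,6)[OF c, of x] compatD(5,6)[OF c, of y] d by auto
    have c1: "compat D p (mv a b I) J \<longleftrightarrow> x \<in> J"
      by (subst cc[of "mv a b I" J]) (use T2 ne c xy in auto)
    have c2: "compat D p I (mv a b J) \<longleftrightarrow> x \<notin> J"
      by (subst cc[of I "mv a b J"]) (use T2 ne c xy in auto)
    have r1: "rev_arcs q n p J = (if b < y then q else 1) * (if x < a \<and> x \<in> J then q else 1) * (if y < b \<and> y \<in> J then q else 1) * R"
      by (subst rp) (use T2 in auto)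
    have r2: "rev_arcs q n p (mv a b J) = (if a < x then q else 1) * (if x < a \<and> x \<in> J then q else 1) * (if y < b \<and> y \<in> J then q else 1) * R"
      by (subst rp) (use T2 ne d in auto)
    have dl: "x < y \<or> y < x" "a < b \<or> b < a" "x < a \<or> a < x" "y < b \<or> b < y" using d by auto
    show ?thesis
    proof (cases "x \<in> J")
      case True
      then have "mvop q a b (bvec q n (D, p)) I J = (if a < b then inverse q else 1) * ((if b < y then q else 1) * (if x < a then q else 1) * R)"
        using T2 c1 c2 xy by (simp add: mvop_def gl_def bvec_def r1)
      also have "\<dots> = (if x < y then q else 1) * R"
      proof (cases "a < b")
        case True
        then show ?thesis using ord ord2(1) dl q by (cases "b < y"; cases "x < a") simp_all
      next
        case False
        then have "b < a" using dl by blast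
        then show ?thesis using ord ord2(2) dl q False by (cases "b < y"; cases "x < a") simp_all
      qed
      also have "\<dots> = bvec q n (?D, ?p) I J"
        unfolding bvec_1[OF c] rt using True xy by simp
      finally show ?thesis .
    next
      case False
      then have "mvop q a b (bvec q n (D, p)) I J = (if a < b then 1 else inverse q) * ((if a < x then q else 1) * (if y < b then q else 1) * R)"
        using T2 c1 c2 xy by (simp add: mvop_def gr_def bvec_def r2)
      also have "\<dots> = (if y < x then q else 1) * R"
      proof -
        have e: "y < x \<longleftrightarrow> \<not> x < y" "a < x \<longleftrightarrow> \<not> x < a" "y < b \<longleftrightarrow> \<not> b < y" using dd by linarith+
        show ?thesis
        proof (cases "a < b")
          case True
          then show ?thesis using ord ord2(1) q unfolding e by (cases "b < y"; cases "x < a") simp_all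
        next
          case False
          then have "b < a" using dl by blast
          then show ?thesis using ord ord2(2) q False unfolding e by (cases "b < y"; cases "x < a") simp_all
        qed
      qed
      also have "\<dots> = bvec q n (?D, ?p) I J"
        unfolding bvec_1[OF c] rt using False xy by simp
      finally show ?thesis .
    qed
  next
    case c: False
    have "\<not> compat D p (mv a b I) J" if "a \<notin> I" "b \<in> I"
      using T[OF _ that] cc[of "mv a b I" J] c that ne by auto
    moreover have "\<not> compat D p I (mv a b J)" if "a \<notin> J" "b \<in> J"
      using T'[OF _ that] cc[of I "mv a b J"] c that ne by auto
    ultimately show ?thesis using c by (simp add: mvop_def bvec_0)
  qed
  then show ?thesis unfolding x_def y_def .
qed

lemma mvop_bvec:
  fixes q :: "'a::field"
  assumes q: "q \<noteq> 0" and w: "is_web n k \<omega>" and ab: "adjacent a b" "a \<in> {1..n}" "b \<in> {1..n}"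
  shows "mvop q a b (bvec q n \<omega>) = (\<lambda>I J. coef (q + inverse q) (kind a b \<omega>) * bvec q n (step a b \<omega>) I J)"
proof (intro ext)
  fix I J
  obtain D p where \<omega>: "\<omega> = (D, p)" by fastforce
  note W = is_webD[OF w[unfolded \<omega>]]
  have ne: "a \<noteq> b" using ab by (auto simp: adjacent_def)
  show "mvop q a b (bvec q n \<omega>) I J = coef (q + inverse q) (kind a b \<omega>) * bvec q n (step a b \<omega>) I J"
  proof (cases "kind a b (D, p) = 0")
    case True
    then have "a \<notin> D \<and> p a = a \<or> b \<in> D" by (auto simp: kind_def split: if_splits)
    then show ?thesis using mvop_bvec_zero[OF W(4) _ ne, of q n I J] True by (simp add: \<omega> coef_def)
  next
    case False
    from False ne W(4,3) show ?thesis
    proof (cases rule: step_cases)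
      case relabel
      show ?thesis unfolding \<omega> relabel(5,6)
        using mvop_bvec_relabel[OF W(4,3) ab relabel(1-4), of q I J] by (simp add: coef_def)
    next
      case cup
      show ?thesis unfolding \<omega> cup(5,6)
        using mvop_bvec_cup[OF W(4,3) ne ab(2,3) cup(1-4), of q I J] by (simp add: coef_def)
    next
      case cap
      show ?thesis
      proof (cases "p a = b")
        case True
        then have "p b = a" using W(3) by metis
        then have "p(p a := p b, p b := p a, a := a, b := b) = p(a := a, b := b)" using True ne by (simp add: fun_upd_twist)
        then show ?thesis unfolding \<omega> cap(5,6)
          using mvop_bvec_matched[OF q W(4,3) ne ab(2,3) True cap(3,4), of I J] True by (simp add: coef_def)
      next
        case False
        then show ?thesis unfolding \<omega> cap(5,6)
          using mvop_bvec_cap[OF q W(4,3,6,2) ab cap(1,2) False, of I J] by (simp add: coef_def)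
      qed
    qed
  qed
qed

section \<open>Leading configurations and linear independence\<close>

definition lead_up :: "web \<Rightarrow> nat set" where "lead_up = (\<lambda>(D, p). D \<union> {i. i < p i})"
definition lead_down :: "web \<Rightarrow> nat set" where "lead_down = (\<lambda>(D, p). D \<union> {i. p i < i})"

lemma bvec_lead:
  assumes w: "is_web n k \<omega>"
  shows "bvec q n \<omega> (lead_up \<omega>) (lead_down \<omega>) = 1"
proof -
  obtain D p where \<omega>: "\<omega> = (D, p)" by fastforce
  note W = is_webD[OF w[unfolded \<omega>]]
  have pp: "p (p i) = i" for i using W by auto
  have nD: "i \<notin> D" if "p i \<noteq> i" for i using W(4) that by auto
  have "compat D p (lead_up \<omega>) (lead_down \<omega>)"
    unfolding compat_def \<omega> lead_up_def lead_down_def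
  proof (intro allI conjI impI)
    fix i assume m: "p i \<noteq> i"
    then have "i \<notin> D" "p i \<notin> D" using nD[of i] nD[of "p i"] pp by auto
    then show "(i \<in> (case (D, p) of (D, p) \<Rightarrow> D \<union> {i. i < p i})) = (i \<notin> (case (D, p) of (D, p) \<Rightarrow> D \<union> {i. p i < i}))"
      "(i \<in> (case (D, p) of (D, p) \<Rightarrow> D \<union> {i. i < p i})) = (p i \<in> (case (D, p) of (D, p) \<Rightarrow> D \<union> {i. p i < i}))"
      using m pp by auto
  qed auto
  moreover have "rev_arcs q n p (lead_down \<omega>) = 1"
    unfolding rev_arcs_def \<omega> lead_down_def by (rule prod.neutral) (use nD in auto)
  ultimately show ?thesis unfolding bvec_def \<omega> by simp
qed

text \<open>Among all orientations the one with every left end in \<open>I\<close> has the least sum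
  over \<open>I\<close>: turning an arc round replaces its left end by its right end.\<close>

lemma compat_sum:
  assumes w: "is_web n k (D, p)" and c: "compat D p I J"
  shows "\<Sum>(lead_up (D, p)) \<le> \<Sum>I" and "\<Sum>(lead_up (D, p)) = \<Sum>I \<Longrightarrow> I = lead_up (D, p) \<and> J = lead_down (D, p)"
proof -
  note W = is_webD[OF w]
  have pp: "p (p i) = i" for i using W by auto
  have nD: "i \<notin> D" if "p i \<noteq> i" for i using W(4) that by auto
  define L where "L = {i. i < p i}"
  \<comment> \<open>For a left end \<open>i\<close>, the end of its arc that lies in
    \<open>I\<close>.\<close>
  define h where "h i = (if i \<in> I then i else p i)" for i
  have finL: "finite L" by (rule finite_subset[OF _ W(8)]) (auto simp: L_def moved_def)
  have DL: "D \<inter> L = {}" using nD by (auto simp: L_def)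
  have inj: "inj_on h L"
  proof (rule inj_onI)
    fix i j assume ij: "i \<in> L" "j \<in> L" "h i = h j"
    show "i = j"
    proof (cases "i \<in> I"; cases "j \<in> I")
      assume "i \<in> I" "j \<notin> I"
      then have "i = p j" using ij(3) by (simp add: h_def)
      then have "p i = j" using pp[of j] by simp
      then show ?thesis using ij(1,2) \<open>i = p j\<close> unfolding L_def by simp
    next
      assume "i \<notin> I" "j \<in> I"
      then have "j = p i" using ij(3) by (simp add: h_def)
      then have "p j = i" using pp[of i] by simp
      then show ?thesis using ij(1,2) \<open>j = p i\<close> unfolding L_def by simp
    next
      assume "i \<notin> I" "j \<notin> I"
      then have "p i = p j" using ij(3) by (simp add: h_def)
      then show ?thesis using pp by metis
    qed (use ij(3) in \<open>simp add: h_def\<close>)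
  qed
  have I: "I = D \<union> h ` L"
  proof (rule equalityI; rule subsetI)
    fix i assume i: "i \<in> I"
    show "i \<in> D \<union> h ` L"
    proof (cases "i \<in> D")
      case False
      then have m: "p i \<noteq> i" using compatD(3)[OF c, of i] i by auto
      show ?thesis
      proof (cases "i < p i")
        case True
        then have "h i = i" "i \<in> L" using i by (auto simp: h_def L_def)
        then show ?thesis by force
      next
        case False
        then have "p i \<in> L" using m pp by (auto simp: L_def)
        moreover have "p i \<notin> I" using compatD(5,6)[OF c, of i] compatD(5,6)[OF c, of "p i"] m i pp by metis
        ultimately have "h (p i) = i" "p i \<in> L" using pp by (simp_all add: h_def)
        then show ?thesis by (metis UnCI image_eqI)
      qed
    qed simp
  next
    fix i assume "i \<in> D \<union> h ` L"
    then show "i \<in> I"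
    proof
      assume "i \<in> D" then show ?thesis using compatD(1)[OF c] by blast
    next
      assume "i \<in> h ` L"
      then obtain j where j: "j < p j" "i = h j" by (auto simp: L_def)
      show ?thesis
      proof (cases "j \<in> I")
        case False
        then have "p j \<in> I" using compatD(5,6)[OF c, of j] compatD(5,6)[OF c, of "p j"] j pp by (metis less_irrefl)
        then show ?thesis using j False by (simp add: h_def)
      qed (use j in \<open>simp add: h_def\<close>)
    qed
  qed
  have DH: "D \<inter> h ` L = {}"
  proof -
    have "h j \<notin> D" if "j \<in> L" for j using that nD[of j] nD[of "p j"] pp by (auto simp: h_def L_def)
    then show ?thesis by auto
  qed
  have s1: "\<Sum>I = \<Sum>D + (\<Sum>i\<in>L. h i)"
    unfolding I using DH finL W(7) inj by (simp add: sum.union_disjoint sum.reindex)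
  have up: "lead_up (D, p) = D \<union> L" by (simp add: lead_up_def L_def)
  have s2: "\<Sum>(lead_up (D, p)) = \<Sum>D + \<Sum>L"
    unfolding up using DL finL W(7) by (simp add: sum.union_disjoint)
  have le: "i \<le> h i" if "i \<in> L" for i using that by (auto simp: h_def L_def)
  show "\<Sum>(lead_up (D, p)) \<le> \<Sum>I" unfolding s1 s2 using sum_mono[of L "\<lambda>i. i" h, OF le] by simp
  assume "\<Sum>(lead_up (D, p)) = \<Sum>I"
  then have eq: "(\<Sum>i\<in>L. i) = (\<Sum>i\<in>L. h i)" unfolding s1 s2 by simp
  have LI: "i \<in> I" if "i \<in> L" for i
  proof (rule ccontr)
    assume "i \<notin> I"
    then have "i < h i" using that by (auto simp: h_def L_def)
    then have "(\<Sum>i\<in>L. i) < (\<Sum>i\<in>L. h i)" by (intro sum_strict_mono_ex1[OF finL]) (use le that in auto)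
    then show False using eq by simp
  qed
  have IL: "I = lead_up (D, p)" unfolding up using I LI by (auto simp: h_def)
  moreover have "J = lead_down (D, p)"
  proof (rule Set.set_eqI)
    fix i
    have iI: "i \<in> I \<longleftrightarrow> i \<in> D \<or> i < p i" unfolding IL by (simp add: lead_up_def)
    have mD: "p i \<noteq> i \<Longrightarrow> i \<notin> D" using nD by blast
    have "i \<in> J \<longleftrightarrow> i \<in> D \<or> p i < i"
      using compatD(2,4,5)[OF c, of i] iI mD by (cases "p i = i") auto
    then show "i \<in> J \<longleftrightarrow> i \<in> lead_down (D, p)" by (simp add: lead_down_def)
  qed
  ultimately show "I = lead_up (D, p) \<and> J = lead_down (D, p)" ..
qed

text \<open>A noncrossing matching is determined by its opening and closing brackets. Induct from
  the right: if the arcs from \<open>i\<close> in two matchings ended differently, the nearer end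
  would close, in the other matching, an arc opened after \<open>i\<close>, and on such arcs the
  matchings agree.\<close>

lemma lead_inj:
  assumes w: "is_web n k \<omega>" and w': "is_web n k \<omega>'" and up: "lead_up \<omega> = lead_up \<omega>'" and down: "lead_down \<omega> = lead_down \<omega>'"
  shows "\<omega> = \<omega>'"
proof -
  obtain D p where \<omega>: "\<omega> = (D, p)" by fastforce
  obtain D' p' where \<omega>': "\<omega>' = (D', p')" by fastforce
  note W = is_webD[OF w[unfolded \<omega>]] and W' = is_webD[OF w'[unfolded \<omega>']]
  have pp: "p (p i) = i" "p' (p' i) = i" for i using W W' by auto
  have nD: "p i \<noteq> i \<Longrightarrow> i \<notin> D" "p' i \<noteq> i \<Longrightarrow> i \<notin> D'" for i using W(4) W'(4) by auto
  have "D = lead_up \<omega> \<inter> lead_down \<omega>" unfolding \<omega> lead_up_def lead_down_def by auto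
  moreover have "D' = lead_up \<omega>' \<inter> lead_down \<omega>'" unfolding \<omega>' lead_up_def lead_down_def by auto
  ultimately have DD: "D = D'" using up down by simp
  have L: "i < p i \<longleftrightarrow> i < p' i" for i
  proof -
    have "i < p i \<longleftrightarrow> i \<in> lead_up \<omega> - D" using nD(1)[of i] by (auto simp: \<omega> lead_up_def)
    also have "\<dots> \<longleftrightarrow> i \<in> lead_up \<omega>' - D'" using DD up by simp
    also have "\<dots> \<longleftrightarrow> i < p' i" using nD(2)[of i] by (auto simp: \<omega>' lead_up_def)
    finally show ?thesis .
  qed
  have R: "p i < i \<longleftrightarrow> p' i < i" for i
  proof -
    have "p i < i \<longleftrightarrow> i \<in> lead_down \<omega> - D" using nD(1)[of i] by (auto simp: \<omega> lead_down_def)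
    also have "\<dots> \<longleftrightarrow> i \<in> lead_down \<omega>' - D'" using DD down by simp
    also have "\<dots> \<longleftrightarrow> p' i < i" using nD(2)[of i] by (auto simp: \<omega>' lead_down_def)
    finally show ?thesis .
  qed
  have nc: "i < j \<Longrightarrow> j < p i \<Longrightarrow> i < p j \<and> p j < p i" "i < j \<Longrightarrow> j < p' i \<Longrightarrow> i < p' j \<and> p' j < p' i" for i j
    using W(6) W'(6) unfolding noncrossing_def by blast+
  have left: "p i = p' i" if "i < p i" for i
    using that
  proof (induction "n - i" arbitrary: i rule: less_induct)
    case less
    have i': "i < p' i" using less.prems L by blast
    have le_n: "p i \<le> n" "p' i \<le> n"
  proof -
    have "p i \<in> moved p" "p' i \<in> moved p'" using less.prems i' pp by (simp_all add: moved_def)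
    then show "p i \<le> n" "p' i \<le> n" using W(9) W'(9) by auto
  qed
    have step: "r i = s i"
      if r: "(r = p \<and> s = p') \<or> (r = p' \<and> s = p)" and l: "r i < s i" for r s
    proof -
      have ir: "i < r i" using r less.prems i' by auto
      have rr: "r (r x) = x" "s (s x) = x" for x using r pp by auto
      let ?j = "r i"
      have ncs: "i < s ?j \<and> s ?j < s i" using r nc[of i ?j] ir l by auto
      have "s ?j < ?j" using r R[of ?j] rr(1)[of i] ir by metis
      then have ls: "s ?j < s (s ?j)" using rr(2)[of ?j] by simp
      have lp: "s ?j < p (s ?j)" using ls r L by metis
      have "n - s ?j < n - i" using ncs le_n ir r by auto
      then have "p (s ?j) = p' (s ?j)" using less.hyps lp by blast
      then have "r (s ?j) = ?j" using r rr(2)[of ?j] by auto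
      then have "s ?j = i" using rr(1) by metis
      then show ?thesis using ncs by simp
    qed
    show ?case using step[of p p'] step[of p' p] by (cases "p i" "p' i" rule: linorder_cases) auto
  qed
  have "p i = p' i" for i
  proof (cases "p i" i rule: linorder_cases)
    case less
    then have "p (p i) = p' (p i)" using left[of "p i"] pp by simp
    then show ?thesis using pp by metis
  next
    case equal
    then show ?thesis using L[of i] R[of i] by auto
  qed (use left in auto)
  then show ?thesis using DD by (auto simp: \<omega> \<omega>')
qed

text \<open>Evaluate the relation at the leading configuration of a web whose leading sum is minimal
  among the webs with nonzero coefficient. By \<open>compat_sum\<close> and \<open>lead_inj\<close>
  no other such web is compatible with it.\<close>

lemma bvec_independent:
  fixes c :: "web \<Rightarrow> 'a::comm_ring_1"
  assumes z: "\<And>I J. (\<Sum>\<omega> | is_web n k \<omega>. c \<omega> * bvec q n \<omega> I J) = 0" and w: "is_web n k \<omega>"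
  shows "c \<omega> = 0"
proof (rule ccontr)
  assume "c \<omega> \<noteq> 0"
  let ?S = "{\<omega>. is_web n k \<omega> \<and> c \<omega> \<noteq> 0}"
  have S: "finite ?S" "?S \<noteq> {}"
  proof -
    have "\<omega> \<in> ?S" using w \<open>c \<omega> \<noteq> 0\<close> by blast
    then show "?S \<noteq> {}" by blast
    show "finite ?S" by (rule finite_subset[OF _ finite_webs[of n k]]) blast
  qed
  define \<mu> where "\<mu> = arg_min_on (\<lambda>\<omega>. \<Sum>(lead_up \<omega>)) ?S"
  have \<mu>: "\<mu> \<in> ?S" unfolding \<mu>_def by (rule arg_min_if_finite(1)[OF S])
  have min: "\<Sum>(lead_up \<mu>) \<le> \<Sum>(lead_up \<omega>)" if "\<omega> \<in> ?S" for \<omega>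
    using arg_min_if_finite(2)[OF S, of "\<lambda>\<omega>. \<Sum>(lead_up \<omega>)"] that unfolding \<mu>_def by (meson not_le)
  have "c \<omega> * bvec q n \<omega> (lead_up \<mu>) (lead_down \<mu>) = 0" if "is_web n k \<omega>" "\<omega> \<noteq> \<mu>" for \<omega>
  proof (cases "c \<omega> = 0")
    case False
    obtain D p where \<omega>: "\<omega> = (D, p)" by fastforce
    have "\<not> compat D p (lead_up \<mu>) (lead_down \<mu>)"
    proof
      assume c: "compat D p (lead_up \<mu>) (lead_down \<mu>)"
      note * = compat_sum[OF that(1)[unfolded \<omega>] c]
      have "\<Sum>(lead_up (D, p)) = \<Sum>(lead_up \<mu>)" using *(1) min[of \<omega>] that False by (auto simp: \<omega>)
      then have "lead_up \<mu> = lead_up \<omega>" "lead_down \<mu> = lead_down \<omega>" using *(2) by (simp_all add: \<omega>)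
      then show False using lead_inj[of n k \<mu> \<omega>] \<mu> that by auto
    qed
    then show ?thesis by (simp add: \<omega> bvec_0)
  qed simp
  then have "(\<Sum>\<omega> | is_web n k \<omega>. c \<omega> * bvec q n \<omega> (lead_up \<mu>) (lead_down \<mu>)) = c \<mu> * bvec q n \<mu> (lead_up \<mu>) (lead_down \<mu>)"
    using \<mu> finite_webs by (subst sum.remove[of _ \<mu>]) (auto intro: sum.neutral)
  then show False using z \<mu> bvec_lead[of n k \<mu> q] by simp
qed

section \<open>Coefficient functions and highest weight vectors\<close>

definition lift_step :: "'a::comm_ring_1 \<Rightarrow> nat \<Rightarrow> nat \<Rightarrow> nat \<Rightarrow> nat \<Rightarrow> (web \<Rightarrow> 'a) \<Rightarrow> web \<Rightarrow> 'a" where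
  "lift_step d n k a b c = (\<lambda>\<omega>'. \<Sum>\<omega> | is_web n k \<omega> \<and> step a b \<omega> = \<omega>'. coef d (kind a b \<omega>) * c \<omega>)"

text \<open>Operators are moved from vectors to coefficient functions, so that the arguments below
  serve for the tensor square, for \<open>M\<close> and for the specialised representation. Here
  \<open>g c \<omega>\<close> stands for the vector of \<open>\<omega>\<close> scaled by
  \<open>c\<close>, and the sum is regrouped along the fibres of \<open>step\<close>.\<close>

lemma lift_step_sum:
  assumes ab: "adjacent a b" "a \<in> {1..n}" "b \<in> {1..n}"
    and add: "\<And>x y \<omega>. g (x + y) \<omega> = g x \<omega> + g y \<omega>" and zero: "\<And>\<omega>. g 0 \<omega> = (0::'b::ab_group_add)"
  shows "(\<Sum>\<omega> | is_web n k \<omega>. g (lift_step d n k a b c \<omega>) \<omega>) =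
    (\<Sum>\<omega> | is_web n k \<omega>. g (coef d (kind a b \<omega>) * c \<omega>) (step a b \<omega>))"
proof -
  let ?W = "{\<omega>. is_web n k \<omega>}"
  have gs: "g (sum f A) \<omega> = (\<Sum>x\<in>A. g (f x) \<omega>)" if "finite A" for f \<omega> and A :: "web set"
    using that by (induction A rule: finite_induct) (simp_all add: add zero)
  have fin: "finite {\<omega>. is_web n k \<omega> \<and> P \<omega>}" for P
    by (rule finite_subset[OF _ finite_webs[of n k]]) blast
  let ?U = "{\<omega> \<in> ?W. kind a b \<omega> \<noteq> 0}"
  have "(\<Sum>\<omega>'\<in>?W. g (lift_step d n k a b c \<omega>') \<omega>') = (\<Sum>\<omega>'\<in>?W. \<Sum>\<omega> | is_web n k \<omega> \<and> step a b \<omega> = \<omega>'. g (coef d (kind a b \<omega>) * c \<omega>) \<omega>')"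
    unfolding lift_step_def by (simp add: gs fin)
  also have "\<dots> = (\<Sum>\<omega>'\<in>?W. \<Sum>\<omega> | \<omega> \<in> ?U \<and> step a b \<omega> = \<omega>'. g (coef d (kind a b \<omega>) * c \<omega>) (step a b \<omega>))"
    by (rule sum.cong[OF refl], rule sum.mono_neutral_cong_right) (use fin in \<open>auto simp: coef_def zero\<close>)
  also have "\<dots> = (\<Sum>\<omega>\<in>?U. g (coef d (kind a b \<omega>) * c \<omega>) (step a b \<omega>))"
    by (rule sum.group) (use fin finite_webs web_step[OF _ ab(2,3,1)] in auto)
  also have "\<dots> = (\<Sum>\<omega>\<in>?W. g (coef d (kind a b \<omega>) * c \<omega>) (step a b \<omega>))"
    by (rule sum.mono_neutral_left) (use finite_webs in \<open>auto simp: coef_def zero\<close>)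
  finally show ?thesis .
qed

lemma mvop_sum:
  assumes "finite A"
  shows "mvop q a b (\<lambda>I J. \<Sum>x\<in>A. c x * f x I J) I J = (\<Sum>x\<in>A. c x * mvop q a b (f x) I J)"
  using assms by (induction A rule: finite_induct) (auto simp: mvop_def algebra_simps)

lemma web_is_image:
  assumes w: "is_web n k \<omega>" and nt: "\<omega> \<noteq> top_web k"
  obtains i \<omega>' where "i \<in> {1..<n}" "is_web n k \<omega>'" "kind i (Suc i) \<omega>' \<noteq> 0" "step i (Suc i) \<omega>' = \<omega>"
proof -
  have "\<not> reduced n \<omega>" using reduced_all[OF w] nt by blast
  then show thesis
    by (rule web_reach[OF w order_refl]) (metis that zero_neq_one, metis that zero_neq_numeral)
qed

lemma kind_top:
  assumes "i \<in> {1..<n}"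
  shows "kind (Suc i) i (top_web k) = 0"
  using assms by (auto simp: kind_def top_web_def)

text \<open>The form on the tensor square is positive definite and \<open>F\<^sub>i\<close> is adjoint to \<open>q E\<^sub>i K\<^sub>i\<close>,
  so a vector killed by all \<open>E\<^sub>i\<close> is orthogonal to every web other than the top one.\<close>

lemma primitive_multiple_of_top:
  fixes c :: "web \<Rightarrow> 'a::linordered_field"
  assumes q: "q \<noteq> 0" "q + inverse q \<noteq> 0"
    and prim: "\<And>i \<omega>. i \<in> {1..<n} \<Longrightarrow> is_web n k \<omega> \<Longrightarrow> lift_step (q + inverse q) n k (Suc i) i c \<omega> = 0"
    and w: "is_web n k \<omega>" "\<omega> \<noteq> top_web k"
  shows "c \<omega> = 0"
proof -
  let ?W = "{\<omega>. is_web n k \<omega>}"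
  define c' where "c' = c(top_web k := 0)"
  define y where "y I J = (\<Sum>\<omega>\<in>?W. c' \<omega> * bvec q n \<omega> I J)" for I J
  have c': "coef d (kind (Suc i) i \<omega>) * c' \<omega> = coef d (kind (Suc i) i \<omega>) * c \<omega>" if "i \<in> {1..<n}" for i \<omega> and d :: 'a
    using kind_top[OF that, of k] by (simp add: c'_def coef_def)
  have TE0: "TE q i y I J = 0" if i: "i \<in> {1..<n}" for i I J
  proof -
    have ab: "adjacent (Suc i) i" "Suc i \<in> {1..n}" "i \<in> {1..n}" using i by (auto simp: adjacent_def)
    have "TE q i y I J = (\<Sum>\<omega>\<in>?W. c' \<omega> * TE q i (bvec q n \<omega>) I J)"
      unfolding y_def using mvop_sum[OF finite_webs[of n k], of q "Suc i" i c' "bvec q n" I J] by simp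
    also have "\<dots> = (\<Sum>\<omega>\<in>?W. (coef (q + inverse q) (kind (Suc i) i \<omega>) * c \<omega>) * bvec q n (step (Suc i) i \<omega>) I J)"
    proof (rule sum.cong[OF refl])
      fix \<omega> assume "\<omega> \<in> ?W"
      then show "c' \<omega> * TE q i (bvec q n \<omega>) I J = (coef (q + inverse q) (kind (Suc i) i \<omega>) * c \<omega>) * bvec q n (step (Suc i) i \<omega>) I J"
        unfolding c'[OF i, symmetric] using mvop_bvec[OF q(1) _ ab, of k \<omega>] by (simp add: mult.assoc mult.left_commute)
    qed
    also have "\<dots> = (\<Sum>\<omega>\<in>?W. lift_step (q + inverse q) n k (Suc i) i c \<omega> * bvec q n \<omega> I J)"
      by (rule lift_step_sum[OF ab, symmetric]) (simp_all add: algebra_simps)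
    also have "\<dots> = 0" by (rule sum.neutral) (use prim[OF i] in auto)
    finally show ?thesis .
  qed
  have orth: "ip n (bvec q n \<omega>) y = 0" if w: "is_web n k \<omega>" "\<omega> \<noteq> top_web k" for \<omega>
  proof -
    obtain i \<omega>' where i: "i \<in> {1..<n}" "is_web n k \<omega>'" "kind i (Suc i) \<omega>' \<noteq> 0" "step i (Suc i) \<omega>' = \<omega>"
      using web_is_image[OF w] .
    have ab: "adjacent i (Suc i)" "i \<in> {1..n}" "Suc i \<in> {1..n}" using i by (auto simp: adjacent_def)
    let ?r = "coef (q + inverse q) (kind i (Suc i) \<omega>')"
    have r: "?r \<noteq> 0" using i q by (auto simp: coef_def)
    have TF: "TF q i (bvec q n \<omega>') = (\<lambda>I J. ?r * bvec q n \<omega> I J)"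
      using mvop_bvec[OF q(1) i(2) ab] i(4) by simp
    have "TE q i (TK q i y) I J = 0" for I J using TE_TK[OF q(1), of i y I J] TE0[OF i(1), of I J] by (simp add: TK_def)
    then have "ip n (TF q i (bvec q n \<omega>')) y = 0"
      using ip_TF[OF q(1) i(1)] by (simp add: ip_def)
    then have "?r * ip n (bvec q n \<omega>) y = 0"
      unfolding TF by (simp add: ip_def sum_distrib_left mult.assoc)
    then show ?thesis using r by simp
  qed
  have "ip n y y = (\<Sum>\<omega>\<in>?W. c' \<omega> * ip n (bvec q n \<omega>) y)"
  proof -
    have "ip n y y = (\<Sum>I\<in>Pow {1..n}. \<Sum>J\<in>Pow {1..n}. \<Sum>\<omega>\<in>?W. c' \<omega> * (bvec q n \<omega> I J * y I J))"
      unfolding ip_def by (subst y_def) (simp add: sum_distrib_right mult.assoc)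
    also have "\<dots> = (\<Sum>I\<in>Pow {1..n}. \<Sum>\<omega>\<in>?W. \<Sum>J\<in>Pow {1..n}. c' \<omega> * (bvec q n \<omega> I J * y I J))"
      by (rule sum.cong[OF refl], rule sum.swap)
    also have "\<dots> = (\<Sum>\<omega>\<in>?W. \<Sum>I\<in>Pow {1..n}. \<Sum>J\<in>Pow {1..n}. c' \<omega> * (bvec q n \<omega> I J * y I J))"
      by (rule sum.swap)
    finally show ?thesis unfolding ip_def by (simp add: sum_distrib_left)
  qed
  also have "\<dots> = 0"
  proof (rule sum.neutral, rule ballI)
    fix \<omega> assume "\<omega> \<in> ?W"
    then show "c' \<omega> * ip n (bvec q n \<omega>) y = 0"
      using orth[of \<omega>] by (cases "\<omega> = top_web k") (simp_all add: c'_def)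
  qed
  finally have "ip n y y = 0" .
  \<comment> \<open>A vanishing sum of squares in an ordered field.\<close>
  then have y0: "y I J = 0" if "I \<in> Pow {1..n}" "J \<in> Pow {1..n}" for I J
    using that unfolding ip_def by (simp add: sum_nonneg_eq_0_iff sum_nonneg)
  have "y I J = 0" for I J
  proof (cases "I \<subseteq> {1..n} \<and> J \<subseteq> {1..n}")
    case False
    have "bvec q n \<omega> I J = 0" if w: "is_web n k \<omega>" for \<omega>
    proof -
      obtain D p where \<omega>: "\<omega> = (D, p)" by fastforce
      note W = is_webD[OF w[unfolded \<omega>]]
      obtain i where i: "i \<notin> {1..n}" "i \<in> I \<or> i \<in> J" using False by blast
      have "i \<notin> D" "p i = i" using W(1,2) i(1) by (auto simp: permutes_def)
      then have "\<not> compat D p I J" using compatD(3,4)[of D p I J i] i by auto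
      then show ?thesis by (simp add: \<omega> bvec_0)
    qed
    then show ?thesis unfolding y_def by (intro sum.neutral) auto
  qed (use y0 in auto)
  then have "c' \<omega> = 0" using bvec_independent[where n = n and k = k and c = c' and q = q and \<omega> = \<omega>] w(1) unfolding y_def by blast
  then show ?thesis using w by (simp add: c'_def)
qed

text \<open>A subspace of coefficient functions stable under the raising operators, if nonzero,
  contains a nonzero multiple of the top coefficient: take an element of least maximal height.\<close>

lemma raising_stable_top:
  fixes N :: "(web \<Rightarrow> 'a::field) set"
  assumes stable: "\<And>c i. c \<in> N \<Longrightarrow> i \<in> {1..<n} \<Longrightarrow> lift_step d n k (Suc i) i c \<in> N"
    and prim: "\<And>c. (\<And>i \<omega>. i \<in> {1..<n} \<Longrightarrow> is_web n k \<omega> \<Longrightarrow> lift_step d n k (Suc i) i c \<omega> = 0) \<Longrightarrow>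
       (\<And>\<omega>. is_web n k \<omega> \<Longrightarrow> \<omega> \<noteq> top_web k \<Longrightarrow> c \<omega> = 0)"
    and c: "c \<in> N" "is_web n k \<omega>" "c \<omega> \<noteq> 0"
  obtains c' where "c' \<in> N" "c' (top_web k) \<noteq> 0" "\<And>\<omega>. is_web n k \<omega> \<Longrightarrow> \<omega> \<noteq> top_web k \<Longrightarrow> c' \<omega> = 0"
proof -
  have "\<exists>c'\<in>N. c' (top_web k) \<noteq> 0 \<and> (\<forall>\<omega>. is_web n k \<omega> \<longrightarrow> \<omega> \<noteq> top_web k \<longrightarrow> c' \<omega> = 0)"
    if "c \<in> N" "is_web n k \<omega>" "c \<omega> \<noteq> 0" "\<And>\<omega>. is_web n k \<omega> \<Longrightarrow> c \<omega> \<noteq> 0 \<Longrightarrow> height \<omega> \<le> m" for m c \<omega>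
    using that
  proof (induction m arbitrary: c \<omega> rule: less_induct)
    case (less m)
    show ?case
    proof (cases "\<forall>i\<in>{1..<n}. \<forall>\<omega>. is_web n k \<omega> \<longrightarrow> lift_step d n k (Suc i) i c \<omega> = 0")
      case True
      then have z: "c \<omega> = 0" if "is_web n k \<omega>" "\<omega> \<noteq> top_web k" for \<omega> using prim[of c \<omega>] that by blast
      then have "c (top_web k) \<noteq> 0" using less.prems by metis
      then show ?thesis using less.prems(1) z by blast
    next
      case False
      then obtain i \<omega>1 where i: "i \<in> {1..<n}" and \<omega>1: "is_web n k \<omega>1" "lift_step d n k (Suc i) i c \<omega>1 \<noteq> 0" by blast
      \<comment> \<open>A web in the support of the raised function comes from a web in the old
        support that is higher by one.\<close>
      have hh: "Suc (height \<omega>') \<le> m" if nz: "lift_step d n k (Suc i) i c \<omega>' \<noteq> 0" for \<omega>'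
      proof -
        obtain \<omega>'' where "is_web n k \<omega>''" "step (Suc i) i \<omega>'' = \<omega>'" "coef d (kind (Suc i) i \<omega>'') * c \<omega>'' \<noteq> 0"
          using nz unfolding lift_step_def by (metis (mono_tags, lifting) mem_Collect_eq sum.neutral)
        then show ?thesis using less.prems(4)[of \<omega>''] height_step[of n k \<omega>'' "Suc i" i] by (auto simp: coef_def split: if_splits)
      qed
      have "0 < m" using hh[OF \<omega>1(2)] by simp
      show ?thesis
        by (rule less.IH[of "m - 1" "lift_step d n k (Suc i) i c" \<omega>1])
          (use \<open>0 < m\<close> stable[OF less.prems(1) i] \<omega>1 hh in force)+
    qed
  qed
  moreover have "\<exists>m. \<forall>\<omega>. is_web n k \<omega> \<longrightarrow> height \<omega> \<le> m"
    using finite_webs[of n k] by (metis (no_types) finite_nat_set_iff_bounded_le finite_imageI imageI mem_Collect_eq)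
  ultimately show thesis using that c by metis
qed

section \<open>Laurent polynomials and the bar involution\<close>

abbreviation poly_X :: "rat poly" where "poly_X \<equiv> [:0, 1:]"

definition cst :: "rat \<Rightarrow> Qq" where
  "cst r = Fract [:r:] 1"

definition qtwo :: Qq where
  "qtwo = qv + inverse qv"

lemma qv_nz [simp]: "qv \<noteq> 0"
  by (simp add: qv_def Zero_fract_def eq_fract)

lemma qv_power: "qv ^ m = Fract (monom 1 m) 1"
proof (induction m)
  case (Suc m)
  have "[:0, 1:] * monom (1::rat) m = monom 1 (Suc m)" by (simp add: monom_Suc)
  then show ?case unfolding power_Suc Suc by (simp add: qv_def)
qed (simp add: One_fract_def monom_0 one_pCons)

lemma qv_power_neq_1: "m \<noteq> 0 \<Longrightarrow> qv ^ m \<noteq> 1"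
  by (simp add: qv_power One_fract_def eq_fract monom_eq_1_iff)

lemma qv_inverse: "qv - inverse qv \<noteq> 0"
proof
  assume "qv - inverse qv = 0"
  then have "qv ^ 2 = 1" by (simp add: power2_eq_square field_simps)
  then show False using qv_power_neq_1[of 2] by simp
qed

text \<open>\<open>Qq\<close> is an ordered field, so \<open>qv * qv + 1\<close> is positive. The
  same order makes the form on the tensor square definite.\<close>

lemma qtwo_nz [simp]: "qtwo \<noteq> 0"
proof
  assume "qtwo = 0"
  then have "qv * qv + 1 = 0" unfolding qtwo_def by (metis distrib_left mult_zero_right qv_nz right_inverse)
  moreover have "qv * qv \<ge> 0" by simp
  ultimately show False using add_nonneg_pos[of "qv * qv" 1] by simp
qed

lemma qint_1: "qint 1 = 1" and qint_2: "qint 2 = qtwo"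
proof -
  show "qint 1 = 1" using qv_inverse by (simp add: qint_def)
  have "qv ^ 2 - inverse qv ^ 2 = qtwo * (qv - inverse qv)"
    unfolding qtwo_def by (simp add: power2_eq_square algebra_simps)
  then show "qint 2 = qtwo" using qv_inverse by (simp add: qint_def)
qed

lemma qfact_values: "qfact 0 = 1" "qfact 1 = 1" "qfact 2 = qtwo"
  using qint_1 qint_2 by (simp_all add: qfact_def numeral_2_eq_2)

lemma cst_simps: "cst 0 = 0" "cst 1 = 1" "cst (r + s) = cst r + cst s" "cst (r * s) = cst r * cst s" "cst r = 0 \<longleftrightarrow> r = 0"
  by (simp_all add: cst_def Zero_fract_def One_fract_def eq_fract one_pCons)

lemma Fract_pCons: "Fract (pCons a p) 1 = cst a + qv * Fract p 1"
  by (simp add: cst_def qv_def)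

lemma Fract_hom: "Fract (p + r) 1 = Fract p 1 + Fract r 1" "Fract (p * r) 1 = Fract p 1 * Fract r 1"
  for p r :: "rat poly" by simp_all

section \<open>Laurent polynomials and regularity at 0\<close>

lemma laurentI: "Fract p 1 / qv ^ m \<in> laurent_polys"
  by (auto simp: laurent_polys_def)

lemma laurent_simps: "0 \<in> laurent_polys" "1 \<in> laurent_polys" "qtwo \<in> laurent_polys" "cst r \<in> laurent_polys"
proof -
  show "0 \<in> laurent_polys" using laurentI[of 0 0] by (simp add: Zero_fract_def)
  show "1 \<in> laurent_polys" using laurentI[of 1 0] unfolding One_fract_def[symmetric] by simp
  show "cst r \<in> laurent_polys" using laurentI[of "[:r:]" 0] by (simp add: cst_def)
  have "qtwo = Fract [:1, 0, 1:] 1 / qv ^ 1"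
    unfolding Fract_pCons cst_simps by (simp add: qtwo_def Zero_fract_def[symmetric] cst_simps field_simps)
  then show "qtwo \<in> laurent_polys" using laurentI by metis
qed

lemma laurent_mult: "c \<in> laurent_polys \<Longrightarrow> d \<in> laurent_polys \<Longrightarrow> c * d \<in> laurent_polys"
proof -
  assume "c \<in> laurent_polys" "d \<in> laurent_polys"
  then obtain p m r l where "c = Fract p 1 / qv ^ m" "d = Fract r 1 / qv ^ l" by (auto simp: laurent_polys_def)
  then have "c * d = Fract (p * r) 1 / qv ^ (m + l)" unfolding Fract_hom by (simp add: power_add)
  then show ?thesis using laurentI by metis
qed

lemma laurent_add: "c \<in> laurent_polys \<Longrightarrow> d \<in> laurent_polys \<Longrightarrow> c + d \<in> laurent_polys"
proof -
  assume "c \<in> laurent_polys" "d \<in> laurent_polys"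
  then obtain p m r l where cd: "c = Fract p 1 / qv ^ m" "d = Fract r 1 / qv ^ l" by (auto simp: laurent_polys_def)
  have "c + d = Fract (p * monom 1 l + r * monom 1 m) 1 / qv ^ (m + l)"
    unfolding Fract_hom cd qv_power[symmetric] by (simp add: power_add field_simps)
  then show ?thesis using laurentI by metis
qed

lemma laurent_sum: "(\<And>x. x \<in> A \<Longrightarrow> f x \<in> laurent_polys) \<Longrightarrow> sum f A \<in> laurent_polys"
  by (induction A rule: infinite_finite_induct) (auto intro: laurent_add laurent_simps)

lemma regularI: "poly b 0 \<noteq> 0 \<Longrightarrow> Fract a b \<in> regular_at_0"
  by (auto simp: regular_at_0_def)

lemma regular_mult: "c \<in> regular_at_0 \<Longrightarrow> d \<in> regular_at_0 \<Longrightarrow> c * d \<in> regular_at_0"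
proof -
  assume "c \<in> regular_at_0" "d \<in> regular_at_0"
  then obtain a b a' b' where "c = Fract a b" "d = Fract a' b'" "poly b 0 \<noteq> 0" "poly b' 0 \<noteq> 0" by (auto simp: regular_at_0_def)
  then show ?thesis by (auto intro: regularI)
qed

lemma regular_add: "c \<in> regular_at_0 \<Longrightarrow> d \<in> regular_at_0 \<Longrightarrow> c + d \<in> regular_at_0"
proof -
  assume "c \<in> regular_at_0" "d \<in> regular_at_0"
  then obtain a b a' b' where cd: "c = Fract a b" "d = Fract a' b'" and nz: "poly b 0 \<noteq> 0" "poly b' 0 \<noteq> 0" by (auto simp: regular_at_0_def)
  have "b \<noteq> 0" "b' \<noteq> 0" using nz by auto
  then show ?thesis unfolding cd using nz by (auto intro: regularI)
qed

lemma regular_simps: "0 \<in> regular_at_0" "1 \<in> regular_at_0" "qv \<in> regular_at_0" "cst r \<in> regular_at_0"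
  unfolding Zero_fract_def One_fract_def qv_def cst_def by (rule regularI, simp)+

definition qreg :: "Qq set" where
  "qreg = (*) qv ` regular_at_0"

lemma qreg_regular: "c \<in> qreg \<Longrightarrow> c \<in> regular_at_0"
  by (auto simp: qreg_def intro: regular_mult regular_simps)

lemma qreg_add: "c \<in> qreg \<Longrightarrow> d \<in> qreg \<Longrightarrow> c + d \<in> qreg"
  unfolding qreg_def by (auto simp: distrib_left[symmetric] intro!: imageI regular_add)

lemma qreg_mult: "c \<in> regular_at_0 \<Longrightarrow> d \<in> qreg \<Longrightarrow> c * d \<in> qreg"
  unfolding qreg_def by (auto simp: mult.left_commute intro!: imageI regular_mult)

lemma qreg_0: "0 \<in> qreg"
  unfolding qreg_def using regular_simps(1) by force

lemma qreg_diff: "c \<in> qreg \<Longrightarrow> d \<in> qreg \<Longrightarrow> c - d \<in> qreg"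
proof -
  assume "c \<in> qreg" "d \<in> qreg"
  moreover have "cst (-1) = -1" using cst_simps(3)[of 1 "-1"] cst_simps(1,2) by (simp add: eq_neg_iff_add_eq_0 add.commute)
  ultimately have "c + cst (-1) * d \<in> qreg" by (intro qreg_add qreg_mult regular_simps)
  then show ?thesis by (simp add: \<open>cst (-1) = -1\<close>)
qed

text \<open>The inverse of \<open>q + q\<^sup>-\<^sup>1\<close> is
  \<open>q / (1 + q\<^sup>2)\<close> and vanishes at 0. By this a web with coefficient
  \<open>inverse qtwo\<close> disappears modulo \<open>q\<close> times the crystal lattice.\<close>

lemma qreg_inverse_qtwo: "inverse qtwo \<in> qreg"
proof -
  have e: "Fract [:1, 0, 1:] 1 = 1 + qv * qv"
    unfolding Fract_pCons cst_simps by (simp add: Zero_fract_def[symmetric] cst_simps)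
  have "Fract 1 [:1, 0, 1:] = inverse (1 + qv * qv)" unfolding e[symmetric] by simp
  moreover have "inverse qtwo = qv * inverse (1 + qv * qv)"
  proof -
    have e: "qtwo = inverse qv * (1 + qv * qv)" by (simp add: qtwo_def field_simps)
    show ?thesis unfolding e inverse_mult_distrib by simp
  qed
  moreover have "Fract 1 [:1, 0, 1:] \<in> regular_at_0" by (rule regularI) simp
  ultimately show ?thesis unfolding qreg_def by (metis imageI)
qed

lemma qreg_cst: "cst r \<in> qreg \<Longrightarrow> r = 0"
proof -
  assume "cst r \<in> qreg"
  then obtain a b where b: "poly b 0 \<noteq> 0" and e: "cst r = qv * Fract a b" by (auto simp: qreg_def regular_at_0_def)
  have "b \<noteq> 0" using b by auto
  then have "[:r:] * b = [:0, 1:] * a" using e by (simp add: cst_def qv_def eq_fract)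
  then have "poly ([:r:] * b) 0 = poly ([:0, 1:] * a) 0" by simp
  then show "r = 0" using b by simp
qed

section \<open>The substitution of the inverse of q\<close>

definition bar_poly :: "rat poly \<Rightarrow> Qq" where
  "bar_poly p = poly (map_poly cst p) (inverse qv)"

lemma bar_poly_pCons: "bar_poly (pCons a p) = cst a + inverse qv * bar_poly p"
  by (simp add: bar_poly_def map_poly_pCons cst_simps)

lemma bar_poly_0: "bar_poly 0 = 0"
  by (simp add: bar_poly_def)

lemma bar_poly_add: "bar_poly (p + r) = bar_poly p + bar_poly r"
  by (induction p r rule: poly_induct2) (simp_all add: bar_poly_0 bar_poly_pCons cst_simps algebra_simps)

lemma bar_poly_smult: "bar_poly (smult a p) = cst a * bar_poly p"
  by (induction p) (simp_all add: bar_poly_0 bar_poly_pCons cst_simps algebra_simps)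

lemma bar_poly_mult: "bar_poly (p * r) = bar_poly p * bar_poly r"
  by (induction p) (simp_all add: bar_poly_0 bar_poly_pCons bar_poly_add bar_poly_smult cst_simps algebra_simps)

text \<open>Reversing the coefficients clears the denominator. This shows that the substitution is
  injective, and it later allows degrees to be compared.\<close>

lemma bar_poly_reflect: "Fract (reflect_poly p) 1 = qv ^ degree p * bar_poly p"
proof (induction p)
  case 0 then show ?case by (simp add: bar_poly_0 Zero_fract_def)
next
  case (pCons a p)
  show ?case
  proof (cases "p = 0")
    case True
    then show ?thesis by (cases "a = 0") (simp_all add: bar_poly_pCons bar_poly_0 cst_def Zero_fract_def reflect_poly_const)
  next
    case False
    have "Fract (reflect_poly (pCons a p)) 1 = Fract (reflect_poly p) 1 + Fract (monom a (Suc (degree p))) 1"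
      unfolding reflect_poly_pCons'[OF False] Fract_hom ..
    also have "Fract (monom a (Suc (degree p))) 1 = cst a * qv ^ Suc (degree p)"
      unfolding qv_power cst_def by (simp add: smult_monom)
    finally show ?thesis using False pCons.IH by (simp add: bar_poly_pCons algebra_simps)
  qed
qed

lemma bar_poly_eq_0: "bar_poly p = 0 \<Longrightarrow> p = 0"
proof -
  assume "bar_poly p = 0"
  then have "Fract (reflect_poly p) 1 = 0" unfolding bar_poly_reflect by simp
  then show ?thesis by (simp add: Zero_fract_def eq_fract)
qed

text \<open>The choice of a fraction is immaterial by \<open>bar_Fract\<close>: the substitution
  preserves cross multiplication and keeps denominators nonzero.\<close>

definition bar :: "Qq \<Rightarrow> Qq" where
  "bar c = (SOME d. \<exists>a b. b \<noteq> 0 \<and> c = Fract a b \<and> d = bar_poly a / bar_poly b)"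

lemma bar_Fract: "b \<noteq> 0 \<Longrightarrow> bar (Fract a b) = bar_poly a / bar_poly b"
proof -
  assume b: "b \<noteq> 0"
  have "\<exists>a' b'. b' \<noteq> 0 \<and> Fract a b = Fract a' b' \<and> bar (Fract a b) = bar_poly a' / bar_poly b'"
    unfolding bar_def by (rule someI_ex) (use b in blast)
  then obtain a' b' where *: "b' \<noteq> 0" "Fract a b = Fract a' b'" "bar (Fract a b) = bar_poly a' / bar_poly b'" by blast
  have "a * b' = a' * b" using * b by (simp add: eq_fract)
  then have "bar_poly a * bar_poly b' = bar_poly a' * bar_poly b" by (metis bar_poly_mult)
  then show ?thesis using *(1,3) b bar_poly_eq_0 by (metis frac_eq_eq)
qed

lemma bar_poly_cst: "bar_poly [:r:] = cst r"
  by (simp add: bar_poly_pCons bar_poly_0)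

lemma bar_poly_1: "bar_poly 1 = 1"
  by (simp add: one_pCons bar_poly_cst cst_simps)

lemma bar_simps: "bar 0 = 0" "bar 1 = 1" "bar qv = inverse qv" "bar (cst r) = cst r"
  unfolding Zero_fract_def One_fract_def qv_def cst_def
  by (simp_all add: bar_Fract bar_poly_0 bar_poly_1 bar_poly_pCons cst_simps, simp_all add: Zero_fract_def One_fract_def qv_def cst_def)

lemma bar_mult: "bar (c * d) = bar c * bar d"
proof -
  obtain a b a' b' where "c = Fract a b" "d = Fract a' b'" "b \<noteq> 0" "b' \<noteq> 0" by (metis Fract_cases)
  then show ?thesis by (simp add: bar_Fract bar_poly_mult)
qed

lemma bar_add: "bar (c + d) = bar c + bar d"
proof -
  obtain a b a' b' where cd: "c = Fract a b" "d = Fract a' b'" "b \<noteq> 0" "b' \<noteq> 0" by (metis Fract_cases)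
  have "bar_poly b \<noteq> 0" "bar_poly b' \<noteq> 0" using cd bar_poly_eq_0 by blast+
  then show ?thesis using cd by (simp add: bar_Fract bar_poly_mult bar_poly_add field_simps)
qed

lemma bar_inverse: "bar (inverse c) = inverse (bar c)"
proof -
  have "bar c * bar (inverse c) = 1" if "c \<noteq> 0" using that bar_mult[of c "inverse c"] by (simp add: bar_simps)
  then show ?thesis by (cases "c = 0") (simp_all add: bar_simps inverse_unique)
qed

lemma bar_sum: "bar (sum f A) = (\<Sum>x\<in>A. bar (f x))"
  by (induction A rule: infinite_finite_induct) (simp_all add: bar_simps bar_add)

lemma bar_qtwo: "bar qtwo = qtwo"
  by (simp add: qtwo_def bar_add bar_inverse bar_simps)

text \<open>Regularity forces the numerator to vanish at 0, so factors \<open>q\<close> cancel one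
  at a time.\<close>

lemma laurent_regular_poly:
  "Fract p 1 / qv ^ m \<in> regular_at_0 \<Longrightarrow> \<exists>P. Fract p 1 / qv ^ m = Fract P 1"
proof (induction m arbitrary: p)
  case 0 then show ?case by auto
next
  case (Suc m)
  then obtain a b where b: "poly b 0 \<noteq> 0" and e: "Fract p 1 / qv ^ Suc m = Fract a b" by (auto simp: regular_at_0_def)
  have "b \<noteq> 0" using b by auto
  have "Fract p 1 = Fract a b * Fract (monom 1 (Suc m)) 1"
    using e unfolding qv_power[symmetric] by (simp add: field_simps)
  then have "p * b = a * monom 1 (Suc m)" using \<open>b \<noteq> 0\<close> by (simp add: eq_fract)
  then have "poly p 0 * poly b 0 = 0" by (metis mult_zero_right poly_monom poly_mult power_0_Suc)
  then have "poly p 0 = 0" using b by simp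
  then obtain p' where p': "p = pCons 0 p'" by (cases p) auto
  have "Fract p 1 / qv ^ Suc m = Fract p' 1 / qv ^ m" unfolding p' Fract_pCons cst_simps by simp
  then show ?case using Suc by metis
qed

text \<open>Regularity at 0 makes \<open>c\<close> a polynomial in \<open>q\<close>, and
  \<open>c = bar d\<close> keeps it bounded at infinity: comparing degrees in \<open>eq\<close>
  leaves degree 0 for \<open>P\<close>. This rigidity gives the uniqueness of global basis
  elements.\<close>

lemma balanced_constant:
  assumes "c \<in> laurent_polys" "c \<in> regular_at_0" "c = bar d" "d \<in> regular_at_0"
  obtains r where "c = cst r"
proof -
  obtain P where P: "c = Fract P 1" using assms(1,2) laurent_regular_poly by (auto simp: laurent_polys_def)
  obtain a b where ab: "d = Fract a b" "poly b 0 \<noteq> 0" using assms(4) by (auto simp: regular_at_0_def)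
  have b: "b \<noteq> 0" using ab by auto
  show thesis
  proof (cases "P = 0")
    case True
    then show thesis using that[of 0] P by (simp add: cst_def)
  next
    case False
    have "Fract P 1 = bar_poly a / bar_poly b" using assms(3) P ab b by (simp add: bar_Fract)
    then have e: "Fract P 1 * bar_poly b = bar_poly a" using bar_poly_eq_0[of b] b by (auto simp: field_simps)
    have "Fract (P * reflect_poly b * monom 1 (degree a)) 1 = Fract P 1 * (qv ^ degree b * bar_poly b) * qv ^ degree a"
      unfolding Fract_hom bar_poly_reflect qv_power[symmetric] ..
    also have "\<dots> = Fract (reflect_poly a) 1 * Fract (monom 1 (degree b)) 1"
      unfolding bar_poly_reflect qv_power[symmetric] e[symmetric] by simp
    also have "\<dots> = Fract (reflect_poly a * monom 1 (degree b)) 1" by simp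
    finally have eq: "P * reflect_poly b * monom 1 (degree a) = reflect_poly a * monom 1 (degree b)" by (simp add: eq_fract)
    have dm: "degree (monom (1::rat) x) = x" for x by (simp add: degree_monom_eq)
    have nzb: "reflect_poly b \<noteq> 0" using b by simp
    have "degree (P * reflect_poly b * monom 1 (degree a)) = degree P + degree b + degree a"
      using False nzb ab(2) by (simp add: degree_mult_eq dm poly_0_coeff_0)
    moreover have "degree (reflect_poly a * monom 1 (degree b)) \<le> degree a + degree b"
      using degree_mult_le[of "reflect_poly a" "monom 1 (degree b)"] degree_reflect_poly_le[of a] dm by (metis (no_types, lifting) add_mono_thms_linordered_semiring(3) le_trans)
    ultimately have "degree P = 0" using eq by simp
    then obtain r where "P = [:r:]" by (metis degree_eq_zeroE)
    then show thesis using that[of r] P by (simp add: cst_def)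
  qed
qed

text \<open>An additive map respects integer multiples, hence rational ones. Induction handles
  polynomials in \<open>q\<close>, and a denominator is moved to the other side and
  cancelled.\<close>

lemma semilinear_of_qv:
  fixes s :: "Qq \<Rightarrow> 'v::ab_group_add \<Rightarrow> 'v"
  assumes vs: "vector_space s" and add: "\<And>x y. \<beta> (x + y) = \<beta> x + \<beta> y"
    and q: "\<And>x. \<beta> (s qv x) = s (inverse qv) (\<beta> x)"
  shows "\<beta> (s c x) = s (bar c) (\<beta> x)"
proof -
  interpret vector_space s by fact
  have z: "\<beta> 0 = 0" using add[of 0 0] by simp
  have neg: "\<beta> (- x) = - \<beta> x" for x using add[of x "- x"] z by (simp add: eq_neg_iff_add_eq_0 add.commute)
  have nat: "\<beta> (s (of_nat m) x) = s (of_nat m) (\<beta> x)" for m x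
    by (induction m) (simp_all add: z scale_left_distrib add)
  have int: "\<beta> (s (of_int m) x) = s (of_int m) (\<beta> x)" for m x
    by (cases m) (simp_all add: nat neg del: of_nat_Suc)
  have cint: "cst (of_int m) = of_int m" for m
  proof -
    have cn: "cst (of_nat m) = of_nat m" for m by (induction m) (simp_all add: cst_simps)
    have "cst (- r) = - cst r" for r using cst_simps(3)[of r "- r"] cst_simps(1) by (simp add: eq_neg_iff_add_eq_0 add.commute)
    then show ?thesis by (cases m) (simp_all add: cn del: of_nat_Suc)
  qed
  have rat: "\<beta> (s (cst r) x) = s (cst r) (\<beta> x)" for r x
  proof -
    obtain i j where r: "r = of_int i / of_int j" "j > 0" by (metis Fract_of_int_quotient Rat_cases)
    have j0: "(of_int j :: Qq) \<noteq> 0" using r by simp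
    have "r * of_int j = of_int i" using r by simp
    then have ij: "of_int j * cst r = (of_int i :: Qq)" by (metis cint cst_simps(4) mult.commute)
    have "s (of_int j) (\<beta> (s (cst r) x)) = \<beta> (s (of_int i) x)" unfolding int[symmetric] scale_scale ij ..
    also have "\<dots> = s (of_int j) (s (cst r) (\<beta> x))" unfolding int scale_scale ij ..
    finally show ?thesis using scale_left_imp_eq[OF j0] by blast
  qed
  have pol: "\<beta> (s (Fract p 1) x) = s (bar_poly p) (\<beta> x)" for p x
  proof (induction p)
    case 0 then show ?case by (simp add: Zero_fract_def[symmetric] bar_poly_0 z)
  next
    case (pCons a p)
    show ?case
      unfolding Fract_pCons bar_poly_pCons scale_left_distrib add rat scale_scale[symmetric] q pCons.IH ..
  qed
  obtain a b where c: "c = Fract a b" "b \<noteq> 0" by (metis Fract_cases)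
  have cb: "Fract b 1 * c = Fract a 1" using c by (simp add: eq_fract)
  have nz: "bar_poly b \<noteq> 0" using bar_poly_eq_0 c by blast
  have "s (bar_poly b) (\<beta> (s c x)) = s (bar_poly a) (\<beta> x)"
    unfolding pol[symmetric] scale_scale cb ..
  also have "\<dots> = s (bar_poly b) (s (bar c) (\<beta> x))"
    unfolding c(1) bar_Fract[OF c(2)] using nz by simp
  finally show ?thesis using scale_left_imp_eq[OF nz] by blast
qed

section \<open>The global basis\<close>

text \<open>Two steps from \<open>a\<close> to \<open>b\<close> need weight 2 at \<open>a\<close>
  and weight 0 at \<open>b\<close>; only there is the second divided power nonzero.\<close>

lemma step_twice_cup:
  assumes w: "is_web n k (D, p)" and ne: "a \<noteq> b" and k1: "kind a b (D, p) \<noteq> 0" and k2: "kind a b (step a b (D, p)) \<noteq> 0"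
  shows "a \<in> D" "b \<notin> D" "p a = a" "p b = b" "kind a b (D, p) = 1" "kind a b (step a b (D, p)) = 2"
    "step a b (step a b (D, p)) = (insert b (D - {a}), p)"
proof -
  note W = is_webD[OF w]
  have "a \<in> D \<and> b \<notin> D \<and> p a = a \<and> p b = b \<and> kind a b (D, p) = 1"
    using k1 ne W(4,3)
  proof (cases rule: step_cases)
    case relabel
    have "kind a b (step a b (D, p)) = 0"
    proof (cases "a \<in> D")
      case True
      then have "b \<in> Transposition.transpose a b ` D" by (metis image_eqI transpose_apply_first)
      then show ?thesis unfolding relabel(6) by (simp add: kind_def)
    next
      case False
      then have "p b = b" using relabel by blast
      moreover have "a \<notin> Transposition.transpose a b ` D" using relabel(4) False
        by (metis imageE transpose_apply_second transpose_involutory)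
      ultimately show ?thesis unfolding relabel(6) by (simp add: kind_def)
    qed
    then show ?thesis using k2 by simp
  next
    case cup then show ?thesis by simp
  next
    case cap
    have "kind a b (step a b (D, p)) = 0" unfolding cap(6) by (simp add: kind_def)
    then show ?thesis using k2 by simp
  qed
  then show "a \<in> D" "b \<notin> D" "p a = a" "p b = b" "kind a b (D, p) = 1" by auto
  then show "kind a b (step a b (D, p)) = 2" "step a b (step a b (D, p)) = (insert b (D - {a}), p)"
    using step_step_cup[of a D b p] W(3) ne by auto
qed

text \<open>The combinatorial content of
  \<open>F\<^sub>i\<^sup>(\<^sup>2\<^sup>) E\<^sub>i = F\<^sub>i\<close> on webs with arc ends at
  both sites, used with \<open>a = Suc i\<close> and \<open>b = i\<close>. On all other webs the
  left side is 0 by \<open>step_noncap_double\<close>.\<close>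

lemma step_cap_double:
  assumes w: "is_web n k (D, p)" and ne: "a \<noteq> b" and s: "p a \<noteq> a" "p b \<noteq> b"
  shows "kind a b (D, p) = kind b a (D, p)" "kind b a (step a b (D, p)) = 1" "kind b a (step b a (step a b (D, p))) = 2"
    "step b a (step b a (step a b (D, p))) = step b a (D, p)"
proof -
  note W = is_webD[OF w]
  have nD: "a \<notin> D" "b \<notin> D" using W(4) s by auto
  have pin: "p i = p j \<longleftrightarrow> i = j" for i j using W(3) by metis
  have pab: "p a = b \<longleftrightarrow> p b = a" using W(3) by metis
  show "kind a b (D, p) = kind b a (D, p)" using nD s pab by (simp add: kind_def)
  define r where "r = p(p a := p b, p b := p a, a := a, b := b)"
  have st: "step a b (D, p) = (insert b D, r)" using s nD by (simp add: step_def r_def)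
  have r': "p(p b := p a, p a := p b, b := b, a := a) = r"
    unfolding r_def using ne pin by (auto simp: fun_eq_iff)
  have st': "step b a (D, p) = (insert a D, r)" using s nD r' by (simp add: step_def)
  have rab: "r a = a" "r b = b" using ne by (auto simp: r_def)
  have inv: "\<forall>i. r (r i) = i" using join_involution(1)[OF W(3) ne s] by (simp add: r_def)
  note ss = step_step_cup[of b "insert b D" a r, OF _ _ rab(2,1) inv]
  show "kind b a (step a b (D, p)) = 1" unfolding st using rab nD ne by (simp add: kind_def)
  show "kind b a (step b a (step a b (D, p))) = 2" unfolding st using ss(3) nD ne by simp
  show "step b a (step b a (step a b (D, p))) = step b a (D, p)" unfolding st st' using ss(4) nD ne by simp
qed

lemma step_noncap_double:
  assumes w: "is_web n k (D, p)" and ne: "a \<noteq> b" and s: "p a = a \<or> p b = b" and ab: "adjacent a b" "a \<in> {1..n}" "b \<in> {1..n}"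
    and k: "kind a b (D, p) \<noteq> 0"
  shows "kind b a (step a b (D, p)) = 0 \<or> kind b a (step b a (step a b (D, p))) = 0"
proof (rule ccontr)
  assume n: "\<not> ?thesis"
  note W = is_webD[OF w]
  obtain D' p' where st: "step a b (D, p) = (D', p')" by fastforce
  have w': "is_web n k (D', p')" using web_step[OF w ab(2,3,1) k] st by simp
  have *: "p' b = b" "p' a = a" using step_twice_cup[OF w', of b a] ne n st by auto
  show False using k ne W(4,3)
  proof (cases rule: step_cases)
    case relabel
    have "p' = Transposition.transpose a b \<circ> p \<circ> Transposition.transpose a b" using relabel(6) st by simp
    then have "p a = a" "p b = b" using * by (simp_all, (metis transpose_apply_first transpose_apply_second transpose_involutory)+)
    then show False using relabel(2) by simp
  next
    case cup
    then show False using st * ne by auto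
  next
    case cap
    then show False using s by simp
  qed
qed

section \<open>The irreducible highest weight module\<close>

locale quantum_hw =
  fixes n k :: nat and M :: "'v::ab_group_add Uq_structure" and u :: 'v
  assumes k1: "1 \<le> k" and kn: "k < n"
    and irr: "Uq_irreducible_hw n (\<lambda>i. 2 * fundamental_weight k i) M u"
begin

lemma vector_space_M: "vector_space (qscale M)"
  using irr by (simp add: Uq_irreducible_hw_def Uq_module_def)

sublocale vector_space "qscale M" by (rule vector_space_M)

abbreviation sc :: "Qq \<Rightarrow> 'v \<Rightarrow> 'v" where "sc \<equiv> qscale M"
abbreviation webs :: "web set" where "webs \<equiv> {\<omega>. is_web n k \<omega>}"

lemma lin_simps:
  assumes "Vector_Spaces.linear sc sc f"
  shows "f (x + y) = f x + f y" "f (sc c x) = sc c (f x)" "f 0 = 0" "f (sum g A) = (\<Sum>x\<in>A. f (g x))" "f (x - y) = f x - f y"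
proof -
  interpret f: Vector_Spaces.linear sc sc f by fact
  show "f (x + y) = f x + f y" "f (sc c x) = sc c (f x)" "f 0 = 0" "f (sum g A) = (\<Sum>x\<in>A. f (g x))" "f (x - y) = f x - f y"
    by (rule f.add f.scale f.zero f.sum f.diff)+
qed

lemma Uq: "Uq_module n M" and unz: "u \<noteq> 0"
  and simple: "Uq_submodule n M S \<Longrightarrow> S = {0} \<or> S = UNIV"
  and Eu: "i \<in> {1..<n} \<Longrightarrow> Eop M i u = 0"
  and Ku: "i \<in> {1..<n} \<Longrightarrow> Kop M i u = sc (qv ^ (2 * fundamental_weight k i)) u"
  using irr unfolding Uq_irreducible_hw_def by auto

lemma E_lin: "i \<in> {1..<n} \<Longrightarrow> Vector_Spaces.linear sc sc (Eop M i)"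
  and F_lin: "i \<in> {1..<n} \<Longrightarrow> Vector_Spaces.linear sc sc (Fop M i)"
  and K_lin: "i \<in> {1..<n} \<Longrightarrow> Vector_Spaces.linear sc sc (Kop M i)"
  and Ki_lin: "i \<in> {1..<n} \<Longrightarrow> Vector_Spaces.linear sc sc (Kinv M i)"
  and K_Ki: "i \<in> {1..<n} \<Longrightarrow> Kop M i (Kinv M i x) = x" "i \<in> {1..<n} \<Longrightarrow> Kinv M i (Kop M i x) = x"
  using Uq unfolding Uq_module_def by blast+

lemma KF: "i \<in> {1..<n} \<Longrightarrow> j \<in> {1..<n} \<Longrightarrow> Kop M i (Fop M j x) = sc (qv powi (- cartan i j)) (Fop M j (Kop M i x))"
  and EF: "i \<in> {1..<n} \<Longrightarrow> j \<in> {1..<n} \<Longrightarrow> Eop M i (Fop M j x) - Fop M j (Eop M i x) =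
     (if i = j then sc (inverse (qv - inverse qv)) (Kop M i x - Kinv M i x) else 0)"
  using Uq unfolding Uq_module_def by blast+

lemmas E_simps = lin_simps[OF E_lin] and F_simps = lin_simps[OF F_lin]
  and K_simps = lin_simps[OF K_lin] and Ki_simps = lin_simps[OF Ki_lin]

lemma KiF:
  assumes i: "i \<in> {1..<n}" "j \<in> {1..<n}"
  shows "Kinv M i (Fop M j x) = sc (qv powi (cartan i j)) (Fop M j (Kinv M i x))"
proof -
  have "Kop M i (Fop M j (Kinv M i x)) = sc (qv powi (- cartan i j)) (Fop M j x)"
    using KF[OF i, of "Kinv M i x"] K_Ki(1)[OF i(1)] by simp
  from arg_cong[OF this, of "Kinv M i"]
  have "Fop M j (Kinv M i x) = sc (qv powi (- cartan i j)) (Kinv M i (Fop M j x))"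
    unfolding K_Ki(2)[OF i(1)] Ki_simps(2)[OF i(1)] .
  then show ?thesis by (simp add: power_int_minus)
qed

text \<open>The graph of a homomorphism from \<open>M\<close> to the tensor square, single-valued because \<open>M\<close> is
  irreducible.\<close>

inductive_set model_graph :: "('v \<times> (nat set \<Rightarrow> nat set \<Rightarrow> Qq)) set" where
  base: "(u, bvec qv n (top_web k)) \<in> model_graph"
| add: "(x, y) \<in> model_graph \<Longrightarrow> (x', y') \<in> model_graph \<Longrightarrow> (x + x', \<lambda>I J. y I J + y' I J) \<in> model_graph"
| scale: "(x, y) \<in> model_graph \<Longrightarrow> (sc c x, \<lambda>I J. c * y I J) \<in> model_graph"
| lower: "i \<in> {1..<n} \<Longrightarrow> (x, y) \<in> model_graph \<Longrightarrow> (Fop M i x, TF qv i y) \<in> model_graph"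

section \<open>Comparison with the tensor square\<close>

lemma model_graph_zero: "(0, \<lambda>I J. 0) \<in> model_graph"
  using model_graph.scale[OF model_graph.base, of 0] by simp

lemma model_graph_diff: "(x, y) \<in> model_graph \<Longrightarrow> (x', y') \<in> model_graph \<Longrightarrow> (x - x', \<lambda>I J. y I J - y' I J) \<in> model_graph"
  using model_graph.add[of x y "sc (-1) x'" "\<lambda>I J. -1 * y' I J", OF _ model_graph.scale] by simp

lemma top_support:
  assumes "bvec qv n (top_web k) I J \<noteq> 0"
  shows "I = {1..k}" "J = {1..k}"
proof -
  have c: "compat {1..k} id I J" using assms by (auto simp: bvec_def top_web_def split: if_splits)
  show "I = {1..k}" by (rule Set.set_eqI) (metis compatD(1,3)[OF c] id_apply)
  show "J = {1..k}" by (rule Set.set_eqI) (metis compatD(2,4)[OF c] id_apply)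
qed

lemma TK_top:
  assumes i: "i \<in> {1..<n}"
  shows "TK qv i (bvec qv n (top_web k)) = (\<lambda>I J. qv ^ (2 * fundamental_weight k i) * bvec qv n (top_web k) I J)"
    and "TKi qv i (bvec qv n (top_web k)) = (\<lambda>I J. inverse (qv ^ (2 * fundamental_weight k i)) * bvec qv n (top_web k) I J)"
proof -
  have k: "kap qv i {1..k} = (if i = k then qv else 1)" using i k1 by (auto simp: kap_def)
  show "TK qv i (bvec qv n (top_web k)) = (\<lambda>I J. qv ^ (2 * fundamental_weight k i) * bvec qv n (top_web k) I J)"
    "TKi qv i (bvec qv n (top_web k)) = (\<lambda>I J. inverse (qv ^ (2 * fundamental_weight k i)) * bvec qv n (top_web k) I J)"
  proof (intro ext)
    fix I J
    show "TK qv i (bvec qv n (top_web k)) I J = qv ^ (2 * fundamental_weight k i) * bvec qv n (top_web k) I J"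
    proof (cases "bvec qv n (top_web k) I J = 0")
      case False
      then show ?thesis using top_support[OF False] k by (simp add: TK_def fundamental_weight_def power2_eq_square)
    qed (simp add: TK_def)
  next
    show "TKi qv i (bvec qv n (top_web k)) = (\<lambda>I J. inverse (qv ^ (2 * fundamental_weight k i)) * bvec qv n (top_web k) I J)"
    proof (intro ext)
      fix I J
      show "TKi qv i (bvec qv n (top_web k)) I J = inverse (qv ^ (2 * fundamental_weight k i)) * bvec qv n (top_web k) I J"
      proof (cases "bvec qv n (top_web k) I J = 0")
        case False
        then show ?thesis using top_support[OF False] k by (simp add: TKi_def fundamental_weight_def power2_eq_square)
      qed (simp add: TKi_def)
    qed
  qed
qed

lemma mvop_add: "mvop q a b (\<lambda>I J. y I J + y' I J) = (\<lambda>I J. mvop q a b y I J + mvop q a b y' I J)"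
  and mvop_scale: "mvop q a b (\<lambda>I J. c * y I J) = (\<lambda>I J. c * mvop q a b y I J)"
  and mvop_zero: "mvop q a b (\<lambda>I J. 0) = (\<lambda>I J. 0)"
  by (auto simp: mvop_def fun_eq_iff distrib_left)

lemma model_graph_K: "(x, y) \<in> model_graph \<Longrightarrow> i \<in> {1..<n} \<Longrightarrow> (Kop M i x, TK qv i y) \<in> model_graph \<and> (Kinv M i x, TKi qv i y) \<in> model_graph"
proof (induction rule: model_graph.induct)
  case base
  have "Kinv M i u = sc (inverse (qv ^ (2 * fundamental_weight k i))) u"
  proof -
    have "u = sc (qv ^ (2 * fundamental_weight k i)) (Kinv M i u)"
      using K_Ki(2)[OF base, of u] unfolding Ku[OF base] Ki_simps(2)[OF base] by simp
    then show ?thesis by (metis inverse_unique left_inverse power_not_zero qv_nz scale_one scale_scale)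
  qed
  then show ?case unfolding TK_top[OF base] Ku[OF base] using model_graph.scale[OF model_graph.base] by simp
next
  case (add x y x' y')
  have "TK qv i (\<lambda>I J. y I J + y' I J) = (\<lambda>I J. TK qv i y I J + TK qv i y' I J)"
    "TKi qv i (\<lambda>I J. y I J + y' I J) = (\<lambda>I J. TKi qv i y I J + TKi qv i y' I J)"
    by (simp_all add: TK_def TKi_def fun_eq_iff distrib_left)
  then show ?case using add model_graph.add by (simp add: K_simps[OF add.prems] Ki_simps[OF add.prems])
next
  case (scale x y c)
  have "TK qv i (\<lambda>I J. c * y I J) = (\<lambda>I J. c * TK qv i y I J)" "TKi qv i (\<lambda>I J. c * y I J) = (\<lambda>I J. c * TKi qv i y I J)"
    by (simp_all add: TK_def TKi_def fun_eq_iff)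
  then show ?case using scale model_graph.scale by (simp add: K_simps[OF scale.prems] Ki_simps[OF scale.prems])
next
  case (lower j x y)
  have "TK qv i (TF qv j y) = (\<lambda>I J. qv powi (- cartan i j) * TF qv j (TK qv i y) I J)"
    "TKi qv i (TF qv j y) = (\<lambda>I J. qv powi (cartan i j) * TF qv j (TKi qv i y) I J)"
    by (intro ext TK_TF qv_nz)+
  then show ?case using lower model_graph.scale model_graph.lower by (simp add: KF[OF lower.prems lower.hyps(1)] KiF[OF lower.prems lower.hyps(1)])
qed

lemma model_graph_E: "(x, y) \<in> model_graph \<Longrightarrow> i \<in> {1..<n} \<Longrightarrow> (Eop M i x, TE qv i y) \<in> model_graph"
proof (induction rule: model_graph.induct)
  case base
  have "TE qv i (bvec qv n (top_web k)) = (\<lambda>I J. 0)"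
    using mvop_bvec[OF qv_nz web_top, of k n "Suc i" i] base kn kind_top[OF base] by (simp add: adjacent_def coef_def)
  then show ?case using model_graph_zero Eu[OF base] by simp
next
  case (add x y x' y')
  then show ?case using model_graph.add by (simp add: E_simps[OF add.prems] mvop_add)
next
  case (scale x y c)
  then show ?case using model_graph.scale by (simp add: E_simps[OF scale.prems] mvop_scale)
next
  case (lower j x y)
  have FE: "(Fop M j (Eop M i x), TF qv j (TE qv i y)) \<in> model_graph" using model_graph.lower lower by blast
  show ?case
  proof (cases "i = j")
    case False
    have "Eop M i (Fop M j x) = Fop M j (Eop M i x)" using EF[OF lower.prems lower.hyps(1), of x] False by simp
    moreover have "TE qv i (TF qv j y) = TF qv j (TE qv i y)" by (intro ext TE_TF_diff qv_nz False)
    ultimately show ?thesis using FE by simp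
  next
    case True
    let ?h = "inverse (qv - inverse qv)"
    have "Eop M i (Fop M j x) = Fop M j (Eop M i x) + sc ?h (Kop M i x - Kinv M i x)"
      using EF[OF lower.prems lower.hyps(1), of x] True by (simp add: algebra_simps)
    moreover have "TE qv i (TF qv j y) = (\<lambda>I J. TF qv j (TE qv i y) I J + ?h * (TK qv i y I J - TKi qv i y I J))"
      using TE_TF_same[OF qv_nz qv_inverse, of i y] True by (auto simp: fun_eq_iff algebra_simps)
    moreover have "(sc ?h (Kop M i x - Kinv M i x), \<lambda>I J. ?h * (TK qv i y I J - TKi qv i y I J)) \<in> model_graph"
      by (rule model_graph.scale, rule model_graph_diff) (use model_graph_K[OF lower.hyps(2) lower.prems] in auto)
    ultimately show ?thesis using model_graph.add[OF FE] by simp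
  qed
qed

text \<open>By irreducibility the vectors related to 0 are then 0 alone, once it is known that
  \<open>u\<close> is not among them.\<close>

lemma model_graph_kernel_submodule: "Uq_submodule n M {x. (x, \<lambda>I J. 0) \<in> model_graph}"
  unfolding Uq_submodule_def
proof (intro conjI subspaceI ballI)
  show "0 \<in> {x. (x, \<lambda>I J. 0) \<in> model_graph}" using model_graph_zero by simp
  fix x y c assume "x \<in> {x. (x, \<lambda>I J. 0) \<in> model_graph}" "y \<in> {x. (x, \<lambda>I J. 0) \<in> model_graph}"
  then show "x + y \<in> {x. (x, \<lambda>I J. 0) \<in> model_graph}" using model_graph.add[of x _ y] by force
next
  fix c x assume "x \<in> {x. (x, \<lambda>I J. 0) \<in> model_graph}"
  then show "sc c x \<in> {x. (x, \<lambda>I J. 0) \<in> model_graph}" using model_graph.scale[of x _ c] by force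
next
  fix i x assume i: "i \<in> {1..<n}" and "x \<in> {x. (x, \<lambda>I J. 0) \<in> model_graph}"
  then have x: "(x, \<lambda>I J. 0) \<in> model_graph" by simp
  have "TK qv i (\<lambda>I J. 0) = (\<lambda>I J. 0)" "TKi qv i (\<lambda>I J. 0) = (\<lambda>I J. 0)" by (auto simp: TK_def TKi_def fun_eq_iff)
  then show "Eop M i x \<in> {x. (x, \<lambda>I J. 0) \<in> model_graph}" "Fop M i x \<in> {x. (x, \<lambda>I J. 0) \<in> model_graph}"
     "Kop M i x \<in> {x. (x, \<lambda>I J. 0) \<in> model_graph}" "Kinv M i x \<in> {x. (x, \<lambda>I J. 0) \<in> model_graph}"
    using model_graph_E[OF x i] model_graph.lower[OF i x] model_graph_K[OF x i] by (simp_all add: mvop_zero)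
qed

text \<open>The weights of \<open>M\<close> are separated by \<open>K = \<Prod>\<^sub>i K\<^sub>i\<^bsup>i(n-i)\<^esup>\<close>, which \<open>q\<^sup>2\<close>-commutes with every \<open>F\<^sub>j\<close>.\<close>

inductive word :: "nat \<Rightarrow> 'v \<Rightarrow> bool" where
  "word 0 u"
| "i \<in> {1..<n} \<Longrightarrow> word r x \<Longrightarrow> word (Suc r) (Fop M i x)"

section \<open>Separating the highest weight from the lower ones\<close>

primrec KK :: "nat \<Rightarrow> 'v \<Rightarrow> 'v" where
  "KK 0 x = x"
| "KK (Suc m) x = (if m \<in> {1..<n} then (Kop M m ^^ (m * (n - m))) (KK m x) else KK m x)"

text \<open>The numbers \<open>i * (n - i)\<close> are the coefficients of the sum of all positive
  coroots in terms of the simple ones, and this sum pairs to 2 with every simple root. The partial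
  sums are there for an induction on \<open>m\<close>.\<close>

definition kexp :: "nat \<Rightarrow> nat \<Rightarrow> int" where
  "kexp m j = (\<Sum>i\<in>{1..<m}. int (i * (n - i)) * cartan i j)"

lemma kexp_Suc: "kexp (Suc m) j = kexp m j + (if m = 0 then 0 else int (m * (n - m)) * cartan m j)"
  by (auto simp: kexp_def)

lemma kexp_value:
  assumes "j \<in> {1..<n}" "m \<le> n"
  shows "kexp m j = (if m < j then 0 else if m = j then - (int j - 1) * (int n - int j + 1)
     else if m = Suc j then 2 * int j * (int n - int j) - (int j - 1) * (int n - int j + 1) else 2)"
  using assms(2)
proof (induction m)
  case 0 then show ?case using assms by (simp add: kexp_def)
next
  case (Suc m)
  have m: "int (m * (n - m)) = int m * (int n - int m)" using Suc.prems by (simp add: of_nat_diff)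
  have IH: "kexp m j = (if m < j then 0 else if m = j then - (int j - 1) * (int n - int j + 1)
     else if m = Suc j then 2 * int j * (int n - int j) - (int j - 1) * (int n - int j + 1) else 2)" using Suc by simp
  consider "Suc m < j" | "Suc m = j" | "m = j" | "m = Suc j" | "m > Suc j" by linarith
  then show ?case
    by cases (use assms(1) IH m in \<open>auto simp: kexp_Suc cartan_def algebra_simps\<close>)
qed

lemma kexp_n: "j \<in> {1..<n} \<Longrightarrow> kexp n j = 2"
  using kexp_value[of j n] by (auto simp: algebra_simps)

lemma Kpow:
  assumes i: "i \<in> {1..<n}"
  shows "(Kop M i ^^ c) (x + y) = (Kop M i ^^ c) x + (Kop M i ^^ c) y" "(Kop M i ^^ c) (sc d x) = sc d ((Kop M i ^^ c) x)"
    "j \<in> {1..<n} \<Longrightarrow> (Kop M i ^^ c) (Fop M j x) = sc (qv powi (- int c * cartan i j)) (Fop M j ((Kop M i ^^ c) x))"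
    "(Kop M i ^^ c) u = sc ((qv ^ (2 * fundamental_weight k i)) ^ c) u"
proof (induction c)
  case (Suc c)
  {
    case 1 then show ?case using Suc by (simp add: K_simps[OF i])
  next
    case 2 then show ?case using Suc by (simp add: K_simps[OF i])
  next
    case 3
    have "qv powi (- int c * cartan i j) * qv powi (- cartan i j) = qv powi (- int (Suc c) * cartan i j)"
      by (simp add: power_int_add[symmetric] algebra_simps)
    then show ?case using Suc(3)[OF 3] by (simp add: K_simps[OF i] KF[OF i 3])
  next
    case 4 then show ?case using Suc by (simp add: K_simps[OF i] Ku[OF i] mult.commute)
  }
qed simp_all

lemma KK_lin: "m \<le> n \<Longrightarrow> KK m (x + y) = KK m x + KK m y" "m \<le> n \<Longrightarrow> KK m (sc d x) = sc d (KK m x)"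
  by (induction m) (simp_all add: Kpow)

lemma KK_F: "m \<le> n \<Longrightarrow> j \<in> {1..<n} \<Longrightarrow> KK m (Fop M j x) = sc (qv powi (- kexp m j)) (Fop M j (KK m x))"
proof (induction m)
  case 0 then show ?case by (simp add: kexp_def)
next
  case (Suc m)
  have *: "qv powi (- kexp m j) * qv powi (- int (m * (n - m)) * cartan m j) = qv powi (- kexp (Suc m) j)" if "m \<noteq> 0"
    using that by (simp add: power_int_add[symmetric] kexp_Suc algebra_simps)
  show ?case
  proof (cases "m = 0")
    case True then show ?thesis using Suc by (simp add: kexp_Suc)
  next
    case False
    then have m: "m \<in> {1..<n}" using Suc.prems by simp
    show ?thesis using Suc m *[OF False] by (simp add: Kpow[OF m])
  qed
qed

lemma KK_u: "m \<le> n \<Longrightarrow> \<exists>c. c \<noteq> 0 \<and> KK m u = sc c u"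
proof (induction m)
  case 0 show ?case by (rule exI[of _ 1]) simp
next
  case (Suc m)
  then obtain c where c: "c \<noteq> 0" "KK m u = sc c u" by auto
  show ?case
  proof (cases "m \<in> {1..<n}")
    case True
    then show ?thesis using c
      by (intro exI[of _ "c * (qv ^ (2 * fundamental_weight k m)) ^ (m * (n - m))"]) (simp add: Kpow[OF True])
  next
    case False then show ?thesis using c by auto
  qed
qed

definition lam :: Qq where "lam = (SOME c. c \<noteq> 0 \<and> KK n u = sc c u)"

lemma lam: "lam \<noteq> 0" "KK n u = sc lam u"
  using someI_ex[OF KK_u[OF order_refl]] unfolding lam_def by auto

definition eig :: "nat \<Rightarrow> Qq" where "eig r = lam * inverse qv ^ (2 * r)"

lemma eig_inj: "eig 0 \<noteq> eig (Suc s)"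
proof
  assume "eig 0 = eig (Suc s)"
  then have "inverse (qv ^ (2 * Suc s)) = 1" using lam by (simp add: eig_def power_inverse)
  then have "qv ^ (2 * Suc s) = 1" by (metis inverse_1 inverse_inverse_eq)
  then show False using qv_power_neq_1[of "2 * Suc s"] by simp
qed

lemma word_eigen: "word r x \<Longrightarrow> KK n x = sc (eig r) x"
proof (induction rule: word.induct)
  case 1 then show ?case using lam by (simp add: eig_def)
next
  case (2 i r x)
  have "qv powi (- 2) = inverse qv ^ 2" by (simp add: power_int_def)
  then show ?case using 2 by (simp add: KK_F kexp_n F_simps[OF 2(1)] eig_def mult.commute mult.left_commute power_add power2_eq_square mult.assoc)
qed

text \<open>The product of the operators \<open>KK n - eig s\<close> over
  \<open>s = 1, \<dots>, N\<close>. It kills all words of lengths 1 to \<open>N\<close> and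
  multiplies \<open>u\<close> by a nonzero scalar; \<open>N\<close> is chosen according to the
  vector that has to be killed.\<close>

primrec PP :: "nat \<Rightarrow> 'v \<Rightarrow> 'v" where
  "PP 0 x = x"
| "PP (Suc N) x = KK n (PP N x) - sc (eig (Suc N)) (PP N x)"

lemma PP_lin: "PP N (x + y) = PP N x + PP N y" "PP N (sc c x) = sc c (PP N x)"
  by (induction N) (simp_all add: KK_lin algebra_simps)

lemma PP_eigen: "KK n x = sc e x \<Longrightarrow> PP N x = sc (\<Prod>s\<in>{1..N}. e - eig s) x"
proof (induction N)
  case (Suc N)
  have "PP (Suc N) x = sc (e * (\<Prod>s\<in>{1..N}. e - eig s) - eig (Suc N) * (\<Prod>s\<in>{1..N}. e - eig s)) x"
    using Suc by (simp add: KK_lin scale_left_diff_distrib mult.commute)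
  also have "e * (\<Prod>s\<in>{1..N}. e - eig s) - eig (Suc N) * (\<Prod>s\<in>{1..N}. e - eig s) = (\<Prod>s\<in>{1..Suc N}. e - eig s)"
    by (simp add: algebra_simps)
  finally show ?case .
qed simp

definition low :: "'v set" where "low = span {x. \<exists>r. word (Suc r) x}"

lemma low_killed: "x \<in> low \<Longrightarrow> \<exists>N0. \<forall>N\<ge>N0. PP N x = 0"
  unfolding low_def
proof (induction rule: span_induct_alt)
  case base
  have "PP N 0 = 0" for N using PP_lin(2)[of N 0 0] by simp
  then show ?case by blast
next
  case (step c x y)
  then obtain N0 r where N0: "\<forall>N\<ge>N0. PP N y = 0" and r: "word (Suc r) x" by blast
  have "PP N x = 0" if "N \<ge> Suc r" for N
  proof -
    have "(\<Prod>s\<in>{1..N}. eig (Suc r) - eig s) = 0" using that by (intro prod_zero) auto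
    then show ?thesis using PP_eigen[OF word_eigen[OF r], of N] by simp
  qed
  then have "\<forall>N\<ge>max N0 (Suc r). PP N (sc c x + y) = 0" using N0 by (simp add: PP_lin)
  then show ?case by blast
qed

lemma u_notin_low: "u \<notin> low"
proof
  assume "u \<in> low"
  then obtain N where "PP N u = 0" using low_killed by blast
  moreover have "KK n u = sc (eig 0) u" using word_eigen[OF word.intros(1)] .
  ultimately have "(\<Prod>s\<in>{1..N}. eig 0 - eig s) = 0" using PP_eigen[of u "eig 0" N] unz by simp
  then obtain s where "s \<in> {1..N}" "eig 0 = eig s" by (auto simp: prod_zero_iff)
  then show False using eig_inj[of "s - 1"] by simp
qed

lemma F_low: "x \<in> span {x. \<exists>r. word r x} \<Longrightarrow> i \<in> {1..<n} \<Longrightarrow> Fop M i x \<in> low"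
  unfolding low_def
proof (induction rule: span_induct_alt)
  case base then show ?case by (simp add: F_simps span_zero)
next
  case (step c x y)
  then obtain r where "word r x" by blast
  then have "word (Suc r) (Fop M i x)" using word.intros(2) step by blast
  then have "Fop M i x \<in> span {x. \<exists>r. word (Suc r) x}" by (intro span_base) blast
  then show ?case using step by (simp add: F_simps span_add span_scale)
qed

lemma low_words: "low \<subseteq> span {x. \<exists>r. word r x}"
  unfolding low_def by (rule span_mono) blast

text \<open>No move \<open>F\<^sub>i\<close> ends in the configuration \<open>{1..k}\<close>, so the
  coefficient there records the multiple of \<open>u\<close> in \<open>x\<close>. A pair of
  \<open>u\<close> with 0 would put \<open>u\<close> into \<open>low\<close>.\<close>

lemma model_graph_top:
  "(x, y) \<in> model_graph \<Longrightarrow> x - sc (y {1..k} {1..k}) u \<in> low \<and> x \<in> span {x. \<exists>r. word r x}"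
proof (induction rule: model_graph.induct)
  case base
  have "bvec qv n (top_web k) {1..k} {1..k} = 1"
    using bvec_lead[OF web_top, of k n qv] kn by (simp add: lead_up_def lead_down_def top_web_def)
  moreover have "u \<in> span {x. \<exists>r. word r x}" by (rule span_base) (use word.intros(1) in blast)
  ultimately show ?case by (simp add: low_def span_zero)
next
  case (add x y x' y')
  have "x + x' - sc (y {1..k} {1..k} + y' {1..k} {1..k}) u = (x - sc (y {1..k} {1..k}) u) + (x' - sc (y' {1..k} {1..k}) u)"
    by (simp add: scale_left_distrib)
  then have "x + x' - sc (y {1..k} {1..k} + y' {1..k} {1..k}) u \<in> low"
    using add unfolding low_def by (metis span_add)
  moreover have "x + x' \<in> span {x. \<exists>r. word r x}" using add by (blast intro: span_add)
  ultimately show ?case ..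
next
  case (scale x y c)
  have "sc c x - sc (c * y {1..k} {1..k}) u = sc c (x - sc (y {1..k} {1..k}) u)"
    by (simp add: scale_right_diff_distrib)
  then show ?case using scale by (simp add: low_def span_scale)
next
  case (lower i x y)
  have "TF qv i y {1..k} {1..k} = 0" using lower(1) by (simp add: mvop_def)
  moreover have "Fop M i x \<in> low" using F_low lower by blast
  ultimately show ?case using low_words by auto
qed

lemma model_graph_kernel: "(x, \<lambda>I J. 0) \<in> model_graph \<Longrightarrow> x = 0"
proof -
  assume x: "(x, \<lambda>I J. 0) \<in> model_graph"
  have "u \<notin> {x. (x, \<lambda>I J. 0) \<in> model_graph}" using model_graph_top[of u "\<lambda>I J. 0"] u_notin_low by auto
  then have "{x. (x, \<lambda>I J. 0) \<in> model_graph} = {0}" using simple[OF model_graph_kernel_submodule] by blast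
  then show "x = 0" using x by blast
qed

lemma model_graph_unique: "(x, y) \<in> model_graph \<Longrightarrow> (x', y) \<in> model_graph \<Longrightarrow> x = x'"
  using model_graph_diff[of x y x' y] model_graph_kernel[of "x - x'"] by simp

section \<open>Webs as a basis of the module\<close>

definition bm :: "web \<Rightarrow> 'v" where
  "bm \<omega> = (THE x. (x, bvec qv n \<omega>) \<in> model_graph)"

lemma bm_eqI: "(x, bvec qv n \<omega>) \<in> model_graph \<Longrightarrow> bm \<omega> = x"
  unfolding bm_def using model_graph_unique by blast

lemma TF_bvec: "is_web n k \<omega> \<Longrightarrow> i \<in> {1..<n} \<Longrightarrow> TF qv i (bvec qv n \<omega>) = (\<lambda>I J. coef qtwo (kind i (Suc i) \<omega>) * bvec qv n (step i (Suc i) \<omega>) I J)"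
  and TE_bvec: "is_web n k \<omega> \<Longrightarrow> i \<in> {1..<n} \<Longrightarrow> TE qv i (bvec qv n \<omega>) = (\<lambda>I J. coef qtwo (kind (Suc i) i \<omega>) * bvec qv n (step (Suc i) i \<omega>) I J)"
  unfolding qtwo_def by (rule mvop_bvec; simp add: adjacent_def)+

lemma qtwo_cancel: "inverse qtwo * (qtwo * x) = x"
  by (simp add: mult.assoc[symmetric])

lemma bm_gr: "is_web n k \<omega> \<Longrightarrow> (bm \<omega>, bvec qv n \<omega>) \<in> model_graph"
proof -
  assume "is_web n k \<omega>"
  then have "\<exists>x. (x, bvec qv n \<omega>) \<in> model_graph"
  proof (induction rule: web_induct)
    case top show ?case using model_graph.base by blast
  next
    case (step i \<omega>)
    then obtain x where "(x, bvec qv n \<omega>) \<in> model_graph" by blast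
    from model_graph.lower[OF step(1) this] show ?case
      unfolding TF_bvec[OF step(2,1)] step(3) by (auto simp: coef_def)
  next
    case (double i \<omega> \<omega>1)
    then obtain x where "(x, bvec qv n \<omega>1) \<in> model_graph" by blast
    from model_graph.scale[OF model_graph.lower[OF double(1) this], of "inverse qtwo"] show ?case
      unfolding TF_bvec[OF double(6,1)] double(7) by (auto simp: coef_def qtwo_cancel)
  qed
  then show ?thesis using bm_eqI by metis
qed

lemma bm_top: "bm (top_web k) = u"
  by (rule bm_eqI[OF model_graph.base])

lemma F_bm: "is_web n k \<omega> \<Longrightarrow> i \<in> {1..<n} \<Longrightarrow> Fop M i (bm \<omega>) = sc (coef qtwo (kind i (Suc i) \<omega>)) (bm (step i (Suc i) \<omega>))"
proof -
  assume w: "is_web n k \<omega>" and i: "i \<in> {1..<n}"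
  have g: "(Fop M i (bm \<omega>), \<lambda>I J. coef qtwo (kind i (Suc i) \<omega>) * bvec qv n (step i (Suc i) \<omega>) I J) \<in> model_graph"
    using model_graph.lower[OF i bm_gr[OF w]] unfolding TF_bvec[OF w i] .
  show ?thesis
  proof (cases "kind i (Suc i) \<omega> = 0")
    case True then show ?thesis using g model_graph_kernel by (simp add: coef_def)
  next
    case False
    then have "is_web n k (step i (Suc i) \<omega>)" using web_step[OF w, of i "Suc i"] i by (simp add: adjacent_def)
    from model_graph.scale[OF bm_gr[OF this]] show ?thesis using model_graph_unique[OF g] by blast
  qed
qed

lemma E_bm: "is_web n k \<omega> \<Longrightarrow> i \<in> {1..<n} \<Longrightarrow> Eop M i (bm \<omega>) = sc (coef qtwo (kind (Suc i) i \<omega>)) (bm (step (Suc i) i \<omega>))"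
proof -
  assume w: "is_web n k \<omega>" and i: "i \<in> {1..<n}"
  have g: "(Eop M i (bm \<omega>), \<lambda>I J. coef qtwo (kind (Suc i) i \<omega>) * bvec qv n (step (Suc i) i \<omega>) I J) \<in> model_graph"
    using model_graph_E[OF bm_gr[OF w] i] unfolding TE_bvec[OF w i] .
  show ?thesis
  proof (cases "kind (Suc i) i \<omega> = 0")
    case True then show ?thesis using g model_graph_kernel by (simp add: coef_def)
  next
    case False
    then have "is_web n k (step (Suc i) i \<omega>)" using web_step[OF w, of "Suc i" i] i by (simp add: adjacent_def)
    from model_graph.scale[OF bm_gr[OF this]] show ?thesis using model_graph_unique[OF g] by blast
  qed
qed

text \<open>The vectors occurring in the graph form a submodule containing \<open>u\<close>, so they
  are all of \<open>M\<close>. They lie in the span of the webs because the operators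
  \<open>F\<^sub>i\<close> preserve this span.\<close>

lemma bm_spans: "span (bm ` webs) = UNIV"
proof -
  have sp: "x \<in> span (bm ` webs)" if "(x, y) \<in> model_graph" for x y
    using that
  proof (induction rule: model_graph.induct)
    case base
    have "bm (top_web k) \<in> span (bm ` webs)" by (rule span_base) (use web_top kn in auto)
    then show ?case by (simp only: bm_top)
  next
    case (lower i x y)
    from lower(3) show ?case
    proof (induction rule: span_induct_alt)
      case base then show ?case by (simp add: F_simps[OF lower(1)] span_zero)
    next
      case (step c z x)
      then obtain \<omega> where w: "is_web n k \<omega>" "z = bm \<omega>" by blast
      have "Fop M i z \<in> span (bm ` webs)"
      proof (cases "kind i (Suc i) \<omega> = 0")
        case True then show ?thesis using F_bm[OF w(1) lower(1)] by (simp add: w coef_def span_zero)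
      next
        case False
        then have "is_web n k (step i (Suc i) \<omega>)" using web_step[OF w(1), of i "Suc i"] lower(1) by (simp add: adjacent_def)
        then show ?thesis using F_bm[OF w(1) lower(1)] by (auto simp: w intro: span_scale span_base)
      qed
      then show ?case using step by (simp add: F_simps[OF lower(1)] span_add span_scale)
    qed
  qed (auto intro: span_add span_scale)
  have "Uq_submodule n M {x. \<exists>y. (x, y) \<in> model_graph}"
    unfolding Uq_submodule_def
  proof (intro conjI subspaceI ballI)
    show "0 \<in> {x. \<exists>y. (x, y) \<in> model_graph}" using model_graph_zero by blast
    fix x x' assume "x \<in> {x. \<exists>y. (x, y) \<in> model_graph}" "x' \<in> {x. \<exists>y. (x, y) \<in> model_graph}"
    then show "x + x' \<in> {x. \<exists>y. (x, y) \<in> model_graph}" using model_graph.add by blast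
  next
    fix c x assume "x \<in> {x. \<exists>y. (x, y) \<in> model_graph}"
    then show "sc c x \<in> {x. \<exists>y. (x, y) \<in> model_graph}" using model_graph.scale by blast
  next
    fix i x assume i: "i \<in> {1..<n}" and "x \<in> {x. \<exists>y. (x, y) \<in> model_graph}"
    then obtain y where y: "(x, y) \<in> model_graph" by blast
    show "Eop M i x \<in> {x. \<exists>y. (x, y) \<in> model_graph}" using model_graph_E[OF y i] by blast
    show "Fop M i x \<in> {x. \<exists>y. (x, y) \<in> model_graph}" using model_graph.lower[OF i y] by blast
    show "Kop M i x \<in> {x. \<exists>y. (x, y) \<in> model_graph}" "Kinv M i x \<in> {x. \<exists>y. (x, y) \<in> model_graph}" using model_graph_K[OF y i] by blast+
  qed
  moreover have "u \<in> {x. \<exists>y. (x, y) \<in> model_graph}" using model_graph.base by blast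
  ultimately have "{x. \<exists>y. (x, y) \<in> model_graph} = UNIV" using simple unz by blast
  then show ?thesis using sp by blast
qed

lemma finite_W: "finite webs" by (rule finite_webs)

lemma ex_coords: "\<exists>c. x = (\<Sum>\<omega>\<in>webs. sc (c \<omega>) (bm \<omega>))"
proof -
  have "x \<in> span (bm ` webs)" using bm_spans by simp
  then show ?thesis
  proof (induction rule: span_induct_alt)
    case base
    show ?case by (rule exI[of _ "\<lambda>_. 0"]) simp
  next
    case (step c x y)
    then obtain d \<mu> where y: "y = (\<Sum>\<omega>\<in>webs. sc (d \<omega>) (bm \<omega>))" and m: "\<mu> \<in> webs" "x = bm \<mu>" by blast
    have "sc c x = (\<Sum>\<omega>\<in>webs. sc (if \<omega> = \<mu> then c else 0) (bm \<omega>))"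
      using m finite_W by (simp add: if_distrib[of "\<lambda>t. sc t _"] sum.delta cong: if_cong)
    then have "sc c x + y = (\<Sum>\<omega>\<in>webs. sc ((if \<omega> = \<mu> then c else 0) + d \<omega>) (bm \<omega>))"
      by (simp only: y scale_left_distrib sum.distrib)
    then show ?case by (rule exI[of _ "\<lambda>\<omega>. (if \<omega> = \<mu> then c else 0) + d \<omega>"])
  qed
qed

lemma E_sum_bm:
  assumes i: "i \<in> {1..<n}"
  shows "Eop M i (\<Sum>\<omega>\<in>webs. sc (c \<omega>) (bm \<omega>)) = (\<Sum>\<omega>\<in>webs. sc (lift_step qtwo n k (Suc i) i c \<omega>) (bm \<omega>))"
proof -
  have "Eop M i (\<Sum>\<omega>\<in>webs. sc (c \<omega>) (bm \<omega>)) = (\<Sum>\<omega>\<in>webs. sc (coef qtwo (kind (Suc i) i \<omega>) * c \<omega>) (bm (step (Suc i) i \<omega>)))"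
    unfolding E_simps(4)[OF i] by (rule sum.cong[OF refl]) (simp add: E_simps[OF i] E_bm[OF _ i] mult.commute)
  also have "\<dots> = (\<Sum>\<omega>\<in>webs. sc (lift_step qtwo n k (Suc i) i c \<omega>) (bm \<omega>))"
    by (rule lift_step_sum[symmetric]) (use i in \<open>auto simp: adjacent_def scale_left_distrib\<close>)
  finally show ?thesis .
qed

lemma F_sum_bm:
  assumes i: "i \<in> {1..<n}"
  shows "Fop M i (\<Sum>\<omega>\<in>webs. sc (c \<omega>) (bm \<omega>)) = (\<Sum>\<omega>\<in>webs. sc (lift_step qtwo n k i (Suc i) c \<omega>) (bm \<omega>))"
proof -
  have "Fop M i (\<Sum>\<omega>\<in>webs. sc (c \<omega>) (bm \<omega>)) = (\<Sum>\<omega>\<in>webs. sc (coef qtwo (kind i (Suc i) \<omega>) * c \<omega>) (bm (step i (Suc i) \<omega>)))"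
    unfolding F_simps(4)[OF i] by (rule sum.cong[OF refl]) (simp add: F_simps[OF i] F_bm[OF _ i] mult.commute)
  also have "\<dots> = (\<Sum>\<omega>\<in>webs. sc (lift_step qtwo n k i (Suc i) c \<omega>) (bm \<omega>))"
    by (rule lift_step_sum[symmetric]) (use i in \<open>auto simp: adjacent_def scale_left_distrib\<close>)
  finally show ?thesis .
qed

text \<open>The coefficient functions of relations are stable under raising, so a nontrivial
  relation would produce one that involves only the top web, that is \<open>u = 0\<close>.\<close>

lemma bm_independent:
  assumes z: "(\<Sum>\<omega>\<in>webs. sc (c \<omega>) (bm \<omega>)) = 0" and w: "is_web n k \<omega>"
  shows "c \<omega> = 0"
proof (rule ccontr)
  assume nz: "c \<omega> \<noteq> 0"
  define N where "N = {c. (\<Sum>\<omega>\<in>webs. sc (c \<omega>) (bm \<omega>)) = 0}"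
  have stable: "lift_step qtwo n k (Suc i) i c \<in> N" if "c \<in> N" "i \<in> {1..<n}" for c i
    using that E_sum_bm[OF that(2), of c] E_simps(3)[OF that(2)] unfolding N_def by simp
  have prim: "c \<omega> = 0" if "\<And>i \<omega>. i \<in> {1..<n} \<Longrightarrow> is_web n k \<omega> \<Longrightarrow> lift_step qtwo n k (Suc i) i c \<omega> = 0" "is_web n k \<omega>" "\<omega> \<noteq> top_web k" for c \<omega>
    using primitive_multiple_of_top[of qv n k c \<omega>] that qtwo_nz unfolding qtwo_def by simp
  have c: "c \<in> N" using z by (simp add: N_def)
  have "\<exists>c'. c' \<in> N \<and> c' (top_web k) \<noteq> 0 \<and> (\<forall>\<omega>. is_web n k \<omega> \<longrightarrow> \<omega> \<noteq> top_web k \<longrightarrow> c' \<omega> = 0)"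
  proof (rule raising_stable_top[where N = N and n = n and d = qtwo and k = k and c = c and \<omega> = \<omega>])
    show "lift_step qtwo n k (Suc i) i c \<in> N" if "c \<in> N" "i \<in> {1..<n}" for c i by (rule stable[OF that])
    show "c \<omega> = 0" if "\<And>i \<omega>. i \<in> {1..<n} \<Longrightarrow> is_web n k \<omega> \<Longrightarrow> lift_step qtwo n k (Suc i) i c \<omega> = 0"
      "is_web n k \<omega>" "\<omega> \<noteq> top_web k" for c \<omega> by (rule prim[OF that(1) that(2,3)])
  qed (use c w nz in blast)+
  then obtain c' where c': "c' \<in> N" "c' (top_web k) \<noteq> 0" "\<And>\<omega>. is_web n k \<omega> \<Longrightarrow> \<omega> \<noteq> top_web k \<Longrightarrow> c' \<omega> = 0"
    by blast
  have "(\<Sum>\<omega>\<in>webs. sc (c' \<omega>) (bm \<omega>)) = sc (c' (top_web k)) (bm (top_web k)) + (\<Sum>\<omega>\<in>webs - {top_web k}. sc (c' \<omega>) (bm \<omega>))"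
    by (rule sum.remove[OF finite_W]) (use web_top kn in auto)
  also have "(\<Sum>\<omega>\<in>webs - {top_web k}. sc (c' \<omega>) (bm \<omega>)) = 0" by (rule sum.neutral) (use c'(3) in auto)
  finally show False using c'(1,2) unz by (simp add: N_def bm_top)
qed

section \<open>Coordinates, divided powers and the integral form\<close>

definition crd :: "'v \<Rightarrow> web \<Rightarrow> Qq" where
  "crd x = (SOME c. x = (\<Sum>\<omega>\<in>webs. sc (c \<omega>) (bm \<omega>)))"

lemma crd: "x = (\<Sum>\<omega>\<in>webs. sc (crd x \<omega>) (bm \<omega>))"
  unfolding crd_def by (rule someI_ex[OF ex_coords])

lemma crd_eqI:
  assumes "x = (\<Sum>\<omega>\<in>webs. sc (c \<omega>) (bm \<omega>))" "is_web n k \<omega>"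
  shows "crd x \<omega> = c \<omega>"
proof -
  have "(\<Sum>\<omega>\<in>webs. sc (crd x \<omega> - c \<omega>) (bm \<omega>)) = 0"
    using crd[of x] assms(1) by (simp add: scale_left_diff_distrib sum_subtractf)
  from bm_independent[OF this assms(2)] show ?thesis by simp
qed

lemma crd_add: "is_web n k \<omega> \<Longrightarrow> crd (x + y) \<omega> = crd x \<omega> + crd y \<omega>"
proof (rule crd_eqI)
  show "x + y = (\<Sum>\<omega>\<in>webs. sc (crd x \<omega> + crd y \<omega>) (bm \<omega>))"
    using crd[of x] crd[of y] by (simp add: scale_left_distrib sum.distrib)
qed

lemma crd_scale: "is_web n k \<omega> \<Longrightarrow> crd (sc a x) \<omega> = a * crd x \<omega>"
proof (rule crd_eqI)
  have "sc a x = sc a (\<Sum>\<omega>\<in>webs. sc (crd x \<omega>) (bm \<omega>))" using crd[of x] by simp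
  then show "sc a x = (\<Sum>\<omega>\<in>webs. sc (a * crd x \<omega>) (bm \<omega>))"
    by (simp add: scale_sum_right)
qed

lemma crd_bm: "is_web n k \<omega> \<Longrightarrow> is_web n k \<mu> \<Longrightarrow> crd (bm \<mu>) \<omega> = (if \<omega> = \<mu> then 1 else 0)"
proof (rule crd_eqI)
  assume "is_web n k \<mu>"
  then show "bm \<mu> = (\<Sum>\<omega>\<in>webs. sc (if \<omega> = \<mu> then 1 else 0) (bm \<omega>))"
    using finite_W by (simp add: if_distrib[of "\<lambda>t. sc t _"] sum.delta cong: if_cong)
qed

lemma crd_0: "is_web n k \<omega> \<Longrightarrow> crd 0 \<omega> = 0"
  using crd_scale[of \<omega> 0 0] by simp

lemma crd_sum: "is_web n k \<omega> \<Longrightarrow> crd (sum f A) \<omega> = (\<Sum>x\<in>A. crd (f x) \<omega>)"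
  by (induction A rule: infinite_finite_induct) (simp_all add: crd_0 crd_add)

lemma crd_diff: "is_web n k \<omega> \<Longrightarrow> crd (x - y) \<omega> = crd x \<omega> - crd y \<omega>"
  using crd_add[of \<omega> "x - y" y] by simp

lemma eq_crdI:
  assumes "\<And>\<omega>. is_web n k \<omega> \<Longrightarrow> crd x \<omega> = crd y \<omega>"
  shows "x = y"
proof -
  have "x = (\<Sum>\<omega>\<in>webs. sc (crd x \<omega>) (bm \<omega>))" by (rule crd)
  also have "\<dots> = (\<Sum>\<omega>\<in>webs. sc (crd y \<omega>) (bm \<omega>))" by (rule sum.cong) (use assms in auto)
  also have "\<dots> = y" by (rule crd[symmetric])
  finally show ?thesis .
qed

lemma Fpow_lin: "i \<in> {1..<n} \<Longrightarrow> (Fop M i ^^ m) (sum f A) = (\<Sum>x\<in>A. (Fop M i ^^ m) (f x))"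
    "i \<in> {1..<n} \<Longrightarrow> (Fop M i ^^ m) (sc c x) = sc c ((Fop M i ^^ m) x)"
  by (induction m) (simp_all add: F_simps)

lemma F2_bm:
  assumes w: "is_web n k (D, p)" and i: "i \<in> {1..<n}"
  shows "Fop M i (Fop M i (bm (D, p))) =
    (if kind i (Suc i) (D, p) \<noteq> 0 \<and> kind i (Suc i) (step i (Suc i) (D, p)) \<noteq> 0
     then sc qtwo (bm (step i (Suc i) (step i (Suc i) (D, p)))) else 0)"
proof (cases "kind i (Suc i) (D, p) = 0")
  case True then show ?thesis using F_bm[OF w i] F_simps(3)[OF i] by (simp add: coef_def)
next
  case False
  then have w': "is_web n k (step i (Suc i) (D, p))" using web_step[OF w, of i "Suc i"] i by (simp add: adjacent_def)
  show ?thesis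
  proof (cases "kind i (Suc i) (step i (Suc i) (D, p)) = 0")
    case True then show ?thesis using F_bm[OF w i] F_bm[OF w' i] by (simp add: F_simps[OF i] coef_def)
  next
    case F2: False
    have "kind i (Suc i) (D, p) = 1" "kind i (Suc i) (step i (Suc i) (D, p)) = 2"
      using step_twice_cup[OF w _ False F2] by auto
    then show ?thesis using F_bm[OF w i] F_bm[OF w' i] by (simp add: F_simps[OF i] coef_def)
  qed
qed

lemma F3: "i \<in> {1..<n} \<Longrightarrow> Fop M i (Fop M i (Fop M i x)) = 0"
proof -
  assume i: "i \<in> {1..<n}"
  have b: "Fop M i (Fop M i (Fop M i (bm \<omega>))) = 0" if w: "is_web n k \<omega>" for \<omega>
  proof -
    obtain D p where \<omega>: "\<omega> = (D, p)" by fastforce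
    let ?s = "step i (Suc i)"
    show ?thesis
    proof (cases "kind i (Suc i) (D, p) \<noteq> 0 \<and> kind i (Suc i) (?s (D, p)) \<noteq> 0")
      case False
      show ?thesis unfolding \<omega> F2_bm[OF w[unfolded \<omega>] i] if_not_P[OF False] by (rule F_simps(3)[OF i])
    next
      case True
      note c = step_twice_cup[OF w[unfolded \<omega>] _ True[THEN conjunct1] True[THEN conjunct2]]
      have w1: "is_web n k (?s (D, p))" using web_step[OF w[unfolded \<omega>], of i "Suc i"] i True by (simp add: adjacent_def)
      have w2: "is_web n k (?s (?s (D, p)))" using web_step[OF w1, of i "Suc i"] i True by (simp add: adjacent_def)
      have "kind i (Suc i) (?s (?s (D, p))) = 0" using c by (simp add: kind_def)
      then have "Fop M i (bm (?s (?s (D, p)))) = 0" using F_bm[OF w2 i] by (simp add: coef_def)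
      then show ?thesis using F2_bm[OF w[unfolded \<omega>] i] True by (simp add: \<omega> F_simps[OF i])
    qed
  qed
  have "Fop M i (Fop M i (Fop M i x)) = (\<Sum>\<omega>\<in>webs. sc (crd x \<omega>) (Fop M i (Fop M i (Fop M i (bm \<omega>)))))"
    by (subst crd[of x]) (simp only: F_simps[OF i])
  also have "\<dots> = 0" by (rule sum.neutral) (use b in auto)
  finally show ?thesis .
qed

lemma Fdiv_simps:
  assumes i: "i \<in> {1..<n}"
  shows "Fdiv M i 0 x = x" "Fdiv M i 1 x = Fop M i x" "Fdiv M i 2 x = sc (inverse qtwo) (Fop M i (Fop M i x))"
    "m \<ge> 3 \<Longrightarrow> Fdiv M i m x = 0"
proof -
  show "Fdiv M i 0 x = x" "Fdiv M i 1 x = Fop M i x" by (simp_all add: Fdiv_def qfact_values[simplified])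
  show "Fdiv M i 2 x = sc (inverse qtwo) (Fop M i (Fop M i x))"
    unfolding Fdiv_def qfact_values by (simp add: numeral_2_eq_2)
  assume "m \<ge> 3"
  then obtain l where "m = 3 + l" using le_Suc_ex by blast
  then have m: "m = Suc (Suc (Suc l))" by simp
  have "(Fop M i ^^ m) x = 0" unfolding m using F3[OF i] by simp
  then show "Fdiv M i m x = 0" by (simp add: Fdiv_def)
qed

lemma Fdiv_lin:
  assumes i: "i \<in> {1..<n}"
  shows "Fdiv M i m (sum f A) = (\<Sum>x\<in>A. Fdiv M i m (f x))" "Fdiv M i m (sc c x) = sc c (Fdiv M i m x)"
  unfolding Fdiv_def Fpow_lin[OF i] by (simp_all add: scale_sum_right mult.commute)

lemma Fdiv2_bm:
  assumes w: "is_web n k \<omega>" and i: "i \<in> {1..<n}"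
  shows "Fdiv M i 2 (bm \<omega>) =
    (if kind i (Suc i) \<omega> \<noteq> 0 \<and> kind i (Suc i) (step i (Suc i) \<omega>) \<noteq> 0
     then bm (step i (Suc i) (step i (Suc i) \<omega>)) else 0)"
proof -
  obtain D p where \<omega>: "\<omega> = (D, p)" by fastforce
  show ?thesis unfolding Fdiv_simps(3)[OF i] \<omega> F2_bm[OF w[unfolded \<omega>] i] by simp
qed

lemma Fdiv_bm_laurent:
  assumes w: "is_web n k \<omega>" and i: "i \<in> {1..<n}" and w': "is_web n k \<omega>'"
  shows "crd (Fdiv M i m (bm \<omega>)) \<omega>' \<in> laurent_polys"
proof -
  have ws: "is_web n k (step i (Suc i) \<mu>)" if "is_web n k \<mu>" "kind i (Suc i) \<mu> \<noteq> 0" for \<mu>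
    using web_step[OF that(1), of i "Suc i"] i that by (simp add: adjacent_def)
  consider "m = 0" | "m = 1" | "m = 2" | "m \<ge> 3" by linarith
  then show ?thesis
  proof cases
    case 1 then show ?thesis using Fdiv_simps[OF i] crd_bm[OF w' w] by (simp add: laurent_simps)
  next
    case 2
    show ?thesis
    proof (cases "kind i (Suc i) \<omega> = 0")
      case True then show ?thesis unfolding 2 Fdiv_simps(2)[OF i] F_bm[OF w i] by (simp add: coef_def crd_0[OF w'] laurent_simps)
    next
      case False
      show ?thesis unfolding 2 Fdiv_simps(2)[OF i] F_bm[OF w i] crd_scale[OF w'] crd_bm[OF w' ws[OF w False]]
        by (simp add: coef_def laurent_simps)
    qed
  next
    case 3
    show ?thesis
    proof (cases "kind i (Suc i) \<omega> \<noteq> 0 \<and> kind i (Suc i) (step i (Suc i) \<omega>) \<noteq> 0")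
      case True
      then have "is_web n k (step i (Suc i) (step i (Suc i) \<omega>))" using ws w by blast
      then show ?thesis unfolding 3 Fdiv2_bm[OF w i] using True crd_bm[OF w'] by (simp add: laurent_simps)
    next
      case False
      show ?thesis unfolding 3 Fdiv2_bm[OF w i] if_not_P[OF False] by (simp add: crd_0[OF w'] laurent_simps)
    qed
  next
    case 4 then show ?thesis using Fdiv_simps(4)[OF i] by (simp add: crd_0[OF w'] laurent_simps)
  qed
qed

lemma integral_form_laurent: "x \<in> integral_form n M u \<Longrightarrow> is_web n k \<omega> \<Longrightarrow> crd x \<omega> \<in> laurent_polys"
proof (induction arbitrary: \<omega> rule: integral_form.induct)
  case hw
  then show ?case using crd_bm[of \<omega> "top_web k"] web_top kn by (simp add: bm_top laurent_simps)
next
  case (div_power i x m)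
  have "Fdiv M i m x = (\<Sum>\<mu>\<in>webs. sc (crd x \<mu>) (Fdiv M i m (bm \<mu>)))"
    by (subst crd[of x]) (simp only: Fdiv_lin[OF div_power.hyps(1)])
  then show ?case
    using div_power by (auto simp: crd_sum crd_scale intro!: laurent_sum laurent_mult Fdiv_bm_laurent)
qed (simp_all add: crd_add crd_scale laurent_add laurent_mult)

lemma bm_integral: "is_web n k \<omega> \<Longrightarrow> bm \<omega> \<in> integral_form n M u"
proof (induction rule: web_induct)
  case top show ?case by (simp only: bm_top integral_form.hw)
next
  case (step i \<omega>)
  have "bm (step i (Suc i) \<omega>) = Fdiv M i 1 (bm \<omega>)"
    using F_bm[OF step(2,1)] step(3) by (simp add: Fdiv_simps(2)[OF step(1), simplified] coef_def)
  then show ?case using integral_form.div_power[OF step(1) step(6)] by simp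
next
  case (double i \<omega> \<omega>1)
  have "bm (step i (Suc i) \<omega>1) = Fdiv M i 2 (bm \<omega>)"
    using double(7) unfolding Fdiv2_bm[OF double(2,1)] double(5)[symmetric] using double(3) by simp
  then show ?case using integral_form.div_power[OF double(1) double(9)] by simp
qed

text \<open>In the top coordinate \<open>q - 1\<close> would divide a power of \<open>q\<close>,
  which is false at \<open>q = 1\<close>. This keeps the highest weight vector nonzero under
  specialization.\<close>

lemma u_not_divisible: "u \<notin> sc (qv - 1) ` integral_form n M u"
proof
  assume "u \<in> sc (qv - 1) ` integral_form n M u"
  then obtain x where x: "x \<in> integral_form n M u" "u = sc (qv - 1) x" by blast
  have t: "is_web n k (top_web k)" using web_top kn by simp
  have "1 = crd u (top_web k)" using crd_bm[OF t t] by (simp add: bm_top)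
  also have "\<dots> = (qv - 1) * crd x (top_web k)"
    using arg_cong[OF x(2), of "\<lambda>z. crd z (top_web k)"] unfolding crd_scale[OF t] .
  finally have e: "(qv - 1) * crd x (top_web k) = 1" by simp
  obtain p m where pm: "crd x (top_web k) = Fract p 1 / qv ^ m"
    using integral_form_laurent[OF x(1) t] by (auto simp: laurent_polys_def)
  have q1: "qv - 1 = Fract [:-1, 1:] 1" by (simp add: qv_def One_fract_def one_pCons)
  have "(qv - 1) * Fract p 1 = qv ^ m" using e unfolding pm by (simp add: field_simps)
  then have "Fract ([:-1, 1:] * p) 1 = Fract (monom 1 m) 1"
    unfolding q1 qv_power by (simp del: mult_pCons_left)
  then have "[:-1, 1:] * p = monom 1 m" by (simp add: eq_fract del: mult_pCons_left)
  then have "poly ([:-1, 1:] * p) 1 = poly (monom 1 m) 1" by simp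
  then show False by (simp add: poly_monom)
qed

text \<open>A closed formula for the Kashiwara operator. If \<open>E\<^sub>i c = 0\<close>, then
  \<open>F\<^sub>i\<close> and \<open>F\<^sub>i\<^sup>(\<^sup>2\<^sup>) E\<^sub>i\<close> both send
  \<open>F\<^sub>i c\<close> to \<open>qtwo\<close> times
  \<open>F\<^sub>i\<^sup>(\<^sup>2\<^sup>) c\<close>, and the coefficient
  \<open>1 - inverse qtwo\<close> leaves this vector exactly once; on \<open>c\<close> and on
  \<open>F\<^sub>i\<^sup>(\<^sup>2\<^sup>) c\<close> the correction vanishes.\<close>

definition raise2 :: "nat \<Rightarrow> 'v \<Rightarrow> 'v" where
  "raise2 i x = Fop M i x - sc (1 - inverse qtwo) (Fdiv M i 2 (Eop M i x))"

definition capped :: "nat \<Rightarrow> web \<Rightarrow> bool" where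
  "capped i \<omega> \<longleftrightarrow> snd \<omega> i \<noteq> i \<and> snd \<omega> (Suc i) \<noteq> Suc i"

lemma raise2_lin:
  assumes i: "i \<in> {1..<n}"
  shows "raise2 i (x + y) = raise2 i x + raise2 i y" "raise2 i (sc c x) = sc c (raise2 i x)" "raise2 i (sum f A) = (\<Sum>x\<in>A. raise2 i (f x))"
proof -
  have D: "Fdiv M i 2 (a + b) = Fdiv M i 2 a + Fdiv M i 2 b" for a b
    unfolding Fdiv_simps(3)[OF i] by (simp add: F_simps[OF i] scale_right_distrib)
  show a: "raise2 i (x + y) = raise2 i x + raise2 i y" for x y
    unfolding raise2_def by (simp add: F_simps[OF i] E_simps[OF i] D scale_right_distrib)
  show c: "raise2 i (sc c x) = sc c (raise2 i x)" for x c
    unfolding raise2_def by (simp add: F_simps[OF i] E_simps[OF i] Fdiv_lin[OF i] scale_right_diff_distrib mult.commute)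
  have "raise2 i 0 = 0" using c[of 0 0] by simp
  then show "raise2 i (sum f A) = (\<Sum>x\<in>A. raise2 i (f x))"
    by (induction A rule: infinite_finite_induct) (simp_all add: a)
qed

lemma Fdiv2_E_bm:
  assumes w: "is_web n k \<omega>" and i: "i \<in> {1..<n}"
  shows "Fdiv M i 2 (Eop M i (bm \<omega>)) = (if capped i \<omega> then Fop M i (bm \<omega>) else 0)"
proof -
  obtain D p where \<omega>: "\<omega> = (D, p)" by fastforce
  note w' = w[unfolded \<omega>]
  let ?e = "step (Suc i) i" and ?f = "step i (Suc i)"
  have ab: "adjacent (Suc i) i" "Suc i \<in> {1..n}" "i \<in> {1..n}" "Suc i \<noteq> i" using i by (auto simp: adjacent_def)
  have EE: "Fdiv M i 2 (Eop M i (bm \<omega>)) = sc (coef qtwo (kind (Suc i) i (D, p))) (Fdiv M i 2 (bm (?e (D, p))))"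
    unfolding \<omega> E_bm[OF w' i] Fdiv_lin[OF i] ..
  show ?thesis
  proof (cases "capped i \<omega>")
    case True
    then have s: "p (Suc i) \<noteq> Suc i" "p i \<noteq> i" by (auto simp: capped_def \<omega>)
    note c = step_cap_double[OF w' ab(4) s]
    have "kind (Suc i) i (D, p) \<noteq> 0" using s is_webD(4)[OF w'] by (auto simp: kind_def)
    then have we: "is_web n k (?e (D, p))" using web_step[OF w' ab(2,3,1)] by simp
    have "Fdiv M i 2 (bm (?e (D, p))) = bm (?f (D, p))"
      unfolding Fdiv2_bm[OF we i] using c by simp
    then have "Fdiv M i 2 (Eop M i (bm \<omega>)) = Fop M i (bm \<omega>)" unfolding EE c(1) F_bm[OF w i] by (simp add: \<omega>)
    then show ?thesis using True by simp
  next
    case False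
    then have s: "p (Suc i) = Suc i \<or> p i = i" by (auto simp: capped_def \<omega>)
    have "sc (coef qtwo (kind (Suc i) i (D, p))) (Fdiv M i 2 (bm (?e (D, p)))) = 0"
    proof (cases "kind (Suc i) i (D, p) = 0")
      case True then show ?thesis by (simp add: coef_def)
    next
      case kn: False
      then have we: "is_web n k (?e (D, p))" using web_step[OF w' ab(2,3,1)] by simp
      have nk: "\<not> (kind i (Suc i) (?e (D, p)) \<noteq> 0 \<and> kind i (Suc i) (?f (?e (D, p))) \<noteq> 0)"
        using step_noncap_double[OF w' ab(4) s ab(1-3) kn] by auto
      show ?thesis unfolding Fdiv2_bm[OF we i] if_not_P[OF nk] by simp
    qed
    then show ?thesis unfolding EE if_not_P[OF False] .
  qed
qed

definition tcoef :: "nat \<Rightarrow> web \<Rightarrow> Qq" where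
  "tcoef i \<omega> = (if capped i \<omega> then inverse qtwo * coef qtwo (kind i (Suc i) \<omega>) else coef qtwo (kind i (Suc i) \<omega>))"

lemma raise2_bm:
  assumes w: "is_web n k \<omega>" and i: "i \<in> {1..<n}"
  shows "raise2 i (bm \<omega>) = sc (tcoef i \<omega>) (bm (step i (Suc i) \<omega>))"
  unfolding raise2_def Fdiv2_E_bm[OF w i] F_bm[OF w i] tcoef_def
  by (simp add: scale_left_diff_distrib)

lemma kind_values: "kind a b \<omega> = 0 \<or> kind a b \<omega> = 1 \<or> kind a b \<omega> = 2"
  by (auto simp: kind_def split: prod.splits)

lemma kind_2_capped: "is_web n k \<omega> \<Longrightarrow> kind i (Suc i) \<omega> = 2 \<Longrightarrow> capped i \<omega>"
proof -
  assume w: "is_web n k \<omega>" and k: "kind i (Suc i) \<omega> = 2"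
  obtain D p where \<omega>: "\<omega> = (D, p)" by fastforce
  have "p i = Suc i" using k by (auto simp: \<omega> kind_def split: if_splits)
  moreover from this have "p (Suc i) = i" using is_webD(3)[OF w[unfolded \<omega>]] by metis
  ultimately show ?thesis by (simp add: capped_def \<omega>)
qed

lemma tcoef_cases:
  assumes w: "is_web n k \<omega>" and i: "i \<in> {1..<n}"
  shows "tcoef i \<omega> = 0 \<or> (tcoef i \<omega> = inverse qtwo \<or> tcoef i \<omega> = 1) \<and> is_web n k (step i (Suc i) \<omega>)"
proof (cases "kind i (Suc i) \<omega> = 0")
  case True then show ?thesis by (simp add: tcoef_def coef_def)
next
  case False
  then have "is_web n k (step i (Suc i) \<omega>)" using web_step[OF w, of i "Suc i"] i by (simp add: adjacent_def)
  moreover have "tcoef i \<omega> = inverse qtwo \<or> tcoef i \<omega> = 1"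
    using kind_values[of i "Suc i" \<omega>] False kind_2_capped[OF w] by (auto simp: tcoef_def coef_def)
  ultimately show ?thesis by blast
qed

lemma tcoef_regular: "is_web n k \<omega> \<Longrightarrow> i \<in> {1..<n} \<Longrightarrow> tcoef i \<omega> \<in> regular_at_0"
  using tcoef_cases[of \<omega> i] qreg_regular[OF qreg_inverse_qtwo] regular_simps by auto

lemma raise2_F:
  assumes i: "i \<in> {1..<n}"
  shows "raise2 i (Fop M i x) = Fdiv M i 2 x"
proof -
  have b: "raise2 i (Fop M i (bm \<omega>)) = Fdiv M i 2 (bm \<omega>)" if w: "is_web n k \<omega>" for \<omega>
  proof -
    have e: "Fop M i (Fop M i (bm \<omega>)) = sc qtwo (Fdiv M i 2 (bm \<omega>))" unfolding Fdiv_simps(3)[OF i] by simp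
    show ?thesis
    proof (cases "kind i (Suc i) \<omega> = 0")
      case True
      then have "Fop M i (bm \<omega>) = 0" using F_bm[OF w i] by (simp add: coef_def)
      then show ?thesis using raise2_lin(2)[OF i, of 0 0] e F_simps(3)[OF i] by simp
    next
      case False
      then have w1: "is_web n k (step i (Suc i) \<omega>)" using web_step[OF w, of i "Suc i"] i by (simp add: adjacent_def)
      have l: "raise2 i (Fop M i (bm \<omega>)) = sc (coef qtwo (kind i (Suc i) \<omega>) * tcoef i (step i (Suc i) \<omega>)) (bm (step i (Suc i) (step i (Suc i) \<omega>)))"
        unfolding F_bm[OF w i] raise2_lin[OF i] raise2_bm[OF w1 i] by simp
      show ?thesis
      proof (cases "kind i (Suc i) (step i (Suc i) \<omega>) = 0")
        case True
        then show ?thesis unfolding l Fdiv2_bm[OF w i] by (simp add: tcoef_def coef_def)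
      next
        case F2: False
        obtain D p where \<omega>: "\<omega> = (D, p)" by fastforce
        have "kind i (Suc i) \<omega> = 1" "kind i (Suc i) (step i (Suc i) \<omega>) = 2"
          using step_twice_cup[OF w[unfolded \<omega>] _ False[unfolded \<omega>] F2[unfolded \<omega>]] by (auto simp: \<omega>)
        moreover from this have "capped i (step i (Suc i) \<omega>)" using kind_2_capped[OF w1] by blast
        ultimately show ?thesis unfolding l Fdiv2_bm[OF w i] by (simp add: tcoef_def coef_def)
      qed
    qed
  qed
  have "raise2 i (Fop M i x) = (\<Sum>\<omega>\<in>webs. sc (crd x \<omega>) (raise2 i (Fop M i (bm \<omega>))))"
    by (subst crd[of x]) (simp only: F_simps[OF i] raise2_lin[OF i])
  also have "\<dots> = (\<Sum>\<omega>\<in>webs. sc (crd x \<omega>) (Fdiv M i 2 (bm \<omega>)))"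
    by (rule sum.cong) (use b in auto)
  also have "\<dots> = Fdiv M i 2 x"
    by (subst (2) crd[of x]) (simp only: Fdiv_lin[OF i])
  finally show ?thesis .
qed

lemma raise2_Fdiv:
  assumes i: "i \<in> {1..<n}" and E: "Eop M i c = 0"
  shows "raise2 i (Fdiv M i m c) = Fdiv M i (Suc m) c"
proof -
  have 0: "Fdiv M i 2 0 = 0" using Fdiv_lin(2)[OF i, of 2 0 0] by simp
  consider "m = 0" | "m = 1" | "m = 2" | "m \<ge> 3" by linarith
  then show ?thesis
  proof cases
    case 1 then show ?thesis using Fdiv_simps(1,2)[OF i] E 0 by (simp add: raise2_def)
  next
    case 2 then show ?thesis using Fdiv_simps(2)[OF i] raise2_F[OF i] by (simp add: numeral_2_eq_2)
  next
    case 3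
    have "raise2 i (Fdiv M i 2 c) = sc (inverse qtwo) (raise2 i (Fop M i (Fop M i c)))"
      unfolding Fdiv_simps(3)[OF i] raise2_lin[OF i] ..
    also have "\<dots> = 0" unfolding raise2_F[OF i] Fdiv_simps(3)[OF i] F3[OF i] by simp
    finally show ?thesis using Fdiv_simps(4)[OF i, of "Suc m" c] 3 by simp
  next
    case 4 then show ?thesis using Fdiv_simps(4)[OF i, of m c] Fdiv_simps(4)[OF i, of "Suc m" c] raise2_lin(2)[OF i, of 0 0] by simp
  qed
qed

text \<open>Most webs have a single component: they are killed by \<open>E\<^sub>i\<close>, or arise
  by \<open>F\<^sub>i\<close> or its second divided power from a web that is. Only with arc ends at
  both sites are two components needed.\<close>

lemma kernel_decomposition:
  assumes i: "i \<in> {1..<n}"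
  shows "\<exists>c. (\<forall>m. Eop M i (c m) = 0) \<and> x = (\<Sum>m\<le>2. Fdiv M i m (c m))"
proof -
  have S: "(\<Sum>m\<le>2. Fdiv M i m (c m)) = c 0 + Fop M i (c 1) + Fdiv M i 2 (c 2)" for c
    using Fdiv_simps(1,2)[OF i] by (simp add: numeral_2_eq_2 atMost_Suc algebra_simps)
  have b: "\<exists>c. (\<forall>m. Eop M i (c m) = 0) \<and> bm \<omega> = (\<Sum>m\<le>2. Fdiv M i m (c m))" if w: "is_web n k \<omega>" for \<omega>
  proof -
    obtain D p where \<omega>: "\<omega> = (D, p)" by fastforce
    note w' = w[unfolded \<omega>]
    note W = is_webD[OF w']
    let ?e = "step (Suc i) i" and ?f = "step i (Suc i)"
    have ab: "adjacent (Suc i) i" "Suc i \<in> {1..n}" "i \<in> {1..n}" "Suc i \<noteq> i" "i \<noteq> Suc i" using i by (auto simp: adjacent_def)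
    have mk: ?thesis if "Eop M i c0 = 0" "Eop M i c1 = 0" "Eop M i c2 = 0" "bm \<omega> = c0 + Fop M i c1 + Fdiv M i 2 c2" for c0 c1 c2
      by (rule exI[of _ "(\<lambda>m. 0)(0 := c0, 1 := c1, 2 := c2)"], subst S) (use that in \<open>auto simp: E_simps[OF i]\<close>)
    have z: "Eop M i 0 = 0" "Fop M i 0 = 0" "Fdiv M i 2 0 = 0"
      using E_simps(3)[OF i] F_simps(3)[OF i] Fdiv_lin(2)[OF i, of 2 0 0] by simp_all
    show ?thesis
    proof (cases "kind (Suc i) i (D, p) = 0")
      case True
      then have "Eop M i (bm \<omega>) = 0" using E_bm[OF w i] by (simp add: \<omega> coef_def)
      then show ?thesis using mk[of "bm \<omega>" 0 0] z by simp
    next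
      case False
      have we: "is_web n k (?e (D, p))" using web_step[OF w' ab(2,3,1) False] .
      from False ab(4) W(4,3) show ?thesis
      proof (cases rule: step_cases)
        case relabel
        note s = step_step_relabel[OF relabel(1-4) W(3,4) ab(4)]
        have F: "Fop M i (bm (?e (D, p))) = bm \<omega>" using F_bm[OF we i] s by (simp add: \<omega> coef_def)
        have "kind (Suc i) i (?e (D, p)) = 0"
        proof (rule ccontr)
          assume "kind (Suc i) i (?e (D, p)) \<noteq> 0"
          from step_twice_cup[OF w' ab(4) False this] show False using relabel by blast
        qed
        then have "Eop M i (bm (?e (D, p))) = 0" using E_bm[OF we i] by (simp add: coef_def)
        then show ?thesis using mk[of 0 "bm (?e (D, p))" 0] z F by simp
      next
        case cup
        note s = step_step_cup[OF cup(1,2,4,3) W(3) ab(4)]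
        have we2: "is_web n k (?e (?e (D, p)))" using web_step[OF we ab(2,3,1)] s(3) by simp
        have e2: "?e (?e (D, p)) = (insert i (D - {Suc i}), p)" by (rule s(4))
        have "kind (Suc i) i (?e (?e (D, p))) = 0" unfolding e2 by (simp add: kind_def)
        then have E0: "Eop M i (bm (?e (?e (D, p)))) = 0" using E_bm[OF we2 i] by (simp add: coef_def)
        have "i \<in> insert i (D - {Suc i})" "Suc i \<notin> insert i (D - {Suc i})" by auto
        note s' = step_step_cup[OF this cup(3,4) W(3) ab(5)]
        have ff: "?f (?f (?e (?e (D, p)))) = (D, p)" unfolding e2 s'(4) using cup by auto
        have kk: "kind i (Suc i) (?e (?e (D, p))) \<noteq> 0" unfolding e2 using cup by (simp add: kind_def)
        have kk2: "kind i (Suc i) (?f (?e (?e (D, p)))) \<noteq> 0" unfolding e2 using s'(3) by simp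
        have "Fdiv M i 2 (bm (?e (?e (D, p)))) = bm \<omega>"
          unfolding Fdiv2_bm[OF we2 i] using kk kk2 ff by (simp add: \<omega>)
        then show ?thesis using mk[of 0 0 "bm (?e (?e (D, p)))"] z E0 by simp
      next
        case cap
        \<comment> \<open>\<open>E\<^sub>i F\<^sub>i\<close> multiplies
          \<open>E\<^sub>i (bm \<omega>)\<close> by \<open>qtwo\<close>. So
          \<open>F\<^sub>i c1\<close> has the same image under \<open>E\<^sub>i\<close> as
          \<open>bm \<omega>\<close>, and the difference is killed.\<close>
        define c1 where "c1 = sc (inverse qtwo) (Eop M i (bm \<omega>))"
        have e1: "?e (D, p) = (insert i D, p(p (Suc i) := p i, p i := p (Suc i), Suc i := Suc i, i := i))" by (rule cap(6))
        have "kind (Suc i) i (?e (D, p)) = 0" unfolding e1 by (simp add: kind_def)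
        then have EE: "Eop M i (Eop M i (bm \<omega>)) = 0" using E_bm[OF w i] E_bm[OF we i] by (simp add: \<omega> coef_def E_simps[OF i])
        note c = step_cap_double[OF w' ab(4) cap(1,2)]
        have wf: "is_web n k (?f (?e (D, p)))" using web_step[OF we, of i "Suc i"] i c(2) by (simp add: adjacent_def)
        have Fe: "Fop M i (bm (?e (D, p))) = bm (?f (?e (D, p)))" using F_bm[OF we i] c(2) by (simp add: coef_def)
        have rr: "(p(p (Suc i) := p i, p i := p (Suc i), Suc i := Suc i, i := i)) (Suc i) = Suc i"
          "(p(p (Suc i) := p i, p i := p (Suc i), Suc i := Suc i, i := i)) i = i" by simp_all
        have inv: "\<forall>j. (p(p (Suc i) := p i, p i := p (Suc i), Suc i := Suc i, i := i)) ((p(p (Suc i) := p i, p i := p (Suc i), Suc i := Suc i, i := i)) j) = j"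
          using join_involution(1)[OF W(3) ab(4) cap(1,2)] by blast
        have "i \<in> insert i D" "Suc i \<notin> insert i D" using cap(3) by auto
        note s = step_step_cup[OF this rr(2,1) inv ab(5)]
        have "kind (Suc i) i (?f (?e (D, p))) = 2" "?e (?f (?e (D, p))) = ?e (D, p)" unfolding e1 by (rule s(1), rule s(2))
        then have "Eop M i (Fop M i (bm (?e (D, p)))) = sc qtwo (bm (?e (D, p)))"
          unfolding Fe using E_bm[OF wf i] by (simp add: coef_def)
        then have "Eop M i (Fop M i c1) = Eop M i (bm \<omega>)"
          unfolding c1_def using E_bm[OF w i] by (simp add: \<omega> E_simps[OF i] F_simps[OF i])
        then have "Eop M i (bm \<omega> - Fop M i c1) = 0" by (simp add: E_simps[OF i])
        moreover have "Eop M i c1 = 0" unfolding c1_def by (simp add: E_simps[OF i] EE)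
        ultimately show ?thesis using mk[of "bm \<omega> - Fop M i c1" c1 0] z by simp
      qed
    qed
  qed
  then obtain c where c: "\<And>\<omega>. is_web n k \<omega> \<Longrightarrow> (\<forall>m. Eop M i (c \<omega> m) = 0) \<and> bm \<omega> = (\<Sum>m\<le>2. Fdiv M i m (c \<omega> m))"
    by metis
  define d where "d m = (\<Sum>\<omega>\<in>webs. sc (crd x \<omega>) (c \<omega> m))" for m
  have "Eop M i (d m) = 0" for m
    unfolding d_def E_simps(4)[OF i] E_simps(2)[OF i] by (rule sum.neutral) (use c in auto)
  moreover have "x = (\<Sum>m\<le>2. Fdiv M i m (d m))"
  proof -
    have "x = (\<Sum>\<omega>\<in>webs. sc (crd x \<omega>) (bm \<omega>))" by (rule crd)
    also have "\<dots> = (\<Sum>\<omega>\<in>webs. sc (crd x \<omega>) (\<Sum>m\<le>2. Fdiv M i m (c \<omega> m)))" by (rule sum.cong) (use c in auto)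
    also have "\<dots> = (\<Sum>m\<le>2. Fdiv M i m (d m))"
      unfolding d_def scale_sum_right by (subst sum.swap) (simp only: Fdiv_lin[OF i])
    finally show ?thesis .
  qed
  ultimately show ?thesis by blast
qed

text \<open>The formula gives the same value for every decomposition of \<open>x\<close>, which is
  the uniqueness that \<open>THE\<close> requires.\<close>

lemma kashiwara_raise2:
  assumes i: "i \<in> {1..<n}"
  shows "kashiwara_f M i x = raise2 i x"
  unfolding kashiwara_f_def
proof (rule the_equality)
  obtain c where c: "\<forall>m. Eop M i (c m) = 0" "x = (\<Sum>m\<le>2. Fdiv M i m (c m))" using kernel_decomposition[OF i] by blast
  have "raise2 i x = (\<Sum>m\<le>2. Fdiv M i (Suc m) (c m))"
    unfolding c(2) raise2_lin[OF i] by (rule sum.cong) (use c raise2_Fdiv[OF i] in auto)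
  then show "\<exists>c N. (\<forall>m. Eop M i (c m) = 0) \<and> x = (\<Sum>m\<le>N. Fdiv M i m (c m)) \<and> raise2 i x = (\<Sum>m\<le>N. Fdiv M i (Suc m) (c m))"
    using c by blast
next
  fix y assume "\<exists>c N. (\<forall>m. Eop M i (c m) = 0) \<and> x = (\<Sum>m\<le>N. Fdiv M i m (c m)) \<and> y = (\<Sum>m\<le>N. Fdiv M i (Suc m) (c m))"
  then obtain c N where c: "\<forall>m. Eop M i (c m) = 0" "x = (\<Sum>m\<le>N. Fdiv M i m (c m))" "y = (\<Sum>m\<le>N. Fdiv M i (Suc m) (c m))" by blast
  show "y = raise2 i x"
    unfolding c(2,3) raise2_lin[OF i] by (rule sum.cong) (use c raise2_Fdiv[OF i] in auto)
qed

section \<open>The crystal lattice and its residues\<close>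

definition lat :: "Qq set \<Rightarrow> 'v set" where
  "lat P = {x. \<forall>\<omega>. is_web n k \<omega> \<longrightarrow> crd x \<omega> \<in> P}"

lemma latD: "x \<in> lat P \<Longrightarrow> is_web n k \<omega> \<Longrightarrow> crd x \<omega> \<in> P"
  unfolding lat_def by blast

lemma raise2_lat:
  assumes i: "i \<in> {1..<n}" and P: "0 \<in> P" "\<And>c d. c \<in> P \<Longrightarrow> d \<in> P \<Longrightarrow> c + d \<in> P" "\<And>c d. c \<in> regular_at_0 \<Longrightarrow> d \<in> P \<Longrightarrow> c * d \<in> P"
    and x: "x \<in> lat P"
  shows "raise2 i x \<in> lat P"
proof -
  have e: "raise2 i x = (\<Sum>\<omega>\<in>webs. sc (crd x \<omega> * tcoef i \<omega>) (bm (step i (Suc i) \<omega>)))"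
    by (subst crd[of x], unfold raise2_lin[OF i], rule sum.cong) (use raise2_bm[OF _ i] in auto)
  have Ps: "sum f A \<in> P" if "\<And>x. x \<in> A \<Longrightarrow> f x \<in> P" for f and A :: "web set"
    using that by (induction A rule: infinite_finite_induct) (auto intro: P)
  show ?thesis
    unfolding lat_def
  proof (intro CollectI allI impI)
    fix \<mu> assume m: "is_web n k \<mu>"
    have "crd (sc (crd x \<omega> * tcoef i \<omega>) (bm (step i (Suc i) \<omega>))) \<mu> \<in> P" if w: "\<omega> \<in> webs" for \<omega>
    proof (cases "tcoef i \<omega> = 0")
      case True then show ?thesis using P(1) crd_0[OF m] by simp
    next
      case False
      then have w1: "is_web n k (step i (Suc i) \<omega>)" using tcoef_cases[of \<omega> i] w i by blast
      have "tcoef i \<omega> * crd x \<omega> \<in> P" by (rule P(3)[OF tcoef_regular[OF _ i] latD[OF x]]) (use w in auto)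
      then have "crd x \<omega> * tcoef i \<omega> \<in> P" by (simp add: mult.commute)
      then show ?thesis unfolding crd_scale[OF m] crd_bm[OF m w1] using P(1) by simp
    qed
    then show "crd (raise2 i x) \<mu> \<in> P" unfolding e crd_sum[OF m] by (rule Ps)
  qed
qed

lemma raise2_regular: "i \<in> {1..<n} \<Longrightarrow> x \<in> lat regular_at_0 \<Longrightarrow> raise2 i x \<in> lat regular_at_0"
  by (rule raise2_lat) (auto intro: regular_simps regular_add regular_mult)

lemma raise2_qreg: "i \<in> {1..<n} \<Longrightarrow> x \<in> lat qreg \<Longrightarrow> raise2 i x \<in> lat qreg"
  by (rule raise2_lat) (auto intro: qreg_0 qreg_add qreg_mult)

lemma lat_lin:
  "x \<in> lat regular_at_0 \<Longrightarrow> y \<in> lat regular_at_0 \<Longrightarrow> x + y \<in> lat regular_at_0"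
  "c \<in> regular_at_0 \<Longrightarrow> x \<in> lat regular_at_0 \<Longrightarrow> sc c x \<in> lat regular_at_0"
  "x \<in> lat qreg \<Longrightarrow> y \<in> lat qreg \<Longrightarrow> x + y \<in> lat qreg"
  "x \<in> lat qreg \<Longrightarrow> y \<in> lat qreg \<Longrightarrow> x - y \<in> lat qreg"
  "x \<in> lat qreg \<Longrightarrow> x \<in> lat regular_at_0"
  by (simp_all add: lat_def crd_add crd_scale crd_diff regular_add regular_mult qreg_add qreg_diff qreg_regular)

lemma bm_lat: "is_web n k \<mu> \<Longrightarrow> bm \<mu> \<in> lat regular_at_0"
  by (simp add: lat_def crd_bm regular_simps)

text \<open>Modulo \<open>q\<close> times the lattice the Kashiwara operator sends a web to a web or
  to 0, since its coefficient is 0, 1 or \<open>inverse qtwo\<close>.\<close>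

lemma crystal_vector_residue:
  "x \<in> crystal_vectors n M u \<Longrightarrow> x \<in> lat regular_at_0 \<and> (x \<in> lat qreg \<or> (\<exists>\<mu>. is_web n k \<mu> \<and> x - bm \<mu> \<in> lat qreg))"
proof (induction rule: crystal_vectors.induct)
  case hw
  have t: "is_web n k (top_web k)" using web_top kn by simp
  have "u - bm (top_web k) \<in> lat qreg" by (simp add: bm_top lat_def crd_0 qreg_0)
  moreover have "u \<in> lat regular_at_0" using bm_lat[OF t] by (simp only: bm_top)
  ultimately show ?case using t by blast
next
  case (step i x)
  note i = step(1)
  have r: "kashiwara_f M i x = raise2 i x" by (rule kashiwara_raise2[OF i])
  have L: "raise2 i x \<in> lat regular_at_0" using raise2_regular[OF i] step by blast
  moreover have "raise2 i x \<in> lat qreg \<or> (\<exists>\<mu>. is_web n k \<mu> \<and> raise2 i x - bm \<mu> \<in> lat qreg)"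
  proof (cases "x \<in> lat qreg")
    case True then show ?thesis using raise2_qreg[OF i] by blast
  next
    case False
    then obtain \<mu> where m: "is_web n k \<mu>" "x - bm \<mu> \<in> lat qreg" using step by blast
    have x: "raise2 i x = raise2 i (x - bm \<mu>) + sc (tcoef i \<mu>) (bm (step i (Suc i) \<mu>))"
      using raise2_lin(1)[OF i, of "x - bm \<mu>" "bm \<mu>"] raise2_bm[OF m(1) i] by simp
    have q: "raise2 i (x - bm \<mu>) \<in> lat qreg" using raise2_qreg[OF i m(2)] .
    consider "tcoef i \<mu> = 0" | "tcoef i \<mu> = inverse qtwo" "is_web n k (step i (Suc i) \<mu>)" | "tcoef i \<mu> = 1" "is_web n k (step i (Suc i) \<mu>)"
      using tcoef_cases[OF m(1) i] by blast
    then show ?thesis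
    proof cases
      case 1 then show ?thesis using x q by simp
    next
      case 2
      have "sc (inverse qtwo) (bm (step i (Suc i) \<mu>)) \<in> lat qreg"
        using 2(2) by (simp add: lat_def crd_scale crd_bm qreg_inverse_qtwo qreg_0)
      then show ?thesis using x q 2(1) lat_lin(3) by simp
    next
      case 3
      then have "raise2 i x - bm (step i (Suc i) \<mu>) \<in> lat qreg" using x q by simp
      then show ?thesis using 3(2) by blast
    qed
  qed
  ultimately show ?case unfolding r by blast
qed

lemma bm_crystal: "is_web n k \<omega> \<Longrightarrow> bm \<omega> \<in> crystal_vectors n M u"
proof (induction rule: web_induct)
  case top show ?case by (simp only: bm_top crystal_vectors.hw)
next
  case (step i \<omega>)
  have "\<not> capped i \<omega>" using step(4) by (auto simp: capped_def)
  then have "kashiwara_f M i (bm \<omega>) = bm (step i (Suc i) \<omega>)"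
    unfolding kashiwara_raise2[OF step(1)] raise2_bm[OF step(2,1)] using step(3) by (simp add: tcoef_def coef_def)
  then show ?case using crystal_vectors.step[OF step(1) step(6)] by simp
next
  case (double i \<omega> \<omega>1)
  have "capped i \<omega>1" using kind_2_capped double by blast
  then have "kashiwara_f M i (bm \<omega>1) = bm (step i (Suc i) \<omega>1)"
    unfolding kashiwara_raise2[OF double(1)] raise2_bm[OF double(6,1)] using double(7) by (simp add: tcoef_def coef_def)
  then show ?case using crystal_vectors.step[OF double(1) double(10)] by simp
qed

lemma crystal_lattice_eq: "crystal_lattice n M u = lat regular_at_0"
proof
  show "crystal_lattice n M u \<subseteq> lat regular_at_0"
  proof
    fix x assume "x \<in> crystal_lattice n M u"
    then show "x \<in> lat regular_at_0"
      by induction (use crystal_vector_residue lat_lin in blast)+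
  qed
  show "lat regular_at_0 \<subseteq> crystal_lattice n M u"
  proof
    fix x assume x: "x \<in> lat regular_at_0"
    have z: "0 \<in> crystal_lattice n M u"
      using crystal_lattice.scale[OF regular_simps(1) crystal_lattice.gen[OF crystal_vectors.hw], where n = n and M = M and u = u] by simp
    have s: "sum f A \<in> crystal_lattice n M u" if "\<And>\<omega>. \<omega> \<in> A \<Longrightarrow> f \<omega> \<in> crystal_lattice n M u" for f and A :: "web set"
      using that by (induction A rule: infinite_finite_induct) (auto intro: z crystal_lattice.add)
    have "(\<Sum>\<omega>\<in>webs. sc (crd x \<omega>) (bm \<omega>)) \<in> crystal_lattice n M u"
    proof (rule s)
      fix \<omega> assume "\<omega> \<in> webs"
      then have w: "is_web n k \<omega>" by simp
      show "sc (crd x \<omega>) (bm \<omega>) \<in> crystal_lattice n M u"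
        by (rule crystal_lattice.scale[OF latD[OF x w] crystal_lattice.gen[OF bm_crystal[OF w]]])
    qed
    then show "x \<in> crystal_lattice n M u" using crd[of x] by simp
  qed
qed

lemma q_crystal_lattice_eq: "q_crystal_lattice n M u = lat qreg"
proof
  show "q_crystal_lattice n M u \<subseteq> lat qreg"
    unfolding q_crystal_lattice_def crystal_lattice_eq by (auto simp: lat_def crd_scale qreg_def)
  show "lat qreg \<subseteq> q_crystal_lattice n M u"
  proof
    fix x assume x: "x \<in> lat qreg"
    have "sc (inverse qv) x \<in> lat regular_at_0"
      unfolding lat_def
    proof (intro CollectI allI impI)
      fix \<omega> assume w: "is_web n k \<omega>"
      obtain d where "crd x \<omega> = qv * d" "d \<in> regular_at_0" using latD[OF x w] by (auto simp: qreg_def)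
      then show "crd (sc (inverse qv) x) \<omega> \<in> regular_at_0" using crd_scale[OF w] by (simp add: mult.assoc[symmetric])
    qed
    moreover have "x = sc qv (sc (inverse qv) x)" by simp
    ultimately show "x \<in> q_crystal_lattice n M u" unfolding q_crystal_lattice_def crystal_lattice_eq by blast
  qed
qed

section \<open>The bar involution and the global basis\<close>

definition bar0 :: "'v \<Rightarrow> 'v" where
  "bar0 x = (\<Sum>\<omega>\<in>webs. sc (bar (crd x \<omega>)) (bm \<omega>))"

lemma crd_bar0: "is_web n k \<omega> \<Longrightarrow> crd (bar0 x) \<omega> = bar (crd x \<omega>)"
  by (rule crd_eqI) (simp_all add: bar0_def)

lemma bar0_bm: "is_web n k \<mu> \<Longrightarrow> bar0 (bm \<mu>) = bm \<mu>"
  by (rule eq_crdI) (simp add: crd_bar0 crd_bm bar_simps)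

lemma bar0_F: "i \<in> {1..<n} \<Longrightarrow> bar0 (Fop M i x) = Fop M i (bar0 x)"
proof (rule eq_crdI)
  fix \<omega> assume i: "i \<in> {1..<n}" and w: "is_web n k \<omega>"
  have F: "crd (Fop M i y) \<omega> = lift_step qtwo n k i (Suc i) (crd y) \<omega>" for y
    by (rule crd_eqI[OF _ w]) (subst crd[of y], rule F_sum_bm[OF i])
  have c: "bar (coef qtwo m) = coef qtwo m" for m by (simp add: coef_def bar_simps bar_qtwo)
  show "crd (bar0 (Fop M i x)) \<omega> = crd (Fop M i (bar0 x)) \<omega>"
    unfolding crd_bar0[OF w] F unfolding lift_step_def bar_sum bar_mult c
    by (rule sum.cong) (auto simp: crd_bar0)
qed

text \<open>A competing map fixes \<open>u\<close> and commutes with all \<open>F\<^sub>i\<close>,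
  so it fixes every web vector; in the double case the bar-invariant factor \<open>qtwo\<close> is
  cancelled.\<close>

lemma bar_involution_eq: "bar_involution n M u = bar0"
  unfolding bar_involution_def
proof (rule the_equality)
  have t: "is_web n k (top_web k)" using web_top kn by simp
  show "(\<forall>x y. bar0 (x + y) = bar0 x + bar0 y) \<and> (\<forall>x. bar0 (sc qv x) = sc (inverse qv) (bar0 x)) \<and>
        bar0 u = u \<and> (\<forall>i\<in>{1..<n}. \<forall>x. bar0 (Fop M i x) = Fop M i (bar0 x))"
  proof (intro conjI allI ballI)
    show "bar0 (x + y) = bar0 x + bar0 y" for x y
      by (rule eq_crdI) (simp add: crd_bar0 crd_add bar_add)
    show "bar0 (sc qv x) = sc (inverse qv) (bar0 x)" for x
      by (rule eq_crdI) (simp add: crd_bar0 crd_scale bar_mult bar_simps)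
    show "bar0 u = u" using bar0_bm[OF t] by (simp only: bm_top)
  qed (rule bar0_F)
  fix \<beta> assume "(\<forall>x y. \<beta> (x + y) = \<beta> x + \<beta> y) \<and> (\<forall>x. \<beta> (sc qv x) = sc (inverse qv) (\<beta> x)) \<and>
        \<beta> u = u \<and> (\<forall>i\<in>{1..<n}. \<forall>x. \<beta> (Fop M i x) = Fop M i (\<beta> x))"
  then have add: "\<And>x y. \<beta> (x + y) = \<beta> x + \<beta> y" and q: "\<And>x. \<beta> (sc qv x) = sc (inverse qv) (\<beta> x)"
    and bu: "\<beta> u = u" and F: "\<And>i x. i \<in> {1..<n} \<Longrightarrow> \<beta> (Fop M i x) = Fop M i (\<beta> x)" by auto
  have semi: "\<beta> (sc c x) = sc (bar c) (\<beta> x)" for c x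
    by (rule semilinear_of_qv[OF vector_space_M add q])
  have b: "\<beta> (bm \<omega>) = bm \<omega>" if "is_web n k \<omega>" for \<omega>
    using that
  proof (induction rule: web_induct)
    case top show ?case using bu by (simp only: bm_top)
  next
    case (step i \<omega>)
    have "bm (step i (Suc i) \<omega>) = Fop M i (bm \<omega>)" using F_bm[OF step(2,1)] step(3) by (simp add: coef_def)
    then show ?case using F[OF step(1), of "bm \<omega>"] step(6) by simp
  next
    case (double i \<omega> \<omega>1)
    have e: "Fop M i (bm \<omega>1) = sc qtwo (bm (step i (Suc i) \<omega>1))" using F_bm[OF double(6,1)] double(7) by (simp add: coef_def)
    have "sc qtwo (\<beta> (bm (step i (Suc i) \<omega>1))) = \<beta> (Fop M i (bm \<omega>1))" unfolding e semi bar_qtwo ..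
    also have "\<dots> = sc qtwo (bm (step i (Suc i) \<omega>1))" using F[OF double(1), of "bm \<omega>1"] double(10) e by simp
    finally show ?case using scale_left_imp_eq[OF qtwo_nz] by blast
  qed
  have z: "\<beta> 0 = 0" using add[of 0 0] by simp
  have s: "\<beta> (sum f A) = (\<Sum>x\<in>A. \<beta> (f x))" for f and A :: "web set"
    by (induction A rule: infinite_finite_induct) (simp_all add: z add)
  show "\<beta> = bar0"
  proof
    fix x
    have "\<beta> x = (\<Sum>\<omega>\<in>webs. \<beta> (sc (crd x \<omega>) (bm \<omega>)))" by (subst crd[of x]) (rule s)
    also have "\<dots> = bar0 x" unfolding bar0_def semi by (rule sum.cong) (use b in auto)
    finally show "\<beta> x = bar0 x" .
  qed
qed

text \<open>Webs qualify because they are bar-invariant crystal vectors in the integral form.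
  Conversely \<open>balanced_constant\<close> makes every coordinate of an element constant, and the
  residues of these constants modulo \<open>q\<close> are those of a single web.\<close>

theorem global_basis_webs: "global_basis n M u = bm ` webs"
proof
  show "bm ` webs \<subseteq> global_basis n M u"
  proof
    fix x assume "x \<in> bm ` webs"
    then obtain \<omega> where w: "is_web n k \<omega>" "x = bm \<omega>" by blast
    have "bar0 (bm \<omega>) \<in> bar0 ` lat regular_at_0" using bm_lat[OF w(1)] by blast
    moreover have "bm \<omega> \<notin> lat qreg"
    proof
      assume "bm \<omega> \<in> lat qreg"
      from latD[OF this w(1)] have "cst 1 \<in> qreg" using crd_bm[OF w(1) w(1)] by (simp add: cst_simps)
      then show False using qreg_cst by fastforce
    qed
    moreover have "bm \<omega> - bm \<omega> \<in> lat qreg" by (simp add: lat_def crd_0 qreg_0)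
    ultimately show "x \<in> global_basis n M u"
      unfolding global_basis_def crystal_lattice_eq q_crystal_lattice_eq bar_involution_eq w(2)
      using bm_integral[OF w(1)] bm_lat[OF w(1)] bm_crystal[OF w(1)] bar0_bm[OF w(1)] by auto
  qed
  show "global_basis n M u \<subseteq> bm ` webs"
  proof
    fix x assume "x \<in> global_basis n M u"
    then obtain y b where x: "x \<in> integral_form n M u" "x \<in> lat regular_at_0" and y: "y \<in> lat regular_at_0" "x = bar0 y"
      and b: "b \<in> crystal_vectors n M u" "b \<notin> lat qreg" "x - b \<in> lat qreg"
      unfolding global_basis_def crystal_lattice_eq q_crystal_lattice_eq bar_involution_eq by auto
    obtain \<mu> where m: "is_web n k \<mu>" "b - bm \<mu> \<in> lat qreg" using crystal_vector_residue[OF b(1)] b(2) by blast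
    have xm: "x - bm \<mu> \<in> lat qreg" using lat_lin(3)[OF b(3) m(2)] by simp
    have "x = bm \<mu>"
    proof (rule eq_crdI)
      fix \<omega> assume w: "is_web n k \<omega>"
      have "crd x \<omega> \<in> laurent_polys" using integral_form_laurent[OF x(1) w] .
      moreover have "crd x \<omega> \<in> regular_at_0" by (rule latD[OF x(2) w])
      moreover have "crd x \<omega> = bar (crd y \<omega>)" unfolding y(2) by (rule crd_bar0[OF w])
      moreover have "crd y \<omega> \<in> regular_at_0" by (rule latD[OF y(1) w])
      ultimately obtain r where r: "crd x \<omega> = cst r" using balanced_constant by blast
      have "crd x \<omega> - crd (bm \<mu>) \<omega> \<in> qreg" using latD[OF xm w] crd_diff[OF w] by simp
      moreover have "crd (bm \<mu>) \<omega> = cst (if \<omega> = \<mu> then 1 else 0)" using crd_bm[OF w m(1)] by (simp add: cst_simps)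
      moreover have "cst a - cst b = cst (a - b)" for a b using cst_simps(3)[of "a - b" b] by simp
      ultimately have "cst (r - (if \<omega> = \<mu> then 1 else 0)) \<in> qreg" using r by simp
      then have "r = (if \<omega> = \<mu> then 1 else 0)" using qreg_cst by fastforce
      then show "crd x \<omega> = crd (bm \<mu>) \<omega>" using r crd_bm[OF w m(1)] by (simp add: cst_simps)
    qed
    then show "x \<in> bm ` webs" using m(1) by blast
  qed
qed

end

section \<open>Monomial matrices and root subgroups\<close>

text \<open>It sends the coordinate vector of \<open>j\<close> to \<open>m j\<close> times that of
  \<open>w j\<close>, with coordinates counted from 1.\<close>

definition monomial_mat :: "nat \<Rightarrow> (nat \<Rightarrow> nat) \<Rightarrow> (nat \<Rightarrow> complex) \<Rightarrow> complex mat" where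
  "monomial_mat n w m = Matrix.mat n n (\<lambda>(i, j). if Suc i = w (Suc j) then m (Suc j) else 0)"

lemma SL_simps: "carrier (SL n) = {A \<in> carrier_mat n n. det A = 1}" "A \<otimes>\<^bsub>SL n\<^esub> B = A * B" "\<one>\<^bsub>SL n\<^esub> = 1\<^sub>m n"
  by (simp_all add: SL_def)

lemma group_SL: "group (SL n)"
proof (rule groupI)
  show "x \<otimes>\<^bsub>SL n\<^esub> y \<in> carrier (SL n)" if "x \<in> carrier (SL n)" "y \<in> carrier (SL n)" for x y
    using that by (auto simp: SL_simps det_mult[of _ n])
  show "\<one>\<^bsub>SL n\<^esub> \<in> carrier (SL n)" by (simp add: SL_simps)
  show "x \<otimes>\<^bsub>SL n\<^esub> y \<otimes>\<^bsub>SL n\<^esub> z = x \<otimes>\<^bsub>SL n\<^esub> (y \<otimes>\<^bsub>SL n\<^esub> z)"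
    if "x \<in> carrier (SL n)" "y \<in> carrier (SL n)" "z \<in> carrier (SL n)" for x y z
    using that by (auto simp: SL_simps intro: assoc_mult_mat)
  show "\<one>\<^bsub>SL n\<^esub> \<otimes>\<^bsub>SL n\<^esub> x = x" if "x \<in> carrier (SL n)" for x
    using that by (auto simp: SL_simps)
  show "\<exists>y\<in>carrier (SL n). y \<otimes>\<^bsub>SL n\<^esub> x = \<one>\<^bsub>SL n\<^esub>" if x: "x \<in> carrier (SL n)" for x
  proof -
    have c: "x \<in> carrier_mat n n" "det x = 1" using x by (auto simp: SL_simps)
    then have "x \<in> Units (ring_mat TYPE(complex) n ())" by (intro det_non_zero_imp_unit) auto
    then obtain y where y: "y \<in> carrier_mat n n" "y * x = 1\<^sub>m n" by (auto simp: Units_def ring_mat_def)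
    have "det y * det x = 1" using det_mult[OF y(1) c(1)] y(2) by simp
    then have "det y = 1" using c(2) by simp
    then show ?thesis using y by (auto simp: SL_simps)
  qed
qed

lemma SL_mult: "A \<in> carrier (SL n) \<Longrightarrow> B \<in> carrier (SL n) \<Longrightarrow> A * B \<in> carrier (SL n)"
  using monoid.m_closed[OF group.is_monoid[OF group_SL], of A n B] by (simp add: SL_simps)

lemma monomial_mat_carrier [simp]: "monomial_mat n w m \<in> carrier_mat n n"
  by (simp add: monomial_mat_def)

lemma rs_carrier [simp]: "root_subgroup n a b t \<in> carrier_mat n n"
  by (simp add: root_subgroup_def)

lemma monomial_mat_id: "monomial_mat n id t = diag_elt n t"
  by (rule eq_matI) (auto simp: monomial_mat_def diag_elt_def mat_diag_def)

lemma monomial_mat_cong: "(\<And>j. j \<in> {1..n} \<Longrightarrow> w j = w' j \<and> m j = m' j) \<Longrightarrow> monomial_mat n w m = monomial_mat n w' m'"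
  by (rule eq_matI) (auto simp: monomial_mat_def)

lemma monomial_mat_mult:
  assumes "w' permutes {1..n}"
  shows "monomial_mat n w m * monomial_mat n w' m' = monomial_mat n (w \<circ> w') (\<lambda>j. m (w' j) * m' j)"
proof (rule eq_matI)
  fix i j assume "i < dim_row (monomial_mat n (w \<circ> w') (\<lambda>j. m (w' j) * m' j))" "j < dim_col (monomial_mat n (w \<circ> w') (\<lambda>j. m (w' j) * m' j))"
  then have ij: "i < n" "j < n" by (auto simp: monomial_mat_def)
  then have "w' (Suc j) \<in> {1..n}" using permutes_in_image[OF assms, of "Suc j"] by auto
  then obtain l where l: "w' (Suc j) = Suc l" "l < n" by (metis atLeastAtMost_iff not_less_eq_eq One_nat_def Suc_le_D less_eq_Suc_le)
  have "(monomial_mat n w m * monomial_mat n w' m') $$ (i, j) =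
     (\<Sum>x\<in>{0..<n}. (if Suc i = w (Suc x) then m (Suc x) else 0) * (if Suc x = w' (Suc j) then m' (Suc j) else 0))"
    using ij by (auto simp: monomial_mat_def scalar_prod_def intro!: sum.cong)
  also have "\<dots> = (\<Sum>x\<in>{0..<n}. if x = l then (if Suc i = w (Suc x) then m (Suc x) else 0) * m' (Suc j) else 0)"
    by (intro sum.cong refl) (auto simp: l)
  also have "\<dots> = (if Suc i = w (Suc l) then m (Suc l) else 0) * m' (Suc j)"
    using l(2) by (subst sum.delta) auto
  finally show "(monomial_mat n w m * monomial_mat n w' m') $$ (i, j) = monomial_mat n (w \<circ> w') (\<lambda>j. m (w' j) * m' j) $$ (i, j)"
    using ij l by (simp add: monomial_mat_def)
qed (auto simp: monomial_mat_def)

lemma mult_rs_index: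
  assumes A: "A \<in> carrier_mat n n" and ij: "i < n" "j < n" and a: "a \<in> {1..n}" "a \<noteq> b"
  shows "(A * root_subgroup n a b t) $$ (i, j) = A $$ (i, j) + (if Suc j = b then t * A $$ (i, a - 1) else 0)"
proof -
  have "(A * root_subgroup n a b t) $$ (i, j) =
      (\<Sum>x\<in>{0..<n}. A $$ (i, x) * (if x = j then 1 else if Suc x = a \<and> Suc j = b then t else 0))"
    using assms by (auto simp: root_subgroup_def scalar_prod_def intro!: sum.cong)
  also have "\<dots> = (\<Sum>x\<in>{0..<n}. (if x = j then A $$ (i, x) else 0) + (if x = a - 1 then (if Suc j = b then t * A $$ (i, x) else 0) else 0))"
    by (intro sum.cong refl) (use a in auto)
  also have "\<dots> = A $$ (i, j) + (if Suc j = b then t * A $$ (i, a - 1) else 0)"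
    using ij a by (subst sum.distrib, subst (1 2) sum.delta) auto
  finally show ?thesis .
qed

lemma rs_mult_index:
  assumes A: "A \<in> carrier_mat n n" and ij: "i < n" "j < n" and b: "b \<in> {1..n}" "a \<noteq> b"
  shows "(root_subgroup n a b t * A) $$ (i, j) = A $$ (i, j) + (if Suc i = a then t * A $$ (b - 1, j) else 0)"
proof -
  have "(root_subgroup n a b t * A) $$ (i, j) =
      (\<Sum>x\<in>{0..<n}. (if i = x then 1 else if Suc i = a \<and> Suc x = b then t else 0) * A $$ (x, j))"
    using assms by (auto simp: root_subgroup_def scalar_prod_def intro!: sum.cong)
  also have "\<dots> = (\<Sum>x\<in>{0..<n}. (if x = i then A $$ (x, j) else 0) + (if x = b - 1 then (if Suc i = a then t * A $$ (x, j) else 0) else 0))"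
    by (intro sum.cong refl) (use b in auto)
  also have "\<dots> = A $$ (i, j) + (if Suc i = a then t * A $$ (b - 1, j) else 0)"
    using ij b by (subst sum.distrib, subst (1 2) sum.delta) auto
  finally show ?thesis .
qed

lemma rs_SL: "a \<noteq> b \<Longrightarrow> a \<in> {1..n} \<Longrightarrow> b \<in> {1..n} \<Longrightarrow> root_subgroup n a b t \<in> carrier (SL n)"
proof -
  assume ab: "a \<noteq> b" "a \<in> {1..n}" "b \<in> {1..n}"
  have "root_subgroup n a b t = addrow_mat n t (a - 1) (b - 1)"
    by (rule eq_matI) (use ab in \<open>auto simp: root_subgroup_def addrow_mat_def\<close>)
  moreover have "a - 1 \<noteq> b - 1" using ab by auto
  ultimately show ?thesis using det_addrow_mat by (auto simp: SL_simps)
qed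

lemma rs_add:
  assumes ab: "a \<noteq> b" "a \<in> {1..n}" "b \<in> {1..n}"
  shows "root_subgroup n a b t * root_subgroup n a b t' = root_subgroup n a b (t + t')"
proof (rule eq_matI)
  fix i j assume "i < dim_row (root_subgroup n a b (t + t'))" "j < dim_col (root_subgroup n a b (t + t'))"
  then have ij: "i < n" "j < n" by (auto simp: root_subgroup_def)
  show "(root_subgroup n a b t * root_subgroup n a b t') $$ (i, j) = root_subgroup n a b (t + t') $$ (i, j)"
    using ab ij by (subst mult_rs_index[OF rs_carrier ij]) (auto simp: root_subgroup_def)
qed (auto simp: root_subgroup_def)

lemma monomial_mat_rs:
  assumes w: "w permutes {1..n}" and ab: "a \<noteq> b" "a \<in> {1..n}" "b \<in> {1..n}" and m: "m b \<noteq> 0"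
  shows "monomial_mat n w m * root_subgroup n a b t = root_subgroup n (w a) (w b) (m a / m b * t) * monomial_mat n w m"
proof (rule eq_matI)
  let ?R = "root_subgroup n (w a) (w b) (m a / m b * t) * monomial_mat n w m"
  have wab: "w a \<noteq> w b" "w a \<in> {1..n}" "w b \<in> {1..n}"
    using ab permutes_in_image[OF w] permutes_inj[OF w] by (auto dest: injD)
  fix i j assume "i < dim_row ?R" "j < dim_col ?R"
  then have ij: "i < n" "j < n" by (auto simp: root_subgroup_def monomial_mat_def)
  have wb: "w b = w (Suc j) \<longleftrightarrow> b = Suc j" using permutes_inj[OF w] by (auto dest: injD)
  show "(monomial_mat n w m * root_subgroup n a b t) $$ (i, j) = ?R $$ (i, j)"
    using ij ab wab wb m
    by (simp add: mult_rs_index[OF monomial_mat_carrier ij ab(2,1)] rs_mult_index[OF monomial_mat_carrier ij wab(3,1)])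
       (auto simp: monomial_mat_def Suc_diff_1)
qed (auto simp: root_subgroup_def monomial_mat_def)

section \<open>Representatives of permutations\<close>

definition monomial_rep :: "nat \<Rightarrow> complex mat \<Rightarrow> (nat \<Rightarrow> nat) \<Rightarrow> (nat \<Rightarrow> complex) \<Rightarrow> bool" where
  "monomial_rep n W w m \<longleftrightarrow> W = monomial_mat n w m \<and> W \<in> carrier (SL n) \<and> w permutes {1..n} \<and> (\<forall>i\<in>{1..n}. m i \<noteq> 0)"

lemma monomial_rep_mult: "monomial_rep n W w m \<Longrightarrow> monomial_rep n W' w' m' \<Longrightarrow> monomial_rep n (W * W') (w \<circ> w') (\<lambda>j. m (w' j) * m' j)"
proof -
  assume a: "monomial_rep n W w m" "monomial_rep n W' w' m'"
  then have w': "w' permutes {1..n}" by (simp add: monomial_rep_def)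
  have "W * W' \<in> carrier (SL n)" using a SL_mult unfolding monomial_rep_def by blast
  moreover have "W * W' = monomial_mat n (w \<circ> w') (\<lambda>j. m (w' j) * m' j)" using a monomial_mat_mult[OF w'] unfolding monomial_rep_def by metis
  moreover have "w \<circ> w' permutes {1..n}" using a permutes_compose unfolding monomial_rep_def by blast
  moreover have "m (w' j) * m' j \<noteq> 0" if "j \<in> {1..n}" for j
    using a that permutes_in_image[OF w', of j] unfolding monomial_rep_def by auto
  ultimately show ?thesis unfolding monomial_rep_def by blast
qed

lemma det_diag: "det (monomial_mat n id t) = (\<Prod>i = 1..n. t i)"
proof -
  have "det (monomial_mat n id t) = prod_list (diag_mat (monomial_mat n id t))"
    by (rule det_upper_triangular[of _ n]) (auto simp: monomial_mat_def)
  also have "\<dots> = (\<Prod>i\<in>{0..<n}. t (Suc i))"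
    by (auto simp: prod_list_diag_prod monomial_mat_def intro!: prod.cong)
  also have "\<dots> = (\<Prod>i\<in>{Suc 0..<Suc n}. t i)" by (rule prod.shift_bounds_Suc_ivl[symmetric])
  finally show ?thesis by (simp add: atLeastLessThanSuc_atLeastAtMost)
qed

lemma monomial_rep_diag: "(\<Prod>i = 1..n. t i) = 1 \<Longrightarrow> monomial_rep n (diag_elt n t) id t"
proof -
  assume p: "(\<Prod>i = 1..n. t i) = 1"
  have "t i \<noteq> 0" if i: "i \<in> {1..n}" for i
  proof
    assume "t i = 0"
    then have "(\<Prod>i = 1..n. t i) = 0" using i by (intro prod_zero) auto
    then show False using p by (metis zero_neq_one)
  qed
  then show ?thesis using p det_diag[of n t] monomial_mat_carrier[of n id t] permutes_id[of "{1..n}"] unfolding monomial_rep_def SL_simps monomial_mat_id by simp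
qed

lemma monomial_rep_inverse:
  assumes "monomial_rep n W w m"
  obtains W' m' where "monomial_rep n W' (inv' w) m'" "W * W' = 1\<^sub>m n" "W' * W = 1\<^sub>m n"
proof -
  let ?m = "\<lambda>j. inverse (m (inv' w j))"
  let ?W = "monomial_mat n (inv' w) ?m"
  have w: "w permutes {1..n}" "inv' w permutes {1..n}" and m: "\<And>i. i \<in> {1..n} \<Longrightarrow> m i \<noteq> 0" and W: "W = monomial_mat n w m" "det W = 1"
    using assms permutes_inv by (auto simp: monomial_rep_def SL_simps)
  have i: "inv' w (w j) = j" "w (inv' w j) = j" for j using permutes_inverses[OF w(1)] by auto
  have "inv' w j \<in> {1..n} \<longleftrightarrow> j \<in> {1..n}" for j using permutes_in_image[OF w(2)] by blast
  then have nz: "?m j \<noteq> 0" if "j \<in> {1..n}" for j using m that by simp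
  have 1: "W * ?W = 1\<^sub>m n"
    unfolding W monomial_mat_mult[OF w(2)] using nz
    by (subst monomial_mat_cong[of n _ id _ "\<lambda>_. 1"]) (auto simp: i monomial_mat_def)
  have 2: "?W * W = 1\<^sub>m n"
    unfolding W monomial_mat_mult[OF w(1)] using m
    by (subst monomial_mat_cong[of n _ id _ "\<lambda>_. 1"]) (auto simp: i monomial_mat_def)
  have "det ?W = 1" using det_mult[of W n ?W] 1 W by simp
  then show thesis using that[of ?W ?m] 1 2 w nz by (auto simp: monomial_rep_def SL_simps)
qed

lemma monomial_rep_exists:
  assumes w: "w permutes {1..n}" and n: "1 \<le> n"
  obtains W m where "monomial_rep n W w m"
proof -
  let ?m = "monomial_mat n w (\<lambda>_. 1)"
  have i: "inv' w (w j) = j" "w (inv' w j) = j" for j using permutes_inverses[OF w] by auto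
  have "?m * monomial_mat n (inv' w) (\<lambda>_. 1) = 1\<^sub>m n"
    unfolding monomial_mat_mult[OF permutes_inv[OF w]]
    by (subst monomial_mat_cong[of n _ id _ "\<lambda>_. 1"]) (auto simp: i monomial_mat_def)
  then have d: "det ?m \<noteq> 0" using det_mult[of ?m n "monomial_mat n (inv' w) (\<lambda>_. 1)"] by auto
  \<comment> \<open>Rescaling the first column makes the determinant 1.\<close>
  let ?t = "\<lambda>j. if j = 1 then inverse (det ?m) else (1::complex)"
  have "(\<Prod>i = 1..n. ?t i) = inverse (det ?m)" using n by (subst prod.delta) auto
  then have "det (?m * monomial_mat n id ?t) = 1" using d det_mult[of ?m n "monomial_mat n id ?t"] det_diag[of n ?t] by simp
  then have "monomial_rep n (?m * monomial_mat n id ?t) w ?t"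
    using d w monomial_mat_mult[of id n w "\<lambda>_. 1" ?t] unfolding monomial_rep_def
    by (auto simp: SL_simps permutes_id)
  then show thesis by (rule that)
qed

lemma represents_monomial_rep:
  assumes r: "represents n W w" and n: "2 \<le> n"
  obtains m where "monomial_rep n W w m"
proof -
  interpret group "SL n" by (rule group_SL)
  have W: "W \<in> carrier (SL n)" and w: "w permutes {1..n}"
    and c: "\<And>t. (\<Prod>i = 1..n. t i) = 1 \<Longrightarrow> W \<otimes>\<^bsub>SL n\<^esub> diag_elt n t \<otimes>\<^bsub>SL n\<^esub> inv\<^bsub>SL n\<^esub> W = diag_elt n (t \<circ> inv' w)"
    using r by (auto simp: represents_def normalizer_def stabilizer_def)
  have Wc: "W \<in> carrier_mat n n" "det W = 1" using W by (auto simp: SL_simps)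
  have com: "W * diag_elt n t = diag_elt n (t \<circ> inv' w) * W" if "(\<Prod>i = 1..n. t i) = 1" for t
  proof -
    have d: "diag_elt n t \<in> carrier (SL n)" using monomial_rep_diag[OF that] unfolding monomial_rep_def by blast
    have "W \<otimes>\<^bsub>SL n\<^esub> diag_elt n t \<otimes>\<^bsub>SL n\<^esub> inv\<^bsub>SL n\<^esub> W \<otimes>\<^bsub>SL n\<^esub> W = W \<otimes>\<^bsub>SL n\<^esub> diag_elt n t"
      using W d by (simp add: m_assoc)
    then show ?thesis using c[OF that] by (simp add: SL_simps)
  qed
  have z: "Suc i = w (Suc j)" if ij: "i < n" "j < n" and nz: "W $$ (i, j) \<noteq> 0" for i j
  proof (rule ccontr)
    assume "Suc i \<noteq> w (Suc j)"
    then have ne: "inv' w (Suc i) \<noteq> Suc j" using permutes_inverses[OF w] by metis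
    have i: "inv' w (Suc i) \<in> {1..n}" using permutes_in_image[OF permutes_inv[OF w]] ij by simp
    \<comment> \<open>A torus element with the values 2 and 1/2 at the two sites to be told apart.
      Commuting it past \<open>W\<close> forces the entry to vanish.\<close>
    define t :: "nat \<Rightarrow> complex" where "t = (\<lambda>l. if l = Suc j then 2 else if l = inv' w (Suc i) then 1 / 2 else 1)"
    have "(\<Prod>l = 1..n. t l) = t (Suc j) * (t (inv' w (Suc i)) * (\<Prod>l\<in>{1..n} - {Suc j} - {inv' w (Suc i)}. t l))"
      using ij i ne by (subst prod.remove[of _ "Suc j"], simp, simp, subst prod.remove[of _ "inv' w (Suc i)"]) auto
    also have "(\<Prod>l\<in>{1..n} - {Suc j} - {inv' w (Suc i)}. t l) = 1" by (rule prod.neutral) (auto simp: t_def)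
    finally have "(\<Prod>l = 1..n. t l) = 1" using ne by (simp add: t_def)
    from arg_cong[OF com[OF this], of "\<lambda>A. A $$ (i, j)"] have "W $$ (i, j) * t (Suc j) = t (inv' w (Suc i)) * W $$ (i, j)"
      unfolding diag_elt_def using ij Wc
      by (subst (asm) mat_diag_mult_left[OF Wc(1)], subst (asm) mat_diag_mult_right[OF Wc(1)]) simp
    then show False using nz ne by (simp add: t_def)
  qed
  let ?m = "\<lambda>j. W $$ (w j - 1, j - 1)"
  have Wm: "W = monomial_mat n w ?m"
  proof (rule eq_matI)
    fix i j assume "i < dim_row (monomial_mat n w ?m)" "j < dim_col (monomial_mat n w ?m)"
    then have ij: "i < n" "j < n" by (auto simp: monomial_mat_def)
    show "W $$ (i, j) = monomial_mat n w ?m $$ (i, j)"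
      using z[OF ij] ij by (cases "Suc i = w (Suc j)") (auto simp: monomial_mat_def dest: sym)
  qed (use Wc in \<open>auto simp: monomial_mat_def\<close>)
  have "?m l \<noteq> 0" if l: "l \<in> {1..n}" for l
  proof
    assume 0: "?m l = 0"
    \<comment> \<open>If the entry in column \<open>l\<close> were 0, then \<open>W\<close> would
      absorb a singular diagonal matrix.\<close>
    let ?t = "\<lambda>i. if i = l then 0 else (1::complex)"
    have "monomial_mat n w ?m * monomial_mat n id ?t = monomial_mat n w ?m"
      by (subst monomial_mat_mult[OF permutes_id], rule monomial_mat_cong) (use 0 in auto)
    then have "det W * det (monomial_mat n id ?t) = det W" using Wm det_mult[OF Wc(1), of "monomial_mat n id ?t"] by simp
    moreover have "(\<Prod>i = 1..n. ?t i) = 0" using l by (intro prod_zero) auto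
    ultimately show False using Wc(2) det_diag[of n ?t] by simp
  qed
  then show thesis using that[of ?m] Wm W w unfolding monomial_rep_def by blast
qed

text \<open>The usual lift of a reflection: the product of the exponentials of
  \<open>E\<^sub>a\<^sub>b\<close>, \<open>- E\<^sub>b\<^sub>a\<close> and
  \<open>E\<^sub>a\<^sub>b\<close>.\<close>

lemma monomial_rep_transpose:
  assumes ab: "a \<noteq> b" "a \<in> {1..n}" "b \<in> {1..n}"
  shows "monomial_rep n (root_subgroup n a b 1 * root_subgroup n b a (-1) * root_subgroup n a b 1)
    (Transposition.transpose a b) (\<lambda>j. if j = a then -1 else 1)"
proof -
  let ?A = "root_subgroup n a b 1" and ?B = "root_subgroup n b a (-1)"
  have ba: "b \<noteq> a" using ab by simp
  have "?A * ?B * ?A = monomial_mat n (Transposition.transpose a b) (\<lambda>j. if j = a then -1 else 1)"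
  proof (rule eq_matI)
    fix i j assume "i < dim_row (monomial_mat n (Transposition.transpose a b) (\<lambda>j. if j = a then -1 else 1))"
      "j < dim_col (monomial_mat n (Transposition.transpose a b) (\<lambda>j. if j = a then -1 else 1))"
    then have ij: "i < n" "j < n" by (auto simp: monomial_mat_def)
    have AB: "?A * ?B \<in> carrier_mat n n" by (rule mult_carrier_mat[of _ n n]) simp_all
    have a1: "a - 1 < n" "b - 1 < n" "Suc (a - 1) = a" "Suc (b - 1) = b" using ab by auto
    show "(?A * ?B * ?A) $$ (i, j) = monomial_mat n (Transposition.transpose a b) (\<lambda>j. if j = a then -1 else 1) $$ (i, j)"
      using ab ba ij a1
      by (simp only: mult_rs_index[OF AB ij ab(2,1)] mult_rs_index[OF rs_carrier ij(1) ij(2) ab(3) ba]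
          mult_rs_index[OF rs_carrier ij(1) a1(1) ab(3) ba])
        (auto simp: root_subgroup_def monomial_mat_def transpose_def)
  qed (auto simp: monomial_mat_def root_subgroup_def)
  moreover have "?A * ?B * ?A \<in> carrier (SL n)" using ab ba by (intro SL_mult rs_SL)
  ultimately show ?thesis using ab unfolding monomial_rep_def by (auto intro: permutes_swap_id)
qed

section \<open>The differential of an algebraic representation\<close>

lemma functional_iff: "vector_space s \<Longrightarrow> functional s \<phi> \<longleftrightarrow> (\<forall>x y. \<phi> (x + y) = \<phi> x + \<phi> y) \<and> (\<forall>c x. \<phi> (s c x) = c * \<phi> x)"
proof -
  have "vector_space ((*) :: complex \<Rightarrow> complex \<Rightarrow> complex)" by unfold_locales (auto simp: algebra_simps)
  then show "vector_space s \<Longrightarrow> ?thesis" by (simp add: Vector_Spaces.linear_iff)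
qed

lemma poly_of_matrix_polynomial:
  assumes "f \<in> matrix_polynomials n"
  shows "\<exists>P. \<forall>t. f (root_subgroup n a b t) = poly P t"
  using assms
proof induction
  case (const c)
  then show ?case by (intro exI[of _ "[:c:]"]) simp
next
  case (entry i j)
  then show ?case
    by (intro exI[of _ "if i = j then 1 else if Suc i = a \<and> Suc j = b then [:0, 1:] else 0"]) (auto simp: root_subgroup_def)
next
  case (add f g)
  then obtain P Q where "\<forall>t. f (root_subgroup n a b t) = poly P t" "\<forall>t. g (root_subgroup n a b t) = poly Q t" by blast
  then show ?case by (intro exI[of _ "P + Q"]) simp
next
  case (mult f g)
  then obtain P Q where "\<forall>t. f (root_subgroup n a b t) = poly P t" "\<forall>t. g (root_subgroup n a b t) = poly Q t" by blast
  then show ?case by (intro exI[of _ "P * Q"]) simp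
qed

locale sl_rep =
  fixes n :: nat and s :: "complex \<Rightarrow> 'w::ab_group_add \<Rightarrow> 'w" and \<rho> :: "complex mat \<Rightarrow> 'w \<Rightarrow> 'w"
  assumes rep: "SL_rep n s \<rho>"
begin

lemma vector_space_s: "vector_space s"
  using rep by (simp add: SL_rep_def)

sublocale vector_space s by (rule vector_space_s)

lemma functional: "functional s \<phi> \<longleftrightarrow> (\<forall>x y. \<phi> (x + y) = \<phi> x + \<phi> y) \<and> (\<forall>c x. \<phi> (s c x) = c * \<phi> x)"
  by (rule functional_iff[OF vector_space_s])

lemma functional_sum: "functional s \<phi> \<Longrightarrow> \<phi> (sum f A) = (\<Sum>x\<in>A. \<phi> (f x))"
proof -
  assume f: "functional s \<phi>"
  then have "\<phi> 0 = 0" unfolding functional by (metis add_cancel_right_right add_0)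
  then show ?thesis using f by (induction A rule: infinite_finite_induct) (auto simp: functional)
qed

lemma basis_ex:
  obtains B where "finite B" "independent B" "span B = UNIV"
proof -
  obtain X where X: "finite X" "span X = UNIV" using rep by (auto simp: SL_rep_def)
  obtain B where B: "B \<subseteq> X" "independent B" "X \<subseteq> span B" using maximal_independent_subset by metis
  have "span X \<subseteq> span B" using B(3) span_minimal subspace_span by blast
  then show thesis using that[of B] B X finite_subset by blast
qed

lemma coordinate_functional:
  "independent B \<Longrightarrow> span B = UNIV \<Longrightarrow> functional s (\<lambda>v. representation B v b)"
  unfolding functional by (auto simp: representation_add representation_scale)

lemma separate: "(\<And>\<phi>. functional s \<phi> \<Longrightarrow> \<phi> x = \<phi> y) \<Longrightarrow> x = y"
proof -
  assume a: "\<And>\<phi>. functional s \<phi> \<Longrightarrow> \<phi> x = \<phi> y"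
  obtain B where B: "finite B" "independent B" "span B = UNIV" using basis_ex by metis
  have "(\<Sum>b\<in>B. s (representation B x b) b) = (\<Sum>b\<in>B. s (representation B y b) b)"
    by (intro sum.cong refl) (simp add: a[OF coordinate_functional[OF B(2,3)]])
  then show "x = y" using sum_representation_eq[OF B(2) _ B(1) subset_refl, of x] sum_representation_eq[OF B(2) _ B(1) subset_refl, of y] B(3)
    by simp
qed

lemma rho_lin:
  assumes "A \<in> carrier (SL n)"
  shows "\<rho> A (x + y) = \<rho> A x + \<rho> A y" "\<rho> A (s c x) = s c (\<rho> A x)" "\<rho> A 0 = 0" "\<rho> A (sum f X) = (\<Sum>x\<in>X. \<rho> A (f x))"
proof -
  interpret f: Vector_Spaces.linear s s "\<rho> A" using rep assms by (simp add: SL_rep_def)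
  show "\<rho> A (x + y) = \<rho> A x + \<rho> A y" "\<rho> A (s c x) = s c (\<rho> A x)" "\<rho> A 0 = 0" "\<rho> A (sum f X) = (\<Sum>x\<in>X. \<rho> A (f x))"
    by (rule f.add f.scale f.zero f.sum)+
qed

lemma rho_mult: "A \<in> carrier (SL n) \<Longrightarrow> B \<in> carrier (SL n) \<Longrightarrow> \<rho> (A * B) x = \<rho> A (\<rho> B x)"
  using rep by (simp add: SL_rep_def SL_simps)

lemma rho_one: "\<rho> (1\<^sub>m n) x = x"
  using rep by (simp add: SL_rep_def SL_simps)

lemma functional_rho: "functional s \<phi> \<Longrightarrow> A \<in> carrier (SL n) \<Longrightarrow> functional s (\<lambda>x. \<phi> (\<rho> A x))"
  unfolding functional by (simp add: rho_lin)

abbreviation "rs \<equiv> root_subgroup n"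
abbreviation "mu \<equiv> matrix_unit_action n s \<rho>"

definition root :: "nat \<Rightarrow> nat \<Rightarrow> bool" where
  "root a b \<longleftrightarrow> a \<noteq> b \<and> a \<in> {1..n} \<and> b \<in> {1..n}"

lemma rs_in: "root a b \<Longrightarrow> rs a b t \<in> carrier (SL n)"
  by (simp add: root_def rs_SL)

lemma curve_poly:
  assumes "root a b" "functional s \<phi>"
  obtains P where "\<And>t. \<phi> (\<rho> (rs a b t) x) = poly P t"
proof -
  obtain f where f: "f \<in> matrix_polynomials n" "\<forall>A\<in>carrier (SL n). \<phi> (\<rho> A x) = f A"
    using rep assms unfolding SL_rep_def by blast
  obtain P where "\<forall>t. f (rs a b t) = poly P t" using poly_of_matrix_polynomial[OF f(1)] by blast
  then show thesis using that[of P] f(2) rs_in[OF assms(1)] by simp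
qed

lemma rs_0: "rs a b 0 = 1\<^sub>m n"
  by (rule eq_matI) (auto simp: root_subgroup_def)

text \<open>Matrix coefficients along a root subgroup are polynomials in \<open>t\<close>, so the
  derivative exists in every coordinate. It is unique since functionals separate vectors.\<close>

lemma mu_derivative:
  assumes ab: "root a b" and phi: "functional s \<phi>"
  shows "((\<lambda>t. \<phi> (\<rho> (rs a b t) x)) has_field_derivative \<phi> (mu a b x)) (at 0)"
proof -
  obtain B where B: "finite B" "independent B" "span B = UNIV" using basis_ex by metis
  have "\<exists>P. \<forall>t. representation B (\<rho> (rs a b t) x) c = poly P t" for c
  proof -
    obtain P where "\<And>t. representation B (\<rho> (rs a b t) x) c = poly P t"
      using curve_poly[OF ab coordinate_functional[OF B(2,3)], where x = x and b1 = c] by blast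
    then show ?thesis by blast
  qed
  then obtain P where P: "\<And>c t. representation B (\<rho> (rs a b t) x) c = poly (P c) t" by metis
  have curve: "\<rho> (rs a b t) x = (\<Sum>c\<in>B. s (poly (P c) t) c)" for t
    using sum_representation_eq[OF B(2) _ B(1) subset_refl, of "\<rho> (rs a b t) x"] B(3) by (simp add: P)
  define y where "y = (\<Sum>c\<in>B. s (poly (pderiv (P c)) 0) c)"
  have y: "((\<lambda>t. \<psi> (\<rho> (rs a b t) x)) has_field_derivative \<psi> y) (at 0)" if f: "functional s \<psi>" for \<psi>
  proof -
    have "((\<lambda>t. \<Sum>c\<in>B. poly (P c) t * \<psi> c) has_field_derivative (\<Sum>c\<in>B. poly (pderiv (P c)) 0 * \<psi> c)) (at 0)"
      by (intro DERIV_sum DERIV_cmult_right poly_DERIV)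
    moreover have "\<psi> (\<rho> (rs a b t) x) = (\<Sum>c\<in>B. poly (P c) t * \<psi> c)" for t
      using f by (simp add: curve functional_sum[OF f] functional)
    moreover have "\<psi> y = (\<Sum>c\<in>B. poly (pderiv (P c)) 0 * \<psi> c)"
      using f by (simp add: y_def functional_sum[OF f] functional)
    ultimately show ?thesis by simp
  qed
  have "mu a b x = y"
    unfolding matrix_unit_action_def
  proof (rule the_equality)
    fix z assume z: "\<forall>\<psi>. functional s \<psi> \<longrightarrow> ((\<lambda>t. \<psi> (\<rho> (rs a b t) x)) has_field_derivative \<psi> z) (at 0)"
    show "z = y" by (rule separate) (use z y DERIV_unique in blast)
  qed (use y in blast)
  then show ?thesis using y[OF phi] by simp
qed

lemma mu_eqI:
  assumes "root a b"
    and "\<And>\<phi>. functional s \<phi> \<Longrightarrow> ((\<lambda>t. \<phi> (\<rho> (rs a b t) x)) has_field_derivative \<phi> y) (at 0)"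
  shows "mu a b x = y"
  by (rule separate) (use assms mu_derivative DERIV_unique in blast)

lemma mu_lin:
  assumes ab: "root a b"
  shows "mu a b (x + y) = mu a b x + mu a b y" "mu a b (s c x) = s c (mu a b x)" "mu a b 0 = 0"
    "mu a b (sum f X) = (\<Sum>x\<in>X. mu a b (f x))"
proof -
  show add: "mu a b (x + y) = mu a b x + mu a b y" for x y
  proof (rule mu_eqI[OF ab])
    fix \<phi> assume f: "functional s \<phi>"
    then show "((\<lambda>t. \<phi> (\<rho> (rs a b t) (x + y))) has_field_derivative \<phi> (mu a b x + mu a b y)) (at 0)"
      using DERIV_add[OF mu_derivative[OF ab f, of x] mu_derivative[OF ab f, of y]]
      by (simp add: rho_lin[OF rs_in[OF ab]] functional)
  qed
  show sc: "mu a b (s c x) = s c (mu a b x)" for c x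
  proof (rule mu_eqI[OF ab])
    fix \<phi> assume f: "functional s \<phi>"
    then show "((\<lambda>t. \<phi> (\<rho> (rs a b t) (s c x))) has_field_derivative \<phi> (s c (mu a b x))) (at 0)"
      using DERIV_cmult[OF mu_derivative[OF ab f, of x], of c]
      by (simp add: rho_lin[OF rs_in[OF ab]] functional)
  qed
  show z: "mu a b 0 = 0" using sc[of 0 0] by simp
  show "mu a b (sum f X) = (\<Sum>x\<in>X. mu a b (f x))"
    by (induction X rule: infinite_finite_induct) (auto simp: add z)
qed

text \<open>The derivative at \<open>t\<close> of the curve through \<open>x\<close> is the value at
  \<open>t\<close> of the curve through \<open>mu a b x\<close>. Used once, this shows that the
  latter curve is constant; used again, that the former is linear.\<close>

lemma exp_linear:
  assumes ab: "root a b" and c: "mu a b (mu a b x) = 0"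
  shows "\<rho> (rs a b t) x = x + s t (mu a b x)"
proof -
  have der: "((\<lambda>t. \<phi> (\<rho> (rs a b t) x)) has_field_derivative \<phi> (\<rho> (rs a b t) (mu a b x))) (at t)"
    if f: "functional s \<phi>" for \<phi> t x
  proof -
    have "rs a b (h + t) = rs a b t * rs a b h" for h
      using rs_add[of a b n t h] ab by (simp add: root_def add.commute)
    then have "\<phi> (\<rho> (rs a b (h + t)) x) = \<phi> (\<rho> (rs a b t) (\<rho> (rs a b h) x))" for h
      using rho_mult rs_in[OF ab] by simp
    then show ?thesis
      using mu_derivative[OF ab functional_rho[OF f rs_in[OF ab, of t]], of x] DERIV_shift[of "\<lambda>t. \<phi> (\<rho> (rs a b t) x)" _ 0 t]
      by simp
  qed
  have lin: "\<rho> (rs a b t) x = x + s t z" if z: "\<And>t. \<rho> (rs a b t) (mu a b x) = z" for x z t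
  proof (rule separate)
    fix \<phi> assume f: "functional s \<phi>"
    obtain P where P: "\<And>t. \<phi> (\<rho> (rs a b t) x) = poly P t" using curve_poly[OF ab f] by metis
    let ?Q = "P - [:0, \<phi> z:]"
    have "poly (pderiv P) t = \<phi> z" for t
      using der[OF f, of x t] poly_DERIV[of P t] DERIV_unique unfolding P z by blast
    then have "poly (pderiv ?Q) t = 0" for t by (simp add: pderiv_diff pderiv_pCons)
    then have "pderiv ?Q = 0" using poly_all_0_iff_0 by blast
    then obtain h where h: "?Q = [:h:]" using pderiv_iszero by blast
    have Q: "poly P t - t * \<phi> z = h" for t using arg_cong[OF h, of "\<lambda>q. poly q t"] by simp
    have "poly P t = poly P 0 + t * \<phi> z" using Q[of t] Q[of 0] by (auto simp: algebra_simps)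
    moreover have "poly P 0 = \<phi> x" using P[of 0] by (simp add: rs_0 rho_one)
    ultimately show "\<phi> (\<rho> (rs a b t) x) = \<phi> (x + s t z)" using f by (simp add: P functional)
  qed
  show ?thesis
    by (rule lin) (use lin[of "mu a b x" 0] c rho_lin(3)[OF rs_in[OF ab]] in simp)
qed

text \<open>The derivative at 0 of \<open>monomial_mat_rs\<close>; the scalar comes from the
  reparametrised root subgroup.\<close>

lemma equivariance:
  assumes W: "monomial_rep n W w m" and ab: "root a b"
  shows "\<rho> W (mu a b x) = s (m a / m b) (mu (w a) (w b) (\<rho> W x))"
proof (rule separate)
  have w: "W = monomial_mat n w m" "W \<in> carrier (SL n)" "w permutes {1..n}" "m a \<noteq> 0" "m b \<noteq> 0"
    using W ab by (auto simp: monomial_rep_def root_def)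
  have wab: "root (w a) (w b)" using permutes_inj[OF w(3)] permutes_in_image[OF w(3)] ab by (auto simp: root_def dest: injD)
  let ?r = "m a / m b"
  fix \<phi> assume f: "functional s \<phi>"
  have "\<rho> W (\<rho> (rs a b t) x) = \<rho> (rs (w a) (w b) (?r * t)) (\<rho> W x)" for t
    using monomial_mat_rs[OF w(3), of a b m t] ab w rho_mult[OF w(2) rs_in[OF ab]] rho_mult[OF rs_in[OF wab] w(2)]
    by (auto simp: root_def) metis
  then have "((\<lambda>t. \<phi> (\<rho> (rs (w a) (w b) (?r * t)) (\<rho> W x))) has_field_derivative \<phi> (\<rho> W (mu a b x))) (at 0)"
    using mu_derivative[OF ab functional_rho[OF f w(2)], of x] by simp
  moreover have "((\<lambda>t. \<phi> (\<rho> (rs (w a) (w b) (?r * t)) (\<rho> W x))) has_field_derivative \<phi> (mu (w a) (w b) (\<rho> W x)) * ?r) (at 0)"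
  proof -
    have "((\<lambda>t. ?r * t) has_field_derivative ?r) (at 0)" using DERIV_cmult_Id by blast
    moreover have "((\<lambda>t. \<phi> (\<rho> (rs (w a) (w b) t) (\<rho> W x))) has_field_derivative \<phi> (mu (w a) (w b) (\<rho> W x))) (at (?r * 0))"
      using mu_derivative[OF wab f] by simp
    ultimately show ?thesis using DERIV_chain'[of "\<lambda>t. ?r * t" ?r 0 UNIV] by blast
  qed
  ultimately have "\<phi> (\<rho> W (mu a b x)) = \<phi> (mu (w a) (w b) (\<rho> W x)) * ?r" by (rule DERIV_unique)
  then show "\<phi> (\<rho> W (mu a b x)) = \<phi> (s ?r (mu (w a) (w b) (\<rho> W x)))" using f by (simp add: functional)
qed

lemma monomial_rep_inj:
  assumes "monomial_rep n W w m"
  shows "\<rho> W x = 0 \<longleftrightarrow> x = 0"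
proof
  obtain W' m' where W': "monomial_rep n W' (inv' w) m'" "W * W' = 1\<^sub>m n" "W' * W = 1\<^sub>m n" using monomial_rep_inverse[OF assms] by blast
  have c: "W \<in> carrier (SL n)" "W' \<in> carrier (SL n)" using assms W' by (auto simp: monomial_rep_def)
  assume "\<rho> W x = 0"
  then have "\<rho> W' (\<rho> W x) = 0" using rho_lin(3)[OF c(2)] by simp
  then show "x = 0" using rho_mult[OF c(2,1), of x] W'(3) rho_one by simp
qed (use assms in \<open>auto simp: monomial_rep_def rho_lin\<close>)

lemma monomial_rep_SL: "monomial_rep n W w m \<Longrightarrow> W \<in> carrier (SL n)"
  unfolding monomial_rep_def by blast

end

section \<open>The specialized basis and its weights\<close>

lemma permutation_with_values:
  assumes "distinct xs" "distinct ys" "length xs = length ys" "set xs \<subseteq> S" "set ys \<subseteq> S"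
  obtains u where "u permutes S" "map u xs = ys"
proof -
  have "\<exists>u. u permutes S \<and> map u xs = ys"
    using assms(3) assms(1,2,4,5)
  proof (induction xs ys rule: list_induct2)
    case Nil
    then show ?case using permutes_id by fastforce
  next
    case (Cons x xs y ys)
    then obtain u where u: "u permutes S" "map u xs = ys" by auto
    let ?v = "Transposition.transpose (u x) y \<circ> u"
    have "?v z = u z" if "z \<in> set xs" for z
    proof -
      have "u z \<in> set ys" using u(2) that by auto
      moreover have "z \<noteq> x" using that Cons.prems by auto
      ultimately show ?thesis using Cons.prems permutes_inj[OF u(1)] by (auto dest: injD intro: transpose_apply_other)
    qed
    then have "map ?v (x # xs) = y # ys" using u(2) by (auto cong: map_cong)
    moreover have "?v permutes S"
      using Cons.prems u(1) permutes_in_image[OF u(1)] by (intro permutes_compose[OF u(1)] permutes_swap_id) auto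
    ultimately show ?case by (intro exI[of _ ?v] conjI)
  qed
  then show thesis using that by blast
qed

lemma weight_step:
  assumes w: "is_web n k (D, p)" and ab: "a \<noteq> b" and kd: "kind a b (D, p) \<noteq> 0"
  shows "weight (step a b (D, p)) j + (if j = a then 1 else 0) = weight (D, p) j + (if j = b then 1 else 0)"
proof -
  note W = is_webD[OF w]
  note pD = W(4)[rule_format]
  show ?thesis
    using kd ab W(4,3)
  proof (cases rule: step_cases)
    case relabel
    have T: "j \<in> Transposition.transpose a b ` D \<longleftrightarrow> Transposition.transpose a b j \<in> D"
      by (metis image_iff transpose_involutory)
    have E: "(Transposition.transpose a b \<circ> p \<circ> Transposition.transpose a b) j = j \<longleftrightarrow> p (Transposition.transpose a b j) = Transposition.transpose a b j"
      by (metis comp_apply transpose_involutory)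
    show ?thesis
      unfolding relabel(6) weight_def prod.case T E
      using relabel(1-4) ab by (auto simp: transpose_def)
  next
    case cup
    then show ?thesis using ab unfolding weight_def by auto
  next
    case cap
    have "p (p a) = a" "p (p b) = b" "p a \<noteq> p b" using W(3) ab by metis+
    moreover have "p a \<notin> D" "p b \<notin> D" using pD cap \<open>p (p a) = a\<close> \<open>p (p b) = b\<close> by metis+
    ultimately show ?thesis using cap ab unfolding cap(6) weight_def by auto
  qed
qed

lemma weight_sum:
  assumes w: "is_web n k \<omega>"
  shows "(\<Sum>i = 1..n. weight \<omega> i) = 2 * k"
proof -
  obtain D p where \<omega>: "\<omega> = (D, p)" by fastforce
  note W = is_webD[OF w[unfolded \<omega>]]
  have "(\<Sum>i = 1..n. weight \<omega> i) = (\<Sum>i = 1..n. (if i \<in> D then 2 else 0) + (if i \<in> moved p then 1 else 0))"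
    by (rule sum.cong) (use W(4) in \<open>auto simp: \<omega> weight_def moved_def\<close>)
  also have "\<dots> = 2 * card ({1..n} \<inter> D) + card ({1..n} \<inter> moved p)"
    by (simp add: sum.distrib sum.If_cases Int_def)
  also have "\<dots> = 2 * k" using W(1,5,9) by (simp add: Int_absorb1)
  finally show ?thesis .
qed

lemma weight_eqD:
  assumes w: "is_web n k (D, p)" "is_web n k (D', p')" and e: "\<And>i. i \<in> {1..n} \<Longrightarrow> weight (D, p) i = weight (D', p') i"
  shows "D = D'" "moved p = moved p'"
proof -
  note W = is_webD[OF w(1)] and W' = is_webD[OF w(2)]
  have "i \<in> D \<longleftrightarrow> i \<in> D'" "p i \<noteq> i \<longleftrightarrow> p' i \<noteq> i" if "i \<in> {1..n}" for i
    using e[OF that] W(4) W'(4) by (auto simp: weight_def split: if_splits)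
  then show "D = D'" "moved p = moved p'"
    using W(1,9) W'(1,9) by (auto simp: moved_def)
qed

text \<open>An involution moving at most two points is determined by the set of points it
  moves.\<close>

lemma small_web_eq:
  assumes w: "is_web n k (D, p)" "is_web n k (D', p')" and e: "\<And>i. i \<in> {1..n} \<Longrightarrow> weight (D, p) i = weight (D', p') i"
    and c: "card (moved p) \<le> 2"
  shows "(D, p) = (D', p')"
proof -
  note W = is_webD[OF w(1)] and W' = is_webD[OF w(2)]
  have m: "D = D'" "moved p = moved p'" using weight_eqD[OF w] e by blast+
  have "p i = p' i" for i
  proof (cases "i \<in> moved p")
    case True
    have i: "p i \<noteq> i" "p' i \<noteq> i" using True m(2) by (auto simp: moved_def)
    have "p (p i) \<noteq> p i" "p' (p' i) \<noteq> p' i" using i W(3) W'(3) by auto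
    then have "p i \<in> moved p" "p' i \<in> moved p" using m(2) by (auto simp: moved_def)
    then have "{i, p i, p' i} \<subseteq> moved p" using True by simp
    then have "card {i, p i, p' i} \<le> 2" using c card_mono[OF W(8)] le_trans by blast
    then show ?thesis using i by (cases "p i = p' i") auto
  next
    case False
    then have "i \<notin> moved p" "i \<notin> moved p'" using m(2) by auto
    then show ?thesis by (simp add: moved_def)
  qed
  then show ?thesis using m(1) by (simp add: fun_eq_iff)
qed

section \<open>Torus characters\<close>

definition web_char :: "nat \<Rightarrow> web \<Rightarrow> (nat \<Rightarrow> complex) \<Rightarrow> complex" where
  "web_char n \<omega> t = (\<Prod>i = 1..n. t i ^ weight \<omega> i)"

lemma web_char_step:
  assumes w: "is_web n k \<omega>" and ab: "a \<noteq> b" "a \<in> {1..n}" "b \<in> {1..n}" and kd: "kind a b \<omega> \<noteq> 0"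
  shows "web_char n (step a b \<omega>) t * t a = web_char n \<omega> t * t b"
proof -
  have delta: "(\<Prod>i = 1..n. t i ^ (if i = c then 1 else 0)) = t c" if "c \<in> {1..n}" for c
  proof -
    have "(\<Prod>i = 1..n. t i ^ (if i = c then 1 else 0)) = (\<Prod>i = 1..n. if i = c then t i else 1)"
      by (rule prod.cong) auto
    then show ?thesis using that by (simp add: prod.delta)
  qed
  obtain D p where \<omega>: "\<omega> = (D, p)" by fastforce
  have "web_char n (step a b \<omega>) t * t a = (\<Prod>i = 1..n. t i ^ (weight (step a b \<omega>) i + (if i = a then 1 else 0)))"
    unfolding power_add prod.distrib web_char_def delta[OF ab(2)] ..
  also have "\<dots> = (\<Prod>i = 1..n. t i ^ (weight \<omega> i + (if i = b then 1 else 0)))"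
    using weight_step[OF w[unfolded \<omega>] ab(1) kd[unfolded \<omega>]] unfolding \<omega> by simp
  also have "\<dots> = web_char n \<omega> t * t b"
    unfolding power_add prod.distrib web_char_def delta[OF ab(3)] ..
  finally show ?thesis .
qed

lemma prod_two_special:
  fixes f :: "nat \<Rightarrow> nat"
  assumes ab: "a \<noteq> b" "a \<in> {1..n}" "b \<in> {1..n}"
  shows "(\<Prod>i = 1..n. (if i = a then 2 else if i = b then 1 / 2 else 1 :: complex) ^ f i) = 2 ^ f a * (1 / 2) ^ f b"
proof -
  let ?g = "\<lambda>i. (if i = a then 2 else if i = b then 1 / 2 else 1 :: complex) ^ f i"
  have "prod ?g {1..n} = ?g a * (?g b * prod ?g ({1..n} - {a} - {b}))"
    using ab by (subst prod.remove[of _ a], simp, simp, subst prod.remove[of _ b]) auto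
  also have "prod ?g ({1..n} - {a} - {b}) = 1" by (rule prod.neutral) auto
  finally show ?thesis using ab by simp
qed

text \<open>On the torus of \<open>SL\<^sub>n\<close> a character determines its exponents up to a
  common constant, which the equality of the sums excludes. The differences are read off at elements
  with 2 at \<open>a\<close> and 1/2 at \<open>b\<close>.\<close>

lemma weights_of_characters:
  fixes f g :: "nat \<Rightarrow> nat"
  assumes n: "1 \<le> n" and fg: "(\<Sum>i = 1..n. f i) = (\<Sum>i = 1..n. g i)"
    and e: "\<And>t. (\<Prod>i = 1..n. t i) = 1 \<Longrightarrow> (\<Prod>i = 1..n. t i ^ f i) = (\<Prod>i = 1..n. (t i :: complex) ^ g i)"
    and a: "a \<in> {1..n}"
  shows "f a = g a"
proof -
  have eq: "f a + g b = g a + f b" if b: "b \<in> {1..n}" for b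
  proof (cases "a = b")
    case False
    let ?t = "\<lambda>i. if i = a then 2 else if i = b then 1 / 2 else 1 :: complex"
    have "(\<Prod>i = 1..n. ?t i) = 1" using prod_two_special[OF False a b, of "\<lambda>_. 1"] by simp
    from e[OF this] have "(2::complex) ^ f a * (1 / 2) ^ f b = 2 ^ g a * (1 / 2) ^ g b"
      unfolding prod_two_special[OF False a b] .
    then have "(2::complex) ^ (f a + g b) = 2 ^ (g a + f b)" by (simp add: power_add power_divide field_simps)
    then have "norm ((2::complex) ^ (f a + g b)) = norm ((2::complex) ^ (g a + f b))" by simp
    then have "(2::real) ^ (f a + g b) = 2 ^ (g a + f b)" by (simp only: norm_power norm_numeral)
    then show ?thesis by (simp add: power_inject_exp)
  qed simp
  have "(\<Sum>b = 1..n. f a + g b) = (\<Sum>b = 1..n. g a + f b)" by (rule sum.cong) (use eq in auto)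
  then have "n * f a = n * g a" using fg by (simp add: sum.distrib)
  then show ?thesis using n by simp
qed

text \<open>The positivity argument needs an ordered field. At \<open>q = 1\<close> the structure
  constants are real, so it applies to real and imaginary parts separately.\<close>

lemma primitive_multiple_of_top_complex:
  assumes "\<And>i \<omega>. i \<in> {1..<n} \<Longrightarrow> is_web n k \<omega> \<Longrightarrow> lift_step (2::complex) n k (Suc i) i c \<omega> = 0"
    and "is_web n k \<omega>" "\<omega> \<noteq> top_web k"
  shows "c \<omega> = 0"
proof -
  have c: "coef (2::complex) m = of_real (coef 2 m)" for m by (simp add: coef_def)
  have "lift_step 2 n k a b (\<lambda>\<omega>. Re (c \<omega>)) \<omega> = Re (lift_step 2 n k a b c \<omega>)" for a b \<omega>
    by (simp add: lift_step_def c)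
  then have "Re (c \<omega>) = 0"
    using primitive_multiple_of_top[of "1::real" n k "\<lambda>\<omega>. Re (c \<omega>)" \<omega>] assms by simp
  moreover have "lift_step 2 n k a b (\<lambda>\<omega>. Im (c \<omega>)) \<omega> = Im (lift_step 2 n k a b c \<omega>)" for a b \<omega>
    by (simp add: lift_step_def c)
  then have "Im (c \<omega>) = 0"
    using primitive_multiple_of_top[of "1::real" n k "\<lambda>\<omega>. Im (c \<omega>)" \<omega>] assms by simp
  ultimately show ?thesis by (simp add: complex_eq_iff)
qed

text \<open>The situation after specialization, with \<open>vb\<close> giving the images of the
  webs. A step from \<open>a\<close> to \<open>b\<close> belongs to the matrix unit with indices
  \<open>b\<close>, \<open>a\<close>, which maps the coordinate vector of \<open>a\<close> to that
  of \<open>b\<close>.\<close>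

locale web_rep = sl_rep n s \<rho> for n and s :: "complex \<Rightarrow> 'w::ab_group_add \<Rightarrow> 'w" and \<rho> +
  fixes k :: nat and vb :: "web \<Rightarrow> 'w"
  assumes k2: "2 \<le> k" and kn: "k + 2 \<le> n"
    and hw: "SL_irreducible_hw n (\<lambda>i. 2 * fundamental_weight k i) s \<rho>"
    and mu_vb: "\<And>\<omega> a b. is_web n k \<omega> \<Longrightarrow> adjacent a b \<Longrightarrow> a \<in> {1..n} \<Longrightarrow> b \<in> {1..n} \<Longrightarrow>
      matrix_unit_action n s \<rho> b a (vb \<omega>) = s (coef 2 (kind a b \<omega>)) (vb (step a b \<omega>))"
    and vb_span: "module.span s (vb ` {\<omega>. is_web n k \<omega>}) = UNIV"
    and vb_top: "vb (top_web k) \<noteq> 0"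
begin

section \<open>The webs as a basis of weight vectors\<close>

abbreviation webs :: "web set" where "webs \<equiv> {\<omega>. is_web n k \<omega>}"

lemma finite_W: "finite webs" by (rule finite_webs)

lemma adjacent_root: "adjacent a b \<Longrightarrow> a \<in> {1..n} \<Longrightarrow> b \<in> {1..n} \<Longrightarrow> root a b \<and> root b a"
  by (auto simp: adjacent_def root_def)

lemma mu_sum_vb:
  assumes i: "i \<in> {1..<n}"
  shows "mu i (Suc i) (\<Sum>\<omega>\<in>webs. s (c \<omega>) (vb \<omega>)) = (\<Sum>\<omega>\<in>webs. s (lift_step 2 n k (Suc i) i c \<omega>) (vb \<omega>))"
proof -
  have ad: "adjacent (Suc i) i" "Suc i \<in> {1..n}" "i \<in> {1..n}" using i by (auto simp: adjacent_def)
  then have r: "root i (Suc i)" using adjacent_root by blast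
  have "mu i (Suc i) (\<Sum>\<omega>\<in>webs. s (c \<omega>) (vb \<omega>)) = (\<Sum>\<omega>\<in>webs. s (coef 2 (kind (Suc i) i \<omega>) * c \<omega>) (vb (step (Suc i) i \<omega>)))"
    unfolding mu_lin(4)[OF r] by (rule sum.cong[OF refl]) (simp add: mu_lin[OF r] mu_vb[OF _ ad] mult.commute)
  also have "\<dots> = (\<Sum>\<omega>\<in>webs. s (lift_step 2 n k (Suc i) i c \<omega>) (vb \<omega>))"
    by (rule lift_step_sum[symmetric, OF ad]) (simp_all add: scale_left_distrib)
  finally show ?thesis .
qed

lemma vb_independent:
  assumes z: "(\<Sum>\<omega>\<in>webs. s (c \<omega>) (vb \<omega>)) = 0" and w: "is_web n k \<omega>"
  shows "c \<omega> = 0"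
proof (rule ccontr)
  assume nz: "c \<omega> \<noteq> 0"
  define N where "N = {c. (\<Sum>\<omega>\<in>webs. s (c \<omega>) (vb \<omega>)) = 0}"
  have stable: "lift_step 2 n k (Suc i) i c \<in> N" if "c \<in> N" "i \<in> {1..<n}" for c i
  proof -
    have "root i (Suc i)" using that(2) by (auto simp: root_def)
    then show ?thesis using that mu_sum_vb[OF that(2), of c] mu_lin(3)[of i "Suc i"] unfolding N_def by simp
  qed
 have c: "c \<in> N" using z by (simp add: N_def)
  have prim: "c \<omega> = 0" if "\<And>i \<omega>. i \<in> {1..<n} \<Longrightarrow> is_web n k \<omega> \<Longrightarrow> lift_step 2 n k (Suc i) i c \<omega> = 0" "is_web n k \<omega>" "\<omega> \<noteq> top_web k"
    for c :: "web \<Rightarrow> complex" and \<omega>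
    using that by (rule primitive_multiple_of_top_complex)
  have "\<exists>c'. c' \<in> N \<and> c' (top_web k) \<noteq> 0 \<and> (\<forall>\<omega>. is_web n k \<omega> \<longrightarrow> \<omega> \<noteq> top_web k \<longrightarrow> c' \<omega> = 0)"
  proof (rule raising_stable_top[where N = N and n = n and d = 2 and k = k and c = c and \<omega> = \<omega>])
    show "lift_step 2 n k (Suc i) i c \<in> N" if "c \<in> N" "i \<in> {1..<n}" for c i by (rule stable[OF that])
    show "c \<omega> = 0" if "\<And>i \<omega>. i \<in> {1..<n} \<Longrightarrow> is_web n k \<omega> \<Longrightarrow> lift_step 2 n k (Suc i) i c \<omega> = 0"
      "is_web n k \<omega>" "\<omega> \<noteq> top_web k" for c :: "web \<Rightarrow> complex" and \<omega> by (rule prim[OF that(1) that(2,3)])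
  qed (use c w nz in blast)+
  then obtain c' where c': "c' \<in> N" "c' (top_web k) \<noteq> 0" "\<And>\<omega>. is_web n k \<omega> \<Longrightarrow> \<omega> \<noteq> top_web k \<Longrightarrow> c' \<omega> = 0"
    by blast
  have t: "top_web k \<in> webs" using web_top[of k n] kn by simp
  have "(\<Sum>\<omega>\<in>webs. s (c' \<omega>) (vb \<omega>)) = s (c' (top_web k)) (vb (top_web k)) + (\<Sum>\<omega>\<in>webs - {top_web k}. s (c' \<omega>) (vb \<omega>))"
    by (rule sum.remove[OF finite_W t])
  also have "(\<Sum>\<omega>\<in>webs - {top_web k}. s (c' \<omega>) (vb \<omega>)) = 0"
    by (rule sum.neutral) (use c'(3) in auto)
  finally show False using c'(1,2) vb_top by (simp add: N_def)
qed

lemma vb_coords: "\<exists>c. x = (\<Sum>\<omega>\<in>webs. s (c \<omega>) (vb \<omega>))"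
proof -
  have "x \<in> span (vb ` webs)" using vb_span by simp
  then show ?thesis
  proof (induction rule: span_induct_alt)
    case base
    show ?case by (rule exI[of _ "\<lambda>_. 0"]) simp
  next
    case (step c x y)
    then obtain d \<mu> where y: "y = (\<Sum>\<omega>\<in>webs. s (d \<omega>) (vb \<omega>))" and m: "\<mu> \<in> webs" "x = vb \<mu>" by blast
    have "s c x = (\<Sum>\<omega>\<in>webs. s (if \<omega> = \<mu> then c else 0) (vb \<omega>))"
      using m finite_W by (simp add: if_distrib[of "\<lambda>t. s t _"] sum.delta cong: if_cong)
    then have "s c x + y = (\<Sum>\<omega>\<in>webs. s ((if \<omega> = \<mu> then c else 0) + d \<omega>) (vb \<omega>))"
      by (simp only: y scale_left_distrib sum.distrib)
    then show ?case by (rule exI[of _ "\<lambda>\<omega>. (if \<omega> = \<mu> then c else 0) + d \<omega>"])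
  qed
qed

lemma vb_coords_unique:
  assumes "(\<Sum>\<omega>\<in>webs. s (c \<omega>) (vb \<omega>)) = (\<Sum>\<omega>\<in>webs. s (d \<omega>) (vb \<omega>))" "is_web n k \<omega>"
  shows "c \<omega> = d \<omega>"
  using vb_independent[of "\<lambda>\<omega>. c \<omega> - d \<omega>" \<omega>] assms by (simp add: scale_left_diff_distrib sum_subtractf)

lemma vb_single: "is_web n k \<mu> \<Longrightarrow> s c (vb \<mu>) = (\<Sum>\<omega>\<in>webs. s (if \<omega> = \<mu> then c else 0) (vb \<omega>))"
  using finite_W by (simp add: if_distrib[of "\<lambda>t. s t _"] sum.delta cong: if_cong)

lemma vb_scaled_eqD:
  assumes "is_web n k \<omega>" "is_web n k \<omega>'" "s c (vb \<omega>) = s c' (vb \<omega>')" "c \<noteq> 0"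
  shows "\<omega> = \<omega>'" "c = c'"
proof -
  have "(if \<omega> = \<omega> then c else 0) = (if \<omega> = \<omega>' then c' else 0)"
    by (rule vb_coords_unique[of "\<lambda>\<mu>. if \<mu> = \<omega> then c else 0" "\<lambda>\<mu>. if \<mu> = \<omega>' then c' else 0"])
      (use assms vb_single in auto)
  then show "\<omega> = \<omega>'" "c = c'" using assms(4) by (auto split: if_splits)
qed

lemma vb_nz: "is_web n k \<omega> \<Longrightarrow> vb \<omega> \<noteq> 0"
  using vb_scaled_eqD(2)[of \<omega> \<omega> 1 0] by auto

lemma vb_inj: "inj_on vb webs"
  using vb_scaled_eqD(1)[of _ _ 1 1] by (auto intro!: inj_onI)

text \<open>A vector fixed by the upper unitriangular matrices is killed by all
  \<open>E\<^sub>i\<close>, hence is a multiple of the top web vector. So the highest weight can be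
  read off on the latter.\<close>

lemma torus_top:
  assumes t: "(\<Prod>i = 1..n. t i) = 1"
  shows "\<rho> (diag_elt n t) (vb (top_web k)) = s (web_char n (top_web k) t) (vb (top_web k))"
proof -
  obtain v where v: "v \<noteq> 0"
    and U: "\<And>A. A \<in> carrier (SL n) \<Longrightarrow> upper_triangular A \<Longrightarrow> (\<forall>i<n. A $$ (i, i) = 1) \<Longrightarrow> \<rho> A v = v"
    and T: "\<And>t. (\<Prod>i = 1..n. t i) = 1 \<Longrightarrow> \<rho> (diag_elt n t) v = s (torus_character n (\<lambda>i. 2 * fundamental_weight k i) t) v"
    using hw unfolding SL_irreducible_hw_def by blast
  have mu0: "mu i (Suc i) v = 0" if i: "i \<in> {1..<n}" for i
  proof (rule mu_eqI)
    show r: "root i (Suc i)" using i by (auto simp: root_def)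
    fix \<phi> assume f: "functional s \<phi>"
    have "\<rho> (rs i (Suc i) t) v = v" for t
      by (rule U[OF rs_in[OF r]]) (auto simp: root_subgroup_def upper_triangular_def)
    moreover have "\<phi> 0 = 0" using functional_sum[OF f, of "\<lambda>_. 0" "{}"] by simp
    ultimately show "((\<lambda>t. \<phi> (\<rho> (rs i (Suc i) t) v)) has_field_derivative \<phi> 0) (at 0)" by simp
  qed
  obtain c where c: "v = (\<Sum>\<omega>\<in>webs. s (c \<omega>) (vb \<omega>))" using vb_coords by blast
  have l: "lift_step 2 n k (Suc i) i c \<omega> = 0" if "i \<in> {1..<n}" "is_web n k \<omega>" for i \<omega>
    by (rule vb_independent[OF _ that(2)]) (use mu_sum_vb[OF that(1), of c] mu0[OF that(1)] c in simp)
  have t0: "top_web k \<in> webs" using web_top[of k n] kn by simp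
  have "v = s (c (top_web k)) (vb (top_web k)) + (\<Sum>\<omega>\<in>webs - {top_web k}. s (c \<omega>) (vb \<omega>))"
    unfolding c by (rule sum.remove[OF finite_W t0])
  also have "(\<Sum>\<omega>\<in>webs - {top_web k}. s (c \<omega>) (vb \<omega>)) = 0"
    by (rule sum.neutral) (use primitive_multiple_of_top_complex[OF l] in auto)
  finally have vt: "v = s (c (top_web k)) (vb (top_web k))" by simp
  then have cn: "c (top_web k) \<noteq> 0" using v by auto
  have web_char: "torus_character n (\<lambda>i. 2 * fundamental_weight k i) t = web_char n (top_web k) t"
  proof -
    have "torus_character n (\<lambda>i. 2 * fundamental_weight k i) t = (\<Prod>j = 1..<n. if j = k then (\<Prod>i = 1..j. t i) ^ 2 else 1)"
      unfolding torus_character_def by (rule prod.cong) (auto simp: fundamental_weight_def)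
    also have "\<dots> = (\<Prod>i = 1..k. t i ^ 2)" using k2 kn by (subst prod.delta) (auto simp: prod_power_distrib)
    also have "\<dots> = (\<Prod>i = 1..k. t i ^ weight (top_web k) i)" by (rule prod.cong) (auto simp: weight_def top_web_def)
    also have "\<dots> = web_char n (top_web k) t"
      unfolding web_char_def by (rule prod.mono_neutral_left) (use kn in \<open>auto simp: weight_def top_web_def\<close>)
    finally show ?thesis .
  qed
  have dS: "diag_elt n t \<in> carrier (SL n)" using monomial_rep_SL[OF monomial_rep_diag[OF t]] .
  have "s (c (top_web k)) (\<rho> (diag_elt n t) (vb (top_web k))) = s (c (top_web k)) (s (web_char n (top_web k) t) (vb (top_web k)))"
    using T[OF t] unfolding vt rho_lin(2)[OF dS] web_char by (simp add: mult.commute)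
  then show ?thesis using cn by (simp only: scale_left_imp_eq scale_cancel_left) simp
qed

lemma torus_step:
  assumes t: "(\<Prod>i = 1..n. t i) = 1" and w: "is_web n k \<omega>" and ab: "adjacent a b" "a \<in> {1..n}" "b \<in> {1..n}"
    and kd: "kind a b \<omega> \<noteq> 0" and ih: "\<rho> (diag_elt n t) (vb \<omega>) = s (web_char n \<omega> t) (vb \<omega>)"
  shows "\<rho> (diag_elt n t) (vb (step a b \<omega>)) = s (web_char n (step a b \<omega>) t) (vb (step a b \<omega>))"
proof -
  note md = monomial_rep_diag[OF t]
  have ba: "root b a" and ne: "a \<noteq> b" using adjacent_root[OF ab] by (auto simp: root_def)
  let ?K = "coef 2 (kind a b \<omega>) :: complex"
  have K: "?K \<noteq> 0" using kd by (simp add: coef_def)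
  have ta: "t a \<noteq> 0" using md ab(2) unfolding monomial_rep_def by blast
  have "s ?K (\<rho> (diag_elt n t) (vb (step a b \<omega>))) = \<rho> (diag_elt n t) (mu b a (vb \<omega>))"
    unfolding mu_vb[OF w ab] rho_lin(2)[OF monomial_rep_SL[OF md]] ..
  also have "\<dots> = s (t b / t a) (mu b a (s (web_char n \<omega> t) (vb \<omega>)))"
    unfolding equivariance[OF md ba] id_apply ih ..
  also have "\<dots> = s ?K (s (web_char n \<omega> t * t b / t a) (vb (step a b \<omega>)))"
    unfolding mu_lin(2)[OF ba] mu_vb[OF w ab] by (simp add: mult.commute mult.left_commute)
  also have "web_char n \<omega> t * t b / t a = web_char n (step a b \<omega>) t"
    using web_char_step[OF w ne ab(2,3) kd, of t] ta by (simp add: field_simps)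
  finally show ?thesis using K by (simp only: scale_cancel_left) simp
qed

lemma torus_vb:
  assumes t: "(\<Prod>i = 1..n. t i) = 1" and w: "is_web n k \<omega>"
  shows "\<rho> (diag_elt n t) (vb \<omega>) = s (web_char n \<omega> t) (vb \<omega>)"
  using w
proof (induction rule: web_induct)
  case top
  then show ?case by (rule torus_top[OF t])
next
  case (step i \<omega>)
  show ?case by (rule torus_step[OF t step(2)]) (use step in \<open>auto simp: adjacent_def\<close>)
next
  case (double i \<omega> \<omega>1)
  show ?case by (rule torus_step[OF t double(6)]) (use double in \<open>auto simp: adjacent_def\<close>)
qed

text \<open>\<open>diag_elt n t * W\<close> equals \<open>W * diag_elt n (t \<circ> w)\<close>, so
  every web occurring in the image has the permuted character, and the exponents can be
  compared.\<close>

lemma image_weight: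
  assumes W: "monomial_rep n W w m" and \<omega>: "is_web n k \<omega>" and c: "\<rho> W (vb \<omega>) = (\<Sum>\<mu>\<in>webs. s (c \<mu>) (vb \<mu>))"
    and \<mu>: "is_web n k \<mu>" "c \<mu> \<noteq> 0" and i: "i \<in> {1..n}"
  shows "weight \<mu> (w i) = weight \<omega> i"
proof -
  have w: "w permutes {1..n}" and Wm: "W = monomial_mat n w m" using W by (auto simp: monomial_rep_def)
  have iw: "inv' w permutes {1..n}" by (rule permutes_inv[OF w])
  have wi: "inv' w (w j) = j" for j using permutes_inverses[OF w] by simp
  have web_char_w: "web_char n \<omega> (t \<circ> w) = (\<Prod>i = 1..n. t i ^ weight \<omega> (inv' w i))" for t
    unfolding web_char_def using prod.permute[OF w, of "\<lambda>i. t i ^ weight \<omega> (inv' w i)"] by (simp add: wi o_def)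
  have "weight \<mu> (w i) = weight \<omega> (inv' w (w i))"
  proof (rule weights_of_characters[of n "weight \<mu>" "\<lambda>j. weight \<omega> (inv' w j)"])
    show "(\<Sum>i = 1..n. weight \<mu> i) = (\<Sum>i = 1..n. weight \<omega> (inv' w i))"
      using sum.permute[OF iw, of "weight \<omega>"] weight_sum[OF \<mu>(1)] weight_sum[OF \<omega>] by (simp add: o_def)
    show "w i \<in> {1..n}" using permutes_in_image[OF w] i by blast
    show "1 \<le> n" using i by simp
    fix t :: "nat \<Rightarrow> complex" assume t: "(\<Prod>i = 1..n. t i) = 1"
    have tw: "(\<Prod>i = 1..n. (t \<circ> w) i) = 1" using t prod.permute[OF w, of t] by simp
    have com: "diag_elt n t * W = W * diag_elt n (t \<circ> w)"
      unfolding Wm monomial_mat_id[symmetric] monomial_mat_mult[OF w] monomial_mat_mult[OF permutes_id] by (simp add: mult.commute)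
    have "\<rho> (diag_elt n t) (\<rho> W (vb \<omega>)) = \<rho> W (\<rho> (diag_elt n (t \<circ> w)) (vb \<omega>))"
      using com rho_mult[OF monomial_rep_SL[OF monomial_rep_diag[OF t]] monomial_rep_SL[OF W]] rho_mult[OF monomial_rep_SL[OF W] monomial_rep_SL[OF monomial_rep_diag[OF tw]]]
      by metis
    then have "(\<Sum>\<nu>\<in>webs. s (c \<nu> * web_char n \<nu> t) (vb \<nu>)) = (\<Sum>\<nu>\<in>webs. s (web_char n \<omega> (t \<circ> w) * c \<nu>) (vb \<nu>))"
      unfolding torus_vb[OF tw \<omega>] rho_lin(2)[OF monomial_rep_SL[OF W]] c rho_lin(4)[OF monomial_rep_SL[OF monomial_rep_diag[OF t]]] scale_sum_right
      by (simp add: rho_lin(2)[OF monomial_rep_SL[OF monomial_rep_diag[OF t]]] torus_vb[OF t])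
    from vb_coords_unique[OF this \<mu>(1)] have "web_char n \<mu> t = web_char n \<omega> (t \<circ> w)" using \<mu>(2) by simp
    then show "(\<Prod>i = 1..n. t i ^ weight \<mu> i) = (\<Prod>i = 1..n. t i ^ weight \<omega> (inv' w i))"
      unfolding web_char_w by (simp add: web_char_def)
  qed
  then show ?thesis by (simp add: wi)
qed

lemma image_weight_single:
  assumes W: "monomial_rep n W w m" and \<omega>: "is_web n k \<omega>" "\<rho> W (vb \<omega>) = s c (vb \<mu>)" "c \<noteq> 0" "is_web n k \<mu>" and i: "i \<in> {1..n}"
  shows "weight \<mu> (w i) = weight \<omega> i"
  by (rule image_weight[OF W \<omega>(1) _ \<omega>(4) _ i, of "\<lambda>\<omega>. if \<omega> = \<mu> then c else 0"])
    (use \<omega> vb_single in auto)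

section \<open>Sufficiency of preserving neighbours\<close>

definition sends_to_web :: "complex mat \<Rightarrow> web \<Rightarrow> bool" where
  "sends_to_web W \<omega> \<longleftrightarrow> (\<exists>\<omega>' c. is_web n k \<omega>' \<and> c \<noteq> 0 \<and> \<rho> W (vb \<omega>) = s c (vb \<omega>'))"

lemma sends_to_web_small:
  assumes W: "monomial_rep n W w m" and \<omega>: "is_web n k (D, p)" "card (moved p) \<le> 2"
  shows "sends_to_web W (D, p)"
proof -
  have w: "w permutes {1..n}" using W by (auto simp: monomial_rep_def)
  obtain c where c: "\<rho> W (vb (D, p)) = (\<Sum>\<mu>\<in>webs. s (c \<mu>) (vb \<mu>))" using vb_coords by blast
  have "\<rho> W (vb (D, p)) \<noteq> 0" using monomial_rep_inj[OF W] vb_nz[OF \<omega>(1)] by simp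
  then have "\<exists>\<mu>\<in>webs. c \<mu> \<noteq> 0" unfolding c by (metis (mono_tags, lifting) scale_zero_left sum.neutral)
  then obtain D' p' where \<mu>: "is_web n k (D', p')" "c (D', p') \<noteq> 0" by auto
  note wt = image_weight[OF W \<omega>(1) c]
  have "w ` moved p = moved p'"
  proof -
    have iff: "p' (w i) \<noteq> w i \<longleftrightarrow> p i \<noteq> i" if "i \<in> {1..n}" for i
      using wt[OF \<mu> that] is_webD(4)[OF \<mu>(1)] is_webD(4)[OF \<omega>(1)] by (auto simp: weight_def split: if_splits)
    then have "{i \<in> {1..n}. p' i \<noteq> i} \<subseteq> w ` {i \<in> {1..n}. p i \<noteq> i}" "w ` {i \<in> {1..n}. p i \<noteq> i} \<subseteq> {i \<in> {1..n}. p' i \<noteq> i}"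
    proof -
      show "w ` {i \<in> {1..n}. p i \<noteq> i} \<subseteq> {i \<in> {1..n}. p' i \<noteq> i}"
        by (rule image_subsetI) (use iff permutes_in_image[OF w] in simp)
      show "{i \<in> {1..n}. p' i \<noteq> i} \<subseteq> w ` {i \<in> {1..n}. p i \<noteq> i}"
      proof
        fix j assume j: "j \<in> {i \<in> {1..n}. p' i \<noteq> i}"
        then have "j \<in> w ` {1..n}" using permutes_image[OF w] by simp
        then obtain i where i: "i \<in> {1..n}" "j = w i" by (elim imageE) simp
        then show "j \<in> w ` {i \<in> {1..n}. p i \<noteq> i}" using j iff[OF i(1)] by simp
      qed
    qed
    then have "w ` {i \<in> {1..n}. p i \<noteq> i} = {i \<in> {1..n}. p' i \<noteq> i}" by (rule equalityI[rotated])
    moreover have "{i \<in> {1..n}. p i \<noteq> i} = moved p" "{i \<in> {1..n}. p' i \<noteq> i} = moved p'"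
      using is_webD(9)[OF \<omega>(1)] is_webD(9)[OF \<mu>(1)] by (auto simp: moved_def)
    ultimately show ?thesis by simp
  qed
  then have small: "card (moved p') \<le> 2" using \<omega>(2) card_image_le[OF is_webD(8)[OF \<omega>(1)], of w] by simp
  have "c \<nu> = 0" if \<nu>: "\<nu> \<in> webs" "\<nu> \<noteq> (D', p')" for \<nu>
  proof (rule ccontr)
    assume nz: "c \<nu> \<noteq> 0"
    have "weight (D', p') j = weight \<nu> j" if "j \<in> {1..n}" for j
    proof -
      have "j \<in> w ` {1..n}" using \<open>j \<in> {1..n}\<close> permutes_image[OF w] by simp
      then obtain i where "i \<in> {1..n}" "j = w i" by (elim imageE) simp
      then show ?thesis using wt[OF \<mu>] wt[of \<nu>] \<nu> nz by simp
    qed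
    then have "(D', p') = \<nu>" using small_web_eq[OF \<mu>(1), of "fst \<nu>" "snd \<nu>"] small \<nu> by simp
    then show False using \<nu> by simp
  qed
  then have "(\<Sum>\<mu>\<in>webs. s (c \<mu>) (vb \<mu>)) = (\<Sum>\<mu>\<in>webs. s (if \<mu> = (D', p') then c (D', p') else 0) (vb \<mu>))"
    by (intro sum.cong refl) auto
  then have "\<rho> W (vb (D, p)) = s (c (D', p')) (vb (D', p'))" using c vb_single[OF \<mu>(1)] by simp
  then show ?thesis using \<mu> unfolding sends_to_web_def by blast
qed

lemma image_small:
  assumes W: "monomial_rep n W w m" and \<omega>: "is_web n k (D, p)" "card (moved p) \<le> 2" and \<mu>: "is_web n k (D', p')" "card (moved p') \<le> 2"
    and e: "\<And>i. i \<in> {1..n} \<Longrightarrow> weight (D', p') (w i) = weight (D, p) i"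
  obtains c where "c \<noteq> 0" "\<rho> W (vb (D, p)) = s c (vb (D', p'))"
proof -
  have w: "w permutes {1..n}" using W by (auto simp: monomial_rep_def)
  obtain \<nu> c where \<nu>: "is_web n k \<nu>" "c \<noteq> 0" "\<rho> W (vb (D, p)) = s c (vb \<nu>)" using sends_to_web_small[OF W \<omega>] unfolding sends_to_web_def by blast
  have "weight (D', p') j = weight \<nu> j" if "j \<in> {1..n}" for j
  proof -
    have "j \<in> w ` {1..n}" using \<open>j \<in> {1..n}\<close> permutes_image[OF w] by simp
    then obtain i where "i \<in> {1..n}" "j = w i" by (elim imageE) simp
    then show ?thesis using image_weight_single[OF W \<omega>(1) \<nu>(3,2,1)] e by simp
  qed
  then have "(D', p') = \<nu>" using small_web_eq[OF \<mu>(1), of "fst \<nu>" "snd \<nu>"] \<mu>(2) \<nu>(1) by simp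
  then show thesis using that \<nu> by blast
qed

text \<open>If \<open>w a\<close> and \<open>w b\<close> are neighbours, the image web undergoes a
  step as well. Injectivity of the action of \<open>W\<close> excludes that the structure constant
  there is 0.\<close>

lemma sends_to_web_step:
  assumes W: "monomial_rep n W w m" and \<omega>: "is_web n k \<omega>" "sends_to_web W \<omega>" and ab: "adjacent a b" "a \<in> {1..n}" "b \<in> {1..n}"
    and wab: "adjacent (w a) (w b)" and kd: "kind a b \<omega> \<noteq> 0"
  shows "sends_to_web W (step a b \<omega>)"
proof -
  have w: "w permutes {1..n}" and mab: "m a \<noteq> 0" "m b \<noteq> 0" using W ab by (auto simp: monomial_rep_def)
  have win: "w a \<in> {1..n}" "w b \<in> {1..n}" using permutes_in_image[OF w] ab by blast+
  note WS = monomial_rep_SL[OF W]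
  obtain \<omega>' c where \<omega>': "is_web n k \<omega>'" "c \<noteq> 0" "\<rho> W (vb \<omega>) = s c (vb \<omega>')" using \<omega>(2) unfolding sends_to_web_def by blast
  have r: "root b a" "root (w b) (w a)" using adjacent_root ab wab win by blast+
  let ?K = "coef 2 (kind a b \<omega>) :: complex" and ?K' = "coef 2 (kind (w a) (w b) \<omega>') :: complex"
  let ?c = "m b / m a * (c * ?K')"
  have K: "?K \<noteq> 0" using kd by (simp add: coef_def)
  have st: "is_web n k (step a b \<omega>)" using web_step[OF \<omega>(1) ab(2,3,1) kd] .
  have "s ?K (\<rho> W (vb (step a b \<omega>))) = \<rho> W (mu b a (vb \<omega>))"
    unfolding mu_vb[OF \<omega>(1) ab] rho_lin(2)[OF WS] ..
  also have "\<dots> = s ?c (vb (step (w a) (w b) \<omega>'))"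
    unfolding equivariance[OF W r(1)] \<omega>'(3) mu_lin(2)[OF r(2)] mu_vb[OF \<omega>'(1) wab win] by simp
  finally have e: "s ?K (\<rho> W (vb (step a b \<omega>))) = s ?c (vb (step (w a) (w b) \<omega>'))" .
  have "\<rho> W (vb (step a b \<omega>)) \<noteq> 0" using monomial_rep_inj[OF W] vb_nz[OF st] by simp
  then have "s ?K (\<rho> W (vb (step a b \<omega>))) \<noteq> 0" using K by simp
  then have c: "?c \<noteq> 0" using e by auto
  then have kd': "kind (w a) (w b) \<omega>' \<noteq> 0" unfolding coef_def by (metis mult_zero_right)
  have "\<rho> W (vb (step a b \<omega>)) = s (inverse ?K) (s ?K (\<rho> W (vb (step a b \<omega>))))" using K by simp
  also have "\<dots> = s (inverse ?K * ?c) (vb (step (w a) (w b) \<omega>'))" unfolding e by simp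
  finally show ?thesis
    unfolding sends_to_web_def using c K web_step[OF \<omega>'(1) win wab kd'] by (intro exI conjI) auto
qed

definition good :: "(nat \<Rightarrow> nat) \<Rightarrow> bool" where
  "good w \<longleftrightarrow> (\<forall>W m \<omega>. monomial_rep n W w m \<longrightarrow> is_web n k \<omega> \<longrightarrow> sends_to_web W \<omega>)"

lemma good_of_adjacent:
  assumes ad: "\<And>i. i \<in> {1..<n - 1} \<Longrightarrow> adjacent (w i) (w (Suc i))"
  shows "good w"
  unfolding good_def
proof (rule allI, rule allI, rule allI, rule impI, rule impI)
  fix W m \<omega> assume W: "monomial_rep n W w m" and w: "is_web n k \<omega>"
  show "sends_to_web W \<omega>" using w
  proof (induction rule: web_induct_butlast)
    case (base D p)
    have "card (moved p) \<le> card {p n, n}" by (rule card_mono[OF _ base(2)]) simp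
    also have "\<dots> \<le> 2" by (simp add: card_insert_if)
    finally show ?case by (rule sends_to_web_small[OF W base(1)])
  next
    case (step i \<omega>)
    show ?case by (rule sends_to_web_step[OF W step(2)]) (use step ad in \<open>auto simp: adjacent_def\<close>)
  next
    case (double i \<omega> \<omega>1)
    show ?case by (rule sends_to_web_step[OF W double(6)]) (use double ad in \<open>auto simp: adjacent_def\<close>)
  qed
qed

text \<open>Split \<open>W\<close> into a representative of \<open>w\<close> times a representative
  of \<open>w'\<close>. The factors are not under control, which is why \<open>good\<close> speaks
  of all representatives.\<close>

lemma good_compose:
  assumes g: "good w" "good w'" and w': "w' permutes {1..n}"
  shows "good (w \<circ> w')"
  unfolding good_def
proof (rule allI, rule allI, rule allI, rule impI, rule impI)
  fix W m \<omega> assume W: "monomial_rep n W (w \<circ> w') m" and \<omega>: "is_web n k \<omega>"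
  have "1 \<le> n" using kn by simp
  then obtain V v where V: "monomial_rep n V w' v" using monomial_rep_exists[OF w'] by blast
  obtain V' v' where V': "monomial_rep n V' (inv' w') v'" "V * V' = 1\<^sub>m n" "V' * V = 1\<^sub>m n" using monomial_rep_inverse[OF V] by blast
  have c: "W \<in> carrier_mat n n" "V \<in> carrier_mat n n" "V' \<in> carrier_mat n n"
    using monomial_rep_SL[OF W] monomial_rep_SL[OF V] monomial_rep_SL[OF V'(1)] by (auto simp: SL_simps)
  have "w \<circ> w' \<circ> inv' w' = w" using permutes_inverses[OF w'] by (simp add: fun_eq_iff)
  then obtain x where X: "monomial_rep n (W * V') w x" using monomial_rep_mult[OF W V'(1)] by metis
  have "W = (W * V') * V" using c V'(3) by (simp add: assoc_mult_mat[of W n n V' n V n])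
  then have "\<rho> W (vb \<omega>) = \<rho> (W * V') (\<rho> V (vb \<omega>))" using rho_mult[OF monomial_rep_SL[OF X] monomial_rep_SL[OF V]] by metis
  moreover obtain \<omega>1 c1 where 1: "is_web n k \<omega>1" "c1 \<noteq> 0" "\<rho> V (vb \<omega>) = s c1 (vb \<omega>1)" using g(2) V \<omega> unfolding good_def sends_to_web_def by blast
  moreover obtain \<omega>2 c2 where 2: "is_web n k \<omega>2" "c2 \<noteq> 0" "\<rho> (W * V') (vb \<omega>1) = s c2 (vb \<omega>2)" using g(1) X 1 unfolding good_def sends_to_web_def by blast
  ultimately have "\<rho> W (vb \<omega>) = s (c1 * c2) (vb \<omega>2)" by (simp add: rho_lin(2)[OF monomial_rep_SL[OF X]])
  then show "sends_to_web W \<omega>" unfolding sends_to_web_def using 1 2 by (intro exI[of _ \<omega>2] exI[of _ "c1 * c2"]) simp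
qed

lemma good_id: "good id"
  by (rule good_of_adjacent) (simp add: adjacent_def)

end

section \<open>Cyclic adjacency\<close>

definition web1 :: "nat \<Rightarrow> nat \<Rightarrow> nat set \<Rightarrow> web" where
  "web1 c d D = (D, id(c := d, d := c))"

definition web2 :: "nat \<Rightarrow> nat \<Rightarrow> nat \<Rightarrow> nat \<Rightarrow> nat set \<Rightarrow> web" where
  "web2 a b c d D = (D, id(a := b, b := a, c := d, d := c))"

definition between :: "nat \<Rightarrow> nat \<Rightarrow> nat \<Rightarrow> bool" where
  "between a b x \<longleftrightarrow> (a < x \<and> x < b) \<or> (b < x \<and> x < a)"

text \<open>The data of a weight that has exactly two webs: four singly occupied sites and
  \<open>k - 2\<close> doubled ones.\<close>

definition quad :: "nat \<Rightarrow> nat \<Rightarrow> nat \<Rightarrow> nat \<Rightarrow> nat \<Rightarrow> nat \<Rightarrow> nat set \<Rightarrow> bool" where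
  "quad n k a b c d D \<longleftrightarrow> distinct [a, b, c, d] \<and> a \<in> {1..n} \<and> b \<in> {1..n} \<and> c \<in> {1..n} \<and> d \<in> {1..n} \<and>
     D \<subseteq> {1..n} \<and> finite D \<and> a \<notin> D \<and> b \<notin> D \<and> c \<notin> D \<and> d \<notin> D \<and> card D + 2 = k"

lemma is_web1:
  assumes q: "quad n k a b c d D"
  shows "is_web n k (web1 c d (insert a D))"
proof -
  have "id(c := d, d := c) permutes {1..n}" using q by (intro involution_permutes) (auto simp: quad_def)
  moreover have "moved (id(c := d, d := c)) = {c, d}" using q by (auto simp: moved_def quad_def)
  moreover have "noncrossing (id(c := d, d := c))" by (auto simp: noncrossing_def)
  moreover have "card (insert a D) = k - 1" "card {c, d} = 2" using q by (auto simp: quad_def)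
  ultimately show ?thesis using q unfolding is_web_def web1_def quad_def by auto
qed

lemma moved_web2:
  assumes q: "quad n k a b c d D"
  shows "moved (id(a := b, b := a, c := d, d := c)) = {a, b, c, d}"
proof -
  have ne: "a \<noteq> b" "a \<noteq> c" "a \<noteq> d" "b \<noteq> c" "b \<noteq> d" "c \<noteq> d" using q by (auto simp: quad_def)
  have "x \<in> moved (id(a := b, b := a, c := d, d := c)) \<longleftrightarrow> x \<in> {a, b, c, d}" for x
    using ne by (cases "x = a"; cases "x = b"; cases "x = c"; cases "x = d") (simp_all add: moved_def)
  then show ?thesis by blast
qed

lemma weight_web2:
  assumes q: "quad n k a b c d D"
  shows "weight (web2 a b c d D) x = (if x \<in> D then 2 else if x \<in> {a, b, c, d} then 1 else 0)"
  unfolding moved_web2[OF q, symmetric] by (simp add: web2_def weight_def moved_def)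

text \<open>The second hypothesis puts \<open>c\<close> and \<open>d\<close> on the same side of the
  arc from \<open>a\<close> to \<open>b\<close>.\<close>

lemma is_web2:
  assumes q: "quad n k a b c d D" and nc: "between a b c \<longleftrightarrow> between a b d"
  shows "is_web n k (web2 a b c d D)"
proof -
  define p where "p = id(a := b, b := a, c := d, d := c)"
  have ne: "a \<noteq> b" "a \<noteq> c" "a \<noteq> d" "b \<noteq> c" "b \<noteq> d" "c \<noteq> d" using q by (auto simp: quad_def)
  have P: "p a = b" "p b = a" "p c = d" "p d = c" using ne by (auto simp: p_def)
  have P': "x = a \<or> x = b \<or> x = c \<or> x = d \<or> p x = x" for x by (auto simp: p_def)
  have inv: "p (p x) = x" for x using P'[of x] P by auto
  have 1: "p permutes {1..n}" using q inv by (intro involution_permutes) (auto simp: quad_def p_def)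
  have 2: "moved p = {a, b, c, d}" using moved_web2[OF q] by (simp add: p_def)
  have 3: "noncrossing p"
    unfolding noncrossing_def
  proof (intro allI impI)
    fix i j assume ij: "i < j" "j < p i"
    have P2: "x = a \<and> p x = b \<or> x = b \<and> p x = a \<or> x = c \<and> p x = d \<or> x = d \<and> p x = c \<or> p x = x" for x
      using P'[of x] P by blast
    have "i < pj \<and> pj < pi"
      if "i = a \<and> pi = b \<or> i = b \<and> pi = a \<or> i = c \<and> pi = d \<or> i = d \<and> pi = c \<or> pi = i"
        "j = a \<and> pj = b \<or> j = b \<and> pj = a \<or> j = c \<and> pj = d \<or> j = d \<and> pj = c \<or> pj = j" "i < j" "j < pi" for pi pj
      using that nc[unfolded between_def] ne by (elim disjE conjE; hypsubst; presburger)
    from this[OF P2 P2 ij] show "i < p j \<and> p j < p i" .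
  qed
  have 4: "\<forall>i\<in>D. p i = i" using q by (auto simp: p_def quad_def)
  have 5: "card {a, b, c, d} = 4" using ne by simp
  show ?thesis using 1 2 3 4 5 inv q unfolding is_web_def web2_def p_def[symmetric] quad_def by simp
qed

lemma quad_image:
  assumes q: "quad n k a b c d D" and v: "v permutes {1..n}"
  shows "quad n k (v a) (v b) (v c) (v d) (v ` D)"
proof -
  have i: "inj v" using permutes_inj[OF v] .
  have "v ` D \<subseteq> {1..n}" using q permutes_image[OF v] unfolding quad_def by (metis image_mono)
  moreover have "card (v ` D) = card D" using card_image[OF inj_on_subset[OF i subset_UNIV], of D] .
  ultimately show ?thesis
    using q unfolding quad_def by (simp add: inj_image_mem_iff[OF i] inj_eq[OF i] permutes_in_image[OF v] del: atLeastAtMost_iff One_nat_def)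
qed

lemma cup_web1:
  assumes "distinct [a, b, c, d]" "a \<notin> D" "b \<notin> D"
  shows "kind a b (web1 c d (insert a D)) = 1" "step a b (web1 c d (insert a D)) = web2 a b c d D"
  using assms by (auto simp: web1_def web2_def kind_def step_def)

lemma web2_swap: "distinct [a, b, c, d] \<Longrightarrow> web2 c d a b D = web2 a b c d D"
  "distinct [a, b, c, d] \<Longrightarrow> web2 b a c d D = web2 a b c d D" "distinct [a, b, c, d] \<Longrightarrow> web2 a b d c D = web2 a b c d D"
  by (auto simp: web2_def)

lemma web1_swap: "web1 c d D = web1 d c D"
  by (auto simp: web1_def)

lemma weight_web1_image:
  assumes w: "w permutes {1..n}" and cd: "c \<noteq> d"
  shows "weight (web1 (w c) (w d) (w ` D)) (w i) = weight (web1 c d D) i"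
  using permutes_inj[OF w] cd by (auto simp: web1_def weight_def inj_image_mem_iff inj_eq)

lemma moved_web1: "card (moved (id(c := d, d := c :: nat))) \<le> 2"
proof -
  have "card (moved (id(c := d, d := c))) \<le> card {c, d}" by (rule card_mono) (auto simp: moved_def)
  also have "\<dots> \<le> 2" by (simp add: card_insert_if)
  finally show ?thesis .
qed

lemma monomial_rep_same:
  assumes "monomial_rep n W w m" "monomial_rep n W' w m'"
  obtains t where "(\<Prod>i = 1..n. t i) = 1" "W = W' * diag_elt n t" "\<And>i. i \<in> {1..n} \<Longrightarrow> t i \<noteq> 0"
proof -
  let ?t = "\<lambda>j. m j / m' j"
  have a: "W = monomial_mat n w m" "W' = monomial_mat n w m'" "\<And>i. i \<in> {1..n} \<Longrightarrow> m i \<noteq> 0 \<and> m' i \<noteq> 0" "det W = 1" "det W' = 1"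
    using assms by (auto simp: monomial_rep_def SL_simps)
  have W: "W = W' * diag_elt n ?t"
    unfolding a(1,2) monomial_mat_id[symmetric] monomial_mat_mult[OF permutes_id] by (rule monomial_mat_cong) (use a(3) in auto)
  have "det (W' * diag_elt n ?t) = det W' * det (diag_elt n ?t)"
    unfolding a(2) monomial_mat_id[symmetric] by (rule det_mult[of _ n]) auto
  then have "(\<Prod>i = 1..n. ?t i) = 1" using W a(4,5) det_diag[of n ?t] by (simp add: monomial_mat_id)
  then show thesis using that[of ?t] W a(3) by simp
qed

definition cyc_adjacent :: "nat \<Rightarrow> nat \<Rightarrow> nat \<Rightarrow> bool" where
  "cyc_adjacent n p q \<longleftrightarrow> adjacent p q \<or> {p, q} = {1, n}"

lemma separating:
  assumes "p \<in> {1..n}" "q \<in> {1..n}" "p \<noteq> q" "\<not> cyc_adjacent n p q"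
  obtains r t where "r \<in> {1..n}" "t \<in> {1..n}" "between p q r" "\<not> between p q t" "t \<noteq> p" "t \<noteq> q"
proof -
  let ?a = "min p q" and ?b = "max p q"
  \<comment> \<open>The successor of the smaller site lies strictly between. Outside, site 1 is
    available unless it is the smaller of the two; then \<open>n\<close> is, as the pair is not
    \<open>{1, n}\<close>.\<close>
  let ?t = "if ?a = 1 then n else 1"
  have "Suc ?a < ?b" "\<not> (?a = 1 \<and> ?b = n)" using assms by (auto simp: cyc_adjacent_def adjacent_def min_def max_def split: if_splits)
  then show thesis by (intro that[of "Suc ?a" ?t]) (use assms in \<open>auto simp: between_def min_def max_def split: if_splits\<close>)
qed

context web_rep
begin

section \<open>Creating arcs between arbitrary sites\<close>

lemma web_char_nz: "(\<And>i. i \<in> {1..n} \<Longrightarrow> t i \<noteq> 0) \<Longrightarrow> web_char n \<omega> t \<noteq> 0"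
  by (simp add: web_char_def)

text \<open>The web and its step span a string of length two, on which the usual lift of the
  transposition exchanges the two vectors up to sign. Any other representative differs by a torus
  element, which only rescales.\<close>

lemma relabel_kind:
  assumes W: "monomial_rep n W (Transposition.transpose a b) m" and ab: "adjacent a b" "a \<in> {1..n}" "b \<in> {1..n}"
    and w: "is_web n k (D, p)" and one: "p a = a \<or> p b = b" "p a \<noteq> a \<or> p b \<noteq> b" and kd: "kind a b (D, p) \<noteq> 0"
  obtains c where "c \<noteq> 0" "\<rho> W (vb (D, p)) = s c (vb (Transposition.transpose a b ` D, Transposition.transpose a b \<circ> p \<circ> Transposition.transpose a b))"
proof -
  let ?T = "Transposition.transpose a b"
  note Wb = is_webD[OF w]
  have ba: "adjacent b a" using ab by (auto simp: adjacent_def)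
  have r: "root a b" "root b a" using adjacent_root[OF ab] by auto
  have ne: "a \<noteq> b" using r by (simp add: root_def)
  have pp: "p a \<noteq> b" using one Wb(3) ne by metis
  have aD: "a \<in> D \<longleftrightarrow> p a = a" and bD: "b \<notin> D"
    using kd one Wb(4) by (auto simp: kind_def split: if_splits)
  have k1: "kind a b (D, p) = 1" using kd pp by (simp add: kind_def split: if_splits)
  have k0: "kind b a (D, p) = 0" using one aD bD by (auto simp: kind_def)
  have st: "step a b (D, p) = (?T ` D, ?T \<circ> p \<circ> ?T)" using one aD bD ne by (auto simp: step_def)
  note ss = step_step_relabel[OF one aD bD Wb(3,4) ne]
  have k0': "kind a b (step a b (D, p)) = 0"
  proof -
    have "b \<in> ?T ` D \<longleftrightarrow> a \<in> D" by (metis image_iff transpose_apply_second transpose_involutory)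
    moreover have "a \<in> ?T ` D \<longleftrightarrow> b \<in> D" by (metis image_iff transpose_apply_first transpose_involutory)
    moreover have "(?T \<circ> p \<circ> ?T) a = a \<longleftrightarrow> p b = b" by (metis comp_apply transpose_apply_first transpose_apply_second transpose_involutory)
    ultimately show ?thesis unfolding st kind_def using one aD bD by auto
  qed
  have w': "is_web n k (step a b (D, p))" using web_step[OF w ab(2,3,1) kd] .
  let ?x = "vb (D, p)" and ?y = "vb (step a b (D, p))"
  have m: "mu b a ?x = ?y" "mu a b ?x = 0" "mu b a ?y = 0" "mu a b ?y = ?x"
    using mu_vb[OF w ab] mu_vb[OF w ba ab(3,2)] mu_vb[OF w' ab] mu_vb[OF w' ba ab(3,2)] k1 k0 k0' ss by (simp_all add: coef_def)
  let ?A = "rs a b 1" and ?B = "rs b a (-1)"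
  have A: "?A \<in> carrier (SL n)" and B: "?B \<in> carrier (SL n)" using rs_in r by auto
  have m1: "mu a b (?x + s (-1) ?y) = s (-1) ?x" unfolding mu_lin(1,2)[OF r(1)] m by simp
  have m2: "mu a b (s (-1) ?x) = 0" unfolding mu_lin(2)[OF r(1)] m by simp
  have "\<rho> ?A ?x = ?x" using exp_linear[OF r(1), of ?x 1] m mu_lin(3)[OF r(1)] by simp
  moreover have "\<rho> ?B ?x = ?x + s (-1) ?y" using exp_linear[OF r(2), of ?x "-1"] m by simp
  moreover have "\<rho> ?A (?x + s (-1) ?y) = s (-1) ?y"
    using exp_linear[OF r(1), of "?x + s (-1) ?y" 1] unfolding m1 m2 by simp
  ultimately have g: "\<rho> (?A * ?B * ?A) ?x = s (-1) ?y"
    using rho_mult[OF SL_mult[OF A B] A] rho_mult[OF A B] by simp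
  have G: "monomial_rep n (?A * ?B * ?A) ?T (\<lambda>j. if j = a then -1 else 1)" by (rule monomial_rep_transpose[OF ne ab(2,3)])
  obtain t where t: "(\<Prod>i = 1..n. t i) = 1" "W = ?A * ?B * ?A * diag_elt n t" "\<And>i. i \<in> {1..n} \<Longrightarrow> t i \<noteq> 0"
    using monomial_rep_same[OF W G] by blast
  have "\<rho> W ?x = s (web_char n (D, p) t) (s (-1) ?y)"
    unfolding t(2) rho_mult[OF monomial_rep_SL[OF G] monomial_rep_SL[OF monomial_rep_diag[OF t(1)]]] torus_vb[OF t(1) w] rho_lin(2)[OF monomial_rep_SL[OF G]] g ..
  then have "\<rho> W ?x = s (- web_char n (D, p) t) (vb (?T ` D, ?T \<circ> p \<circ> ?T))" by (simp add: st)
  moreover have "- web_char n (D, p) t \<noteq> 0" using web_char_nz[OF t(3)] by simp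
  ultimately show thesis using that by blast
qed

text \<open>One site has weight 1 and the other 0 or 2, so a step is possible in one of the two
  directions.\<close>

lemma relabel:
  assumes W: "monomial_rep n W (Transposition.transpose a b) m" and ab: "adjacent a b" "a \<in> {1..n}" "b \<in> {1..n}"
    and w: "is_web n k (D, p)" and one: "p a = a \<or> p b = b" "p a \<noteq> a \<or> p b \<noteq> b"
  obtains c where "c \<noteq> 0" "\<rho> W (vb (D, p)) = s c (vb (Transposition.transpose a b ` D, Transposition.transpose a b \<circ> p \<circ> Transposition.transpose a b))"
proof (cases "kind a b (D, p) = 0")
  case False
  then show thesis using relabel_kind[OF assms(1-7)] that by blast
next
  case True
  have "kind b a (D, p) \<noteq> 0" using True one is_webD(4)[OF w] by (auto simp: kind_def split: if_splits)
  moreover have "adjacent b a" using ab by (auto simp: adjacent_def)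
  moreover have "monomial_rep n W (Transposition.transpose b a) m" using W by (simp add: transpose_commute)
  ultimately show thesis using relabel_kind[of W b a m D p thesis] ab w one that by (auto simp: transpose_commute[of b a])
qed

text \<open>A web with one arc is determined by its weight, so its image under any permutation is
  known up to a factor. Equivariance then transports the creation of a second arc.\<close>

lemma transport_web1:
  assumes U: "monomial_rep n U v m" and q: "quad n k a b c d D"
  obtains c' where "c' \<noteq> 0"
    "\<rho> U (mu b a (vb (web1 c d (insert a D)))) = s c' (mu (v b) (v a) (vb (web1 (v c) (v d) (insert (v a) (v ` D)))))"
proof -
  have r: "root b a" using q by (auto simp: quad_def root_def)
  have v: "v permutes {1..n}" and mm: "m a \<noteq> 0" "m b \<noteq> 0" using U r by (auto simp: monomial_rep_def root_def)
  have vq: "quad n k (v a) (v b) (v c) (v d) (v ` D)" by (rule quad_image[OF q v])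
  have vab: "root (v b) (v a)" using vq by (auto simp: quad_def root_def)
  have cd: "c \<noteq> d" using q by (simp add: quad_def)
  note w1 = is_web1[OF q] and w2 = is_web1[OF vq]
  have wt: "weight (web1 (v c) (v d) (insert (v a) (v ` D))) (v i) = weight (web1 c d (insert a D)) i" for i
    using weight_web1_image[OF v cd, of "insert a D" i] by simp
  obtain c' where c': "c' \<noteq> 0" "\<rho> U (vb (web1 c d (insert a D))) = s c' (vb (web1 (v c) (v d) (insert (v a) (v ` D))))"
    using image_small[OF U w1[unfolded web1_def] moved_web1 w2[unfolded web1_def] moved_web1 wt[unfolded web1_def]]
    unfolding web1_def by blast
  have "\<rho> U (mu b a (vb (web1 c d (insert a D)))) = s (m b / m a * c') (mu (v b) (v a) (vb (web1 (v c) (v d) (insert (v a) (v ` D)))))"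
    unfolding equivariance[OF U r] c'(2) mu_lin(2)[OF vab] by simp
  then show thesis using that[of "m b / m a * c'"] c'(1) mm by simp
qed

lemma create_adjacent_arc:
  assumes q: "quad n k a b c d D" and ad: "adjacent a b"
  shows "mu b a (vb (web1 c d (insert a D))) = vb (web2 a b c d D)"
proof -
  have ab: "a \<in> {1..n}" "b \<in> {1..n}" and dist: "distinct [a, b, c, d]" and D: "a \<notin> D" "b \<notin> D" using q by (auto simp: quad_def)
  show ?thesis using mu_vb[OF is_web1[OF q] ad ab] unfolding cup_web1[OF dist D] by (simp add: coef_def)
qed

text \<open>Moving one end of an arc by a simple reflection reduces the creation of a long arc to
  that of an arc joining neighbours.\<close>

lemma create_arc:
  assumes "quad n k a b c d D" "\<not> between a b c" "\<not> between a b d"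
  shows "\<exists>x. x \<noteq> 0 \<and> mu b a (vb (web1 c d (insert a D))) = s x (vb (web2 a b c d D))"
  using assms
proof (induction "nat \<bar>int a - int b\<bar>" arbitrary: b D rule: less_induct)
  case less
  note q = less.prems(1) and nb = less.prems(2,3)
  have ne: "a \<noteq> b" "a \<noteq> c" "a \<noteq> d" "b \<noteq> c" "b \<noteq> d" "c \<noteq> d" and ab: "a \<in> {1..n}" "b \<in> {1..n}" using q by (auto simp: quad_def)
  show ?case
  proof (cases "adjacent a b")
    case True
    then show ?thesis using create_adjacent_arc[OF q] by (intro exI[of _ 1]) simp
  next
    case False
    \<comment> \<open>The neighbour of \<open>b\<close> on the side of \<open>a\<close>. It differs
      from \<open>c\<close> and \<open>d\<close>, which are not between \<open>a\<close> and
      \<open>b\<close>, but it may be doubled; hence \<open>D\<close> is replaced by its image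
      \<open>E\<close> in the induction hypothesis.\<close>
    define b' where "b' = (if a < b then b - 1 else Suc b)"
    have b': "adjacent b' b" "b' \<in> {1..n}" "between a b b'" "b' \<noteq> a" "b' \<noteq> b"
      and lt: "nat \<bar>int a - int b'\<bar> < nat \<bar>int a - int b\<bar>"
      using False ne(1) ab by (auto simp: b'_def adjacent_def between_def split: if_splits)
    have b'cd: "b' \<noteq> c" "b' \<noteq> d" using b'(3) nb by auto
    have nb': "\<not> between a b' c" "\<not> between a b' d"
      using nb b'(3) by (auto simp: between_def)
    let ?T = "Transposition.transpose b' b"
    have T: "?T permutes {1..n}" using b'(2) ab(2) by (rule permutes_swap_id)
    have Tf: "?T a = a" "?T c = c" "?T d = d" "?T b' = b" "?T b = b'" using b' b'cd ne by (auto simp: transpose_apply_other)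
    define E where "E = ?T ` D"
    have TE: "?T ` E = D" by (simp add: E_def image_comp)
    have q': "quad n k a b' c d E" using quad_image[OF q T] unfolding Tf E_def .
    obtain x where x: "x \<noteq> 0" "mu b' a (vb (web1 c d (insert a E))) = s x (vb (web2 a b' c d E))"
      using less.hyps[OF lt q' nb'] by blast
    have "1 \<le> n" using kn by simp
    then obtain W m where W: "monomial_rep n W ?T m" using monomial_rep_exists[OF T] by blast
    obtain y where y: "y \<noteq> 0" "\<rho> W (mu b' a (vb (web1 c d (insert a E)))) = s y (mu b a (vb (web1 c d (insert a D))))"
      using transport_web1[OF W q'] unfolding Tf TE by blast
    have w2: "is_web n k (web2 a b' c d E)" using is_web2[OF q'] nb' by blast
    let ?p = "id(a := b', b' := a, c := d, d := c)"
    have pT: "(?T ` E, ?T \<circ> ?p \<circ> ?T) = web2 a b c d D"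
    proof -
      have "(?T \<circ> ?p \<circ> ?T) j = (id(a := b, b := a, c := d, d := c)) j" for j
        using ne b'cd b'(4,5) by (auto simp: transpose_def)
      then show ?thesis by (simp add: TE web2_def fun_eq_iff)
    qed
    have one: "?p b' = b' \<or> ?p b = b" "?p b' \<noteq> b' \<or> ?p b \<noteq> b" using ne b'cd b'(4,5) by auto
    obtain z where z: "z \<noteq> 0" "\<rho> W (vb (web2 a b' c d E)) = s z (vb (web2 a b c d D))"
      using relabel[OF W b'(1,2) ab(2) w2[unfolded web2_def] one] unfolding pT web2_def[of a b' c d E] by blast
    have "s y (mu b a (vb (web1 c d (insert a D)))) = s (x * z) (vb (web2 a b c d D))"
      using y(2) unfolding x(2) rho_lin(2)[OF monomial_rep_SL[OF W]] z(2) by simp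
    then have "s (inverse y) (s y (mu b a (vb (web1 c d (insert a D))))) = s (inverse y) (s (x * z) (vb (web2 a b c d D)))" by simp
    then have "mu b a (vb (web1 c d (insert a D))) = s (inverse y * (x * z)) (vb (web2 a b c d D))" using y(1) by simp
    then show ?thesis using x(1) y(1) z(1) by (intro exI[of _ "inverse y * (x * z)"]) simp
  qed
qed

lemma scale_eq_cancel: "s a x = s b y \<Longrightarrow> a \<noteq> 0 \<Longrightarrow> x = s (inverse a * b) y"
proof -
  assume "s a x = s b y" "a \<noteq> 0"
  then have "s (inverse a) (s a x) = s (inverse a) (s b y)" by simp
  then show ?thesis using \<open>a \<noteq> 0\<close> by simp
qed

text \<open>A permutation bringing the four sites to \<open>1, 2, 3, 4\<close> turns the two vectors into multiples
  of different basis elements.\<close>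

lemma not_proportional:
  assumes q: "quad n k a b c d E" and x: "x \<noteq> 0"
    and ij: "i = b \<and> j = a \<or> i = a \<and> j = b"
    and eq: "mu j i (vb (web1 c d (insert i E))) = s x (mu c b (vb (web1 a d (insert b E))))"
  shows False
proof -
  have n4: "4 \<le> n" using k2 kn by simp
  have "distinct [1::nat, 2, 3, 4]" "set [1::nat, 2, 3, 4] \<subseteq> {1..n}" "length [a, b, c, d] = length [1::nat, 2, 3, 4]" "set [a, b, c, d] \<subseteq> {1..n}"
    "distinct [a, b, c, d]"
    using n4 q by (auto simp: quad_def)
  then obtain v where v: "v permutes {1..n}" "map v [a, b, c, d] = [1, 2, 3, 4]"
    using permutation_with_values by metis
  have vv: "v a = 1" "v b = 2" "v c = 3" "v d = 4" using v(2) by auto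
  have "1 \<le> n" using n4 by simp
  then obtain U m where U: "monomial_rep n U v m" using monomial_rep_exists[OF v(1)] by blast
  define F where "F = v ` E"
  have F: "quad n k 1 2 3 4 F" using quad_image[OF q v(1)] unfolding vv F_def .
  then have Fs: "quad n k 2 1 3 4 F" "quad n k 2 3 1 4 F" by (auto simp: quad_def)
  have qs: "quad n k b a c d E" "quad n k b c a d E" using q by (auto simp: quad_def)
  obtain c2 where c2: "c2 \<noteq> 0" "\<rho> U (mu c b (vb (web1 a d (insert b E)))) = s c2 (vb (web2 2 3 1 4 F))"
    using transport_web1[OF U qs(2)] create_adjacent_arc[OF Fs(2)] unfolding vv F_def[symmetric] by (auto simp: adjacent_def)
  have "\<exists>c1. c1 \<noteq> 0 \<and> \<rho> U (mu j i (vb (web1 c d (insert i E)))) = s c1 (vb (web2 1 2 3 4 F))"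
    using ij
  proof (elim disjE conjE)
    assume ij: "i = b" "j = a"
    obtain c1 where "c1 \<noteq> 0" "\<rho> U (mu a b (vb (web1 c d (insert b E)))) = s c1 (vb (web2 2 1 3 4 F))"
      using transport_web1[OF U qs(1)] create_adjacent_arc[OF Fs(1)] unfolding vv F_def[symmetric] by (auto simp: adjacent_def)
    moreover have "web2 2 1 3 4 F = web2 1 2 3 4 F" by (rule web2_swap) simp
    ultimately show ?thesis unfolding ij by metis
  next
    assume ij: "i = a" "j = b"
    obtain c1 where "c1 \<noteq> 0" "\<rho> U (mu b a (vb (web1 c d (insert a E)))) = s c1 (vb (web2 1 2 3 4 F))"
      using transport_web1[OF U q] create_adjacent_arc[OF F] unfolding vv F_def[symmetric] by (auto simp: adjacent_def)
    then show ?thesis unfolding ij by metis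
  qed
  then obtain c1 where c1: "c1 \<noteq> 0" "\<rho> U (mu j i (vb (web1 c d (insert i E)))) = s c1 (vb (web2 1 2 3 4 F))" by blast
  have "s c1 (vb (web2 1 2 3 4 F)) = s (x * c2) (vb (web2 2 3 1 4 F))"
    using c1(2) unfolding eq rho_lin(2)[OF monomial_rep_SL[OF U]] c2(2) by simp
  moreover have "is_web n k (web2 1 2 3 4 F)" by (rule is_web2[OF F]) (simp add: between_def)
  moreover have "is_web n k (web2 2 3 1 4 F)" by (rule is_web2[OF Fs(2)]) (simp add: between_def)
  ultimately have "web2 1 2 3 4 F = web2 2 3 1 4 F" using vb_scaled_eqD(1) c1(1) by blast
  then have "snd (web2 1 2 3 4 F) 1 = snd (web2 2 3 1 4 F) 1" by simp
  then show False by (simp add: web2_def)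
qed

text \<open>\<open>create_arc\<close> produces an arc only if no end of the other arc lies under it.
  So the web is created by the arc \<open>{a, y}\<close> unless this one encloses
  \<open>{b, z}\<close>, and then by \<open>{b, z}\<close>; in both cases
  \<open>not_proportional\<close> applies.\<close>

lemma not_web_multiple:
  assumes q: "quad n k a b y z E" and nc: "between a y b \<longleftrightarrow> between a y z" and x: "x \<noteq> 0"
    and eq: "mu b a (vb (web1 y z (insert a E))) = s x (vb (web2 a y b z E))"
  shows False
proof (cases "between a y b")
  case False
  have qs: "quad n k a y b z E" "quad n k b a y z E" using q by (auto simp: quad_def)
  obtain x' where x': "x' \<noteq> 0" "mu y a (vb (web1 b z (insert a E))) = s x' (vb (web2 a y b z E))"
    using create_arc[OF qs(1)] False nc by blast
  have "s x' (mu b a (vb (web1 y z (insert a E)))) = s x (mu y a (vb (web1 b z (insert a E))))"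
    unfolding eq x'(2) by (simp add: mult.commute)
  from scale_eq_cancel[OF this x'(1)] x x'(1) show False
    by (intro not_proportional[OF qs(2), of "inverse x' * x" a b]) auto
next
  case True
  have qs: "quad n k b z a y E" "quad n k a b z y E" using q by (auto simp: quad_def)
  have nb: "\<not> between b z a" "\<not> between b z y" using True nc by (auto simp: between_def)
  have "distinct [a, y, b, z]" using q by (auto simp: quad_def)
  then have "web2 b z a y E = web2 a y b z E" by (rule web2_swap)
  then obtain x' where x': "x' \<noteq> 0" "mu z b (vb (web1 a y (insert b E))) = s x' (vb (web2 a y b z E))"
    using create_arc[OF qs(1) nb] by auto
  have "s x' (mu b a (vb (web1 y z (insert a E)))) = s x (mu z b (vb (web1 a y (insert b E))))"
    unfolding eq x'(2) by (simp add: mult.commute)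
  from scale_eq_cancel[OF this x'(1)] x x'(1) show False
    by (intro not_proportional[OF qs(2), of "inverse x' * x" a b]) (auto simp: web1_swap[of z y])
qed

section \<open>Necessity: cyclic neighbours stay cyclic neighbours\<close>

theorem cyclic_adjacency_preserved:
  assumes W: "monomial_rep n W w m" and perm: "\<And>\<omega>. is_web n k \<omega> \<Longrightarrow> sends_to_web W \<omega>" and i: "i \<in> {1..<n}"
  shows "cyc_adjacent n (w i) (w (Suc i))"
proof (rule ccontr)
  assume nadj: "\<not> cyc_adjacent n (w i) (w (Suc i))"
  have w: "w permutes {1..n}" using W by (simp add: monomial_rep_def)
  have wi: "inj w" using permutes_inj[OF w] .
  have ii: "i \<in> {1..n}" "Suc i \<in> {1..n}" "adjacent i (Suc i)" "i \<noteq> Suc i" using i by (auto simp: adjacent_def)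
  define p q where "p = w i" and "q = w (Suc i)"
  have pq: "p \<in> {1..n}" "q \<in> {1..n}" "p \<noteq> q" using ii permutes_in_image[OF w] wi by (auto simp: p_def q_def dest: injD)
  obtain r t where rt: "r \<in> {1..n}" "t \<in> {1..n}" "between p q r" "\<not> between p q t" "t \<noteq> p" "t \<noteq> q"
    using separating[OF pq] nadj unfolding p_def q_def by blast
  have rpq: "r \<noteq> p" "r \<noteq> q" "r \<noteq> t" using rt by (auto simp: between_def)
  define c d where "c = inv' w r" and "d = inv' w t"
  have wcd: "w c = r" "w d = t" using permutes_inverses[OF w] by (auto simp: c_def d_def)
  have cd: "c \<in> {1..n}" "d \<in> {1..n}" using permutes_in_image[OF permutes_inv[OF w]] rt unfolding c_def d_def by blast+
  have dist: "distinct [i, Suc i, c, d]" using rpq rt(5,6) wcd p_def q_def by auto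
  \<comment> \<open>Room for the \<open>k - 2\<close> doubled sites outside the four chosen
    ones.\<close>
  have "card ({1..n} - {i, Suc i, c, d}) = n - 4" using dist ii cd by (subst card_Diff_subset) auto
  then have "k - 2 \<le> card ({1..n} - {i, Suc i, c, d})" using kn by simp
  then obtain D where D: "D \<subseteq> {1..n} - {i, Suc i, c, d}" "card D = k - 2" "finite D"
    using obtain_subset_with_card_n by metis
  have D2: "card D + 2 = k" using D(2) k2 by simp
  have qd: "quad n k i (Suc i) c d D" using dist ii cd D D2 by (auto simp: quad_def)
  let ?\<omega> = "web2 i (Suc i) c d D"
  have \<omega>: "is_web n k ?\<omega>" by (rule is_web2[OF qd]) (auto simp: between_def)
  have v: "vb ?\<omega> = mu (Suc i) i (vb (web1 c d (insert i D)))"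
    using create_adjacent_arc[OF qd ii(3)] by simp
  define E where "E = w ` D"
  obtain e where e: "e \<noteq> 0" "\<rho> W (vb ?\<omega>) = s e (mu q p (vb (web1 r t (insert p E))))"
    using transport_web1[OF W qd] unfolding v wcd p_def q_def E_def by blast
  obtain D' f c' where f: "is_web n k (D', f)" "c' \<noteq> 0" "\<rho> W (vb ?\<omega>) = s c' (vb (D', f))"
    using perm[OF \<omega>] unfolding sends_to_web_def by force
  note F = is_webD[OF f(1)]
  have wt: "weight (D', f) (w j) = weight ?\<omega> j" if "j \<in> {1..n}" for j
    using image_weight_single[OF W \<omega> f(3,2,1) that] .
  have qE: "quad n k p q r t E" using quad_image[OF qd w] unfolding wcd p_def q_def E_def .
  have surj: "\<exists>j\<in>{1..n}. x = w j" if "x \<in> {1..n}" for x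
    using that permutes_image[OF w] by (metis imageE)
  have mem: "(w j \<in> D' \<longleftrightarrow> j \<in> D) \<and> (f (w j) \<noteq> w j \<longleftrightarrow> j \<in> {i, Suc i, c, d})" if "j \<in> {1..n}" for j
  proof -
    have "j \<in> D \<Longrightarrow> j \<notin> {i, Suc i, c, d}" using qd by (auto simp: quad_def)
    then show ?thesis
      using wt[OF that] F(4) unfolding weight_web2[OF qd] by (simp add: weight_def split: if_splits)
  qed
  have D'E: "D' = E"
  proof (rule equalityI; rule subsetI)
    fix x assume x: "x \<in> D'"
    then obtain j where j: "j \<in> {1..n}" "x = w j" using surj F(1) by blast
    then show "x \<in> E" using mem x by (auto simp: E_def)
  next
    fix x assume "x \<in> E"
    then obtain j where j: "j \<in> D" "x = w j" by (auto simp: E_def)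
    then show "x \<in> D'" using mem[of j] D(1) by blast
  qed
  have mv: "f x \<noteq> x \<longleftrightarrow> x \<in> {p, q, r, t}" for x
  proof (cases "x \<in> {1..n}")
    case True
    then obtain j where j: "j \<in> {1..n}" "x = w j" using surj by blast
    have "x \<in> {p, q, r, t} \<longleftrightarrow> j \<in> {i, Suc i, c, d}"
      using j wcd p_def q_def inj_eq[OF wi] by (metis empty_iff insert_iff)
    then show ?thesis using mem[OF j(1)] j by blast
  next
    case False
    then show ?thesis using F(2) pq rt by (auto simp: permutes_def)
  qed
  have ff: "f (f x) = x" for x using F(3) by blast
  have fmem: "f x \<in> {p, q, r, t}" if "x \<in> {p, q, r, t}" for x
    using mv[of "f x"] mv[of x] ff that by metis
  \<comment> \<open>An arc from \<open>p\<close> to \<open>q\<close> would leave \<open>r\<close>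
    and \<open>t\<close>, which it separates, to be joined across it.\<close>
  have fpq: "f p \<noteq> q"
  proof
    assume fp: "f p = q"
    then have fq: "f q = p" using ff by metis
    have "f r \<noteq> p" "f r \<noteq> q" "f r \<noteq> r" using fp fq ff rpq mv[of r] by (metis, metis, simp)
    then have fr: "f r = t" using fmem[of r] by simp
    have "min p q < r" "r < max p q" "f (min p q) = max p q" using rt(3) fp fq by (auto simp: between_def min_def max_def)
    then have "min p q < f r \<and> f r < max p q" using F(6) unfolding noncrossing_def by metis
    then show False using fr rt(4) by (auto simp: between_def min_def max_def split: if_splits)
  qed
  obtain y z where yz: "{y, z} = {r, t}" "y \<noteq> z" "f p = y"
    using fmem[of p] mv[of p] fpq rpq(3) by auto
  have dist4: "distinct [p, q, y, z]" using yz(1,2) pq(3) rpq rt(5,6) by (auto simp: doubleton_eq_iff)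
  have fy: "f y = p" using yz(3) ff by metis
  have "f q \<noteq> q" "f q \<noteq> p" "f q \<noteq> y"
    using mv[of q] fpq ff yz(3) pq(3) by (simp, metis, metis)
  then have fq: "f q = z" using fmem[of q] yz(1) by (auto simp: doubleton_eq_iff)
  then have fz: "f z = q" using ff by metis
  have "(D', f) = web2 p y q z E"
  proof -
    have "f x = (id(p := y, y := p, q := z, z := q)) x" for x
      using mv[of x] yz fy fq fz dist4 by (auto simp: doubleton_eq_iff)
    then show ?thesis by (simp add: web2_def D'E fun_eq_iff)
  qed
  note f' = f[unfolded this]
  have web1: "web1 r t (insert p E) = web1 y z (insert p E)"
    using yz(1) web1_swap[of r t] by (auto simp: doubleton_eq_iff)
  have "s e (mu q p (vb (web1 y z (insert p E)))) = s c' (vb (web2 p y q z E))"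
    using e(2) f'(3) web1 by simp
  from scale_eq_cancel[OF this e(1)] have eq: "mu q p (vb (web1 y z (insert p E))) = s (inverse e * c') (vb (web2 p y q z E))" .
  \<comment> \<open>No arc crosses the one from \<open>p\<close> to \<open>y\<close>, so
    \<open>q\<close> and \<open>z\<close> will lie on the same side of it.\<close>
  have btw: "between p y (f x)" if x: "between p y x" for x
  proof -
    have m: "f (min p y) = max p y" using yz(3) fy by (auto simp: min_def max_def)
    have "min p y < x" "x < f (min p y)" using x unfolding m by (auto simp: between_def min_def max_def)
    then have "min p y < f x \<and> f x < max p y" using F(6) m unfolding noncrossing_def by metis
    then show ?thesis by (auto simp: between_def min_def max_def split: if_splits)
  qed
  have nc: "between p y q \<longleftrightarrow> between p y z" using btw[of q] btw[of z] unfolding fq fz by blast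
  show False
    by (rule not_web_multiple[OF _ nc _ eq]) (use qE yz(1,2) e(1) f(2) in \<open>auto simp: doubleton_eq_iff quad_def\<close>)
qed

end

section \<open>The dihedral group, Coxeter elements and the dual basis\<close>

abbreviation simple_product :: "nat list \<Rightarrow> nat \<Rightarrow> nat" where
  "simple_product is \<equiv> foldr (\<circ>) (map (\<lambda>i. Transposition.transpose i (Suc i)) is) id"

lemma cycle_of_upt:
  assumes "a \<le> b"
  shows "cycle_of_list [a..<Suc b] = simple_product [a..<b]"
    "cycle_of_list [a..<Suc b] x = (if a \<le> x \<and> x < b then Suc x else if x = b then a else x)"
proof -
  have "cycle_of_list [a..<Suc b] = simple_product [a..<b] \<and>
    (\<forall>x. cycle_of_list [a..<Suc b] x = (if a \<le> x \<and> x < b then Suc x else if x = b then a else x))"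
    using assms
  proof (induction rule: inc_induct)
    case base
    then show ?case by simp
  next
    case (step a)
    have u: "[a..<Suc b] = a # Suc a # [Suc (Suc a)..<Suc b]" "[a..<b] = a # [Suc a..<b]" "[Suc a..<Suc b] = Suc a # [Suc (Suc a)..<Suc b]"
      using step.hyps by (simp_all add: upt_conv_Cons)
    have c: "cycle_of_list [a..<Suc b] = Transposition.transpose a (Suc a) \<circ> cycle_of_list [Suc a..<Suc b]"
      unfolding u(1,3) by simp
    have s: "simple_product [a..<b] = Transposition.transpose a (Suc a) \<circ> simple_product [Suc a..<b]"
      unfolding u(2) by simp
    note IH = conjunct1[OF step.IH] conjunct2[OF step.IH, rule_format]
    show ?case
    proof (intro conjI allI)
      show "cycle_of_list [a..<Suc b] = simple_product [a..<b]" unfolding c s IH(1) ..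
      show "cycle_of_list [a..<Suc b] x = (if a \<le> x \<and> x < b then Suc x else if x = b then a else x)" for x
        unfolding c o_apply IH(2) using step.hyps by (auto simp: transpose_def)
    qed
  qed
  then show "cycle_of_list [a..<Suc b] = simple_product [a..<b]"
    "cycle_of_list [a..<Suc b] x = (if a \<le> x \<and> x < b then Suc x else if x = b then a else x)" by blast+
qed

lemma long_cycle_value: "1 \<le> n \<Longrightarrow> long_cycle n x = (if 1 \<le> x \<and> x < n then Suc x else if x = n then 1 else x)"
  unfolding long_cycle_def by (rule cycle_of_upt(2))

lemma long_cycle_product: "1 \<le> n \<Longrightarrow> long_cycle n = simple_product [1..<n]"
  unfolding long_cycle_def by (rule cycle_of_upt(1))

lemma long_cycle_permutes: "long_cycle n permutes {1..n}"
proof -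
  have "set [1..<Suc n] = {1..n}" by auto
  then show ?thesis using cycle_permutes[of "[1..<Suc n]"] unfolding long_cycle_def by simp
qed

lemma longest_perm_permutes: "longest_perm n permutes {1..n}"
  by (rule involution_permutes) (auto simp: longest_perm_def)

lemma longest_perm_involution: "longest_perm n \<circ> longest_perm n = id"
  by (auto simp: longest_perm_def fun_eq_iff)

lemma inv_longest_perm: "inv' (longest_perm n) = longest_perm n"
  by (rule inv_unique_comp) (rule longest_perm_involution)+

lemma reversed_cycle_value:
  assumes "1 \<le> n"
  shows "(longest_perm n \<circ> long_cycle n \<circ> longest_perm n) x = (if 1 < x \<and> x \<le> n then x - 1 else if x = 1 then n else x)"
proof -
  consider "x \<notin> {1..n}" | "x = 1" | "1 < x" "x \<le> n" by force
  then show ?thesis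
  proof cases
    case 3
    then have "longest_perm n x = n + 1 - x" "1 \<le> n + 1 - x" "n + 1 - x < n" by (auto simp: longest_perm_def)
    then have "long_cycle n (longest_perm n x) = n + 2 - x" using long_cycle_value[OF assms] by simp
    then show ?thesis using 3 by (auto simp: longest_perm_def)
  qed (use assms in \<open>auto simp: longest_perm_def long_cycle_value\<close>)
qed

lemma inv_long_cycle:
  assumes n: "1 \<le> n"
  shows "inv' (long_cycle n) = longest_perm n \<circ> long_cycle n \<circ> longest_perm n"
proof (rule inv_unique_comp)
  let ?d = "longest_perm n \<circ> long_cycle n \<circ> longest_perm n"
  have "long_cycle n (?d x) = x" "?d (long_cycle n x) = x" for x
    unfolding reversed_cycle_value[OF n] long_cycle_value[OF n] using n by auto
  then show "long_cycle n \<circ> ?d = id" "?d \<circ> long_cycle n = id" by (simp_all only: fun_eq_iff o_apply id_apply) simp_all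
qed

lemma subgroup_dihedral: "subgroup (dihedral n) (sym_group n)"
proof -
  have "{long_cycle n, longest_perm n} \<subseteq> carrier (sym_group n)"
    using sym_group_carrier long_cycle_permutes longest_perm_permutes by blast
  then show ?thesis unfolding dihedral_def by (rule group.generate_is_subgroup[OF sym_group_is_group])
qed

lemma dihedral_permutes: "w \<in> dihedral n \<Longrightarrow> w permutes {1..n}"
  using subgroup.mem_carrier[OF subgroup_dihedral] sym_group_carrier by blast

lemma dihedral_compose: "v \<in> dihedral n \<Longrightarrow> w \<in> dihedral n \<Longrightarrow> v \<circ> w \<in> dihedral n"
  using subgroup.m_closed[OF subgroup_dihedral, of v n w] by (simp add: sym_group_mult)

lemma dihedral_generators: "long_cycle n \<in> dihedral n" "longest_perm n \<in> dihedral n" "id \<in> dihedral n"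
  unfolding dihedral_def using generate.one[of "sym_group n"] unfolding sym_group_one by (auto intro: generate.incl)

text \<open>Inverses need no case of their own: the reversal is an involution, and conjugation by it
  inverts the long cycle.\<close>

lemma dihedral_induct [consumes 2, case_names id cycle reversal compose]:
  assumes w: "w \<in> dihedral n" and n: "1 \<le> n"
    and P: "P id" "P (long_cycle n)" "P (longest_perm n)"
    and comp: "\<And>v w. v permutes {1..n} \<Longrightarrow> w permutes {1..n} \<Longrightarrow> P v \<Longrightarrow> P w \<Longrightarrow> P (v \<circ> w)"
  shows "P w"
proof -
  have "w permutes {1..n} \<and> P w"
    using w unfolding dihedral_def
  proof induction
    case one
    show ?case using P(1) permutes_id unfolding sym_group_one by blast
  next
    case (incl h)
    then show ?case using P long_cycle_permutes longest_perm_permutes by auto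
  next
    case (inv h)
    have l: "longest_perm n permutes {1..n} \<and> P (longest_perm n)" using P longest_perm_permutes by simp
    have "longest_perm n \<circ> long_cycle n permutes {1..n} \<and> P (longest_perm n \<circ> long_cycle n)"
      using P comp longest_perm_permutes long_cycle_permutes permutes_compose by blast
    then have "longest_perm n \<circ> long_cycle n \<circ> longest_perm n permutes {1..n} \<and> P (longest_perm n \<circ> long_cycle n \<circ> longest_perm n)"
      using P comp longest_perm_permutes permutes_compose by blast
    then show ?case
      using inv l n inv_long_cycle[of n] inv_longest_perm[of n] long_cycle_permutes[of n] longest_perm_permutes[of n]
      by (auto simp: sym_group_carrier)
  next
    case (eng v w)
    then show ?case using comp permutes_compose unfolding sym_group_mult by blast
  qed
  then show ?thesis by blast
qed

section \<open>Automorphisms of the cycle\<close>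

definition cyc_hom :: "nat \<Rightarrow> (nat \<Rightarrow> nat) \<Rightarrow> bool" where
  "cyc_hom n w \<longleftrightarrow> (\<forall>p\<in>{1..n}. \<forall>q\<in>{1..n}. cyc_adjacent n p q \<longrightarrow> cyc_adjacent n (w p) (w q))"

text \<open>Only the edges of the path from 1 to \<open>n\<close> are asked for, as these are what
  \<open>cyclic_adjacency_preserved\<close> delivers. Composition on the left needs the whole cycle,
  which is \<open>cyc_hom\<close>.\<close>

definition cyc_path :: "nat \<Rightarrow> (nat \<Rightarrow> nat) \<Rightarrow> bool" where
  "cyc_path n w \<longleftrightarrow> w permutes {1..n} \<and> (\<forall>i\<in>{1..<n}. cyc_adjacent n (w i) (w (Suc i)))"

lemma cyc_hom_compose_path: "cyc_hom n v \<Longrightarrow> v permutes {1..n} \<Longrightarrow> cyc_path n w \<Longrightarrow> cyc_path n (v \<circ> w)"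
  unfolding cyc_path_def
proof (elim conjE, intro conjI ballI)
  assume a: "cyc_hom n v" "v permutes {1..n}" "w permutes {1..n}" "\<forall>i\<in>{1..<n}. cyc_adjacent n (w i) (w (Suc i))"
  show "v \<circ> w permutes {1..n}" using a permutes_compose by blast
  fix i assume i: "i \<in> {1..<n}"
  then have "i \<in> {1..n}" "Suc i \<in> {1..n}" by auto
  then have "w i \<in> {1..n}" "w (Suc i) \<in> {1..n}" using permutes_in_image[OF a(3)] by blast+
  then show "cyc_adjacent n ((v \<circ> w) i) ((v \<circ> w) (Suc i))" using a i unfolding cyc_hom_def by simp
qed

lemma cyc_path_id: "cyc_path n id"
  by (auto simp: cyc_path_def cyc_adjacent_def adjacent_def permutes_id)

lemma dihedral_cyc_hom: "w \<in> dihedral n \<Longrightarrow> 1 \<le> n \<Longrightarrow> cyc_hom n w"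
proof (induction rule: dihedral_induct)
  case id
  then show ?case by (simp add: cyc_hom_def)
next
  case cycle
  then show ?case by (auto simp: cyc_hom_def cyc_adjacent_def adjacent_def long_cycle_value doubleton_eq_iff)
next
  case reversal
  then show ?case by (auto simp: cyc_hom_def cyc_adjacent_def adjacent_def longest_perm_def doubleton_eq_iff)
next
  case (compose v w)
  show ?case
    unfolding cyc_hom_def
  proof (intro ballI impI)
    fix p q assume pq: "p \<in> {1..n}" "q \<in> {1..n}" "cyc_adjacent n p q"
    then have "w p \<in> {1..n}" "w q \<in> {1..n}" using permutes_in_image[OF compose(2)] by blast+
    then show "cyc_adjacent n ((v \<circ> w) p) ((v \<circ> w) q)" using compose(3,4) pq unfolding cyc_hom_def by simp
  qed
qed

lemma dihedral_cyc_path: "w \<in> dihedral n \<Longrightarrow> 1 \<le> n \<Longrightarrow> cyc_path n w"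
  using cyc_hom_compose_path[OF dihedral_cyc_hom dihedral_permutes cyc_path_id, of w n] by simp

lemma two_neighbours:
  assumes "{p, x, y, z} \<subseteq> {1..n}" "cyc_adjacent n p x" "cyc_adjacent n p y" "cyc_adjacent n p z" "x \<noteq> y" "x \<noteq> z"
  shows "y = z"
  using assms by (auto simp: cyc_adjacent_def adjacent_def doubleton_eq_iff)

text \<open>On a cycle every site has two neighbours and an injective path cannot turn back, so its
  first two values decide the rest.\<close>

lemma cyc_path_determined:
  assumes v: "cyc_path n v" and w: "cyc_path n w" and e: "v 1 = w 1" "v 2 = w 2"
  shows "v = w"
proof -
  have vp: "v permutes {1..n}" and wp: "w permutes {1..n}" using v w by (auto simp: cyc_path_def)
  have eq: "Suc i \<le> n \<longrightarrow> v i = w i \<and> v (Suc i) = w (Suc i)" if "1 \<le> i" for i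
    using that
  proof (induction i rule: dec_induct)
    case base
    then show ?case using e by (simp add: numeral_2_eq_2)
  next
    case (step i)
    show ?case
    proof
      assume i: "Suc (Suc i) \<le> n"
      then have ih: "v i = w i" "v (Suc i) = w (Suc i)" using step.IH by auto
      have in': "i \<in> {1..n}" "Suc i \<in> {1..n}" "Suc (Suc i) \<in> {1..n}" "i \<in> {1..<n}" "Suc i \<in> {1..<n}" using i step.hyps by auto
      have "cyc_adjacent n (v i) (v (Suc i))" "cyc_adjacent n (v (Suc i)) (v (Suc (Suc i)))" "cyc_adjacent n (w (Suc i)) (w (Suc (Suc i)))"
        using v w in' unfolding cyc_path_def by blast+
      then have a: "cyc_adjacent n (v (Suc i)) (v i)" "cyc_adjacent n (v (Suc i)) (v (Suc (Suc i)))" "cyc_adjacent n (v (Suc i)) (w (Suc (Suc i)))"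
        using ih by (auto simp: cyc_adjacent_def adjacent_def)
      have ne: "v i \<noteq> v (Suc (Suc i))" "v i \<noteq> w (Suc (Suc i))"
        using inj_eq[OF permutes_inj[OF wp], of i "Suc (Suc i)"] inj_eq[OF permutes_inj[OF vp], of i "Suc (Suc i)"] ih(1) by simp_all
      have "{v (Suc i), v i, v (Suc (Suc i)), w (Suc (Suc i))} \<subseteq> {1..n}"
        using in' permutes_in_image[OF vp] permutes_in_image[OF wp] by blast
      from two_neighbours[OF this a ne] ih(2) show "v (Suc i) = w (Suc i) \<and> v (Suc (Suc i)) = w (Suc (Suc i))" by simp
    qed
  qed
  show ?thesis
  proof (rule ext)
    fix x
    consider "x \<notin> {1..n}" | "x = 1" | "x \<in> {1..n}" "x \<noteq> 1" by blast
    then show "v x = w x"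
    proof cases
      case 1
      then show ?thesis using vp wp by (metis permutes_not_in)
    next
      case 3
      then have "1 \<le> x - 1" "Suc (x - 1) = x" "x \<le> n" by auto
      then show ?thesis using eq[of "x - 1"] by metis
    qed (use e in simp)
  qed
qed

text \<open>A dihedral element brings the first value to 1, a possible reflection fixing 1 brings
  the second value to 2, and then the path is the identity.\<close>

lemma cyc_path_dihedral:
  assumes w: "cyc_path n w" and n: "3 \<le> n"
  shows "w \<in> dihedral n"
proof -
  have wp: "w permutes {1..n}" using w by (simp add: cyc_path_def)
  have n1: "1 \<le> n" using n by simp
  have to1: "\<exists>g\<in>dihedral n. g x = 1" if "1 \<le> x" "x \<le> n" for x
    using that(2,1)
  proof (induction rule: inc_induct)
    case base
    then show ?case using dihedral_generators(1)[of n] by (intro bexI[of _ "long_cycle n"]) (auto simp: long_cycle_value)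
  next
    case (step x)
    then obtain g where g: "g \<in> dihedral n" "g (Suc x) = 1" by auto
    have "(g \<circ> long_cycle n) x = 1" using g step by (simp add: long_cycle_value)
    then show ?case using dihedral_compose[OF g(1) dihedral_generators(1)] by blast
  qed
  have "w 1 \<in> {1..n}" using permutes_in_image[OF wp] n1 by simp
  then obtain g where g: "g \<in> dihedral n" "g (w 1) = 1" using to1[of "w 1"] by auto
  have gp: "cyc_path n (g \<circ> w)"
    using cyc_hom_compose_path[OF dihedral_cyc_hom[OF g(1) n1] dihedral_permutes[OF g(1)] w] .
  have "cyc_adjacent n ((g \<circ> w) 1) ((g \<circ> w) (Suc 1))" using gp n unfolding cyc_path_def by (metis atLeastLessThan_iff less_le_trans n one_less_numeral_iff order_refl semiring_norm(77))
  moreover have "(g \<circ> w) 2 \<in> {1..n}" using gp n unfolding cyc_path_def by (metis atLeastAtMost_iff le_trans one_le_numeral permutes_in_image numeral_le_iff semiring_norm(69,72) nat_le_linear not_less_eq_eq numeral_2_eq_2 numeral_3_eq_3)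
  ultimately have "(g \<circ> w) 2 = 2 \<or> (g \<circ> w) 2 = n"
    using g(2) by (auto simp: cyc_adjacent_def adjacent_def doubleton_eq_iff numeral_2_eq_2)
  then obtain h where h: "h \<in> dihedral n" "h 1 = 1" "h ((g \<circ> w) 2) = 2"
  proof
    assume "(g \<circ> w) 2 = 2"
    then show thesis using that[of id] dihedral_generators(3) by simp
  next
    assume 2: "(g \<circ> w) 2 = n"
    \<comment> \<open>The reflection that fixes 1 and exchanges 2 with \<open>n\<close>.\<close>
    have "long_cycle n \<circ> longest_perm n \<in> dihedral n" using dihedral_compose dihedral_generators by blast
    moreover have "(long_cycle n \<circ> longest_perm n) 1 = 1" "(long_cycle n \<circ> longest_perm n) n = 2"
      using n by (auto simp: long_cycle_value longest_perm_def)
    ultimately show thesis using that 2 by metis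
  qed
  have "h \<circ> (g \<circ> w) = id"
    by (rule cyc_path_determined[OF cyc_hom_compose_path[OF dihedral_cyc_hom[OF h(1) n1] dihedral_permutes[OF h(1)] gp] cyc_path_id])
      (use g h in auto)
  then have "(h \<circ> g) \<circ> w = id" by (simp add: comp_assoc)
  note hgw = this
  have "w = (inv' (h \<circ> g) \<circ> (h \<circ> g)) \<circ> w"
    unfolding permutes_inv_o(2)[OF dihedral_permutes[OF dihedral_compose[OF h(1) g(1)]]] by simp
  also have "\<dots> = inv' (h \<circ> g) \<circ> ((h \<circ> g) \<circ> w)" by (rule comp_assoc)
  finally have "w = inv' (h \<circ> g)" unfolding hgw by simp
  moreover have "inv\<^bsub>sym_group n\<^esub> (h \<circ> g) = inv' (h \<circ> g)"
    using dihedral_permutes[OF dihedral_compose[OF h(1) g(1)]] by (intro sym_group_inv_equality) (simp add: sym_group_carrier)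
  ultimately show ?thesis
    using subgroup.m_inv_closed[OF subgroup_dihedral dihedral_compose[OF h(1) g(1)]] by simp
qed

section \<open>Coxeter elements\<close>

lemma simple_product_append: "simple_product (xs @ ys) = simple_product xs \<circ> simple_product ys"
  by (induction xs) (auto simp: comp_assoc)

lemma simple_product_rev: "simple_product xs \<circ> simple_product (rev xs) = id"
proof (induction xs)
  case (Cons x xs)
  have r: "simple_product (rev (x # xs)) = simple_product (rev xs) \<circ> Transposition.transpose x (Suc x)"
    using simple_product_append[of "rev xs" "[x]"] by simp
  have "simple_product (x # xs) \<circ> simple_product (rev (x # xs)) =
    Transposition.transpose x (Suc x) \<circ> (simple_product xs \<circ> simple_product (rev xs)) \<circ> Transposition.transpose x (Suc x)"
    unfolding r by (simp add: comp_assoc)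
  also have "\<dots> = id" unfolding Cons.IH by (simp add: fun_eq_iff)
  finally show ?case .
qed simp

lemma inv_simple_product: "inv' (simple_product xs) = simple_product (rev xs)"
  using simple_product_rev[of xs] simple_product_rev[of "rev xs"] by (intro inv_unique_comp) simp_all

lemma simple_product_preserves: "j \<notin> set xs \<Longrightarrow> simple_product xs x \<le> j \<longleftrightarrow> x \<le> j"
  by (induction xs) (auto simp: transpose_def)

text \<open>Only the transposition of \<open>j\<close> and \<open>Suc j\<close> carries points
  across the cut after \<open>j\<close>, and it occurs once in the product.\<close>

lemma coxeter_exchange:
  assumes "coxeter_element n w" "j \<in> {1..<n}"
  shows "\<exists>!x. x \<le> j \<and> j < w x"
proof -
  obtain xs where xs: "distinct xs" "set xs = {1..<n}" "w = simple_product xs" using assms unfolding coxeter_element_def by blast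
  then obtain ys zs where s: "xs = ys @ j # zs" using assms(2) split_list by metis
  have nj: "j \<notin> set ys" "j \<notin> set zs" using xs(1) s by auto
  let ?B = "simple_product zs"
  have w: "w x = simple_product ys (Transposition.transpose j (Suc j) (?B x))" for x
    using simple_product_append[of ys "j # zs"] by (simp add: xs(3) s)
  have iff: "x \<le> j \<and> j < w x \<longleftrightarrow> ?B x = j" for x
    using simple_product_preserves[OF nj(1), of "Transposition.transpose j (Suc j) (?B x)"] simple_product_preserves[OF nj(2), of x]
    unfolding w by (auto simp: transpose_def split: if_splits)
  have "bij ?B"
    using simple_product_rev[of zs] simple_product_rev[of "rev zs"] by (intro o_bij[of "simple_product (rev zs)"]) simp_all
  then show ?thesis unfolding iff by (simp only: bij_iff)
qed

lemma coxeter_long_cycle: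
  assumes "1 \<le> n"
  shows "coxeter_element n (long_cycle n)" "coxeter_element n (inv' (long_cycle n))"
proof -
  show "coxeter_element n (long_cycle n)"
    unfolding coxeter_element_def by (rule exI[of _ "[1..<n]"]) (use long_cycle_product[OF assms] in simp)
  show "coxeter_element n (inv' (long_cycle n))"
    unfolding coxeter_element_def
    by (rule exI[of _ "rev [1..<n]"]) (use long_cycle_product[OF assms] inv_simple_product[of "[1..<n]"] in simp)
qed

text \<open>The cuts after 1, 2 and 3 are each crossed upwards by one point. With cyclic adjacency
  this leaves only \<open>w 1 = 2\<close>, \<open>w 2 = 3\<close> or \<open>w 1 = n\<close>,
  \<open>w 2 = 1\<close>, the initial values of the long cycle and of its inverse.\<close>

lemma coxeter_dihedral:
  assumes c: "coxeter_element n w" and n: "4 \<le> n"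
  shows "w \<in> dihedral n \<longleftrightarrow> w = long_cycle n \<or> w = inv' (long_cycle n)"
proof
  have n1: "1 \<le> n" using n by simp
  have lc: "inv' (long_cycle n) \<in> dihedral n"
    using inv_long_cycle[OF n1] dihedral_compose dihedral_generators by metis
  show "w = long_cycle n \<or> w = inv' (long_cycle n) \<Longrightarrow> w \<in> dihedral n"
    using lc dihedral_generators(1) by blast
  assume d: "w \<in> dihedral n"
  have p: "cyc_path n w" using dihedral_cyc_path[OF d n1] .
  have wp: "w permutes {1..n}" using dihedral_permutes[OF d] .
  have w0: "w 0 = 0" using wp by (simp add: permutes_def)
  have inj: "w 1 \<noteq> w 2" "w 1 \<noteq> w 3" "w 2 \<noteq> w 3" by (simp_all add: inj_eq[OF permutes_inj[OF wp]])
  have r: "w 1 \<in> {1..n}" "w 2 \<in> {1..n}" "w 3 \<in> {1..n}" using permutes_in_image[OF wp] n by auto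
  have "1 \<in> {1..<n}" "2 \<in> {1..<n}" "3 \<in> {1..<n}" using n by auto
  note ex = this[THEN coxeter_exchange[OF c]]
  have j1: "1 < w 1"
  proof -
    obtain x where "x \<le> 1" "1 < w x" using ex(1) by blast
    then show ?thesis using w0 by (cases x) (auto simp: le_Suc_eq)
  qed
  have j2: "2 < w 1 \<longleftrightarrow> \<not> 2 < w 2"
  proof -
    obtain x where x: "x \<le> 2" "2 < w x" and u: "\<And>y. y \<le> 2 \<Longrightarrow> 2 < w y \<Longrightarrow> y = x" using ex(2) by blast
    have "x \<noteq> 0" using x w0 by (cases x) auto
    then have "x = 1 \<or> x = 2" using x(1) by auto
    then show ?thesis using x(2) u[of 1] u[of 2] by auto
  qed
  have j3: "3 < w 1 \<or> 3 < w 2 \<or> 3 < w 3"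
  proof -
    obtain x where x: "x \<le> 3" "3 < w x" using ex(3) by blast
    have "x \<noteq> 0" using x w0 by (cases x) auto
    then have "x = 1 \<or> x = 2 \<or> x = 3" using x(1) by auto
    then show ?thesis using x(2) by auto
  qed
  have "1 \<in> {1..<n}" "2 \<in> {1..<n}" using n by auto
  then have "cyc_adjacent n (w 1) (w (Suc 1))" "cyc_adjacent n (w 2) (w (Suc 2))" using p unfolding cyc_path_def by blast+
  then have a: "cyc_adjacent n (w 1) (w 2)" "cyc_adjacent n (w 2) (w 3)" by (simp_all add: eval_nat_numeral)
  have "w 1 = 2 \<and> w 2 = 3 \<or> w 1 = n \<and> w 2 = 1"
  proof -
    have a1: "w 2 = Suc (w 1) \<or> w 1 = Suc (w 2) \<or> w 1 = 1 \<and> w 2 = n \<or> w 1 = n \<and> w 2 = 1"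
      and a2: "w 3 = Suc (w 2) \<or> w 2 = Suc (w 3) \<or> w 2 = 1 \<and> w 3 = n \<or> w 2 = n \<and> w 3 = 1"
      using a unfolding cyc_adjacent_def adjacent_def doubleton_eq_iff by blast+
    show ?thesis
    proof (cases "2 < w 1")
      case True
      then have "w 2 = 1 \<or> w 2 = 2" using j2 r(2) by auto
      then show ?thesis
      proof
        assume "w 2 = 1"
        then show ?thesis using a1 True by auto
      next
        assume 2: "w 2 = 2"
        then have "w 1 = 3" using a1 True by auto
        then have "w 3 = 1" using a2 2 inj(2) n by auto
        then show ?thesis using j3 2 \<open>w 1 = 3\<close> by simp
      qed
    next
      case False
      then have "w 1 = 2" "2 < w 2" using j1 j2 by auto
      then show ?thesis using a1 n by auto
    qed
  qed
  then show "w = long_cycle n \<or> w = inv' (long_cycle n)"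
  proof
    assume "w 1 = 2 \<and> w 2 = 3"
    then have "w = long_cycle n"
      using n by (intro cyc_path_determined[OF p dihedral_cyc_path[OF dihedral_generators(1) n1]]) (auto simp: long_cycle_value)
    then show ?thesis ..
  next
    assume "w 1 = n \<and> w 2 = 1"
    then have "w = inv' (long_cycle n)"
      using n by (intro cyc_path_determined[OF p dihedral_cyc_path[OF lc n1]]) (auto simp: inv_long_cycle long_cycle_value longest_perm_def)
    then show ?thesis ..
  qed
qed

context web_rep
begin

section \<open>The criterion and its dual\<close>

lemma permutes_basis_iff: "permutes_up_to_scalars s (\<rho> W) (vb ` webs) \<longleftrightarrow> (\<forall>\<omega>. is_web n k \<omega> \<longrightarrow> sends_to_web W \<omega>)"
  unfolding permutes_up_to_scalars_def sends_to_web_def by (simp only: Ball_image_comp Bex_def ball_simps bex_simps) (auto simp del: split_paired_All split_paired_Ex)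

lemma good_dihedral: "w \<in> dihedral n \<Longrightarrow> good w"
proof -
  have n1: "1 \<le> n" using kn by simp
  assume "w \<in> dihedral n"
  then show ?thesis using n1
  proof (induction rule: dihedral_induct)
    case id
    then show ?case by (rule good_id)
  next
    case cycle
    show ?case by (rule good_of_adjacent) (auto simp: long_cycle_value adjacent_def)
  next
    case reversal
    show ?case by (rule good_of_adjacent) (auto simp: longest_perm_def adjacent_def)
  next
    case (compose v w)
    then show ?case using good_compose by blast
  qed
qed

theorem permutes_basis_iff_dihedral:
  assumes W: "monomial_rep n W w m"
  shows "permutes_up_to_scalars s (\<rho> W) (vb ` webs) \<longleftrightarrow> w \<in> dihedral n"
proof
  assume "w \<in> dihedral n"
  then show "permutes_up_to_scalars s (\<rho> W) (vb ` webs)"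
    using good_dihedral W unfolding permutes_basis_iff good_def by blast
next
  assume "permutes_up_to_scalars s (\<rho> W) (vb ` webs)"
  then have "\<And>\<omega>. is_web n k \<omega> \<Longrightarrow> sends_to_web W \<omega>" unfolding permutes_basis_iff by blast
  from cyclic_adjacency_preserved[OF W this] have "cyc_path n w"
    using W unfolding cyc_path_def monomial_rep_def by blast
  then show "w \<in> dihedral n" using cyc_path_dihedral k2 kn by simp
qed

definition wcrd :: "web \<Rightarrow> 'w \<Rightarrow> complex" where
  "wcrd \<omega> x = (SOME c. x = (\<Sum>\<omega>\<in>webs. s (c \<omega>) (vb \<omega>))) \<omega>"

lemma wcrd: "x = (\<Sum>\<omega>\<in>webs. s (wcrd \<omega> x) (vb \<omega>))"
  unfolding wcrd_def by (rule someI_ex[OF vb_coords])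

lemma wcrd_eqI: "x = (\<Sum>\<omega>\<in>webs. s (c \<omega>) (vb \<omega>)) \<Longrightarrow> is_web n k \<omega> \<Longrightarrow> wcrd \<omega> x = c \<omega>"
  using vb_coords_unique[of "\<lambda>\<omega>. wcrd \<omega> x" c \<omega>] wcrd[of x] by simp

lemma wcrd_functional: "is_web n k \<omega> \<Longrightarrow> functional s (wcrd \<omega>)"
  unfolding functional
proof (intro conjI allI)
  assume w: "is_web n k \<omega>"
  show "wcrd \<omega> (x + y) = wcrd \<omega> x + wcrd \<omega> y" for x y
    by (rule wcrd_eqI[OF _ w]) (use wcrd[of x] wcrd[of y] in \<open>simp add: scale_left_distrib sum.distrib\<close>)
  show "wcrd \<omega> (s c x) = c * wcrd \<omega> x" for c x
  proof (rule wcrd_eqI[OF _ w])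
    have "s c x = s c (\<Sum>\<omega>\<in>webs. s (wcrd \<omega> x) (vb \<omega>))" using wcrd[of x] by simp
    then show "s c x = (\<Sum>\<omega>\<in>webs. s (c * wcrd \<omega> x) (vb \<omega>))" by (simp add: scale_sum_right)
  qed
qed

lemma wcrd_vb: "is_web n k \<omega> \<Longrightarrow> is_web n k \<mu> \<Longrightarrow> wcrd \<omega> (vb \<mu>) = (if \<omega> = \<mu> then 1 else 0)"
  by (rule wcrd_eqI) (use vb_single[of \<mu> 1] in auto)

lemma functional_eqI:
  assumes "functional s \<phi>" "functional s \<psi>" "\<And>\<omega>. is_web n k \<omega> \<Longrightarrow> \<phi> (vb \<omega>) = \<psi> (vb \<omega>)"
  shows "\<phi> = \<psi>"
proof
  fix x
  have "\<phi> x = (\<Sum>\<omega>\<in>webs. wcrd \<omega> x * \<phi> (vb \<omega>))" if "functional s \<phi>" for \<phi>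
    using functional_sum[OF that, of "\<lambda>\<omega>. s (wcrd \<omega> x) (vb \<omega>)" webs] wcrd[of x] that unfolding functional by simp
  from this[OF assms(1)] this[OF assms(2)] show "\<phi> x = \<psi> x" using assms(3) by simp
qed

lemma dual_basis_vb: "dual_basis s (vb ` webs) = wcrd ` webs"
proof (rule equalityI; rule subsetI)
  fix \<phi> assume "\<phi> \<in> dual_basis s (vb ` webs)"
  then obtain \<omega> where f: "functional s \<phi>" and w: "is_web n k \<omega>" "\<phi> (vb \<omega>) = 1" and z: "\<forall>b'\<in>vb ` webs - {vb \<omega>}. \<phi> b' = 0"
    unfolding dual_basis_def by blast
  have "\<phi> = wcrd \<omega>"
  proof (rule functional_eqI[OF f wcrd_functional[OF w(1)]])
    fix \<mu> assume m: "is_web n k \<mu>"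
    show "\<phi> (vb \<mu>) = wcrd \<omega> (vb \<mu>)"
    proof (cases "\<omega> = \<mu>")
      case False
      then have "vb \<mu> \<noteq> vb \<omega>" using inj_onD[OF vb_inj, of \<mu> \<omega>] m w by auto
      then show ?thesis using z m wcrd_vb[OF w(1) m] False by simp
    qed (use w wcrd_vb[OF w(1) m] in simp)
  qed
  then show "\<phi> \<in> wcrd ` webs" using w by simp
next
  fix \<phi> assume "\<phi> \<in> wcrd ` webs"
  then obtain \<omega> where w: "is_web n k \<omega>" and f: "\<phi> = wcrd \<omega>" by blast
  have "wcrd \<omega> b = 0" if b: "b \<in> vb ` webs - {vb \<omega>}" for b
  proof -
    obtain \<mu> where m: "\<mu> \<in> webs" "b = vb \<mu>" using b by blast
    then have "\<mu> \<noteq> \<omega>" using b by blast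
    then show ?thesis using m wcrd_vb[OF w, of \<mu>] by simp
  qed
  then show "\<phi> \<in> dual_basis s (vb ` webs)"
    unfolding dual_basis_def f mem_Collect_eq using wcrd_functional[OF w] wcrd_vb[OF w w] w
    by (intro conjI bexI[of _ "vb \<omega>"] ballI) auto
qed

text \<open>With respect to the two bases the actions have inverse transpose matrices. The map
  \<open>\<pi>\<close> of basis elements is injective because the action is invertible, hence a
  permutation of the finite set of webs, and a monomial matrix has a monomial inverse
  transpose.\<close>

lemma dual_permutes_iff:
  assumes W: "monomial_rep n W w m"
  shows "permutes_up_to_scalars dual_scale (dual_action n \<rho> W) (dual_basis s (vb ` webs)) \<longleftrightarrow>
    permutes_up_to_scalars s (\<rho> W) (vb ` webs)"
proof -
  interpret G: group "SL n" by (rule group_SL)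
  let ?V = "inv\<^bsub>SL n\<^esub> W"
  note WS = monomial_rep_SL[OF W]
  have VS: "?V \<in> carrier (SL n)" using WS by simp
  have VW: "\<rho> ?V (\<rho> W x) = x" for x
    using rho_mult[OF VS WS, of x] G.l_inv[OF WS] by (simp add: SL_simps rho_one)
  have fin: "finite webs" by (rule finite_W)
  show ?thesis
  proof
    assume "permutes_up_to_scalars s (\<rho> W) (vb ` webs)"
    then have "\<forall>\<omega>\<in>webs. \<exists>\<omega>'\<in>webs. \<exists>c. c \<noteq> 0 \<and> \<rho> W (vb \<omega>) = s c (vb \<omega>')"
      unfolding permutes_up_to_scalars_def by blast
    then obtain \<pi> c where \<pi>: "\<And>\<omega>. \<omega> \<in> webs \<Longrightarrow> \<pi> \<omega> \<in> webs" and c: "\<And>\<omega>. \<omega> \<in> webs \<Longrightarrow> c \<omega> \<noteq> 0"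
      and e: "\<And>\<omega>. \<omega> \<in> webs \<Longrightarrow> \<rho> W (vb \<omega>) = s (c \<omega>) (vb (\<pi> \<omega>))" by metis
    have undo: "\<rho> ?V (vb (\<pi> \<omega>)) = s (inverse (c \<omega>)) (vb \<omega>)" if "\<omega> \<in> webs" for \<omega>
    proof -
      have "vb \<omega> = s (c \<omega>) (\<rho> ?V (vb (\<pi> \<omega>)))" using VW[of "vb \<omega>"] unfolding e[OF that] rho_lin(2)[OF VS] by simp
      then have "s (inverse (c \<omega>)) (vb \<omega>) = s (inverse (c \<omega>)) (s (c \<omega>) (\<rho> ?V (vb (\<pi> \<omega>))))" by simp
      then show ?thesis using c[OF that] by simp
    qed
    have "inj_on \<pi> webs"
    proof (rule inj_onI)
      fix \<omega> \<mu> assume a: "\<omega> \<in> webs" "\<mu> \<in> webs" "\<pi> \<omega> = \<pi> \<mu>"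
      then have "s (inverse (c \<omega>)) (vb \<omega>) = s (inverse (c \<mu>)) (vb \<mu>)" using undo by metis
      then show "\<omega> = \<mu>" using vb_scaled_eqD(1)[of \<omega> \<mu> "inverse (c \<omega>)" "inverse (c \<mu>)"] a c by simp
    qed
    then have surj: "\<pi> ` webs = webs" using \<pi> endo_inj_surj[OF fin] by blast
    show "permutes_up_to_scalars dual_scale (dual_action n \<rho> W) (dual_basis s (vb ` webs))"
      unfolding permutes_up_to_scalars_def dual_basis_vb
    proof (rule ballI)
      fix \<phi> assume "\<phi> \<in> wcrd ` webs"
      then obtain \<omega> where w: "\<omega> \<in> webs" and f: "\<phi> = wcrd \<omega>" by blast
      have "dual_action n \<rho> W \<phi> = dual_scale (inverse (c \<omega>)) (wcrd (\<pi> \<omega>))"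
      proof (rule functional_eqI)
        show "functional s (dual_action n \<rho> W \<phi>)"
          unfolding f dual_action_def using functional_rho[OF wcrd_functional VS] w by simp
        show "functional s (dual_scale (inverse (c \<omega>)) (wcrd (\<pi> \<omega>)))"
          using wcrd_functional[of "\<pi> \<omega>"] \<pi>[OF w] unfolding functional dual_scale_def by (simp add: algebra_simps)
        fix \<mu> assume "is_web n k \<mu>"
        then obtain \<nu> where n: "\<nu> \<in> webs" "\<mu> = \<pi> \<nu>" using surj by blast
        have inj: "\<pi> \<omega> = \<pi> \<nu> \<longleftrightarrow> \<omega> = \<nu>" using \<open>inj_on \<pi> webs\<close> w n(1) by (simp add: inj_on_eq_iff)
        have "dual_action n \<rho> W \<phi> (vb \<mu>) = inverse (c \<nu>) * wcrd \<omega> (vb \<nu>)"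
          unfolding dual_action_def f n(2) undo[OF n(1)] using wcrd_functional[of \<omega>] w unfolding functional by simp
        also have "\<dots> = inverse (c \<omega>) * wcrd (\<pi> \<omega>) (vb (\<pi> \<nu>))"
          using wcrd_vb[of \<omega> \<nu>] wcrd_vb[of "\<pi> \<omega>" "\<pi> \<nu>"] w n(1) \<pi>[OF w] \<pi>[OF n(1)] inj by simp
        finally show "dual_action n \<rho> W \<phi> (vb \<mu>) = dual_scale (inverse (c \<omega>)) (wcrd (\<pi> \<omega>)) (vb \<mu>)"
          by (simp add: dual_scale_def n(2))
      qed
      moreover have "inverse (c \<omega>) \<noteq> 0" using c[OF w] by simp
      ultimately show "\<exists>b'\<in>wcrd ` webs. \<exists>c. c \<noteq> 0 \<and> dual_action n \<rho> W \<phi> = dual_scale c b'"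
        using \<pi>[OF w] by blast
    qed
  next
    assume "permutes_up_to_scalars dual_scale (dual_action n \<rho> W) (dual_basis s (vb ` webs))"
    then have "\<forall>\<omega>\<in>webs. \<exists>\<omega>'\<in>webs. \<exists>c. c \<noteq> 0 \<and> dual_action n \<rho> W (wcrd \<omega>) = dual_scale c (wcrd \<omega>')"
      unfolding permutes_up_to_scalars_def dual_basis_vb by blast
    then obtain \<pi> c where \<pi>: "\<And>\<omega>. \<omega> \<in> webs \<Longrightarrow> \<pi> \<omega> \<in> webs" and c: "\<And>\<omega>. \<omega> \<in> webs \<Longrightarrow> c \<omega> \<noteq> 0"
      and e: "\<And>\<omega>. \<omega> \<in> webs \<Longrightarrow> dual_action n \<rho> W (wcrd \<omega>) = dual_scale (c \<omega>) (wcrd (\<pi> \<omega>))" by metis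
    have crd: "wcrd \<omega> x = c \<omega> * wcrd (\<pi> \<omega>) (\<rho> W x)" if "\<omega> \<in> webs" for \<omega> x
      using fun_cong[OF e[OF that], of "\<rho> W x"] by (simp add: dual_action_def dual_scale_def VW)
    have "inj_on \<pi> webs"
    proof (rule inj_onI)
      fix \<omega> \<mu> assume a: "\<omega> \<in> webs" "\<mu> \<in> webs" "\<pi> \<omega> = \<pi> \<mu>"
      have "1 = c \<omega> * wcrd (\<pi> \<omega>) (\<rho> W (vb \<omega>))" using crd[OF a(1), of "vb \<omega>"] wcrd_vb[of \<omega> \<omega>] a by simp
      then have "wcrd (\<pi> \<mu>) (\<rho> W (vb \<omega>)) \<noteq> 0" using a(3) by auto
      then have "wcrd \<mu> (vb \<omega>) \<noteq> 0" using crd[OF a(2), of "vb \<omega>"] c[OF a(2)] by simp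
      then show "\<omega> = \<mu>" using wcrd_vb[of \<mu> \<omega>] a by (auto split: if_splits)
    qed
    then have surj: "\<pi> ` webs = webs" using \<pi> endo_inj_surj[OF fin] by blast
    show "permutes_up_to_scalars s (\<rho> W) (vb ` webs)"
      unfolding permutes_up_to_scalars_def
    proof (rule ballI)
      fix b assume "b \<in> vb ` webs"
      then obtain \<mu> where m: "\<mu> \<in> webs" "b = vb \<mu>" by blast
      have "wcrd \<nu> (\<rho> W b) = (if \<nu> = \<pi> \<mu> then inverse (c \<mu>) else 0)" if n: "\<nu> \<in> webs" for \<nu>
      proof -
        obtain \<omega> where w: "\<omega> \<in> webs" "\<nu> = \<pi> \<omega>" using surj n by blast
        have "(if \<omega> = \<mu> then 1 else 0) = c \<omega> * wcrd \<nu> (\<rho> W b)"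
          using crd[OF w(1), of b] wcrd_vb[of \<omega> \<mu>] w m by simp
        moreover have "\<pi> \<omega> = \<pi> \<mu> \<longleftrightarrow> \<omega> = \<mu>" using \<open>inj_on \<pi> webs\<close> w(1) m(1) by (simp add: inj_on_eq_iff)
        ultimately show ?thesis using c[OF w(1)] w(2) by (auto split: if_splits simp: field_simps)
      qed
      then have "(\<Sum>\<nu>\<in>webs. s (wcrd \<nu> (\<rho> W b)) (vb \<nu>)) = (\<Sum>\<nu>\<in>webs. s (if \<nu> = \<pi> \<mu> then inverse (c \<mu>) else 0) (vb \<nu>))"
        by (intro sum.cong refl) simp
      then have "\<rho> W b = s (inverse (c \<mu>)) (vb (\<pi> \<mu>))"
        using wcrd[of "\<rho> W b"] vb_single[of "\<pi> \<mu>" "inverse (c \<mu>)"] \<pi>[OF m(1)] by simp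
      moreover have "inverse (c \<mu>) \<noteq> 0" using c[OF m(1)] by simp
      ultimately show "\<exists>b'\<in>vb ` webs. \<exists>c. c \<noteq> 0 \<and> \<rho> W b = s c b'" using \<pi>[OF m(1)] by blast
    qed
  qed
qed

end

text \<open>Coordinates of integral vectors are Laurent polynomials and can be evaluated at
  \<open>q = 1\<close>, so the images of the webs span; the structure constant \<open>qtwo\<close>
  becomes 2.\<close>

lemma specialized_web_rep:
  assumes k: "2 \<le> k" "k + 2 \<le> n"
    and irr: "Uq_irreducible_hw n (\<lambda>i. 2 * fundamental_weight k i) M u"
    and hw: "SL_irreducible_hw n (\<lambda>i. 2 * fundamental_weight k i) s \<rho>"
    and sp: "specialization_at_1 n M u s \<rho> \<sigma>"
  obtains vb where "web_rep n s \<rho> k vb" "specialized_canonical_basis n M u \<sigma> = vb ` {\<omega>. is_web n k \<omega>}"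
proof -
  interpret Q: quantum_hw n k M u by unfold_locales (use k irr in auto)
  have SLr: "SL_rep n s \<rho>" using hw by (simp add: SL_irreducible_hw_def)
  interpret R: sl_rep n s \<rho> by unfold_locales (rule SLr)
  let ?I = "integral_form n M u"
  let ?W = "{\<omega>. is_web n k \<omega>}"
  define vb where "vb \<omega> = \<sigma> (Q.bm \<omega>)" for \<omega>
  have add: "\<sigma> (x + y) = \<sigma> x + \<sigma> y" if "x \<in> ?I" "y \<in> ?I" for x y
    using sp that unfolding specialization_at_1_def by blast
  have scale: "\<sigma> (qscale M (Fract p 1 / qv ^ m) x) = s (of_rat (poly p 1)) (\<sigma> x)" if "x \<in> ?I" for p m x
    using sp that unfolding specialization_at_1_def by blast
  have E: "\<sigma> (Eop M i x) = matrix_unit_action n s \<rho> i (Suc i) (\<sigma> x)"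
    and F: "\<sigma> (Fop M i x) = matrix_unit_action n s \<rho> (Suc i) i (\<sigma> x)" if "i \<in> {1..<n}" "x \<in> ?I" for i x
    using sp that unfolding specialization_at_1_def by blast+
  have ker: "\<sigma> x = 0 \<longleftrightarrow> x \<in> qscale M (qv - 1) ` ?I" if "x \<in> ?I" for x
    using sp that unfolding specialization_at_1_def by blast
  have spn: "R.span (\<sigma> ` ?I) = UNIV" using sp unfolding specialization_at_1_def by blast
  have coef: "\<sigma> (qscale M (coef qtwo m) x) = s (coef 2 m) (\<sigma> x)" if x: "x \<in> ?I" for m x
  proof -
    \<comment> \<open>\<open>q + q\<^sup>-\<^sup>1\<close> written as a polynomial over a power of
      \<open>q\<close>, the shape of scalars with which \<open>\<sigma>\<close> is known to be
      compatible.\<close>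
    have q: "qtwo = Fract [:1, 0, 1:] 1 / qv ^ 1"
      unfolding Fract_pCons cst_simps Zero_fract_def[symmetric] qtwo_def by (simp add: field_simps)
    have "\<sigma> (qscale M qtwo x) = s 2 (\<sigma> x)" unfolding q scale[OF x] by simp
    moreover have "\<sigma> (qscale M 0 x) = 0" "\<sigma> (qscale M 1 x) = \<sigma> x"
      using scale[OF x, of 0 0] scale[OF x, of 1 0] unfolding Zero_fract_def[symmetric] One_fract_def[symmetric] by simp_all
    ultimately show ?thesis by (simp add: coef_def)
  qed
  have sum_mem: "(\<Sum>\<omega>\<in>A. qscale M (c \<omega>) (Q.bm \<omega>)) \<in> ?I \<and>
      \<sigma> (\<Sum>\<omega>\<in>A. qscale M (c \<omega>) (Q.bm \<omega>)) \<in> R.span (vb ` ?W)"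
    if "finite A" "A \<subseteq> ?W" "\<And>\<omega>. \<omega> \<in> ?W \<Longrightarrow> c \<omega> \<in> laurent_polys" for A c
    using that(1,2)
  proof (induction A rule: finite_induct)
    case empty
    have u: "u \<in> ?I" by (rule integral_form.hw)
    have "qscale M 0 u \<in> ?I" by (rule integral_form.scale[OF laurent_simps(1) u])
    moreover have "\<sigma> (qscale M 0 u) = 0" using scale[OF u, of 0 0] unfolding Zero_fract_def[symmetric] by simp
    ultimately show ?case by (simp add: R.span_zero)
  next
    case (insert \<omega> A)
    have w: "is_web n k \<omega>" using insert by simp
    note b = Q.bm_integral[OF w]
    have cl: "c \<omega> \<in> laurent_polys" using that(3) w by simp
    then obtain p m where c: "c \<omega> = Fract p 1 / qv ^ m" unfolding laurent_polys_def by blast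
    have 1: "qscale M (c \<omega>) (Q.bm \<omega>) \<in> ?I" by (rule integral_form.scale[OF cl b])
    have "\<sigma> (qscale M (c \<omega>) (Q.bm \<omega>)) = s (of_rat (poly p 1)) (vb \<omega>)" unfolding c scale[OF b] vb_def ..
    then have 2: "\<sigma> (qscale M (c \<omega>) (Q.bm \<omega>)) \<in> R.span (vb ` ?W)" using w by (simp add: R.span_scale R.span_base)
    show ?case using insert 1 2 add[OF 1, of "\<Sum>\<omega>\<in>A. qscale M (c \<omega>) (Q.bm \<omega>)"]
      by (simp add: integral_form.add R.span_add)
  qed
  have "\<sigma> ` ?I \<subseteq> R.span (vb ` ?W)"
  proof (rule image_subsetI)
    fix x assume x: "x \<in> ?I"
    have "\<sigma> (\<Sum>\<omega>\<in>?W. qscale M (Q.crd x \<omega>) (Q.bm \<omega>)) \<in> R.span (vb ` ?W)"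
      using sum_mem[of ?W "Q.crd x", OF finite_webs order_refl] Q.integral_form_laurent[OF x] by blast
    then show "\<sigma> x \<in> R.span (vb ` ?W)" using Q.crd[of x] by simp
  qed
  then have span: "R.span (vb ` ?W) = UNIV" using spn R.span_minimal[OF _ R.subspace_span] by (metis UNIV_I subsetI subset_antisym)
  have mu: "matrix_unit_action n s \<rho> b a (vb \<omega>) = s (coef 2 (kind a b \<omega>)) (vb (step a b \<omega>))"
    if w: "is_web n k \<omega>" and ab: "adjacent a b" "a \<in> {1..n}" "b \<in> {1..n}" for \<omega> a b
  proof -
    note b = Q.bm_integral[OF w]
    have c: "\<sigma> (qscale M (coef qtwo (kind a b \<omega>)) (Q.bm (step a b \<omega>))) = s (coef 2 (kind a b \<omega>)) (vb (step a b \<omega>))"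
    proof (cases "kind a b \<omega> = 0")
      case True
      have u: "u \<in> ?I" by (rule integral_form.hw)
      have "\<sigma> 0 = 0" using scale[OF u, of 0 0] unfolding Zero_fract_def[symmetric] by simp
      then show ?thesis using True by (simp add: coef_def)
    next
      case False
      show ?thesis unfolding vb_def by (rule coef[OF Q.bm_integral[OF web_step[OF w ab(2,3,1) False]]])
    qed
    consider "b = Suc a" | "a = Suc b" using ab(1) by (auto simp: adjacent_def)
    then show ?thesis
    proof cases
      case 1
      then have a: "a \<in> {1..<n}" using ab by auto
      show ?thesis using F[OF a b] Q.F_bm[OF w a] c 1 by (simp add: vb_def)
    next
      case 2
      then have a: "b \<in> {1..<n}" using ab by auto
      show ?thesis using E[OF a b] Q.E_bm[OF w a] c 2 by (simp add: vb_def)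
    qed
  qed
  have "vb (top_web k) \<noteq> 0"
    unfolding vb_def Q.bm_top using ker[OF integral_form.hw] Q.u_not_divisible by simp
  then have "web_rep n s \<rho> k vb"
    by unfold_locales (use k hw mu span in auto)
  moreover have "specialized_canonical_basis n M u \<sigma> = vb ` ?W"
    unfolding specialized_canonical_basis_def Q.global_basis_webs by (simp add: image_image vb_def)
  ultimately show thesis by (rule that)
qed

theorem proposition7p4:
  fixes n k :: nat
    and M :: "'v::ab_group_add Uq_structure" and u :: 'v
    and s :: "complex \<Rightarrow> 'w::ab_group_add \<Rightarrow> 'w"
    and \<rho> :: "complex mat \<Rightarrow> 'w \<Rightarrow> 'w"
    and \<sigma> :: "'v \<Rightarrow> 'w"
    and B :: "'w set"
  assumes "2 \<le> k" and "k + 2 \<le> n"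
    and "Uq_irreducible_hw n (\<lambda>i. 2 * fundamental_weight k i) M u"
    and "SL_irreducible_hw n (\<lambda>i. 2 * fundamental_weight k i) s \<rho>"
    and "specialization_at_1 n M u s \<rho> \<sigma>"
  defines "B \<equiv> specialized_canonical_basis n M u \<sigma>"
  shows
    "(\<forall>w W. represents n W w \<longrightarrow>
        (permutes_up_to_scalars s (\<rho> W) B \<longleftrightarrow> w \<in> dihedral n) \<and>
        (permutes_up_to_scalars dual_scale (dual_action n \<rho> W) (dual_basis s B) \<longleftrightarrow> w \<in> dihedral n)) \<and>
     coxeter_element n (long_cycle n) \<and> coxeter_element n (inv' (long_cycle n)) \<and>
     (\<forall>w W. coxeter_element n w \<longrightarrow> represents n W w \<longrightarrow>
        (permutes_up_to_scalars s (\<rho> W) B \<longleftrightarrow>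
           w = long_cycle n \<or> w = inv' (long_cycle n)) \<and>
        (permutes_up_to_scalars dual_scale (dual_action n \<rho> W) (dual_basis s B) \<longleftrightarrow>
           w = long_cycle n \<or> w = inv' (long_cycle n)))"
proof -
  obtain vb where "web_rep n s \<rho> k vb" and B: "B = vb ` {\<omega>. is_web n k \<omega>}"
    using specialized_web_rep[OF assms(1-5)] unfolding B_def by blast
  then interpret web_rep n s \<rho> k vb by simp
  have n: "4 \<le> n" using assms(1,2) by simp
  have crit: "(permutes_up_to_scalars s (\<rho> W) B \<longleftrightarrow> w \<in> dihedral n) \<and>
      (permutes_up_to_scalars dual_scale (dual_action n \<rho> W) (dual_basis s B) \<longleftrightarrow> w \<in> dihedral n)"
    if W: "represents n W w" for w W
  proof -
    have "2 \<le> n" using n by simp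
    then obtain m where m: "monomial_rep n W w m" using represents_monomial_rep[OF W] by blast
    show ?thesis unfolding B dual_permutes_iff[OF m] permutes_basis_iff_dihedral[OF m] by simp
  qed
  show ?thesis
    using crit coxeter_dihedral[OF _ n] coxeter_long_cycle[of n] n by auto
qed

end
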